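(* (1) For each ordered multiplicity list of order $5$ below, the following are, up to isomorphism, all the minimal graphs of order $5$ attaining the list with the SSP: - $(4,1)$: $K_5$; - $(3,2)$: $(K_4)_e$; - $(3,1,1)$: $K_4\,\dot\cup\, K_1$ and $(K_4)_e$; - $(1,3,1)$: $K_4\,\dot\cup\, K_1$ and $K_{2,3}$; - $(2,1,2)$: $C_4\,\dot\cup\, K_1$ and Butterfly; - $(2,2,1)$: $C_4\,\dot\cup\, K_1$, $C_5$ and Campstool; - $(2,1,1,1)$: $C_4\,\dot\cup\, K_1$, $C_5$ and $K_3\,\dot\cup\, 2K_1$; - $(1,2,1,1)$: $C_4\,\dot\cup\, K_1$, $C_5$, $K_3\,\dot\cup\, 2K_1$ and $K_{1,3}\,\dot\cup\, K_1$; - $(1,1,1,1,1)$: $5K_1$. In each case the reversal of the given list has the same minimal graphs. (2) For each connected graph $G$ of order $5$, the ordered multiplicity lists of matrices in $\mathcal{S}(G)$ are exactly the following, together with their reversals: - $P_5$: $(1,1,1,1,1)$; - $S(2,1,1)$: $(1,1,1,1,1)$, $(1,2,1,1)$; - $K_{1,4}$: $(1,1,1,1,1)$, $(1,2,1,1)$, and $(1,3,1)^*$; - $L(3,2)$ and Bull: $(1,1,1,1,1)$, $(1,2,1,1)$, $(2,1,1,1)$; - $C_5$ and Campstool: $(1,1,1,1,1)$, $(1,2,1,1)$, $(2,1,1,1)$, $(2,2,1)$; - Banner, House, Dart, Kite and Gem: $(1,1,1,1,1)$, $(1,2,1,1)$, $(2,1,1,1)$, $(2,2,1)$, $(2,1,2)$;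 - Butterfly: $(1,1,1,1,1)$, $(1,2,1,1)$, $(2,1,1,1)$, $(2,2,1)$, $(2,1,2)$, and $(1,3,1)^*$, $(3,1,1)^*$; - $K_{2,3}$ and $T_5$: $(1,1,1,1,1)$, $(1,2,1,1)$, $(2,1,1,1)$, $(2,2,1)$, $(2,1,2)$, $(1,3,1)$; - $L(4,1)$: $(1,1,1,1,1)$, $(1,2,1,1)$, $(2,1,1,1)$, $(2,2,1)$, $(2,1,2)$, $(1,3,1)$, $(3,1,1)$; - $(K_4)_e$, $W_5$, Full House and $K_5-e$: $(1,1,1,1,1)$, $(1,2,1,1)$, $(2,1,1,1)$, $(2,2,1)$, $(2,1,2)$, $(1,3,1)$, $(3,1,1)$, $(3,2)$; - $K_5$: $(1,1,1,1,1)$, $(1,2,1,1)$, $(2,1,1,1)$, $(2,2,1)$, $(2,1,2)$, $(1,3,1)$, $(3,1,1)$, $(3,2)$, $(4,1)$. Every list so attained is spectrally arbitrary for the graph attaining it. The lists not marked with $^*$ (and their reversals) can be realized with the SSP by the given graph; the lists marked with $^*$ (and their reversals) cannot be realized by a matrix in $\mathcal{S}(G)$ with the SMP (and thus not with the SSP).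
   Context: All matrices are real and symmetric, all graphs simple, undirected and finite. For a graph $G$ on vertices $\{1,\dots,n\}$, $\mathcal{S}(G)$ is the set of real symmetric $n\times n$ matrices $A=[a_{ij}]$ such that, for $i\neq j$, $a_{ij}\ne 0$ if and only if $ij$ is an edge of $G$ (diagonal entries are free). If $A$ has distinct eigenvalues $\lambda_1<\dots<\lambda_q$ with multiplicities $m_1,\dots,m_q$, its ordered multiplicity list is $\mathbf{m}(A)=(m_1,\dots,m_q)$; the reversal of $(m_1,\dots,m_q)$ is $(m_q,\dots,m_1)$. Let $\circ$ be the entrywise product and $[A,X]=AX-XA$. $A$ has the Strong Spectral Property (SSP) if the only symmetric $X$ with $A\circ X=O$, $I\circ X=O$, $[A,X]=O$ is $X=O$. An $n\times n$ matrix $A$ has the Strong Multiplicity Property (SMP) if the only symmetric $X$ with $A\circ X=O$, $I\circ X=O$, $[A,X]=O$ and $\operatorname{tr}(A^iX)=0$ for $i=2,\dots,n-1$ is $X=O$. A list $\mathbf{m}=(m_1,\dots,m_k)$ is spectrally arbitrary for $G$ if for all real $\lambda_1<\dots<\lambda_k$ there is $A\in\mathcal{S}(G)$ whose distinct eigenvalues are the $\lambda_i$, with multiplicities $m_i$. A graph $G$ attains (realizes) $\mathbf{m}$ with the SSP (SMP) if some $A\in\mathcal{S}(G)$ with $\mathbf{m}(A)=\mathbf{m}$ has the SSP (SMP). A graph is minimal attaining $\mathbf{m}$ with the SSP if it attains $\mathbf{m}$ with the SSP and no proper subgraph on the same vertex set does. Graphs: $\dot\cup$ denotes disjoint union. $K_n,C_n,P_n,K_{p,q}$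 are the complete graph, cycle, path and complete bipartite graph. $S(k_1,\dots,k_d)$ is the tree obtained from a central vertex by attaching $d$ paths (arms) having $k_1,\dots,k_d$ vertices, each joined to the center at one end. $L(3,2)$: a triangle with a path of two further vertices attached at one vertex. $L(4,1)$: $K_4$ with one pendant vertex attached. Bull: a triangle with one pendant vertex attached at each of two of its vertices. Campstool: a triangle with two pendant vertices attached at the same vertex. Banner: $C_4$ with one pendant vertex attached. Butterfly: two triangles sharing exactly one vertex. House: the complement of $P_5$. Dart: $K_4$ minus an edge with a pendant vertex attached at a vertex of degree 3. Kite: $K_4$ minus an edge with a pendant vertex attached at a vertex of degree 2. Gem: $P_4$ plus a vertex adjacent to all of it. $T_5=K_{1,1,3}$. $(K_4)_e$: $K_4$ with one edge subdivided once. $W_5$: $C_4$ plus a vertex adjacent to all of it. Full House: $K_4$ plus a vertex adjacent to exactly two vertices of the $K_4$. $K_5-e$: $K_5$ minus an edge. *)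

theory Defs
  imports "Jordan_Normal_Form.Char_Poly"
begin

section \<open>Simple graphs\<close>

text \<open>Vertices are numbered from 0: a graph of order n has vertex set \<open>{..<n}\<close>, matching the
  zero-based row and column indices of \<^typ>\<open>'a mat\<close>.\<close>

datatype graph = Graph (order_of: nat) (edges: "nat set set")

abbreviation verts :: "graph \<Rightarrow> nat set" where
  "verts G \<equiv> {..<order_of G}"

definition simple_graph :: "graph \<Rightarrow> bool" where
  "simple_graph G \<longleftrightarrow> (\<forall>e \<in> edges G. e \<subseteq> verts G \<and> card e = 2)"

definition graph_iso :: "graph \<Rightarrow> graph \<Rightarrow> bool" (infix \<open>\<simeq>\<^sub>G\<close> 50) where
  "G \<simeq>\<^sub>G H \<longleftrightarrow> (\<exists>f. bij_betw f (verts G) (verts H) \<and> edges H = (\<lambda>e. f ` e) ` edges G)"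

definition connected_graph :: "graph \<Rightarrow> bool" where
  "connected_graph G \<longleftrightarrow>
     (\<forall>u \<in> verts G. \<forall>v \<in> verts G. (u, v) \<in> {(x, y). {x, y} \<in> edges G}\<^sup>*)"

subsection \<open>Constructions\<close>

definition graph_complement :: "graph \<Rightarrow> graph" where
  "graph_complement G = Graph (order_of G) ({e. e \<subseteq> verts G \<and> card e = 2} - edges G)"

text \<open>The vertices of the second summand are shifted by the order of the first one.\<close>

definition disjoint_union :: "graph \<Rightarrow> graph \<Rightarrow> graph" (infixl \<open>\<uplus>\<^sub>G\<close> 65) where
  "G \<uplus>\<^sub>G H = Graph (order_of G + order_of H)
     (edges G \<union> (\<lambda>e. (\<lambda>v. order_of G + v) ` e) ` edges H)"

definition copies :: "nat \<Rightarrow> graph \<Rightarrow> graph" where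
  "copies k G = ((\<lambda>H. H \<uplus>\<^sub>G G) ^^ k) (Graph 0 {})"

definition delete_edge :: "graph \<Rightarrow> nat \<Rightarrow> nat \<Rightarrow> graph" where
  "delete_edge G u v = Graph (order_of G) (edges G - {{u, v}})"

text \<open>\<open>add_vertex G N\<close> adds one new vertex, with number \<open>order_of G\<close>, whose neighbours are
  exactly the vertices in \<open>N\<close>.\<close>

definition add_vertex :: "graph \<Rightarrow> nat set \<Rightarrow> graph" where
  "add_vertex G N = Graph (Suc (order_of G)) (edges G \<union> {{v, order_of G} | v. v \<in> N})"

definition add_pendant :: "graph \<Rightarrow> nat \<Rightarrow> graph" where
  "add_pendant G v = add_vertex G {v}"

definition add_dominating :: "graph \<Rightarrow> graph" where
  "add_dominating G = add_vertex G (verts G)"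

definition subdivide_edge :: "graph \<Rightarrow> nat \<Rightarrow> nat \<Rightarrow> graph" where
  "subdivide_edge G u v = add_vertex (delete_edge G u v) {u, v}"

text \<open>Attaches a path with \<open>k\<close> new vertices to \<open>G\<close>, joined to \<open>v\<close> at one of its ends.\<close>

fun attach_path :: "graph \<Rightarrow> nat \<Rightarrow> nat \<Rightarrow> graph" where
  "attach_path G v 0 = G"
| "attach_path G v (Suc k) = attach_path (add_pendant G v) (order_of G) k"

subsection \<open>Families\<close>

definition complete_graph :: "nat \<Rightarrow> graph" where
  "complete_graph n = Graph n {{i, j} | i j. i < n \<and> j < n \<and> i \<noteq> j}"

definition path_graph :: "nat \<Rightarrow> graph" where
  "path_graph n = Graph n {{i, Suc i} | i. Suc i < n}"

text \<open>Only meaningful for \<open>n \<ge> 3\<close>.\<close>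

definition cycle_graph :: "nat \<Rightarrow> graph" where
  "cycle_graph n = Graph n {{i, Suc i mod n} | i. i < n}"

definition complete_bipartite :: "nat \<Rightarrow> nat \<Rightarrow> graph" where
  "complete_bipartite p q = Graph (p + q) {{i, j} | i j. i < p \<and> p \<le> j \<and> j < p + q}"

definition complete_tripartite :: "nat \<Rightarrow> nat \<Rightarrow> nat \<Rightarrow> graph" where
  "complete_tripartite p q r = Graph (p + q + r)
     ({{i, j} | i j. i < p \<and> p \<le> j \<and> j < p + q} \<union>
      {{i, j} | i j. i < p \<and> p + q \<le> j \<and> j < p + q + r} \<union>
      {{i, j} | i j. p \<le> i \<and> i < p + q \<and> p + q \<le> j \<and> j < p + q + r})"

text \<open>The tree \<open>S(k\<^sub>1, \<dots>, k\<^sub>d)\<close>, with central vertex 0.\<close>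

definition generalized_star :: "nat list \<Rightarrow> graph" where
  "generalized_star ks = foldl (\<lambda>G k. attach_path G 0 k) (complete_graph 1) ks"

subsection \<open>Particular graphs of order 5\<close>

definition L_3_2 :: graph where
  "L_3_2 = attach_path (complete_graph 3) 0 2"

definition L_4_1 :: graph where
  "L_4_1 = add_pendant (complete_graph 4) 0"

definition Bull :: graph where
  "Bull = add_pendant (add_pendant (complete_graph 3) 0) 1"

definition Campstool :: graph where
  "Campstool = add_pendant (add_pendant (complete_graph 3) 0) 0"

definition Banner :: graph where
  "Banner = add_pendant (cycle_graph 4) 0"

text \<open>The triangles 0, 1, 2 and 0, 3, 4.\<close>

definition Butterfly :: graph where
  "Butterfly = Graph 5 ({{0, 1}, {0, 2}, {1, 2}} \<union> {{0, 3}, {0, 4}, {3, 4}})"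

definition House :: graph where
  "House = graph_complement (path_graph 5)"

text \<open>In \<open>K\<^sub>4\<close> minus the edge \<open>{0, 1}\<close>, the vertices 2 and 3 have degree 3, and 0 and 1 have
  degree 2.\<close>

definition Dart :: graph where
  "Dart = add_pendant (delete_edge (complete_graph 4) 0 1) 2"

definition Kite :: graph where
  "Kite = add_pendant (delete_edge (complete_graph 4) 0 1) 0"

definition Gem :: graph where
  "Gem = add_dominating (path_graph 4)"

definition T_5 :: graph where
  "T_5 = complete_tripartite 1 1 3"

definition K_4_e :: graph where
  "K_4_e = subdivide_edge (complete_graph 4) 0 1"

definition W_5 :: graph where
  "W_5 = add_dominating (cycle_graph 4)"

definition Full_House :: graph where
  "Full_House = add_vertex (complete_graph 4) {0, 1}"

definition K_5_minus_e :: graph where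
  "K_5_minus_e = delete_edge (complete_graph 5) 0 1"

section \<open>Symmetric matrices of a graph and their spectra\<close>

definition symmetric_mat :: "nat \<Rightarrow> real mat \<Rightarrow> bool" where
  "symmetric_mat n A \<longleftrightarrow> A \<in> carrier_mat n n \<and> transpose_mat A = A"

definition S_graph :: "graph \<Rightarrow> real mat set" where
  "S_graph G = {A. symmetric_mat (order_of G) A \<and>
     (\<forall>i \<in> verts G. \<forall>j \<in> verts G. i \<noteq> j \<longrightarrow> (A $$ (i, j) \<noteq> 0 \<longleftrightarrow> {i, j} \<in> edges G))}"

text \<open>Algebraic multiplicity; the matrices considered are real symmetric, so it coincides with
  the geometric one.\<close>

definition multiplicity_of :: "real mat \<Rightarrow> real \<Rightarrow> nat" where
  "multiplicity_of A x = Polynomial.order x (char_poly A)"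

definition mult_list :: "real mat \<Rightarrow> nat list" where
  "mult_list A = map (multiplicity_of A) (sorted_list_of_set {x. eigenvalue A x})"

definition attains :: "graph \<Rightarrow> nat list \<Rightarrow> bool" where
  "attains G m \<longleftrightarrow> (\<exists>A \<in> S_graph G. mult_list A = m)"

definition spectrally_arbitrary :: "nat list \<Rightarrow> graph \<Rightarrow> bool" where
  "spectrally_arbitrary m G \<longleftrightarrow>
     (\<forall>ls :: real list. length ls = length m \<and> sorted_wrt (<) ls \<longrightarrow>
        (\<exists>A \<in> S_graph G. {x. eigenvalue A x} = set ls \<and>
           (\<forall>i < length m. multiplicity_of A (ls ! i) = m ! i)))"

section \<open>Strong properties\<close>

definition entrywise_prod :: "real mat \<Rightarrow> real mat \<Rightarrow> real mat" (infixl \<open>\<star>\<^sub>m\<close> 70) where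
  "A \<star>\<^sub>m B = mat (dim_row A) (dim_col A) (\<lambda>ij. A $$ ij * B $$ ij)"

definition commutator :: "real mat \<Rightarrow> real mat \<Rightarrow> real mat" where
  "commutator A X = A * X - X * A"

definition mat_trace :: "real mat \<Rightarrow> real" where
  "mat_trace A = (\<Sum>i < dim_row A. A $$ (i, i))"

definition SSP :: "nat \<Rightarrow> real mat \<Rightarrow> bool" where
  "SSP n A \<longleftrightarrow>
     (\<forall>X. symmetric_mat n X \<and> A \<star>\<^sub>m X = 0\<^sub>m n n \<and> 1\<^sub>m n \<star>\<^sub>m X = 0\<^sub>m n n \<and>
          commutator A X = 0\<^sub>m n n \<longrightarrow> X = 0\<^sub>m n n)"

definition SMP :: "nat \<Rightarrow> real mat \<Rightarrow> bool" where
  "SMP n A \<longleftrightarrow>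
     (\<forall>X. symmetric_mat n X \<and> A \<star>\<^sub>m X = 0\<^sub>m n n \<and> 1\<^sub>m n \<star>\<^sub>m X = 0\<^sub>m n n \<and>
          commutator A X = 0\<^sub>m n n \<and> (\<forall>i \<in> {2..n - 1}. mat_trace (A ^\<^sub>m i * X) = 0)
        \<longrightarrow> X = 0\<^sub>m n n)"

definition attains_SSP :: "graph \<Rightarrow> nat list \<Rightarrow> bool" where
  "attains_SSP G m \<longleftrightarrow> (\<exists>A \<in> S_graph G. mult_list A = m \<and> SSP (order_of G) A)"

definition attains_SMP :: "graph \<Rightarrow> nat list \<Rightarrow> bool" where
  "attains_SMP G m \<longleftrightarrow> (\<exists>A \<in> S_graph G. mult_list A = m \<and> SMP (order_of G) A)"

definition minimal_attaining_SSP :: "graph \<Rightarrow> nat list \<Rightarrow> bool" where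
  "minimal_attaining_SSP G m \<longleftrightarrow>
     attains_SSP G m \<and> (\<forall>E. E \<subset> edges G \<longrightarrow> \<not> attains_SSP (Graph (order_of G) E) m)"

section \<open>The two tables\<close>

definition minimal_table :: "(nat list \<times> graph list) list" where
  "minimal_table =
    [([4,1], [complete_graph 5]),
     ([3,2], [K_4_e]),
     ([3,1,1], [complete_graph 4 \<uplus>\<^sub>G complete_graph 1, K_4_e]),
     ([1,3,1], [complete_graph 4 \<uplus>\<^sub>G complete_graph 1, complete_bipartite 2 3]),
     ([2,1,2], [cycle_graph 4 \<uplus>\<^sub>G complete_graph 1, Butterfly]),
     ([2,2,1], [cycle_graph 4 \<uplus>\<^sub>G complete_graph 1, cycle_graph 5, Campstool]),
     ([2,1,1,1], [cycle_graph 4 \<uplus>\<^sub>G complete_graph 1, cycle_graph 5,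
                  complete_graph 3 \<uplus>\<^sub>G copies 2 (complete_graph 1)]),
     ([1,2,1,1], [cycle_graph 4 \<uplus>\<^sub>G complete_graph 1, cycle_graph 5,
                  complete_graph 3 \<uplus>\<^sub>G copies 2 (complete_graph 1),
                  complete_bipartite 1 3 \<uplus>\<^sub>G complete_graph 1]),
     ([1,1,1,1,1], [copies 5 (complete_graph 1)])]"

text \<open>Each row consists of graphs, the lists they attain with the SSP, and the lists they attain
  but not with the SMP (marked with an asterisk in the mathematical text). Lists are given up to
  reversal.\<close>

definition connected_table :: "(graph list \<times> nat list list \<times> nat list list) list" where
  "connected_table =
    [([path_graph 5], [[1,1,1,1,1]], []),
     ([generalized_star [2,1,1]], [[1,1,1,1,1], [1,2,1,1]], []),
     ([complete_bipartite 1 4], [[1,1,1,1,1], [1,2,1,1]], [[1,3,1]]),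
     ([L_3_2, Bull], [[1,1,1,1,1], [1,2,1,1], [2,1,1,1]], []),
     ([cycle_graph 5, Campstool],
        [[1,1,1,1,1], [1,2,1,1], [2,1,1,1], [2,2,1]], []),
     ([Banner, House, Dart, Kite, Gem],
        [[1,1,1,1,1], [1,2,1,1], [2,1,1,1], [2,2,1], [2,1,2]], []),
     ([Butterfly],
        [[1,1,1,1,1], [1,2,1,1], [2,1,1,1], [2,2,1], [2,1,2]], [[1,3,1], [3,1,1]]),
     ([complete_bipartite 2 3, T_5],
        [[1,1,1,1,1], [1,2,1,1], [2,1,1,1], [2,2,1], [2,1,2], [1,3,1]], []),
     ([L_4_1],
        [[1,1,1,1,1], [1,2,1,1], [2,1,1,1], [2,2,1], [2,1,2], [1,3,1], [3,1,1]], []),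
     ([K_4_e, W_5, Full_House, K_5_minus_e],
        [[1,1,1,1,1], [1,2,1,1], [2,1,1,1], [2,2,1], [2,1,2], [1,3,1], [3,1,1], [3,2]], []),
     ([complete_graph 5],
        [[1,1,1,1,1], [1,2,1,1], [2,1,1,1], [2,2,1], [2,1,2], [1,3,1], [3,1,1], [3,2], [4,1]],
        [])]"

definition with_reversals :: "nat list list \<Rightarrow> nat list set" where
  "with_reversals ms = set ms \<union> rev ` set ms"

end

theory Submission
  imports Defs "HOL-Analysis.Analysis" "HOL-Library.Numeral_Type"
begin

text \<open>Lists are produced by two mechanisms. For the minimal graphs, explicit matrices with prescribed
  eigenvalues have the strong spectral property. The property then
  carries the list over to every supergraph: it says that the isospectral manifold of \<open>A\<close> meets the
  space of matrices with the pattern of the graph transversally, so the off-pattern entries can be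
  prescribed to be small and nonzero while the spectrum is kept.

  Lists are excluded by the spectral decomposition: an eigenspace of dimension exceeding a zero
  forcing set contains a nonzero vector that vanishes on it; extreme eigenvalues give semidefinite
  shifts; and few distinct eigenvalues contradict a unique short path between nonadjacent vertices.
  The starred lists fail the strong multiplicity property through an explicit matrix built from
  eigenvectors of the triple eigenvalue.

  The graphs of order five are classified by adding edges one at a time, which leaves finitely many
  isomorphisms and embeddings between edge lists to be checked.\<close>

text \<open>Openness arguments need matrices over a finite index type, characteristic polynomials
  need matrices of variable dimension; \<open>index_bij\<close> carries results across. Spectra are
  prescribed through \<open>roots_poly\<close>, so only the multiset of eigenvalues matters. Every
  unstarred entry is proved as \<open>arbitrary_SSP\<close>, for all choices of eigenvalues at once:
  this form survives passing to supergraphs and to negatives, hence yields the SSP, spectral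
  arbitrariness and the reversed lists together. The starred entries cannot go this way and need
  matrices of their own. Explicit matrices come from Gram vectors or from symmetries that split the
  spectrum; the five-cycle is the hard case, since its few edges leave a cubic equation that is
  solved by the intermediate value theorem. Monotonicity also shortens the negative side:
  obstructions are proved for connected graphs only, because each disconnected graph that fails
  embeds in a connected one that fails, and minimality reduces to single edge deletions.\<close>

no_notation Matrix.vec_index (infixl "$" 100)
no_notation Matrix.scalar_prod (infix "\<bullet>" 70)
hide_const (open) Matrix.mat Matrix.row Matrix.col Matrix.rows Matrix.vec Determinant.det Polynomial.order
hide_type (open) Matrix.vec

section \<open>The spectral theorem for real symmetric matrices\<close>

text \<open>The vector maximizes the Rayleigh quotient on the unit sphere of \<open>S\<close>, which
  is compact. The residual \<open>f u - c *\<^sub>R u\<close> lies in \<open>S\<close> and is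
  orthogonal to \<open>u\<close>, so the first order condition at the maximum makes it orthogonal to
  itself.\<close>

lemma self_adjoint_eigenvector_in_subspace:
  fixes f :: "'a::euclidean_space \<Rightarrow> 'a"
  assumes lin: "linear f" and sa: "\<And>x y. f x \<bullet> y = x \<bullet> f y"
    and S: "subspace S" "f ` S \<subseteq> S" "S \<noteq> {0}"
  obtains u c where "u \<in> S" "norm u = 1" "f u = c *\<^sub>R u"
proof -
  let ?K = "S \<inter> sphere 0 1"
  have bl: "bounded_linear f" using lin by (simp add: linear_conv_bounded_linear)
  obtain w where w: "w \<in> S" "w \<noteq> 0" using S(1,3) subspace_0 by blast
  then have "w /\<^sub>R norm w \<in> ?K" using S(1) by (simp add: subspace_scale)
  then have ne: "?K \<noteq> {}" by blast
  have cmp: "compact ?K" by (intro closed_Int_compact closed_subspace S(1) compact_sphere)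
  have cont: "continuous_on ?K (\<lambda>x. f x \<bullet> x)"
    by (intro continuous_intros bounded_linear.continuous_on[OF bl])
  obtain u where u: "u \<in> ?K" and mx: "\<And>y. y \<in> ?K \<Longrightarrow> f y \<bullet> y \<le> f u \<bullet> u"
    using continuous_attains_sup[OF cmp ne cont] by blast
  define c where "c = f u \<bullet> u"
  have uS: "u \<in> S" and nu: "norm u = 1" using u by auto
  have uu: "u \<bullet> u = 1" using nu by (simp add: dot_square_norm)
  have bound: "f y \<bullet> y \<le> c * (y \<bullet> y)" if "y \<in> S" for y
  proof (cases "y = 0")
    case True then show ?thesis using lin by (simp add: linear_0)
  next
    case False
    have "y /\<^sub>R norm y \<in> ?K" using that False S(1) by (simp add: subspace_scale)
    from mx[OF this] have "(f y \<bullet> y) / (norm y)\<^sup>2 \<le> c"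
      using lin by (simp add: linear_scale c_def power2_eq_square divide_simps)
    then show ?thesis using False by (simp add: dot_square_norm divide_simps mult.commute)
  qed
  have orth: "f u \<bullet> v = 0" if v: "v \<in> S" "u \<bullet> v = 0" for v
  proof (rule ccontr)
    assume nz: "f u \<bullet> v \<noteq> 0"
    define b where "b = f u \<bullet> v"
    define e where "e = c * (v \<bullet> v) - f v \<bullet> v"
    have e0: "e \<ge> 0" using bound[OF v(1)] by (simp add: e_def)
    have ineq: "2 * t * b \<le> t\<^sup>2 * e" for t
    proof -
      have "u + t *\<^sub>R v \<in> S" using uS v(1) S(1) by (simp add: subspace_add subspace_scale)
      from bound[OF this]
      have "f u \<bullet> u + 2 * t * (f u \<bullet> v) + t\<^sup>2 * (f v \<bullet> v)
           \<le> c * (u \<bullet> u + 2 * t * (u \<bullet> v) + t\<^sup>2 * (v \<bullet> v))"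
        using lin sa[of v u]
        by (simp add: linear_add linear_scale inner_add inner_commute power2_eq_square algebra_simps)
      then show ?thesis by (simp add: c_def[symmetric] uu v(2) b_def e_def algebra_simps)
    qed
    \<comment> \<open>This step length makes the linear gain \<open>2 * t * b\<close> exceed the
      quadratic loss \<open>t\<^sup>2 * e\<close>; adding 1 keeps the denominator positive when
      \<open>e = 0\<close>.\<close>
    define t where "t = b / (e + 1)"
    have "2 * t * b = 2 * b\<^sup>2 / (e + 1)" by (simp add: t_def power2_eq_square)
    moreover have "t\<^sup>2 * e \<le> b\<^sup>2 / (e + 1)"
    proof -
      have "t\<^sup>2 * e \<le> t\<^sup>2 * (e + 1)" by (simp add: mult_left_mono)
      also have "\<dots> = b\<^sup>2 / (e + 1)" using e0 by (simp add: t_def power2_eq_square)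
      finally show ?thesis .
    qed
    moreover have "b\<^sup>2 / (e + 1) > 0" using nz e0 by (simp add: b_def)
    ultimately show False using ineq[of t] by simp
  qed
  have "f u - c *\<^sub>R u \<in> S" using S uS by (simp add: image_subset_iff subspace_diff subspace_scale)
  moreover have "u \<bullet> (f u - c *\<^sub>R u) = 0"
    by (simp add: inner_diff_right uu c_def inner_commute)
  ultimately have "f u \<bullet> (f u - c *\<^sub>R u) = 0" "u \<bullet> (f u - c *\<^sub>R u) = 0" using orth by blast+
  then have "(f u - c *\<^sub>R u) \<bullet> (f u - c *\<^sub>R u) = 0" by (simp add: inner_diff_left)
  then have "f u = c *\<^sub>R u" by simp
  then show ?thesis using that uS nu by blast
qed

text \<open>Induction on the dimension of \<open>S\<close>: splitting off one unit eigenvector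
  leaves its orthogonal complement in \<open>S\<close>, which is invariant because \<open>f\<close>
  is self-adjoint.\<close>

lemma self_adjoint_orthonormal_eigenbasis:
  fixes f :: "'a::euclidean_space \<Rightarrow> 'a"
  assumes lin: "linear f" and sa: "\<And>x y. f x \<bullet> y = x \<bullet> f y"
  shows "subspace S \<Longrightarrow> f ` S \<subseteq> S \<Longrightarrow>
    \<exists>B \<subseteq> S. finite B \<and> pairwise orthogonal B \<and> (\<forall>b \<in> B. norm b = 1 \<and> (\<exists>c. f b = c *\<^sub>R b)) \<and> span B = S"
proof (induction "dim S" arbitrary: S rule: less_induct)
  case less
  show ?case
  proof (cases "S = {0}")
    case True
    then show ?thesis by (intro exI[of _ "{}"]) auto
  next
    case False
    obtain u c where u: "u \<in> S" "norm u = 1" "f u = c *\<^sub>R u"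
      using self_adjoint_eigenvector_in_subspace[OF lin sa less.prems False] by blast
    have uu: "u \<bullet> u = 1" using u(2) by (simp add: dot_square_norm)
    let ?T = "S \<inter> {x. u \<bullet> x = 0}"
    have sT: "subspace ?T" by (intro subspace_inter less.prems(1) subspace_hyperplane)
    have fT: "f ` ?T \<subseteq> ?T"
    proof
      fix y assume "y \<in> f ` ?T"
      then obtain x where x: "x \<in> S" "u \<bullet> x = 0" "y = f x" by blast
      have "u \<bullet> f x = f u \<bullet> x" by (rule sa[symmetric])
      then show "y \<in> ?T" using x less.prems(2) u(3) by auto
    qed
    have "u \<notin> ?T" using uu by simp
    then have "?T \<subset> S" using u(1) by blast
    then have "dim ?T < dim S"
      using subspace_dim_equal[OF sT less.prems(1)] dim_subset[of ?T S]
      by (metis Int_lower1 nle_le order_le_imp_less_or_eq psubset_eq)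
    from less.hyps[OF this sT fT] obtain B where B: "B \<subseteq> ?T" "finite B" "pairwise orthogonal B"
      "\<forall>b \<in> B. norm b = 1 \<and> (\<exists>c. f b = c *\<^sub>R b)" "span B = ?T" by blast
    have "span (insert u B) = S"
    proof
      show "span (insert u B) \<subseteq> S" using B(1) u(1) less.prems(1) by (intro span_minimal) auto
      show "S \<subseteq> span (insert u B)"
      proof
        fix x assume x: "x \<in> S"
        have "x - (u \<bullet> x) *\<^sub>R u \<in> ?T"
          using x u(1) less.prems(1) by (simp add: subspace_diff subspace_scale inner_diff_right uu)
        then have "x - (u \<bullet> x) *\<^sub>R u \<in> span (insert u B)"
          using B(5) span_mono[of B "insert u B"] by blast
        moreover have "(u \<bullet> x) *\<^sub>R u \<in> span (insert u B)" by (intro span_scale span_base) simp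
        ultimately show "x \<in> span (insert u B)" by (metis diff_add_cancel span_add)
      qed
    qed
    moreover have "pairwise orthogonal (insert u B)"
      using B(1,3) by (auto simp: pairwise_insert orthogonal_def inner_commute)
    ultimately show ?thesis using B u less.prems
      by (intro exI[of _ "insert u B"]) auto
  qed
qed

text \<open>The entrywise form, with eigenvectors numbered by natural numbers, is the one that
  transfers directly to matrices indexed by numbers.\<close>

lemma symmetric_matrix_spectral_decomposition:
  fixes A :: "real^'n^'n" and g :: "'n \<Rightarrow> nat"
  assumes sym: "transpose A = A"
  obtains d :: "nat \<Rightarrow> real" and q :: "nat \<Rightarrow> real^'n"
  where "\<And>k l. k < CARD('n) \<Longrightarrow> l < CARD('n) \<Longrightarrow> q k \<bullet> q l = (if k = l then 1 else 0)"
    and "\<And>i j. A $ i $ j = (\<Sum>k<CARD('n). d k * q k $ i * q k $ j)"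
proof -
  have lin: "linear (\<lambda>x. A *v x)" by simp
  have sa: "(A *v x) \<bullet> y = x \<bullet> (A *v y)" for x y
    using sym by (metis dot_lmul_matrix vector_transpose_matrix)
  obtain B where B: "finite B" "pairwise orthogonal B" "\<forall>b \<in> B. norm b = 1 \<and> (\<exists>c. A *v b = c *\<^sub>R b)"
    "span B = UNIV"
    using self_adjoint_orthonormal_eigenbasis[OF lin sa, of UNIV] by auto
  have "0 \<notin> B" using B(3) by force
  then have ind: "independent B" using B(2) pairwise_orthogonal_independent by blast
  have card: "card B = CARD('n)"
    using dim_span_eq_card_independent[OF ind] B(4) by simp
  obtain q where q: "bij_betw q {..<CARD('n)} B"
    using ex_bij_betw_nat_finite[OF B(1)] card by (auto simp: atLeast0LessThan)
  have qB: "q k \<in> B" if "k < CARD('n)" for k using q that by (auto simp: bij_betw_def)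
  have on: "q k \<bullet> q l = (if k = l then 1 else 0)" if "k < CARD('n)" "l < CARD('n)" for k l
  proof (cases "k = l")
    case True then show ?thesis using B(3) qB[OF that(1)] by (simp add: dot_square_norm)
  next
    case False
    then have "q k \<noteq> q l" using q that by (auto simp: bij_betw_def inj_on_def)
    then show ?thesis using B(2) qB that False by (auto simp: pairwise_def orthogonal_def)
  qed
  have "\<forall>k. \<exists>c. k < CARD('n) \<longrightarrow> A *v q k = c *\<^sub>R q k" using B(3) qB by blast
  then obtain d where d: "\<And>k. k < CARD('n) \<Longrightarrow> A *v q k = d k *\<^sub>R q k" by metis
  \<comment> \<open>\<open>M\<close> is the rank one expansion; orthonormality gives it the same
    action as \<open>A\<close> on the eigenbasis, so the two linear maps coincide.\<close>
  define M :: "real^'n^'n" where "M = (\<chi> i j. \<Sum>k<CARD('n). d k * q k $ i * q k $ j)"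
  have Mv: "M *v x = (\<Sum>k<CARD('n). (d k * (q k \<bullet> x)) *\<^sub>R q k)" for x
  proof (rule vec_eq_iff[THEN iffD2], rule)
    fix i
    have "(M *v x) $ i = (\<Sum>j\<in>UNIV. \<Sum>k<CARD('n). d k * q k $ i * q k $ j * x $ j)"
      by (simp add: M_def matrix_vector_mult_def sum_distrib_right)
    also have "\<dots> = (\<Sum>k<CARD('n). \<Sum>j\<in>UNIV. d k * q k $ i * q k $ j * x $ j)"
      by (rule sum.swap)
    also have "\<dots> = (\<Sum>k<CARD('n). (d k * (q k \<bullet> x)) * q k $ i)"
      by (intro sum.cong refl) (simp add: inner_vec_def sum_distrib_left sum_distrib_right mult_ac)
    finally show "(M *v x) $ i = (\<Sum>k<CARD('n). (d k * (q k \<bullet> x)) *\<^sub>R q k) $ i" by simp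
  qed
  have "M *v q l = A *v q l" if "l < CARD('n)" for l
  proof -
    have "M *v q l = (\<Sum>k<CARD('n). if k = l then d l *\<^sub>R q l else 0)"
      unfolding Mv by (intro sum.cong) (auto simp: on that)
    then show ?thesis using that d by simp
  qed
  then have agree: "M *v b = A *v b" if "b \<in> B" for b
    using that q by (auto simp: bij_betw_def)
  have "(\<lambda>x. M *v x) = (\<lambda>x. A *v x)"
    by (rule linear_eq_on_span[where B = B, THEN ext]) (use agree B(4) in auto)
  then have "M = A" by (metis matrix_eq)
  then have "\<And>i j. A $ i $ j = (\<Sum>k<CARD('n). d k * q k $ i * q k $ j)"
    by (metis (no_types, lifting) M_def vec_lambda_beta)
  then show ?thesis using that on by blast
qed

section \<open>Perturbing a matrix with the strong spectral property\<close>

lemma bounded_bilinear_matrix_mult: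
  "bounded_bilinear (\<lambda>(A :: real^'m^'l) (B :: real^'n^'m). A ** B)"
  unfolding bilinear_conv_bounded_bilinear[symmetric] bilinear_def
  by (auto intro!: linearI simp: matrix_matrix_mult_def vec_eq_iff distrib_left distrib_right
      sum.distrib sum_distrib_left mult_ac)

lemma linear_transpose: "linear (transpose :: real^'n^'m \<Rightarrow> real^'m^'n)"
  by (auto intro!: linearI simp: transpose_def vec_eq_iff)

lemma inner_transpose: "transpose (A :: real^'n^'m) \<bullet> transpose B = A \<bullet> B"
  unfolding inner_vec_def transpose_def by simp (rule sum.swap)

lemma inner_matrix_mult_left: "(A :: real^'n^'m) \<bullet> (B ** C) = (transpose B ** A) \<bullet> C"
proof -
  have "A \<bullet> (B ** C) = (\<Sum>i\<in>UNIV. \<Sum>j\<in>UNIV. \<Sum>k\<in>UNIV. A $ i $ j * B $ i $ k * C $ k $ j)"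
    by (simp add: inner_vec_def matrix_matrix_mult_def sum_distrib_left mult.assoc)
  also have "\<dots> = (\<Sum>i\<in>UNIV. \<Sum>k\<in>UNIV. \<Sum>j\<in>UNIV. A $ i $ j * B $ i $ k * C $ k $ j)"
    by (intro sum.cong refl sum.swap)
  also have "\<dots> = (\<Sum>k\<in>UNIV. \<Sum>i\<in>UNIV. \<Sum>j\<in>UNIV. A $ i $ j * B $ i $ k * C $ k $ j)"
    by (rule sum.swap)
  also have "\<dots> = (\<Sum>k\<in>UNIV. \<Sum>j\<in>UNIV. \<Sum>i\<in>UNIV. A $ i $ j * B $ i $ k * C $ k $ j)"
    by (intro sum.cong refl sum.swap)
  also have "\<dots> = (transpose B ** A) \<bullet> C"
    by (simp add: inner_vec_def matrix_matrix_mult_def transpose_def sum_distrib_left mult_ac)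
  finally show ?thesis .
qed

text \<open>The strong spectral property for the pattern whose non-edges are given by the relation \<open>N\<close>.\<close>

definition ssp_pattern :: "('n \<Rightarrow> 'n \<Rightarrow> bool) \<Rightarrow> real^'n^'n \<Rightarrow> bool" where
  "ssp_pattern N A \<longleftrightarrow> (\<forall>X. transpose X = X \<longrightarrow> (\<forall>i j. \<not> N i j \<longrightarrow> X $ i $ j = 0) \<longrightarrow>
     A ** X = X ** A \<longrightarrow> X = 0)"

text \<open>The commutator with \<open>A\<close> is injective on the finite dimensional space of
  admissible \<open>X\<close>, hence bounded below by some \<open>c\<close>, and replacing
  \<open>A\<close> by \<open>B\<close> changes it by at most \<open>2 * K * norm (B - A)\<close>
  times the norm of \<open>X\<close>. The perturbed matrix found later therefore keeps the property
  for the old pattern.\<close>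

lemma ssp_pattern_open:
  fixes A :: "real^'n^'n"
  assumes ssp: "ssp_pattern N A"
  obtains e where "e > 0" "\<And>B. norm (B - A) < e \<Longrightarrow> ssp_pattern N B"
proof -
  let ?S = "{X :: real^'n^'n. transpose X = X \<and> (\<forall>i j. \<not> N i j \<longrightarrow> X $ i $ j = 0)}"
  interpret bb: bounded_bilinear "\<lambda>(A :: real^'n^'n) (B :: real^'n^'n). A ** B"
    by (rule bounded_bilinear_matrix_mult)
  have sub: "subspace ?S"
    by (auto simp: subspace_def transpose_def vec_eq_iff)
  have bl: "bounded_linear (\<lambda>X. A ** X - X ** A)"
    by (intro bounded_linear_sub bb.bounded_linear_left bb.bounded_linear_right)
  have "\<forall>X\<in>?S. A ** X - X ** A = 0 \<longrightarrow> X = 0"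
    using ssp by (auto simp: ssp_pattern_def)
  from injective_imp_isometric[OF closed_subspace[OF sub] sub bl this]
  obtain c where c: "c > 0" "\<And>X. X \<in> ?S \<Longrightarrow> c * norm X \<le> norm (A ** X - X ** A)" by blast
  obtain K where K: "K > 0" "\<And>(A :: real^'n^'n) (B :: real^'n^'n). norm (A ** B) \<le> norm A * norm B * K"
    using bb.pos_bounded by blast
  have "ssp_pattern N B" if B: "norm (B - A) < c / (2 * K)" for B
    unfolding ssp_pattern_def
  proof (intro allI impI)
    fix X :: "real^'n^'n"
    assume X: "transpose X = X" "\<forall>i j. \<not> N i j \<longrightarrow> X $ i $ j = 0" "B ** X = X ** B"
    have "A ** X - X ** A = X ** (B - A) - (B - A) ** X"
      using X(3) by (simp add: bb.diff_left bb.diff_right)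
    then have "c * norm X \<le> norm (X ** (B - A) - (B - A) ** X)"
      using c(2)[of X] X by simp
    also have "\<dots> \<le> norm (X ** (B - A)) + norm ((B - A) ** X)" by (rule norm_triangle_ineq4)
    also have "\<dots> \<le> 2 * K * norm (B - A) * norm X"
      using K(2)[of X "B - A"] K(2)[of "B - A" X] by (simp add: mult_ac)
    finally have "(c - 2 * K * norm (B - A)) * norm X \<le> 0" by (simp add: algebra_simps)
    moreover have "c - 2 * K * norm (B - A) > 0" using B K(1) by (simp add: field_simps)
    ultimately have "norm X \<le> 0" by (simp add: mult_le_0_iff)
    then show "X = 0" by simp
  qed
  then show ?thesis using that[of "c / (2 * K)"] c(1) K(1) by simp
qed

text \<open>A vector orthogonal to the range lies in the kernel of the adjoint, and a linear map is
  onto exactly when its adjoint is injective.\<close>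

lemma linear_surj_if_no_orthogonal:
  fixes f :: "'a::euclidean_space \<Rightarrow> 'b::euclidean_space"
  assumes "linear f" and orth: "\<And>y. (\<And>x. y \<bullet> f x = 0) \<Longrightarrow> y = 0"
  shows "surj f"
proof -
  have "inj (adjoint f)"
    unfolding linear_injective_0[OF adjoint_linear[OF assms(1)]]
  proof (intro allI impI)
    fix y assume "adjoint f y = 0"
    then have "y \<bullet> f x = 0" for x using adjoint_clauses(2)[OF assms(1), of y x] by simp
    then show "y = 0" by (rule orth)
  qed
  then show ?thesis using assms(1) by simp
qed

text \<open>The map \<open>(Q, Y, Z) \<mapsto> (Q\<^sup>T Q + Y - Y\<^sup>T, Q\<^sup>T A Q + P Z)\<close> is a submersion at \<open>(I, 0, 0)\<close>: the
  slack variables \<open>Y\<close> and \<open>Z\<close> absorb the coordinates that are redundant by symmetry or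
  unconstrained by the pattern, and a pair orthogonal to the range of the derivative yields a
  symmetric matrix violating the strong spectral property. Openness then provides an orthogonal
  \<open>Q\<close> for which the non-edge entries of \<open>Q\<^sup>T A Q\<close> take prescribed small values.\<close>

lemma ssp_pattern_perturb:
  fixes A W :: "real^'n^'n"
  assumes symA: "transpose A = A"
    and N: "\<And>i j. N i j \<Longrightarrow> N j i"
    and ssp: "ssp_pattern N A" and e: "e > 0"
  obtains d where "d > 0"
    "\<And>W. transpose W = W \<Longrightarrow> norm W < d \<Longrightarrow>
      \<exists>Q. transpose Q ** Q = Finite_Cartesian_Product.mat 1 \<and> norm (transpose Q ** A ** Q - A) < e \<and>
        (\<forall>i j. N i j \<longrightarrow> (transpose Q ** A ** Q) $ i $ j = A $ i $ j + W $ i $ j)"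
proof -
  interpret bb: bounded_bilinear "\<lambda>(A :: real^'n^'n) (B :: real^'n^'n). A ** B"
    by (rule bounded_bilinear_matrix_mult)
  interpret tr: bounded_linear "transpose :: real^'n^'n \<Rightarrow> real^'n^'n"
    using linear_transpose by (simp add: linear_conv_bounded_linear)
  let ?I = "Finite_Cartesian_Product.mat 1 :: real^'n^'n"
  \<comment> \<open>On non-edges \<open>P Z\<close> is antisymmetric, so it leaves the symmetric
    part of those entries untouched; on all other entries it is arbitrary and removes any
    constraint.\<close>
  define P :: "real^'n^'n \<Rightarrow> real^'n^'n" where
    "P Z = (\<chi> i j. if N i j then Z $ i $ j - Z $ j $ i else Z $ i $ j)" for Z
  have "linear P" by (auto intro!: linearI simp: P_def vec_eq_iff algebra_simps)
  then interpret P: bounded_linear P by (simp add: linear_conv_bounded_linear)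
  define f :: "(real^'n^'n) \<times> (real^'n^'n) \<times> (real^'n^'n) \<Rightarrow> (real^'n^'n) \<times> (real^'n^'n)" where
    "f v = (transpose (fst v) ** fst v + fst (snd v) - transpose (fst (snd v)),
            transpose (fst v) ** (A ** fst v) + P (snd (snd v)))" for v
  define f' :: "(real^'n^'n) \<times> (real^'n^'n) \<times> (real^'n^'n) \<Rightarrow> (real^'n^'n) \<times> (real^'n^'n)" where
    "f' h = (fst h + transpose (fst h) + fst (snd h) - transpose (fst (snd h)),
             A ** fst h + transpose (fst h) ** A + P (snd (snd h)))" for h
  let ?x = "(?I, 0, 0) :: (real^'n^'n) \<times> (real^'n^'n) \<times> (real^'n^'n)"
  have bl: "bounded_linear (\<lambda>v :: (real^'n^'n) \<times> (real^'n^'n) \<times> (real^'n^'n). fst (snd v))"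
    "bounded_linear (\<lambda>v :: (real^'n^'n) \<times> (real^'n^'n) \<times> (real^'n^'n). snd (snd v))"
    by (intro bounded_linear_compose[OF bounded_linear_fst] bounded_linear_compose[OF bounded_linear_snd]
        bounded_linear_snd)+
  have d1: "(fst has_derivative fst) (at ?x)"
    by (rule bounded_linear_imp_has_derivative[OF bounded_linear_fst])
  have d2: "((\<lambda>v. transpose (fst v)) has_derivative (\<lambda>h. transpose (fst h))) (at ?x)"
    by (rule tr.has_derivative[OF d1])
  have d3: "((\<lambda>v. A ** fst v) has_derivative (\<lambda>h. A ** fst h)) (at ?x)"
    by (rule bounded_linear.has_derivative[OF bb.bounded_linear_right d1])
  have d4: "((\<lambda>v. fst (snd v)) has_derivative (\<lambda>h. fst (snd h))) (at ?x)"
    by (rule bounded_linear_imp_has_derivative[OF bl(1)])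
  have d5: "((\<lambda>v. P (snd (snd v))) has_derivative (\<lambda>h. P (snd (snd h)))) (at ?x)"
    by (rule P.has_derivative[OF bounded_linear_imp_has_derivative[OF bl(2)]])
  have der: "(f has_derivative f') (at ?x)"
    unfolding f_def
    by (rule has_derivative_eq_rhs[OF has_derivative_Pair[OF
          has_derivative_diff[OF has_derivative_add[OF bb.FDERIV[OF d2 d1] d4] tr.has_derivative[OF d4]]
          has_derivative_add[OF bb.FDERIV[OF d2 d3] d5]]])
      (auto simp: fun_eq_iff f'_def add_ac)
  have contf: "continuous_on UNIV f"
    unfolding f_def
    by (intro continuous_intros bb.continuous_on tr.continuous_on P.continuous_on)
  have "linear f'" using der has_derivative_bounded_linear bounded_linear.linear by blast
  have "surj f'"
  proof (rule linear_surj_if_no_orthogonal[OF \<open>linear f'\<close>])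
    fix y :: "(real^'n^'n) \<times> (real^'n^'n)" assume orth: "\<And>x. y \<bullet> f' x = 0"
    obtain T W where y: "y = (T, W)" by (cases y)
    have eq: "T \<bullet> (H + transpose H + Y - transpose Y) + W \<bullet> (A ** H + transpose H ** A + P Z) = 0" for H Y Z
      using orth[of "(H, Y, Z)"] by (simp add: f'_def y)
    \<comment> \<open>Varying \<open>Y\<close> alone shows that \<open>T\<close> is symmetric;
      varying \<open>Z\<close> alone, over matrix units, shows that \<open>W\<close> is symmetric
      and supported on the non-edges.\<close>
    have "T \<bullet> Y = transpose T \<bullet> Y" for Y
      using eq[of 0 Y 0] inner_transpose[of "transpose T" Y]
      by (simp add: inner_diff_right tr.zero P.zero bb.zero_left bb.zero_right)
    then have symT: "transpose T = T" by (metis vector_eq_rdot)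
    have WP: "W \<bullet> P Z = 0" for Z
      using eq[of 0 0 Z] by (simp add: tr.zero bb.zero_left bb.zero_right)
    have W_Z: "W \<bullet> P (\<chi> a b. if a = i \<and> b = j then 1 else 0) =
      (if N i j then W $ i $ j - W $ j $ i else W $ i $ j)" (is "_ \<bullet> P ?Z = _") for i j
    proof -
      have "P ?Z = (if N i j then ?Z - transpose ?Z else ?Z)"
        using N by (auto simp: P_def vec_eq_iff transpose_def)
      moreover have Z: "W \<bullet> ?Z = W $ i $ j" for W :: "real^'n^'n"
      proof -
        have "(\<Sum>b\<in>UNIV. W $ a $ b * (if a = i \<and> b = j then 1 else 0)) = (if a = i then W $ a $ j else 0)" for a
          by (cases "a = i") (simp_all add: if_distrib cong: if_cong)
        then show ?thesis by (simp add: inner_vec_def)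
      qed
      moreover have "W \<bullet> transpose ?Z = W $ j $ i"
        using inner_transpose[of "transpose W" ?Z] Z[of "transpose W"] by (simp add: transpose_def)
      ultimately show ?thesis by (simp add: inner_diff_right)
    qed
    then have Wentries: "(if N i j then W $ i $ j - W $ j $ i else W $ i $ j) = 0" for i j
      using WP by metis
    have W0: "\<forall>i j. \<not> N i j \<longrightarrow> W $ i $ j = 0" by (metis Wentries)
    have "W $ i $ j = W $ j $ i" for i j
      using Wentries[of i j] Wentries[of j i] N[of i j] N[of j i] by (auto split: if_splits)
    then have symW: "transpose W = W" by (simp add: transpose_def vec_eq_iff)
    have "(T + A ** W) \<bullet> H = 0" for H
    proof -
      have "T \<bullet> transpose H = T \<bullet> H" using inner_transpose[of T H] symT by simp
      moreover have "W \<bullet> (A ** H) = (A ** W) \<bullet> H" by (simp add: inner_matrix_mult_left symA)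
      moreover have "W \<bullet> (transpose H ** A) = W \<bullet> (A ** H)"
        using inner_transpose[of W "A ** H"] symW symA by (simp add: matrix_transpose_mul)
      ultimately show ?thesis using eq[of H 0 0]
        by (simp add: inner_add_right inner_add_left tr.zero P.zero)
    qed
    then have "T + A ** W = 0" using vector_eq_rdot[of "T + A ** W" 0] by simp
    then have AW: "A ** W = - T" by (simp add: add_eq_0_iff2)
    \<comment> \<open>\<open>A ** W = - T\<close> is symmetric, so it equals its transpose
      \<open>W ** A\<close>: thus \<open>W\<close> commutes with \<open>A\<close> and the strong
      property applies.\<close>
    have "W ** A = transpose (A ** W)" by (simp add: matrix_transpose_mul symA symW)
    then have "W ** A = A ** W" by (simp add: AW linear_neg[OF linear_transpose] symT)
    then have "W = 0" using ssp symW W0 unfolding ssp_pattern_def by metis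
    then show "y = 0" using AW y by (simp add: bb.zero_right zero_prod_def)
  qed
  then obtain g' where g': "linear g'" "f' \<circ> g' = id"
    using linear_surjective_right_inverse[OF \<open>linear f'\<close>] by blast
  \<comment> \<open>Restricting to this open set makes the preimage supplied by the open mapping
    theorem satisfy the bound \<open>e\<close> on the change of the matrix.\<close>
  define T where "T = {v :: (real^'n^'n) \<times> (real^'n^'n) \<times> (real^'n^'n).
    norm (transpose (fst v) ** (A ** fst v) - A) < e}"
  have "open T"
    unfolding T_def
    by (intro open_Collect_less continuous_intros bb.continuous_on tr.continuous_on)
  moreover have "?x \<in> T" using e by (simp add: T_def)
  ultimately have "f ?x \<in> interior (f ` T)"
    using sussmann_open_mapping[OF open_UNIV contf UNIV_I der _ g'(2), of T] g'(1)
    by (simp add: linear_conv_bounded_linear interior_open)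
  moreover have "f ?x = (?I, A)" by (simp add: f_def tr.zero P.zero)
  ultimately obtain d where d: "d > 0" "ball (?I, A) d \<subseteq> f ` T"
    by (metis mem_interior)
  have "\<exists>Q. transpose Q ** Q = ?I \<and> norm (transpose Q ** A ** Q - A) < e \<and>
        (\<forall>i j. N i j \<longrightarrow> (transpose Q ** A ** Q) $ i $ j = A $ i $ j + W $ i $ j)"
    if W: "transpose W = W" "norm W < d" for W
  proof -
    have "(?I, A + W) \<in> ball (?I, A) d"
      using W(2) by (simp add: dist_norm norm_Pair)
    then obtain v where v: "v \<in> T" "f v = (?I, A + W)" using d(2) by (metis imageE subset_eq)
    obtain Q Y Z where vv: "v = (Q, Y, Z)" by (cases v)
    have 1: "transpose Q ** Q + Y - transpose Y = ?I" and 2: "transpose Q ** (A ** Q) + P Z = A + W"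
      using v(2) by (simp_all add: f_def vv)
    let ?D = "transpose Q ** Q - ?I"
    \<comment> \<open>The defect \<open>?D\<close> is symmetric as a Gram matrix minus the identity,
      and skew because of the form in which the slack \<open>Y\<close> enters; hence it vanishes and
      \<open>Q\<close> is orthogonal.\<close>
    have D: "?D = transpose Y - Y" using 1 by (simp add: algebra_simps)
    have "?D = transpose ?D" by (simp add: tr.diff matrix_transpose_mul)
    also have "\<dots> = - ?D" unfolding D by (simp add: tr.diff)
    finally have "?D = - ?D" .
    moreover have "X = - X \<Longrightarrow> X = 0" for X :: "real^'n^'n" by (simp add: vec_eq_iff)
    ultimately have "?D = 0" by blast
    then have Q: "transpose Q ** Q = ?I" by simp
    let ?M = "transpose Q ** (A ** Q)"
    have symM: "transpose ?M = ?M" by (simp add: matrix_transpose_mul symA matrix_mul_assoc)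
    have "?M $ i $ j = A $ i $ j + W $ i $ j" if n: "N i j" for i j
    proof -
      \<comment> \<open>Adding the entries at \<open>(i, j)\<close> and \<open>(j, i)\<close>
        cancels the antisymmetric slack, while \<open>?M\<close>, \<open>A\<close> and
        \<open>W\<close> are symmetric.\<close>
      have ent: "?M $ i $ j + P Z $ i $ j = A $ i $ j + W $ i $ j" for i j
        using 2 by (metis vector_add_component)
      have s: "X $ i $ j = X $ j $ i" if "transpose X = X" for X :: "real^'n^'n" and i j
        using that by (metis transpose_def vec_lambda_beta)
      show ?thesis
        using ent[of i j] ent[of j i] s[OF symM, of i j] s[OF symA, of i j] s[OF W(1), of i j] n N[OF n]
        by (simp add: P_def)
    qed
    moreover have "norm (?M - A) < e" using v(1) by (simp add: T_def vv)
    ultimately show ?thesis using Q by (intro exI[of _ Q]) (simp add: matrix_mul_assoc)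
  qed
  then show ?thesis using that d(1) by blast
qed

section \<open>Transfer to matrices indexed by natural numbers\<close>

text \<open>Bridge between matrices over a finite type, where norms and open mappings are available,
  and matrices of dimension \<open>n\<close>, where determinants and characteristic polynomials
  live.\<close>

locale index_bij =
  fixes g :: "'n::finite \<Rightarrow> nat" and n :: nat
  assumes bij: "bij_betw g UNIV {..<n}"
begin

definition h :: "nat \<Rightarrow> 'n" where "h = inv_into UNIV g"

lemma h_g [simp]: "h (g x) = x"
  using bij by (simp add: h_def bij_betw_def)

lemma g_less [simp]: "g x < n"
  using bij by (auto simp: bij_betw_def)

lemma g_h [simp]: "i < n \<Longrightarrow> g (h i) = i"
  using bij unfolding h_def bij_betw_def by (metis f_inv_into_f lessThan_iff)

lemma h_eq [simp]: "i < n \<Longrightarrow> j < n \<Longrightarrow> h i = h j \<longleftrightarrow> i = j"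
  by (metis g_h)

lemma bij_h: "bij_betw h {..<n} UNIV"
  by (rule bij_betw_byWitness[where f' = g]) auto

lemma card_n: "CARD('n) = n"
  using bij_betw_same_card[OF bij] by simp

lemma sum_UNIV: "(\<Sum>x\<in>UNIV. F x) = (\<Sum>k<n. F (h k))"
  using sum.reindex_bij_betw[OF bij_h, of F] by simp

definition to_mat :: "real^'n^'n \<Rightarrow> real mat" where
  "to_mat M = Matrix.mat n n (\<lambda>(i, j). M $ h i $ h j)"

definition of_mat :: "real mat \<Rightarrow> real^'n^'n" where
  "of_mat A = (\<chi> x y. A $$ (g x, g y))"

lemma to_mat_carrier [simp]: "to_mat M \<in> carrier_mat n n"
  by (simp add: to_mat_def)

lemma dim_to_mat [simp]: "dim_row (to_mat M) = n" "dim_col (to_mat M) = n"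
  by (simp_all add: to_mat_def)

lemma to_mat_index [simp]: "i < n \<Longrightarrow> j < n \<Longrightarrow> to_mat M $$ (i, j) = M $ h i $ h j"
  by (simp add: to_mat_def)

lemma of_mat_index [simp]: "of_mat A $ x $ y = A $$ (g x, g y)"
  by (simp add: of_mat_def)

lemma to_of_mat: "A \<in> carrier_mat n n \<Longrightarrow> to_mat (of_mat A) = A"
  by (intro eq_matI) auto

lemma of_to_mat [simp]: "of_mat (to_mat M) = M"
  by (simp add: vec_eq_iff)

lemma to_mat_mult: "to_mat (X ** Y) = to_mat X * to_mat Y"
  by (intro eq_matI)
    (auto simp: matrix_matrix_mult_def scalar_prod_def sum_UNIV atLeast0LessThan intro!: sum.cong)

lemma to_mat_one: "to_mat (Finite_Cartesian_Product.mat 1) = 1\<^sub>m n"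
  by (intro eq_matI) (auto simp: Finite_Cartesian_Product.mat_def)

lemma of_mat_transpose: "A \<in> carrier_mat n n \<Longrightarrow> of_mat (transpose_mat A) = transpose (of_mat A)"
  by (simp add: vec_eq_iff transpose_def)

lemma to_mat_transpose: "to_mat (transpose M) = transpose_mat (to_mat M)"
  by (intro eq_matI) (auto simp: transpose_def)

lemma of_mat_mult:
  "A \<in> carrier_mat n n \<Longrightarrow> B \<in> carrier_mat n n \<Longrightarrow> of_mat (A * B) = of_mat A ** of_mat B"
  by (metis of_to_mat to_mat_mult to_of_mat)

lemma similar_orthogonal_conjugate:
  assumes "A \<in> carrier_mat n n" "transpose Q ** Q = Finite_Cartesian_Product.mat 1"
  shows "similar_mat A (to_mat (transpose Q ** of_mat A ** Q))"
proof -
  have QQ: "Q ** transpose Q = Finite_Cartesian_Product.mat 1"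
    using assms(2) by (simp add: matrix_left_right_inverse)
  have "of_mat A = Q ** (transpose Q ** of_mat A ** Q) ** transpose Q"
    by (metis QQ matrix_mul_assoc matrix_mul_lid matrix_mul_rid)
  then have "A = to_mat Q * to_mat (transpose Q ** of_mat A ** Q) * to_mat (transpose Q)"
    by (metis to_mat_mult to_of_mat[OF assms(1)])
  then have "similar_mat_wit A (to_mat (transpose Q ** of_mat A ** Q)) (to_mat Q) (to_mat (transpose Q))"
    using assms QQ by (auto simp: similar_mat_wit_def Let_def simp flip: to_mat_mult simp: to_mat_one)
  then show ?thesis by (auto simp: similar_mat_def)
qed

definition nonedge :: "graph \<Rightarrow> 'n \<Rightarrow> 'n \<Rightarrow> bool" where
  "nonedge G x y \<longleftrightarrow> x \<noteq> y \<and> {g x, g y} \<notin> edges G"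

lemma ssp_pattern_of_SSP:
  assumes A: "A \<in> S_graph G" "order_of G = n" and ssp: "SSP n A"
  shows "ssp_pattern (nonedge G) (of_mat A)"
  unfolding ssp_pattern_def
proof (intro allI impI)
  fix X :: "real^'n^'n"
  assume X: "transpose X = X" "\<forall>i j. \<not> nonedge G i j \<longrightarrow> X $ i $ j = 0" "of_mat A ** X = X ** of_mat A"
  have cA: "A \<in> carrier_mat n n" using A by (auto simp: S_graph_def symmetric_mat_def)
  let ?X = "to_mat X"
  have X0: "X $ h i $ h j = 0" if "i < n" "j < n" "i = j \<or> A $$ (i, j) \<noteq> 0" for i j
  proof (cases "i = j")
    case True
    then show ?thesis using X(2) by (simp add: nonedge_def)
  next
    case False
    then have "{i, j} \<in> edges G" using that A by (simp add: S_graph_def)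
    then show ?thesis using X(2) that by (simp add: nonedge_def)
  qed
  have "symmetric_mat n ?X" using X(1) by (simp add: symmetric_mat_def flip: to_mat_transpose)
  moreover have "A \<star>\<^sub>m ?X = 0\<^sub>m n n" "1\<^sub>m n \<star>\<^sub>m ?X = 0\<^sub>m n n"
    using cA by (auto simp: entrywise_prod_def intro!: eq_matI) (use X0 in blast)+
  moreover have "commutator A ?X = 0\<^sub>m n n"
  proof -
    have "A * ?X = ?X * A" using X(3) cA by (metis to_mat_mult to_of_mat)
    moreover have "?X * A \<in> carrier_mat n n" using cA by (meson mult_carrier_mat to_mat_carrier)
    ultimately show ?thesis by (simp add: commutator_def)
  qed
  ultimately have "?X = 0\<^sub>m n n" using ssp unfolding SSP_def by blast
  then have "of_mat ?X = of_mat (0\<^sub>m n n)" by simp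
  then have "X $ x $ y = 0" for x y by (simp add: vec_eq_iff)
  then show "X = 0" by (simp add: vec_eq_iff)
qed

text \<open>The pattern belongs to the smaller graph \<open>G\<close>, the matrix to the larger
  \<open>H\<close>: the non-edges of \<open>H\<close> are among those of \<open>G\<close>, so there
  are fewer matrices \<open>X\<close> to exclude.\<close>

lemma SSP_of_ssp_pattern:
  assumes ssp: "ssp_pattern (nonedge G) (of_mat B)" and B: "B \<in> S_graph H" "order_of H = n"
    and sub: "edges G \<subseteq> edges H"
  shows "SSP n B"
  unfolding SSP_def
proof (intro allI impI)
  fix X assume X: "symmetric_mat n X \<and> B \<star>\<^sub>m X = 0\<^sub>m n n \<and> 1\<^sub>m n \<star>\<^sub>m X = 0\<^sub>m n n \<and> commutator B X = 0\<^sub>m n n"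
  have c: "B \<in> carrier_mat n n" "X \<in> carrier_mat n n"
    using B X by (auto simp: S_graph_def symmetric_mat_def)
  have z: "(B \<star>\<^sub>m X) $$ (i, j) = 0" "(1\<^sub>m n \<star>\<^sub>m X) $$ (i, j) = 0" if "i < n" "j < n" for i j
    using X that by auto
  have X0: "B $$ (i, j) * X $$ (i, j) = 0" "i = j \<Longrightarrow> X $$ (i, j) = 0" if "i < n" "j < n" for i j
    using z[OF that] that c by (auto simp: entrywise_prod_def)
  have "transpose (of_mat X) = of_mat X"
    using X c by (metis of_mat_transpose symmetric_mat_def)
  moreover have "of_mat X $ x $ y = 0" if "\<not> nonedge G x y" for x y
  proof (cases "x = y")
    case True
    then show ?thesis using X0(2)[of "g x" "g y"] by simp
  next
    case False
    then have "g x \<noteq> g y" by (metis h_g)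
    moreover have "{g x, g y} \<in> edges H" using that False sub by (auto simp: nonedge_def)
    ultimately have "B $$ (g x, g y) \<noteq> 0" using B by (simp add: S_graph_def)
    then show ?thesis using X0(1)[of "g x" "g y"] by simp
  qed
  moreover have "of_mat B ** of_mat X = of_mat X ** of_mat B"
  proof -
    have "B * X - X * B = 0\<^sub>m n n" using X by (simp add: commutator_def)
    then have "B * X = X * B" using c
      by (intro eq_matI) (auto simp: mat_eq_iff)
    then show ?thesis using c by (metis of_mat_mult)
  qed
  ultimately have "of_mat X = 0" using ssp by (auto simp: ssp_pattern_def)
  then show "X = 0\<^sub>m n n" using c
    by (intro eq_matI) (auto, metis g_h of_mat_index zero_index)
qed

lemma SSP_supergraph:
  assumes A: "A \<in> S_graph G" "SSP n A" and ord: "order_of G = n" "order_of H = n"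
    and sub: "edges G \<subseteq> edges H"
  obtains B where "B \<in> S_graph H" "SSP n B" "similar_mat A B"
proof -
  have cA: "A \<in> carrier_mat n n" "transpose_mat A = A"
    and Aent: "\<And>i j. i < n \<Longrightarrow> j < n \<Longrightarrow> i \<noteq> j \<Longrightarrow> A $$ (i, j) \<noteq> 0 \<longleftrightarrow> {i, j} \<in> edges G"
    using A(1) ord by (auto simp: S_graph_def symmetric_mat_def)
  let ?A = "of_mat A"
  have symA: "transpose ?A = ?A" using cA by (metis of_mat_transpose)
  have ssp: "ssp_pattern (nonedge G) ?A" by (rule ssp_pattern_of_SSP[OF A(1) ord(1) A(2)])
  obtain e1 where e1: "e1 > 0" "\<And>B. norm (B - ?A) < e1 \<Longrightarrow> ssp_pattern (nonedge G) B"
    using ssp_pattern_open[OF ssp] by blast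
  \<comment> \<open>The minimum \<open>e\<close> of this set does not exceed any nonzero absolute
    entry, so a change of less than \<open>e\<close> keeps all edges of \<open>G\<close>; nor does
    it exceed \<open>e1\<close>, so the strong property survives.\<close>
  define E where "E = insert e1 {\<bar>?A $ x $ y\<bar> |x y. ?A $ x $ y \<noteq> 0}"
  have "E = insert e1 ((\<lambda>(x, y). \<bar>?A $ x $ y\<bar>) ` {(x, y). ?A $ x $ y \<noteq> 0})"
    unfolding E_def by (auto simp: image_iff; blast)
  then have finE: "finite E" by (metis finite finite_imageI finite_insert)
  define e where "e = Min E"
  have e: "e > 0" "e \<le> e1" "\<And>x y. ?A $ x $ y \<noteq> 0 \<Longrightarrow> e \<le> \<bar>?A $ x $ y\<bar>"
    unfolding e_def using finE e1(1)
    by (auto simp: E_def Min_gr_iff intro!: Min_le simp del: of_mat_index)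
  have sN: "\<And>i j. nonedge G i j \<Longrightarrow> nonedge G j i" by (auto simp: nonedge_def insert_commute)
  obtain d where d: "d > 0" "\<And>W. transpose W = W \<Longrightarrow> norm W < d \<Longrightarrow>
      \<exists>Q. transpose Q ** Q = Finite_Cartesian_Product.mat 1 \<and> norm (transpose Q ** ?A ** Q - ?A) < e \<and>
        (\<forall>i j. nonedge G i j \<longrightarrow> (transpose Q ** ?A ** Q) $ i $ j = ?A $ i $ j + W $ i $ j)"
    using ssp_pattern_perturb[where N = "nonedge G", OF symA sN ssp e(1)] by blast
  \<comment> \<open>After scaling, this prescribes at the non-edges of \<open>G\<close> a small
    nonzero constant for the new edges of \<open>H\<close> and zero for the non-edges of
    \<open>H\<close>.\<close>
  define W1 :: "real^'n^'n" where "W1 = (\<chi> x y. if {g x, g y} \<in> edges H then 1 else 0)"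
  define s where "s = norm W1 + 1"
  have s: "s > 0" "norm W1 < s" unfolding s_def by (rule add_nonneg_pos) simp_all
  define c where "c = d / s"
  have c: "c > 0" using d(1) s by (simp add: c_def)
  have "norm (c *\<^sub>R W1) = c * norm W1" using c by simp
  also have "\<dots> < c * s" using s(2) c by simp
  also have "\<dots> = d" using s(1) by (simp add: c_def)
  finally have nW: "norm (c *\<^sub>R W1) < d" .
  have sW: "transpose (c *\<^sub>R W1) = c *\<^sub>R W1"
    by (auto simp: W1_def transpose_def vec_eq_iff insert_commute)
  obtain Q where Q: "transpose Q ** Q = Finite_Cartesian_Product.mat 1"
    "norm (transpose Q ** ?A ** Q - ?A) < e"
    "\<forall>i j. nonedge G i j \<longrightarrow> (transpose Q ** ?A ** Q) $ i $ j = ?A $ i $ j + (c *\<^sub>R W1) $ i $ j"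
    using d(2)[OF sW nW] by blast
  define M where "M = transpose Q ** ?A ** Q"
  have Mn: "norm (M - ?A) < e" using Q(2) by (simp add: M_def)
  have symM: "transpose M = M"
    by (simp add: M_def matrix_transpose_mul symA matrix_mul_assoc)
  have near: "\<bar>M $ x $ y - ?A $ x $ y\<bar> < e" for x y
    using component_le_norm_cart[of "(M - ?A) $ x" y] Finite_Cartesian_Product.norm_nth_le[of "M - ?A" x] Mn by simp
  have Ment: "M $ x $ y \<noteq> 0 \<longleftrightarrow> {g x, g y} \<in> edges H" if "x \<noteq> y" for x y
  proof -
    have gxy: "g x \<noteq> g y" using that by (metis h_g)
    show ?thesis
    proof (cases "nonedge G x y")
      case True
      then have "?A $ x $ y = 0" using Aent[of "g x" "g y"] gxy by (simp add: nonedge_def)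
      then show ?thesis using True Q(3) c by (simp add: M_def[symmetric] W1_def)
    next
      case False
      then have ed: "{g x, g y} \<in> edges G" using that by (simp add: nonedge_def)
      then have nz: "?A $ x $ y \<noteq> 0" using Aent[of "g x" "g y"] gxy by simp
      have "M $ x $ y \<noteq> 0" using near[of x y] e(3)[OF nz] by auto
      then show ?thesis using ed sub by auto
    qed
  qed
  let ?B = "to_mat M"
  have BH: "?B \<in> S_graph H"
    using symM Ment ord by (auto simp: S_graph_def symmetric_mat_def simp flip: to_mat_transpose)
  have "ssp_pattern (nonedge G) M" using e1(2) Mn e(2) by simp
  then have "SSP n ?B" using SSP_of_ssp_pattern[OF _ BH ord(2) sub] by simp
  moreover have "similar_mat A ?B"
    unfolding M_def by (rule similar_orthogonal_conjugate[OF cA(1) Q(1)])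
  ultimately show ?thesis using that BH by blast
qed

lemma symmetric_mat_spectral_decomposition:
  assumes A: "symmetric_mat n A"
  obtains d :: "nat \<Rightarrow> real" and q :: "nat \<Rightarrow> nat \<Rightarrow> real"
  where "\<And>k l. k < n \<Longrightarrow> l < n \<Longrightarrow> (\<Sum>i<n. q k i * q l i) = (if k = l then 1 else 0)"
    and "\<And>i j. i < n \<Longrightarrow> j < n \<Longrightarrow> A $$ (i, j) = (\<Sum>k<n. d k * q k i * q k j)"
proof -
  have sA: "transpose (of_mat A) = of_mat A"
    using A by (metis of_mat_transpose symmetric_mat_def)
  show ?thesis
  proof (rule symmetric_matrix_spectral_decomposition[OF sA, unfolded card_n])
    fix d :: "nat \<Rightarrow> real" and v :: "nat \<Rightarrow> real^'n"
    assume v: "\<And>k l. k < n \<Longrightarrow> l < n \<Longrightarrow> v k \<bullet> v l = (if k = l then 1 else 0)"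
      "\<And>x y. of_mat A $ x $ y = (\<Sum>k<n. d k * v k $ x * v k $ y)"
    show ?thesis
    proof (rule that[of "\<lambda>k i. v k $ h i" d])
    fix k l assume "k < n" "l < n"
    then show "(\<Sum>i<n. v k $ h i * v l $ h i) = (if k = l then 1 else 0)"
      using v(1)[of k l] by (simp add: inner_vec_def sum_UNIV)
  next
    fix i j assume "i < n" "j < n"
    then show "A $$ (i, j) = (\<Sum>k<n. d k * v k $ h i * v k $ h j)"
      using v(2)[of "h i" "h j"] by simp
    qed
  qed
qed

end

section \<open>Realizing a list of eigenvalues\<close>

definition roots_poly :: "real list \<Rightarrow> real poly" where
  "roots_poly L = (\<Prod>a\<leftarrow>L. [:- a, 1:])"

text \<open>A list with repetitions, in any order, encodes eigenvalues and multiplicities at once;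
  by \<open>roots_poly_eq_iff\<close> only its multiset matters.\<close>

definition realizes :: "graph \<Rightarrow> real list \<Rightarrow> bool" where
  "realizes G L \<longleftrightarrow> (\<exists>A \<in> S_graph G. char_poly A = roots_poly L)"

definition realizes_SSP :: "graph \<Rightarrow> real list \<Rightarrow> bool" where
  "realizes_SSP G L \<longleftrightarrow> (\<exists>A \<in> S_graph G. char_poly A = roots_poly L \<and> SSP (order_of G) A)"

definition expand :: "real list \<Rightarrow> nat list \<Rightarrow> real list" where
  "expand ls m = concat (map2 (\<lambda>l k. replicate k l) ls m)"

lemma roots_poly_simps [simp]:
  "roots_poly [] = 1" "roots_poly (a # L) = [:- a, 1:] * roots_poly L"
  "roots_poly (L @ L') = roots_poly L * roots_poly L'"
  by (simp_all add: roots_poly_def)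

lemma poly_roots_poly: "poly (roots_poly L) x = (\<Prod>a\<leftarrow>L. x - a)"
  by (induction L) (simp_all add: algebra_simps)

lemma roots_poly_nonzero [simp]: "roots_poly L \<noteq> 0"
  by (auto simp: roots_poly_def prod_list_zero_iff)

lemma order_roots_poly: "Polynomial.order x (roots_poly L) = count_list L x"
proof (induction L)
  case Nil
  then show ?case by (simp add: order_0I)
next
  case (Cons a L)
  have nz: "[:- a, 1:] * roots_poly L \<noteq> 0" by (metis roots_poly_nonzero roots_poly_simps(2))
  have "Polynomial.order x [:- a, 1:] = (if a = x then 1 else 0)"
    using order_power_n_n[of x 1] by (auto intro: order_0I)
  then show ?case using Cons by (simp only: roots_poly_simps order_mult[OF nz]) simp
qed

lemma roots_poly_cong: "mset L = mset L' \<Longrightarrow> roots_poly L = roots_poly L'"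
  unfolding roots_poly_def by (metis mset_map prod_mset_prod_list)

lemma roots_poly_eq_iff: "roots_poly L = roots_poly L' \<longleftrightarrow> mset L = mset L'"
proof
  assume "roots_poly L = roots_poly L'"
  then have "count_list L x = count_list L' x" for x by (metis order_roots_poly)
  then show "mset L = mset L'" by (simp add: multiset_eq_iff count_mset)
qed (rule roots_poly_cong)

lemma roots_poly_root_iff: "poly (roots_poly L) x = 0 \<longleftrightarrow> x \<in> set L"
  by (auto simp: poly_roots_poly prod_list_zero_iff)

lemma spectrum_roots_poly:
  assumes "A \<in> carrier_mat n n" "char_poly A = roots_poly L"
  shows "{x. eigenvalue A x} = set L" "multiplicity_of A x = count_list L x"
    "mult_list A = map (count_list L) (sorted_list_of_set (set L))"
proof -
  show 1: "{x. eigenvalue A x} = set L"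
    using eigenvalue_root_char_poly[OF assms(1)] by (auto simp: assms(2) roots_poly_root_iff)
  show 2: "multiplicity_of A x = count_list L x" for x
    by (simp add: multiplicity_of_def assms(2) order_roots_poly)
  show "mult_list A = map (count_list L) (sorted_list_of_set (set L))"
    unfolding mult_list_def 1 by (simp add: 2)
qed

lemma mult_list_cong:
  assumes "A \<in> carrier_mat n n" "B \<in> carrier_mat n n" "char_poly A = char_poly B"
  shows "mult_list A = mult_list B"
proof -
  have "{x. eigenvalue A x} = {x. eigenvalue B x}"
    using eigenvalue_root_char_poly[OF assms(1)] eigenvalue_root_char_poly[OF assms(2)] assms(3)
    by simp
  moreover have "multiplicity_of A = multiplicity_of B"
    by (simp add: fun_eq_iff multiplicity_of_def assms(3))
  ultimately show ?thesis by (simp add: mult_list_def)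
qed

lemma expand_simps [simp]:
  "expand [] m = []" "expand ls [] = []" "expand (l # ls) (k # m) = replicate k l @ expand ls m"
  by (simp_all add: expand_def)

lemma set_expand:
  "length ls = length m \<Longrightarrow> \<forall>k\<in>set m. 0 < k \<Longrightarrow> set (expand ls m) = set ls"
  by (induction ls m rule: list_induct2) auto

lemma length_expand: "length ls = length m \<Longrightarrow> length (expand ls m) = sum_list m"
  by (induction ls m rule: list_induct2) auto

lemma count_replicate: "count_list (replicate k l) x = (if l = x then k else 0)"
  by (induction k) auto

lemma count_list_expand_notin:
  "length ls = length m \<Longrightarrow> x \<notin> set ls \<Longrightarrow> count_list (expand ls m) x = 0"
  by (induction ls m rule: list_induct2) (auto simp: count_replicate)

lemma count_expand:
  "length ls = length m \<Longrightarrow> distinct ls \<Longrightarrow> map (count_list (expand ls m)) ls = m"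
proof (induction ls m rule: list_induct2)
  case (Cons l ls k m)
  have "map (count_list (replicate k l @ expand ls m)) ls = map (count_list (expand ls m)) ls"
    using Cons.prems by (intro map_cong refl) (auto simp: count_replicate)
  moreover have "count_list (replicate k l @ expand ls m) l = k"
    using Cons by (simp add: count_replicate count_list_expand_notin)
  ultimately show ?case using Cons by (simp del: count_list_append map_eq_conv)
qed simp

lemma sorted_list_of_set_strict: "sorted_wrt (<) ls \<Longrightarrow> sorted_list_of_set (set (ls :: real list)) = ls"
  by (simp add: strict_sorted_equal sorted_list_of_set.strict_sorted_key_list_of_set)

lemma strict_imp_distinct: "sorted_wrt (<) (ls :: real list) \<Longrightarrow> distinct ls"
  using strict_sorted_iff by blast

lemma spectrum_expand:
  assumes A: "A \<in> carrier_mat n n" "char_poly A = roots_poly (expand ls m)"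
    and ls: "sorted_wrt (<) ls" "length ls = length m" "\<forall>k\<in>set m. 0 < k"
  shows "{x. eigenvalue A x} = set ls" "mult_list A = m"
    "\<forall>i<length m. multiplicity_of A (ls ! i) = m ! i"
proof -
  note s = spectrum_roots_poly[OF A] and e = set_expand[OF ls(2,3)]
  have c: "map (count_list (expand ls m)) ls = m"
    using count_expand[OF ls(2) strict_imp_distinct[OF ls(1)]] .
  show "{x. eigenvalue A x} = set ls" using s(1) e by simp
  show "mult_list A = m" using s(3) e c sorted_list_of_set_strict[OF ls(1)] by simp
  show "\<forall>i<length m. multiplicity_of A (ls ! i) = m ! i"
    using s(2) c ls(2) by (metis nth_map)
qed

lemma mset_eq_expand:
  fixes L :: "real list"
  defines "ls \<equiv> sorted_list_of_set (set L)" and "m \<equiv> map (count_list L) (sorted_list_of_set (set L))"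
  shows "mset (expand ls m) = mset L" "sorted_wrt (<) ls" "length ls = length m" "\<forall>k\<in>set m. 0 < k"
proof -
  show ls: "sorted_wrt (<) ls" unfolding ls_def by simp
  show len: "length ls = length m" by (simp add: ls_def m_def)
  show "\<forall>k\<in>set m. 0 < k" by (auto simp: m_def) (metis count_list_0_iff gr0I)
  have m: "m = map (count_list L) ls" by (simp add: ls_def m_def)
  have "count_list (expand ls m) x = count_list L x" for x
  proof (cases "x \<in> set ls")
    case True
    have "map (count_list (expand ls m)) ls = map (count_list L) ls"
      using count_expand[OF len strict_imp_distinct[OF ls]] m by simp
    then show ?thesis using True by simp
  next
    case False
    then have "count_list L x = 0" by (simp add: ls_def count_list_0_iff)
    then show ?thesis using False count_list_expand_notin[OF len] by simp
  qed
  then show "mset (expand ls m) = mset L" by (simp add: multiset_eq_iff count_mset)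
qed

subsection \<open>Spectral decomposition with a given order of the eigenvalues\<close>

text \<open>The rows \<open>q k\<close> form an orthogonal matrix that conjugates \<open>A\<close>
  to a diagonal one. A one-sided inverse of a square matrix is two-sided, so the columns are
  orthonormal as well, which is the second claim.\<close>

lemma char_poly_of_orthonormal_decomposition:
  fixes d :: "nat \<Rightarrow> real"
  assumes A: "A \<in> carrier_mat n n"
    and q: "\<And>k l. k < n \<Longrightarrow> l < n \<Longrightarrow> (\<Sum>i<n. q k i * q l i) = (if k = l then 1 else 0)"
    and dec: "\<And>i j. i < n \<Longrightarrow> j < n \<Longrightarrow> A $$ (i, j) = (\<Sum>k<n. d k * q k i * q k j)"
  shows "char_poly A = roots_poly (map d [0..<n])"
    and "i < n \<Longrightarrow> j < n \<Longrightarrow> (\<Sum>k<n. q k i * q k j) = (if i = j then 1 else 0)"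
proof -
  define Q where "Q = Matrix.mat n n (\<lambda>(k, i). q k i)"
  define D where "D = Matrix.mat n n (\<lambda>(k, l). if k = l then d k else 0)"
  have c: "Q \<in> carrier_mat n n" "D \<in> carrier_mat n n" by (simp_all add: Q_def D_def)
  have 1: "Q * transpose_mat Q = 1\<^sub>m n"
    using q by (intro eq_matI) (auto simp: Q_def scalar_prod_def atLeast0LessThan)
  have 2: "transpose_mat Q * Q = 1\<^sub>m n"
    using mat_mult_left_right_inverse[OF c(1) _ 1] c by simp
  have DQ: "D * Q = Matrix.mat n n (\<lambda>(k, j). d k * q k j)"
    by (intro eq_matI) (auto simp: Q_def D_def scalar_prod_def if_distrib[of "\<lambda>x. x * _"] sum.delta' cong: if_cong)
  have "A = transpose_mat Q * (D * Q)"
    unfolding DQ using A dec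
    by (intro eq_matI) (auto simp: Q_def scalar_prod_def atLeast0LessThan mult_ac intro!: sum.cong)
  also have "\<dots> = transpose_mat Q * D * Q"
    using c by (intro assoc_mult_mat[symmetric]) auto
  finally have eq: "A = (transpose_mat Q * D) * Q" .
  have "transpose_mat Q \<in> carrier_mat n n" using c by simp
  then have "similar_mat A D"
    using similar_mat_witI[OF 2 1 eq A c(2) _ c(1)] similar_mat_def by blast
  then have "char_poly A = char_poly D" by (rule char_poly_similar)
  also have "\<dots> = (\<Prod>a\<leftarrow>diag_mat D. [:- a, 1:])"
    by (rule char_poly_upper_triangular[OF c(2)]) (auto simp: D_def)
  also have "diag_mat D = map d [0..<n]" by (auto simp: diag_mat_def D_def)
  finally show "char_poly A = roots_poly (map d [0..<n])" by (simp add: roots_poly_def)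
  assume ij: "i < n" "j < n"
  have "(transpose_mat Q * Q) $$ (i, j) = (\<Sum>k<n. q k i * q k j)"
    using ij by (simp add: Q_def scalar_prod_def atLeast0LessThan)
  then show "(\<Sum>k<n. q k i * q k j) = (if i = j then 1 else 0)" using 2 ij by simp
qed

lemma (in index_bij) symmetric_mat_char_poly:
  assumes A: "symmetric_mat n A"
  obtains L where "length L = n" "char_poly A = roots_poly L"
proof -
  obtain q :: "nat \<Rightarrow> nat \<Rightarrow> real" and d where
    "\<And>k l. k < n \<Longrightarrow> l < n \<Longrightarrow> (\<Sum>i<n. q k i * q l i) = (if k = l then 1 else 0)"
    "\<And>i j. i < n \<Longrightarrow> j < n \<Longrightarrow> A $$ (i, j) = (\<Sum>k<n. d k * q k i * q k j)"
    by (rule symmetric_mat_spectral_decomposition[OF A]) (rule that)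
  note q = this
  have cA: "A \<in> carrier_mat n n" using A by (simp add: symmetric_mat_def)
  have "char_poly A = roots_poly (map d [0..<n])"
    by (rule char_poly_of_orthonormal_decomposition(1)[OF cA]) (rule q; assumption)+
  then show ?thesis by (intro that[of "map d [0..<n]"]) simp_all
qed

text \<open>The spectral theorem yields the eigenvalues in some order, \<open>L\<close> prescribes
  another. Equality of the characteristic polynomials gives a permutation between them, and
  renumbering the eigenvectors makes the \<open>k\<close>-th one belong to
  \<open>L ! k\<close>.\<close>

lemma (in index_bij) symmetric_mat_decomposition_of_roots:
  assumes A: "symmetric_mat n A" "char_poly A = roots_poly L"
  obtains q where
    "\<And>k l. k < n \<Longrightarrow> l < n \<Longrightarrow> (\<Sum>i<n. q k i * q l i) = (if k = l then 1 else 0)"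
    "\<And>i j. i < n \<Longrightarrow> j < n \<Longrightarrow> (\<Sum>k<n. q k i * q k j) = (if i = j then 1 else 0)"
    "\<And>i j. i < n \<Longrightarrow> j < n \<Longrightarrow> A $$ (i, j) = (\<Sum>k<n. L ! k * q k i * q k j)"
proof -
  obtain q :: "nat \<Rightarrow> nat \<Rightarrow> real" and d where q:
    "\<And>k l. k < n \<Longrightarrow> l < n \<Longrightarrow> (\<Sum>i<n. q k i * q l i) = (if k = l then 1 else 0)"
    and dec: "\<And>i j. i < n \<Longrightarrow> j < n \<Longrightarrow> A $$ (i, j) = (\<Sum>k<n. d k * q k i * q k j)"
    by (rule symmetric_mat_spectral_decomposition[OF A(1)]) (rule that)
  have cA: "A \<in> carrier_mat n n" using A by (simp add: symmetric_mat_def)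
  have r1: "char_poly A = roots_poly (map d [0..<n])"
    by (rule char_poly_of_orthonormal_decomposition(1)[OF cA]) (rule q dec; assumption)+
  have r2: "(\<Sum>k<n. q k i * q k j) = (if i = j then 1 else 0)" if "i < n" "j < n" for i j
    by (rule char_poly_of_orthonormal_decomposition(2)[OF cA _ _ that]) (rule q dec; assumption)+
  have ms: "mset L = mset (map d [0..<n])" using r1 A(2) roots_poly_eq_iff by metis
  then obtain p where p: "p permutes {..<length (map d [0..<n])}" "permute_list p (map d [0..<n]) = L"
    using mset_eq_permutation by blast
  have p': "p permutes {..<n}" using p(1) by simp
  have pn: "p k < n" if "k < n" for k using permutes_in_image[OF p'] that by auto
  have Lk: "L ! k = d (p k)" if "k < n" for k
    using p(2)[symmetric] p(1) that pn by (simp add: permute_list_nth)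
  have re: "(\<Sum>k<n. F (p k)) = (\<Sum>k<n. F k)" for F :: "nat \<Rightarrow> real"
    using sum.permute[OF p', of F] by simp
  show ?thesis
  proof (rule that[of "\<lambda>k. q (p k)"])
    fix k l assume "k < n" "l < n"
    then show "(\<Sum>i<n. q (p k) i * q (p l) i) = (if k = l then 1 else 0)"
      using q[OF pn pn] permutes_inj[OF p'] by (auto simp: inj_eq)
  next
    fix i j assume ij: "i < n" "j < n"
    show "(\<Sum>k<n. q (p k) i * q (p k) j) = (if i = j then 1 else 0)"
      using r2[OF ij] re[of "\<lambda>k. q k i * q k j"] by simp
    have "A $$ (i, j) = (\<Sum>k<n. d (p k) * q (p k) i * q (p k) j)"
      using dec[OF ij] re[of "\<lambda>k. d k * q k i * q k j"] by simp
    then show "A $$ (i, j) = (\<Sum>k<n. L ! k * q (p k) i * q (p k) j)" by (simp add: Lk)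
  qed
qed

section \<open>Strong properties entrywise\<close>

text \<open>Test matrices enter as plain functions of two indices, so that for an explicit
  \<open>A\<close> the conditions become linear equations between numbers.\<close>

lemma SSP_I:
  assumes A: "A \<in> carrier_mat n n"
    and H: "\<And>x. (\<And>i j. i < n \<Longrightarrow> j < n \<Longrightarrow> x i j = x j i) \<Longrightarrow> (\<And>i. i < n \<Longrightarrow> x i i = 0) \<Longrightarrow>
      (\<And>i j. i < n \<Longrightarrow> j < n \<Longrightarrow> A $$ (i, j) \<noteq> 0 \<Longrightarrow> x i j = 0) \<Longrightarrow>
      (\<And>i j. i < n \<Longrightarrow> j < n \<Longrightarrow> (\<Sum>k<n. A $$ (i, k) * x k j) = (\<Sum>k<n. x i k * A $$ (k, j))) \<Longrightarrow>
      \<forall>i<n. \<forall>j<n. x i j = (0 :: real)"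
  shows "SSP n A"
  unfolding SSP_def
proof (intro allI impI, elim conjE)
  fix X assume X: "symmetric_mat n X" "A \<star>\<^sub>m X = 0\<^sub>m n n" "1\<^sub>m n \<star>\<^sub>m X = 0\<^sub>m n n" "commutator A X = 0\<^sub>m n n"
  have c: "X \<in> carrier_mat n n" and s: "transpose_mat X = X" using X(1) by (auto simp: symmetric_mat_def)
  have "\<forall>i<n. \<forall>j<n. X $$ (i, j) = 0"
  proof (rule H)
    fix i j assume ij: "i < n" "j < n"
    show "X $$ (i, j) = X $$ (j, i)" using ij c s by (metis carrier_matD index_transpose_mat(1))
    have "(A \<star>\<^sub>m X) $$ (i, j) = 0" using X(2) ij by simp
    then show "A $$ (i, j) \<noteq> 0 \<Longrightarrow> X $$ (i, j) = 0" using ij A by (simp add: entrywise_prod_def)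
    have "(A * X - X * A) $$ (i, j) = 0" using X(4) ij by (simp add: commutator_def)
    then show "(\<Sum>k<n. A $$ (i, k) * X $$ (k, j)) = (\<Sum>k<n. X $$ (i, k) * A $$ (k, j))"
      using ij A c by (simp add: scalar_prod_def atLeast0LessThan)
  next
    fix i assume i: "i < n"
    have "(1\<^sub>m n \<star>\<^sub>m X) $$ (i, i) = 0" using X(3) i by simp
    then show "X $$ (i, i) = 0" using i by (simp add: entrywise_prod_def)
  qed
  then show "X = 0\<^sub>m n n" using c by (intro eq_matI) auto
qed

lemma degree_roots_poly: "degree (roots_poly L) = length L"
proof (induction L)
  case (Cons a L)
  have "degree ([:- a, 1:] * roots_poly L) = degree [:- a, 1:] + degree (roots_poly L)"
    by (rule degree_mult_eq) auto
  then show ?case using Cons by simp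
qed simp

text \<open>The common form of SSP (\<open>I = {}\<close>) and SMP (\<open>I = {2..n - 1}\<close>).\<close>

definition strong_property :: "nat \<Rightarrow> nat set \<Rightarrow> real mat \<Rightarrow> bool" where
  "strong_property n I A \<longleftrightarrow>
     (\<forall>X. symmetric_mat n X \<and> A \<star>\<^sub>m X = 0\<^sub>m n n \<and> 1\<^sub>m n \<star>\<^sub>m X = 0\<^sub>m n n \<and>
          commutator A X = 0\<^sub>m n n \<and> (\<forall>i \<in> I. mat_trace (A ^\<^sub>m i * X) = 0)
        \<longrightarrow> X = 0\<^sub>m n n)"

lemma SSP_strong_property: "SSP n A = strong_property n {} A"
  by (simp add: SSP_def strong_property_def)

lemma SMP_strong_property: "SMP n A = strong_property n {2..n - 1} A"
  by (simp add: SMP_def strong_property_def)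

lemma SSP_imp_SMP: "SSP n A \<Longrightarrow> SMP n A"
  unfolding SSP_def SMP_def by blast

lemma strong_property_D:
  fixes x :: "nat \<Rightarrow> nat \<Rightarrow> real"
  assumes A: "A \<in> carrier_mat n n" and ssp: "strong_property n I A"
    and x: "\<And>i j. i < n \<Longrightarrow> j < n \<Longrightarrow> x i j = x j i" "\<And>i. i < n \<Longrightarrow> x i i = 0"
      "\<And>i j. i < n \<Longrightarrow> j < n \<Longrightarrow> A $$ (i, j) \<noteq> 0 \<Longrightarrow> x i j = 0"
      "\<And>i j. i < n \<Longrightarrow> j < n \<Longrightarrow> (\<Sum>k<n. A $$ (i, k) * x k j) = (\<Sum>k<n. x i k * A $$ (k, j))"
      "\<And>i. i \<in> I \<Longrightarrow> mat_trace (A ^\<^sub>m i * Matrix.mat n n (\<lambda>(i, j). x i j)) = 0"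
    and ij: "i < n" "j < n"
  shows "x i j = 0"
proof -
  let ?X = "Matrix.mat n n (\<lambda>(i, j). x i j)"
  have "symmetric_mat n ?X" using x(1) by (auto simp: symmetric_mat_def intro!: eq_matI)
  moreover have "A \<star>\<^sub>m ?X = 0\<^sub>m n n" using A by (auto simp: entrywise_prod_def intro!: eq_matI) (use x(3) in blast)
  moreover have "1\<^sub>m n \<star>\<^sub>m ?X = 0\<^sub>m n n" using x(2) by (auto simp: entrywise_prod_def intro!: eq_matI)
  moreover have "commutator A ?X = 0\<^sub>m n n"
    using x(4) A by (auto simp: commutator_def scalar_prod_def atLeast0LessThan intro!: eq_matI)
  ultimately have "?X = 0\<^sub>m n n" using ssp x(5) unfolding strong_property_def by blast
  then have "?X $$ (i, j) = 0\<^sub>m n n $$ (i, j)" by simp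
  then show ?thesis using ij by simp
qed

section \<open>Relabelling, negation and isolated vertices\<close>

definition permute_mat :: "nat \<Rightarrow> (nat \<Rightarrow> nat) \<Rightarrow> real mat \<Rightarrow> real mat" where
  "permute_mat n f A = Matrix.mat n n (\<lambda>(i, j). A $$ (f i, f j))"

definition relabelling :: "nat \<Rightarrow> (nat \<Rightarrow> nat) \<Rightarrow> (nat \<Rightarrow> nat) \<Rightarrow> bool" where
  "relabelling n f g \<longleftrightarrow> (\<forall>i<n. f i < n \<and> g i < n \<and> f (g i) = i \<and> g (f i) = i)"

lemma relabelling_sym: "relabelling n f g \<Longrightarrow> relabelling n g f"
  by (auto simp: relabelling_def)

lemma bij_betw_relabelling:
  assumes "bij_betw f {..<n} {..<n}"
  obtains g where "relabelling n f g"
proof (rule that[of "inv_into {..<n} f"])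
  have "inv_into {..<n} f i < n" if "i < n" for i
    using bij_betwE[OF bij_betw_inv_into[OF assms]] that by auto
  then show "relabelling n f (inv_into {..<n} f)"
    using bij_betwE[OF assms] assms
    by (simp add: relabelling_def bij_betw_inv_into_left bij_betw_inv_into_right)
qed

context
  fixes n :: nat and f g :: "nat \<Rightarrow> nat"
  assumes fg_pair: "relabelling n f g"
begin

lemma f: "i < n \<Longrightarrow> f i < n" and g: "i < n \<Longrightarrow> g i < n"
  and fg: "i < n \<Longrightarrow> f (g i) = i" and gf: "i < n \<Longrightarrow> g (f i) = i"
  using fg_pair by (auto simp: relabelling_def)

lemma sum_reindex: "(\<Sum>k<n. F (f k)) = (\<Sum>k<n. F k :: real)"
proof -
  have "bij_betw f {..<n} {..<n}" by (rule bij_betw_byWitness[where f' = g]) (auto simp: f g fg gf)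
  from sum.reindex_bij_betw[OF this, of F] show ?thesis .
qed

lemma permute_mat_carrier [simp]: "permute_mat n f A \<in> carrier_mat n n"
  by (simp add: permute_mat_def)

lemma permute_mat_index [simp]: "i < n \<Longrightarrow> j < n \<Longrightarrow> permute_mat n f A $$ (i, j) = A $$ (f i, f j)"
  by (simp add: permute_mat_def)

lemma permute_mat_mult:
  assumes "A \<in> carrier_mat n n" "B \<in> carrier_mat n n"
  shows "permute_mat n f (A * B) = permute_mat n f A * permute_mat n f B"
proof (rule eq_matI)
  fix i j assume "i < dim_row (permute_mat n f A * permute_mat n f B)"
    "j < dim_col (permute_mat n f A * permute_mat n f B)"
  then have ij: "i < n" "j < n" by (simp_all add: permute_mat_def)
  show "permute_mat n f (A * B) $$ (i, j) = (permute_mat n f A * permute_mat n f B) $$ (i, j)"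
    using ij assms f sum_reindex[of "\<lambda>k. A $$ (f i, k) * B $$ (k, f j)"]
    by (simp add: scalar_prod_def atLeast0LessThan permute_mat_def)
qed (simp_all add: permute_mat_def)

lemma permute_mat_pow:
  assumes "A \<in> carrier_mat n n"
  shows "permute_mat n f (A ^\<^sub>m k) = permute_mat n f A ^\<^sub>m k"
proof (induction k)
  case 0
  show ?case using assms f gf by (intro eq_matI) (auto simp: permute_mat_def, metis gf)
next
  case (Suc k)
  then show ?case using assms by (simp add: permute_mat_mult pow_carrier_mat)
qed

lemma trace_permute_mat: "A \<in> carrier_mat n n \<Longrightarrow> mat_trace (permute_mat n f A) = mat_trace A"
  using sum_reindex[of "\<lambda>k. A $$ (k, k)"] by (simp add: mat_trace_def permute_mat_def)

lemma char_poly_permute_mat: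
  assumes A: "A \<in> carrier_mat n n"
  shows "char_poly (permute_mat n f A) = char_poly A"
proof -
  define P :: "real mat" where "P = Matrix.mat n n (\<lambda>(i, j). if j = f i then 1 else 0)"
  have P: "P \<in> carrier_mat n n" "transpose_mat P \<in> carrier_mat n n" by (simp_all add: P_def)
  have PA: "P * A = Matrix.mat n n (\<lambda>(i, j). A $$ (f i, j))"
    using A f by (intro eq_matI)
      (auto simp: P_def scalar_prod_def if_distrib[of "\<lambda>x. x * _"] sum.delta cong: if_cong)
  have eq: "permute_mat n f A = P * A * transpose_mat P"
    unfolding PA using A f
    by (intro eq_matI)
      (auto simp: P_def permute_mat_def scalar_prod_def if_distrib[of "\<lambda>x. _ * x"] sum.delta cong: if_cong)
  have 1: "P * transpose_mat P = 1\<^sub>m n"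
    using f gf by (intro eq_matI)
      (auto simp: P_def scalar_prod_def if_distrib[of "\<lambda>x. _ * x"] sum.delta cong: if_cong, metis gf)
  have 2: "transpose_mat P * P = 1\<^sub>m n" by (rule mat_mult_left_right_inverse[OF P 1])
  have "similar_mat (permute_mat n f A) A"
    using similar_mat_witI[OF 1 2 eq _ A P] by (auto simp: similar_mat_def)
  then show ?thesis by (rule char_poly_similar)
qed

end

text \<open>A test matrix for the relabelled matrix becomes one for \<open>A\<close> after
  relabelling back: commutators, entrywise products and traces of products with powers are all
  compatible with a simultaneous permutation.\<close>

lemma strong_property_permute_mat:
  assumes rl: "relabelling n f g" and A: "A \<in> carrier_mat n n" and sp: "strong_property n I A"
  shows "strong_property n I (permute_mat n f A)"
  unfolding strong_property_def
proof (intro allI impI, elim conjE)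
  note f = f[OF rl] and g = g[OF rl] and fg = fg[OF rl] and gf = gf[OF rl]
    and lr = relabelling_sym[OF rl]
  let ?B = "permute_mat n f A" and ?p = "permute_mat n g"
  note pm = permute_mat_mult[OF lr] and pp = permute_mat_pow[OF lr]
    and pt = trace_permute_mat[OF lr] and pe = permute_mat_def
  fix X assume X: "symmetric_mat n X" "?B \<star>\<^sub>m X = 0\<^sub>m n n" "1\<^sub>m n \<star>\<^sub>m X = 0\<^sub>m n n" "commutator ?B X = 0\<^sub>m n n"
    "\<forall>i\<in>I. mat_trace (?B ^\<^sub>m i * X) = 0"
  have c: "X \<in> carrier_mat n n" "?B \<in> carrier_mat n n" using X(1) by (auto simp: symmetric_mat_def pe)
  have AB: "A = ?p ?B" using A by (intro eq_matI) (auto simp: pe g fg)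
  have z: "?p (0\<^sub>m n n) = 0\<^sub>m n n" "?p (1\<^sub>m n) = 1\<^sub>m n"
    using g fg by (auto simp: pe intro!: eq_matI) (metis fg)
  have st: "?p M \<star>\<^sub>m ?p N = ?p (M \<star>\<^sub>m N)" if "M \<in> carrier_mat n n" "N \<in> carrier_mat n n" for M N
    using that g by (intro eq_matI) (auto simp: pe entrywise_prod_def)
  have "transpose_mat (?p X) = ?p (transpose_mat X)"
    using c g by (intro eq_matI) (auto simp: pe)
  then have "symmetric_mat n (?p X)" using X(1) by (simp add: symmetric_mat_def pe)
  moreover have "A \<star>\<^sub>m ?p X = 0\<^sub>m n n" using st[OF c(2,1)] X(2) z AB by simp
  moreover have "1\<^sub>m n \<star>\<^sub>m ?p X = 0\<^sub>m n n" using st[OF one_carrier_mat c(1)] X(3) z by simp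
  moreover have "commutator A (?p X) = 0\<^sub>m n n"
  proof -
    have "commutator A (?p X) = ?p (?B * X) - ?p (X * ?B)"
      using pm[OF c(2,1)] pm[OF c] AB by (simp add: commutator_def)
    also have "\<dots> = ?p (?B * X - X * ?B)" using c g by (intro eq_matI) (auto simp: pe)
    also have "\<dots> = 0\<^sub>m n n" using X(4) z by (simp add: commutator_def)
    finally show ?thesis .
  qed
  moreover have "mat_trace (A ^\<^sub>m i * ?p X) = 0" if "i \<in> I" for i
  proof -
    have ci: "?B ^\<^sub>m i \<in> carrier_mat n n" using c(2) by (rule pow_carrier_mat)
    have "A ^\<^sub>m i * ?p X = ?p (?B ^\<^sub>m i * X)"
      using pm[OF ci c(1)] pp[OF c(2), of i] AB by simp
    moreover have "?B ^\<^sub>m i * X \<in> carrier_mat n n" using ci c(1) by simp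
    ultimately show ?thesis using pt X(5) that by simp
  qed
  ultimately have p0: "?p X = 0\<^sub>m n n" using sp unfolding strong_property_def by blast
  have "X $$ (i, j) = 0" if "i < n" "j < n" for i j
  proof -
    have "?p X $$ (f i, f j) = X $$ (i, j)" using that f gf by (simp add: pe)
    then show ?thesis using p0 that f by simp
  qed
  then show "X = 0\<^sub>m n n" using c by (intro eq_matI) auto
qed

lemma relabel_S_graph:
  assumes sim: "simple_graph G" and n: "order_of G = n" and rl: "relabelling n f g"
    and A: "A \<in> S_graph G"
  shows "permute_mat n g A \<in> S_graph (Graph n ((`) f ` edges G))"
proof -
  note f = f[OF rl] and g = g[OF rl] and fg = fg[OF rl] and gf = gf[OF rl]
  have "{i, j} \<in> (`) f ` edges G \<longleftrightarrow> {g i, g j} \<in> edges G" if "i < n" "j < n" for i j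
  proof
    assume "{i, j} \<in> (`) f ` edges G"
    then obtain e where e: "e \<in> edges G" "{i, j} = f ` e" by blast
    have "e \<subseteq> {..<n}" using sim e n by (auto simp: simple_graph_def)
    then have "e = g ` f ` e" using gf by (force simp: image_image)
    then show "{g i, g j} \<in> edges G" using e by (metis image_empty image_insert)
  next
    assume "{g i, g j} \<in> edges G"
    moreover have "{i, j} = f ` {g i, g j}" using fg that by simp
    ultimately show "{i, j} \<in> (`) f ` edges G" by blast
  qed
  moreover have "g i \<noteq> g j" if "i < n" "j < n" "i \<noteq> j" for i j using that fg by metis
  moreover have "A $$ (i, j) = A $$ (j, i)" if "i < n" "j < n" for i j
    proof -
    have "A \<in> carrier_mat n n" "transpose_mat A = A" using A n by (auto simp: S_graph_def symmetric_mat_def)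
    then show ?thesis using that by (metis carrier_matD index_transpose_mat(1))
  qed
  ultimately show ?thesis
    using A n g by (auto simp: S_graph_def symmetric_mat_def permute_mat_def intro!: eq_matI)
qed

lemma graph_iso_order:
  assumes "G \<simeq>\<^sub>G H" shows "order_of G = order_of H"
proof -
  obtain f where "bij_betw f (verts G) (verts H)"
    using assms unfolding graph_iso_def by (elim exE conjE) (rule that)
  from bij_betw_same_card[OF this] show ?thesis by simp
qed

lemma graph_iso_transport:
  assumes iso: "G \<simeq>\<^sub>G H" and sim: "simple_graph G" and A: "A \<in> S_graph G"
  obtains B where "B \<in> S_graph H" "char_poly B = char_poly A"
    "\<And>I. strong_property (order_of G) I A \<Longrightarrow> strong_property (order_of G) I B"
proof -
  have n: "order_of H = order_of G" using graph_iso_order[OF iso] by simp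
  obtain f where f: "bij_betw f (verts G) (verts G)" "edges H = (`) f ` edges G"
    using iso n by (auto simp: graph_iso_def)
  obtain g where rl: "relabelling (order_of G) f g" using bij_betw_relabelling[OF f(1)] .
  have c: "A \<in> carrier_mat (order_of G) (order_of G)" using A by (simp add: S_graph_def symmetric_mat_def)
  have "H = Graph (order_of G) ((`) f ` edges G)" using n f(2) by (cases H) simp
  then have "permute_mat (order_of G) g A \<in> S_graph H"
    using relabel_S_graph[OF sim refl rl A] by simp
  then show ?thesis
    using that char_poly_permute_mat[OF relabelling_sym[OF rl] c]
      strong_property_permute_mat[OF relabelling_sym[OF rl] c] by blast
qed

lemma bij_betw_image_edges_inverse:
  assumes sim: "simple_graph G" and rl: "relabelling (order_of G) f g"
  shows "(`) g ` (`) f ` edges G = edges G"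
proof -
  have inv: "g ` f ` e = e" if "e \<in> edges G" for e
  proof -
    have "e \<subseteq> verts G" using sim that by (simp add: simple_graph_def)
    then show ?thesis using rl by (force simp: relabelling_def image_image)
  qed
  show ?thesis
  proof (intro equalityI subsetI)
    fix e assume "e \<in> (`) g ` (`) f ` edges G"
    then obtain e' where "e' \<in> edges G" "e = g ` f ` e'" by blast
    then show "e \<in> edges G" by (simp only: inv)
  next
    fix e assume "e \<in> edges G"
    then have "g ` f ` e \<in> (`) g ` (`) f ` edges G" by (intro imageI)
    then show "e \<in> (`) g ` (`) f ` edges G" by (simp only: inv[OF \<open>e \<in> edges G\<close>])
  qed
qed

lemma graph_iso_sym:
  assumes iso: "G \<simeq>\<^sub>G H" and sim: "simple_graph G"
  shows "H \<simeq>\<^sub>G G"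
proof -
  have n: "order_of H = order_of G" using graph_iso_order[OF iso] by simp
  obtain f where f: "bij_betw f (verts G) (verts G)" "edges H = (`) f ` edges G"
    using iso n by (auto simp: graph_iso_def)
  obtain g where rl: "relabelling (order_of G) f g" using bij_betw_relabelling[OF f(1)] .
  have "bij_betw g (verts G) (verts G)"
    using rl by (intro bij_betw_byWitness[where f' = f]) (auto simp: relabelling_def)
  moreover have "edges G = (`) g ` edges H"
    unfolding f(2) by (rule bij_betw_image_edges_inverse[OF sim rl, symmetric])
  ultimately show ?thesis unfolding graph_iso_def n by blast
qed

lemma graph_iso_trans:
  assumes "G \<simeq>\<^sub>G H" "H \<simeq>\<^sub>G K" shows "G \<simeq>\<^sub>G K"
proof -
  obtain f where f: "bij_betw f (verts G) (verts H)" "edges H = (`) f ` edges G"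
    using assms(1) unfolding graph_iso_def by (elim exE conjE) (rule that)
  obtain g where g: "bij_betw g (verts H) (verts K)" "edges K = (`) g ` edges H"
    using assms(2) unfolding graph_iso_def by (elim exE conjE) (rule that)
  have "edges K = (`) (g \<circ> f) ` edges G" by (simp add: f(2) g(2) image_image image_comp)
  then show ?thesis unfolding graph_iso_def by (intro exI[of _ "g \<circ> f"] conjI bij_betw_trans[OF f(1) g(1)])
qed

lemma graph_iso_refl: "G \<simeq>\<^sub>G G"
  unfolding graph_iso_def by (rule exI[of _ id]) auto

definition embeds :: "graph \<Rightarrow> graph \<Rightarrow> bool" where
  "embeds H G \<longleftrightarrow> order_of H = order_of G \<and>
     (\<exists>f. bij_betw f (verts H) (verts H) \<and> (`) f ` edges H \<subseteq> edges G)"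

text \<open>Relabelling moves the matrix to a spanning subgraph of \<open>G\<close>;
  \<open>SSP_supergraph\<close> then adds the missing edges without changing the spectrum.\<close>

lemma (in index_bij) realizes_SSP_embeds:
  assumes emb: "embeds H G" and sim: "simple_graph H" and n: "order_of H = n"
    and real: "realizes_SSP H L"
  shows "realizes_SSP G L"
proof -
  obtain f where f: "bij_betw f (verts H) (verts H)" "(`) f ` edges H \<subseteq> edges G"
    using emb unfolding embeds_def by (elim exE conjE) (rule that)
  have nG: "order_of G = n" using emb n unfolding embeds_def by argo
  let ?K = "Graph n ((`) f ` edges H)"
  have iso: "H \<simeq>\<^sub>G ?K"
    unfolding graph_iso_def using f(1) by (intro exI[of _ f]) (simp add: n)
  obtain A where A: "A \<in> S_graph H" "char_poly A = roots_poly L" "SSP n A"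
    using real n by (auto simp: realizes_SSP_def)
  obtain B where B: "B \<in> S_graph ?K" "char_poly B = char_poly A"
    "\<And>I. strong_property (order_of H) I A \<Longrightarrow> strong_property (order_of H) I B"
    by (rule graph_iso_transport[OF iso sim A(1)]) (rule that)
  have BS: "SSP n B" using B(3)[of "{}"] A(3) n by (simp add: SSP_strong_property)
  have sub: "edges ?K \<subseteq> edges G" using f(2) by simp
  have nK: "order_of ?K = n" by simp
  obtain C where C: "C \<in> S_graph G" "SSP n C" "similar_mat B C"
    by (rule SSP_supergraph[OF B(1) BS nK nG sub]) (rule that)
  have "char_poly C = roots_poly L" using char_poly_similar[OF C(3)] B(2) A(2) by simp
  then show ?thesis using C(1,2) nG unfolding realizes_SSP_def by blast
qed

lemma S_graph_uminus:
  assumes A: "A \<in> S_graph G" shows "- A \<in> S_graph G"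
proof -
  have c: "A \<in> carrier_mat (order_of G) (order_of G)" "transpose_mat A = A"
    using A by (auto simp: S_graph_def symmetric_mat_def)
  have "transpose_mat (- A) = - transpose_mat A" using c(1) by (intro eq_matI) auto
  then show ?thesis using A c by (auto simp: S_graph_def symmetric_mat_def)
qed

lemma SSP_uminus:
  assumes A: "A \<in> carrier_mat n n" and ssp: "SSP n A" shows "SSP n (- A)"
proof (rule SSP_I)
  show "- A \<in> carrier_mat n n" using A by simp
  fix x :: "nat \<Rightarrow> nat \<Rightarrow> real"
  assume x: "\<And>i j. i < n \<Longrightarrow> j < n \<Longrightarrow> x i j = x j i" "\<And>i. i < n \<Longrightarrow> x i i = 0"
    "\<And>i j. i < n \<Longrightarrow> j < n \<Longrightarrow> (- A) $$ (i, j) \<noteq> 0 \<Longrightarrow> x i j = 0"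
    "\<And>i j. i < n \<Longrightarrow> j < n \<Longrightarrow> (\<Sum>k<n. (- A) $$ (i, k) * x k j) = (\<Sum>k<n. x i k * (- A) $$ (k, j))"
  have c: "(\<Sum>k<n. A $$ (i, k) * x k j) = (\<Sum>k<n. x i k * A $$ (k, j))" if "i < n" "j < n" for i j
    using x(4)[OF that] that A by (simp add: sum_negf)
  show "\<forall>i<n. \<forall>j<n. x i j = 0"
    using strong_property_D[OF A ssp[unfolded SSP_strong_property] x(1,2) _ c] x(3) A by auto
qed

lemma (in index_bij) char_poly_uminus:
  assumes A: "symmetric_mat n A" "char_poly A = roots_poly L"
  shows "char_poly (- A) = roots_poly (map uminus L)"
proof -
  have c: "A \<in> carrier_mat n n" using A by (simp add: symmetric_mat_def)
  have len: "length L = n"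
    using degree_monic_char_poly[OF c] A(2) by (auto simp: degree_roots_poly)
  show ?thesis
  proof (rule symmetric_mat_decomposition_of_roots[OF A])
    fix q
    assume q: "\<And>k l. k < n \<Longrightarrow> l < n \<Longrightarrow> (\<Sum>i<n. q k i * q l i) = (if k = l then 1 else 0)"
      and "\<And>i j. i < n \<Longrightarrow> j < n \<Longrightarrow> (\<Sum>k<n. q k i * q k j) = (if i = j then 1 else 0)"
      and dec: "\<And>i j. i < n \<Longrightarrow> j < n \<Longrightarrow> A $$ (i, j) = (\<Sum>k<n. L ! k * q k i * q k j)"
    have dec': "(- A) $$ (i, j) = (\<Sum>k<n. - L ! k * q k i * q k j)" if "i < n" "j < n" for i j
      using dec[OF that] c that by (simp add: sum_negf)
    have "char_poly (- A) = roots_poly (map (\<lambda>k. - L ! k) [0..<n])"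
      by (rule char_poly_of_orthonormal_decomposition(1)[of _ n q]) (use c in simp, (rule q dec'; assumption)+)
    also have "map (\<lambda>k. - L ! k) [0..<n] = map uminus L"
      using len by (intro nth_equalityI) auto
    finally show ?thesis .
  qed
qed

lemma (in index_bij) realizes_uminus:
  assumes "order_of G = n"
  shows "realizes G L \<Longrightarrow> realizes G (map uminus L)" "realizes_SSP G L \<Longrightarrow> realizes_SSP G (map uminus L)"
proof -
  have s: "symmetric_mat n A" "A \<in> carrier_mat n n" if "A \<in> S_graph G" for A
    using that assms by (auto simp: S_graph_def symmetric_mat_def)
  show "realizes G (map uminus L)" if "realizes G L"
    using that char_poly_uminus s S_graph_uminus unfolding realizes_def by metis
  show "realizes_SSP G (map uminus L)" if "realizes_SSP G L"
    using that char_poly_uminus s S_graph_uminus SSP_uminus assms unfolding realizes_SSP_def by metis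
qed

lemma order_isolated: "order_of (G \<uplus>\<^sub>G complete_graph 1) = Suc (order_of G)"
  by (simp add: disjoint_union_def complete_graph_def)

lemma edges_isolated: "edges (G \<uplus>\<^sub>G complete_graph 1) = edges G"
  by (simp add: disjoint_union_def complete_graph_def)

text \<open>For the block matrix with blocks \<open>A\<close> and \<open>c\<close> the commutator
  condition on a test matrix splits. Its block inside \<open>G\<close> is killed by the strong
  property of \<open>A\<close>; its new column \<open>x\<close> satisfies \<open>A x = c x\<close>
  and vanishes because \<open>c\<close> is not an eigenvalue of \<open>A\<close>.\<close>

lemma realizes_SSP_isolated:
  assumes sim: "simple_graph G" and real: "realizes_SSP G L" and c: "c \<notin> set L"
  shows "realizes_SSP (G \<uplus>\<^sub>G complete_graph 1) (L @ [c])"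
proof -
  let ?n = "order_of G" and ?H = "G \<uplus>\<^sub>G complete_graph 1"
  obtain A where A: "A \<in> S_graph G" "char_poly A = roots_poly L" "SSP ?n A"
    using real unfolding realizes_SSP_def by blast
  have cA: "A \<in> carrier_mat ?n ?n" and tA: "transpose_mat A = A"
    using A(1) by (auto simp: S_graph_def symmetric_mat_def)
  have symA: "A $$ (i, j) = A $$ (j, i)" if "i < ?n" "j < ?n" for i j
  proof -
    have "transpose_mat A $$ (i, j) = A $$ (j, i)" using cA that by simp
    then show ?thesis using tA by simp
  qed
  define B where "B = Matrix.mat (Suc ?n) (Suc ?n)
    (\<lambda>(i, j). if i < ?n \<and> j < ?n then A $$ (i, j) else if i = j then c else 0)"
  have cB: "B \<in> carrier_mat (Suc ?n) (Suc ?n)" by (simp add: B_def)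
  have Bij: "B $$ (i, j) = (if i < ?n \<and> j < ?n then A $$ (i, j) else if i = j then c else 0)"
    if "i < Suc ?n" "j < Suc ?n" for i j using that by (simp add: B_def)
  have "symmetric_mat (Suc ?n) B"
    unfolding symmetric_mat_def using cB symA by (auto intro!: eq_matI simp: Bij)
  moreover have "B $$ (i, j) \<noteq> 0 \<longleftrightarrow> {i, j} \<in> edges G" if ij: "i < Suc ?n" "j < Suc ?n" "i \<noteq> j" for i j
  proof (cases "i < ?n \<and> j < ?n")
    case True
    then show ?thesis using A(1) ij by (simp add: Bij S_graph_def)
  next
    case False
    then have "\<not> {i, j} \<subseteq> verts G" by auto
    then have "{i, j} \<notin> edges G" using sim by (auto simp: simple_graph_def)
    moreover have "B $$ (i, j) = 0" unfolding Bij[OF ij(1,2)] using False ij(3) by argo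
    ultimately show ?thesis by simp
  qed
  ultimately have BS: "B \<in> S_graph ?H"
    unfolding S_graph_def mem_Collect_eq order_isolated edges_isolated by auto
  have "mat_delete (char_poly_matrix B) ?n ?n = char_poly_matrix A"
    using cB cA by (intro eq_matI) (auto simp: mat_delete_def char_poly_matrix_def Bij)
  then have cof: "cofactor (char_poly_matrix B) ?n ?n = char_poly A"
    by (simp add: cofactor_def char_poly_def)
  have "char_poly B = (\<Sum>j<Suc ?n. char_poly_matrix B $$ (?n, j) * cofactor (char_poly_matrix B) ?n j)"
    unfolding char_poly_def by (rule laplace_expansion_row) (use cB in auto)
  also have "\<dots> = [:- c, 1:] * cofactor (char_poly_matrix B) ?n ?n"
    using cB by (auto simp: char_poly_matrix_def Bij)
  finally have cp: "char_poly B = roots_poly (L @ [c])" by (simp add: A(2) cof mult.commute)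
  have "SSP (Suc ?n) B"
  proof (rule SSP_I[OF cB])
    fix x :: "nat \<Rightarrow> nat \<Rightarrow> real"
    assume x: "\<And>i j. i < Suc ?n \<Longrightarrow> j < Suc ?n \<Longrightarrow> x i j = x j i" "\<And>i. i < Suc ?n \<Longrightarrow> x i i = 0"
      "\<And>i j. i < Suc ?n \<Longrightarrow> j < Suc ?n \<Longrightarrow> B $$ (i, j) \<noteq> 0 \<Longrightarrow> x i j = 0"
      "\<And>i j. i < Suc ?n \<Longrightarrow> j < Suc ?n \<Longrightarrow>
        (\<Sum>k<Suc ?n. B $$ (i, k) * x k j) = (\<Sum>k<Suc ?n. x i k * B $$ (k, j))"
    have comm: "(\<Sum>k<?n. A $$ (i, k) * x k j) = (\<Sum>k<?n. x i k * A $$ (k, j))" if "i < ?n" "j < ?n" for i j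
      using x(4)[of i j] that by (simp add: Bij)
    have inner: "x i j = 0" if "i < ?n" "j < ?n" for i j
    proof (rule strong_property_D[OF cA A(3)[unfolded SSP_strong_property] _ _ _ comm _ that])
      fix i j assume ij: "i < ?n" "j < ?n"
      show "x i j = x j i" using x(1) ij by simp
      show "A $$ (i, j) \<noteq> 0 \<Longrightarrow> x i j = 0" using x(3)[of i j] ij by (simp add: Bij)
    qed (use x(2) in simp_all)
    have "Matrix.vec ?n (\<lambda>i. x i ?n) = 0\<^sub>v ?n"
    proof (rule ccontr)
      let ?v = "Matrix.vec ?n (\<lambda>i. x i ?n)"
      assume "?v \<noteq> 0\<^sub>v ?n"
      moreover have "A *\<^sub>v ?v = c \<cdot>\<^sub>v ?v"
      proof (rule eq_vecI)
        fix i assume "i < dim_vec (c \<cdot>\<^sub>v ?v)"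
        then have i: "i < ?n" by simp
        have "(\<Sum>k<?n. A $$ (i, k) * x k ?n) = c * x i ?n"
          using x(4)[of i ?n] i by (simp add: Bij mult.commute)
        then show "vec_index (A *\<^sub>v ?v) i = vec_index (c \<cdot>\<^sub>v ?v) i"
          using i cA by (simp add: scalar_prod_def atLeast0LessThan)
      qed (use cA in simp)
      ultimately have "eigenvector A ?v c" using cA by (simp add: eigenvector_def)
      then have "c \<in> set L"
        using eigenvalue_root_char_poly[OF cA] A(2) roots_poly_root_iff eigenvalue_def by metis
      then show False using c by simp
    qed
    then have "vec_index (Matrix.vec ?n (\<lambda>i. x i ?n)) i = 0" if "i < ?n" for i using that by simp
    then have "x i ?n = 0" if "i < ?n" for i using that by simp
    then show "\<forall>i<Suc ?n. \<forall>j<Suc ?n. x i j = 0"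
      using inner x(1)[of _ ?n] x(2) by (auto simp: less_Suc_eq)
  qed
  then show ?thesis using BS cp unfolding realizes_SSP_def order_isolated by blast
qed

section \<open>Multiplicity lists of graphs of order five\<close>

lemma index_bij_5: obtains g :: "5 \<Rightarrow> nat" where "index_bij g 5"
proof -
  obtain g :: "5 \<Rightarrow> nat" where "bij_betw g UNIV {0..<CARD(5)}"
    using ex_bij_betw_finite_nat[OF finite_class.finite_UNIV] by blast
  then have "index_bij g 5" by (simp add: index_bij_def atLeast0LessThan)
  then show ?thesis by (rule that)
qed

lemma mult_list_eq_imp_expand:
  assumes A: "symmetric_mat 5 A" and m: "mult_list A = m"
  obtains ls where "sorted_wrt (<) ls" "length ls = length m" "\<forall>k\<in>set m. 0 < k" "sum_list m = 5"
    "char_poly A = roots_poly (expand ls m)"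
proof -
  obtain g :: "5 \<Rightarrow> nat" where g: "index_bij g 5" by (rule index_bij_5)
  obtain L where L: "length L = 5" "char_poly A = roots_poly L"
    by (rule index_bij.symmetric_mat_char_poly[OF g A]) (rule that)
  define ls m' where "ls = sorted_list_of_set (set L)" and "m' = map (count_list L) (sorted_list_of_set (set L))"
  have e: "mset (expand ls m') = mset L" "sorted_wrt (<) ls" "length ls = length m'" "\<forall>k\<in>set m'. 0 < k"
    using mset_eq_expand[of L] by (simp_all add: ls_def m'_def)
  have cp: "char_poly A = roots_poly (expand ls m')" using L(2) roots_poly_cong[OF e(1)] by simp
  have cA: "A \<in> carrier_mat 5 5" using A by (simp add: symmetric_mat_def)
  have "m' = m" using spectrum_expand(2)[OF cA cp e(2-4)] m by simp
  moreover have "sum_list m' = 5"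
    using length_expand[OF e(3)] mset_eq_length[OF e(1)] L(1) by simp
  ultimately show ?thesis using that e cp by metis
qed

lemma attains_iff:
  assumes "order_of G = 5"
  shows "attains G m \<longleftrightarrow> (\<exists>ls. sorted_wrt (<) ls \<and> length ls = length m \<and> (\<forall>k\<in>set m. 0 < k) \<and>
      sum_list m = 5 \<and> realizes G (expand ls m))" (is "_ \<longleftrightarrow> ?R")
    and "attains_SSP G m \<longleftrightarrow> (\<exists>ls. sorted_wrt (<) ls \<and> length ls = length m \<and> (\<forall>k\<in>set m. 0 < k) \<and>
      sum_list m = 5 \<and> realizes_SSP G (expand ls m))" (is "_ \<longleftrightarrow> ?RS")
proof -
  have s: "symmetric_mat 5 A" "A \<in> carrier_mat 5 5" if "A \<in> S_graph G" for A
    using that assms by (auto simp: S_graph_def symmetric_mat_def)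
  show "attains G m \<longleftrightarrow> ?R"
  proof
    assume "attains G m"
    then obtain A where A: "A \<in> S_graph G" "mult_list A = m" unfolding attains_def by blast
    show ?R by (rule mult_list_eq_imp_expand[OF s(1)[OF A(1)] A(2)]) (use A(1) realizes_def in blast)
  next
    assume ?R
    then show "attains G m" unfolding attains_def realizes_def using spectrum_expand(2) s(2) by blast
  qed
  show "attains_SSP G m \<longleftrightarrow> ?RS"
  proof
    assume "attains_SSP G m"
    then obtain A where A: "A \<in> S_graph G" "mult_list A = m" "SSP (order_of G) A"
      unfolding attains_SSP_def by blast
    show ?RS by (rule mult_list_eq_imp_expand[OF s(1)[OF A(1)] A(2)]) (use A(1,3) realizes_SSP_def in blast)
  next
    assume ?RS
    then show "attains_SSP G m" unfolding attains_SSP_def realizes_SSP_def using spectrum_expand(2) s(2) by blast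
  qed
qed

lemma attains_SSP_imp_attains: "attains_SSP G m \<Longrightarrow> attains G m"
  by (auto simp: attains_def attains_SSP_def)

lemma expand_map: "length ls = length m \<Longrightarrow> expand (map f ls) m = map f (expand ls m)"
  by (induction ls m rule: list_induct2) auto

lemma expand_append: "length ls = length m \<Longrightarrow> expand (ls @ ls') (m @ m') = expand ls m @ expand ls' m'"
  by (induction ls m rule: list_induct2) auto

lemma expand_rev: "length ls = length m \<Longrightarrow> expand (rev ls) (rev m) = rev (expand ls m)"
  by (induction ls m rule: list_induct2) (auto simp: expand_append)

lemma realizes_cong:
  assumes "mset L = mset L'"
  shows "realizes G L = realizes G L'" "realizes_SSP G L = realizes_SSP G L'"
  using roots_poly_cong[OF assms] by (simp_all add: realizes_def realizes_SSP_def)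

text \<open>The spectrum of \<open>- A\<close> in increasing order when \<open>ls\<close> is that of
  \<open>A\<close>. Negating matrices is how multiplicity lists get reversed.\<close>

definition neg_rev :: "real list \<Rightarrow> real list" where "neg_rev ls = rev (map uminus ls)"

lemma neg_rev_simps [simp]: "length (neg_rev ls) = length ls" "neg_rev (neg_rev ls) = ls"
  by (simp_all add: neg_rev_def rev_map o_def)

lemma sorted_neg_rev [simp]: "sorted_wrt (<) (neg_rev ls) \<longleftrightarrow> sorted_wrt (<) ls"
  by (simp add: neg_rev_def sorted_wrt_rev sorted_wrt_map)

lemma mset_expand_neg_rev:
  "length ls = length m \<Longrightarrow> mset (expand (neg_rev ls) (rev m)) = mset (map uminus (expand ls m))"
  by (simp add: neg_rev_def expand_rev expand_map)

lemma realizes_neg_rev: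
  assumes "order_of G = 5" "length ls = length m"
  shows "realizes G (expand ls m) \<Longrightarrow> realizes G (expand (neg_rev ls) (rev m))"
    "realizes_SSP G (expand ls m) \<Longrightarrow> realizes_SSP G (expand (neg_rev ls) (rev m))"
proof -
  obtain g :: "5 \<Rightarrow> nat" where g: "index_bij g 5" by (rule index_bij_5)
  note u = index_bij.realizes_uminus[OF g assms(1)] and c = realizes_cong[OF mset_expand_neg_rev[OF assms(2)]]
  show "realizes G (expand ls m) \<Longrightarrow> realizes G (expand (neg_rev ls) (rev m))"
    using u(1) c(1) by blast
  show "realizes_SSP G (expand ls m) \<Longrightarrow> realizes_SSP G (expand (neg_rev ls) (rev m))"
    using u(2) c(2) by blast
qed

lemma attains_rev_imp:
  assumes "order_of G = 5"
  shows "attains G m \<Longrightarrow> attains G (rev m)" "attains_SSP G m \<Longrightarrow> attains_SSP G (rev m)"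
proof -
  show "attains G (rev m)" if at: "attains G m"
  proof -
    obtain ls where "sorted_wrt (<) ls" "length ls = length m" "\<forall>k\<in>set m. 0 < k" "sum_list m = 5"
      "realizes G (expand ls m)" using at unfolding attains_iff(1)[OF assms] by blast
    then show ?thesis unfolding attains_iff(1)[OF assms]
      using realizes_neg_rev(1)[OF assms] by (intro exI[of _ "neg_rev ls"]) simp
  qed
  show "attains_SSP G (rev m)" if at: "attains_SSP G m"
  proof -
    obtain ls where "sorted_wrt (<) ls" "length ls = length m" "\<forall>k\<in>set m. 0 < k" "sum_list m = 5"
      "realizes_SSP G (expand ls m)" using at unfolding attains_iff(2)[OF assms] by blast
    then show ?thesis unfolding attains_iff(2)[OF assms]
      using realizes_neg_rev(2)[OF assms] by (intro exI[of _ "neg_rev ls"]) simp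
  qed
qed

lemma attains_rev:
  assumes "order_of G = 5"
  shows "attains G (rev m) = attains G m" "attains_SSP G (rev m) = attains_SSP G m"
  using attains_rev_imp[OF assms] by (metis rev_rev_ident)+

definition arbitrary :: "graph \<Rightarrow> nat list \<Rightarrow> bool" where
  "arbitrary G m \<longleftrightarrow> (\<forall>ls. length ls = length m \<and> sorted_wrt (<) ls \<longrightarrow> realizes G (expand ls m))"

text \<open>Stronger than spectral arbitrariness together with attainment under the SSP: every
  choice of eigenvalues must be realized by a matrix with the SSP. This joint form is inherited by
  supergraphs.\<close>

definition arbitrary_SSP :: "graph \<Rightarrow> nat list \<Rightarrow> bool" where
  "arbitrary_SSP G m \<longleftrightarrow> (\<forall>ls. length ls = length m \<and> sorted_wrt (<) ls \<longrightarrow> realizes_SSP G (expand ls m))"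

lemma arbitrary_SSP_imp_arbitrary: "arbitrary_SSP G m \<Longrightarrow> arbitrary G m"
  unfolding arbitrary_def arbitrary_SSP_def realizes_def realizes_SSP_def by blast

lemma arbitrary_rev:
  assumes "order_of G = 5"
  shows "arbitrary G m \<Longrightarrow> arbitrary G (rev m)" "arbitrary_SSP G m \<Longrightarrow> arbitrary_SSP G (rev m)"
proof -
  show "arbitrary G (rev m)" if at: "arbitrary G m"
    unfolding arbitrary_def
  proof (intro allI impI, elim conjE)
    fix ls :: "real list" assume ls: "length ls = length (rev m)" "sorted_wrt (<) ls"
    then have "realizes G (expand (neg_rev ls) m)" using at unfolding arbitrary_def by simp
    then show "realizes G (expand ls (rev m))"
      using realizes_neg_rev(1)[OF assms, of "neg_rev ls" m] ls by simp
  qed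
  show "arbitrary_SSP G (rev m)" if at: "arbitrary_SSP G m"
    unfolding arbitrary_SSP_def
  proof (intro allI impI, elim conjE)
    fix ls :: "real list" assume ls: "length ls = length (rev m)" "sorted_wrt (<) ls"
    then have "realizes_SSP G (expand (neg_rev ls) m)" using at unfolding arbitrary_SSP_def by simp
    then show "realizes_SSP G (expand ls (rev m))"
      using realizes_neg_rev(2)[OF assms, of "neg_rev ls" m] ls by simp
  qed
qed

lemma arbitrary_imp_attains:
  assumes "order_of G = 5" "\<forall>k\<in>set m. 0 < k" "sum_list m = 5"
  shows "arbitrary G m \<Longrightarrow> attains G m" "arbitrary_SSP G m \<Longrightarrow> attains_SSP G m"
proof -
  let ?ls = "map real [0..<length m]"
  have ls: "sorted_wrt (<) ?ls" "length ?ls = length m"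
    by (simp_all add: sorted_wrt_map sorted_wrt_upt)
  show "arbitrary G m \<Longrightarrow> attains G m"
    unfolding attains_iff(1)[OF assms(1)] arbitrary_def using ls assms(2,3) by blast
  show "arbitrary_SSP G m \<Longrightarrow> attains_SSP G m"
    unfolding attains_iff(2)[OF assms(1)] arbitrary_SSP_def using ls assms(2,3) by blast
qed

lemma arbitrary_imp_spectrally_arbitrary:
  assumes "\<forall>k\<in>set m. 0 < k" "arbitrary G m"
  shows "spectrally_arbitrary m G"
  unfolding spectrally_arbitrary_def
proof (intro allI impI, elim conjE)
  fix ls :: "real list" assume ls: "length ls = length m" "sorted_wrt (<) ls"
  then obtain A where A: "A \<in> S_graph G" "char_poly A = roots_poly (expand ls m)"
    using assms(2) unfolding arbitrary_def realizes_def by blast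
  have c: "A \<in> carrier_mat (order_of G) (order_of G)" using A(1) by (auto simp: S_graph_def symmetric_mat_def)
  show "\<exists>A\<in>S_graph G. {x. eigenvalue A x} = set ls \<and> (\<forall>i<length m. multiplicity_of A (ls ! i) = m ! i)"
    using spectrum_expand(1,3)[OF c A(2) ls(2,1) assms(1)] A(1) by blast
qed

lemma attains_SSP_embeds:
  assumes "order_of H = 5" "simple_graph H" "embeds H G" "attains_SSP H m"
  shows "attains_SSP G m"
proof -
  obtain g :: "5 \<Rightarrow> nat" where g: "index_bij g 5" by (rule index_bij_5)
  have "order_of G = 5" using assms(1,3) unfolding embeds_def by argo
  then show ?thesis using assms(4) index_bij.realizes_SSP_embeds[OF g assms(3,2,1)]
    unfolding attains_iff(2)[OF assms(1)] attains_iff(2)[OF \<open>order_of G = 5\<close>] by blast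
qed

lemma arbitrary_SSP_embeds:
  assumes "order_of H = 5" "simple_graph H" "embeds H G" "arbitrary_SSP H m"
  shows "arbitrary_SSP G m"
proof -
  obtain g :: "5 \<Rightarrow> nat" where g: "index_bij g 5" by (rule index_bij_5)
  show ?thesis using assms(4) index_bij.realizes_SSP_embeds[OF g assms(3,2,1)]
    unfolding arbitrary_SSP_def by blast
qed

lemma attains_iso:
  assumes iso: "G \<simeq>\<^sub>G H" and sim: "simple_graph G"
  shows "attains G m \<Longrightarrow> attains H m" "attains_SSP G m \<Longrightarrow> attains_SSP H m"
    "attains_SMP G m \<Longrightarrow> attains_SMP H m" "spectrally_arbitrary m G \<Longrightarrow> spectrally_arbitrary m H"
proof -
  let ?n = "order_of G"
  have n: "order_of H = ?n" using graph_iso_order[OF iso] by simp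
  have tr: "\<exists>B \<in> S_graph H. char_poly B = char_poly A \<and> B \<in> carrier_mat ?n ?n \<and> A \<in> carrier_mat ?n ?n \<and>
      (\<forall>I. strong_property ?n I A \<longrightarrow> strong_property ?n I B)" if A: "A \<in> S_graph G" for A
  proof (rule graph_iso_transport[OF iso sim A])
    fix B assume "B \<in> S_graph H" "char_poly B = char_poly A"
      "\<And>I. strong_property ?n I A \<Longrightarrow> strong_property ?n I B"
    moreover have "C \<in> carrier_mat (order_of K) (order_of K)" if "C \<in> S_graph K" for C K
      using that by (simp add: S_graph_def symmetric_mat_def)
    ultimately show ?thesis using A n by metis
  qed
  show "attains G m \<Longrightarrow> attains H m"
    unfolding attains_def using tr mult_list_cong by metis
  show "attains_SSP G m \<Longrightarrow> attains_SSP H m"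
    unfolding attains_SSP_def SSP_strong_property n using tr mult_list_cong by metis
  show "attains_SMP G m \<Longrightarrow> attains_SMP H m"
    unfolding attains_SMP_def SMP_strong_property n using tr mult_list_cong by metis
  show "spectrally_arbitrary m H" if sa: "spectrally_arbitrary m G"
    unfolding spectrally_arbitrary_def
  proof (intro allI impI)
    fix ls :: "real list" assume ls: "length ls = length m \<and> sorted_wrt (<) ls"
    then obtain A where A: "A \<in> S_graph G" "{x. eigenvalue A x} = set ls"
      "\<forall>i<length m. multiplicity_of A (ls ! i) = m ! i"
      using sa unfolding spectrally_arbitrary_def by blast
    obtain B where B: "B \<in> S_graph H" "char_poly B = char_poly A" "B \<in> carrier_mat ?n ?n" "A \<in> carrier_mat ?n ?n"
      using tr[OF A(1)] by blast
    have "eigenvalue B x = eigenvalue A x" for x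
      using eigenvalue_root_char_poly[OF B(3)] eigenvalue_root_char_poly[OF B(4)] B(2) by simp
    moreover have "multiplicity_of B x = multiplicity_of A x" for x by (simp add: multiplicity_of_def B(2))
    ultimately show "\<exists>A\<in>S_graph H. {x. eigenvalue A x} = set ls \<and> (\<forall>i<length m. multiplicity_of A (ls ! i) = m ! i)"
      using A(2,3) by (intro bexI[OF _ B(1)]) simp
  qed
qed

section \<open>Obstructions to multiplicity lists\<close>

text \<open>The third conjunct is the resolution of the identity; with it, a polynomial identity
  satisfied by all eigenvalues becomes an identity between entries of powers of
  \<open>A\<close>.\<close>

definition spectral_decomposition :: "nat \<Rightarrow> real mat \<Rightarrow> real list \<Rightarrow> (nat \<Rightarrow> nat \<Rightarrow> real) \<Rightarrow> bool" where
  "spectral_decomposition n A L q \<longleftrightarrow> length L = n \<and>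
     (\<forall>k<n. \<forall>l<n. (\<Sum>i<n. q k i * q l i) = (if k = l then 1 else 0)) \<and>
     (\<forall>i<n. \<forall>j<n. (\<Sum>k<n. q k i * q k j) = (if i = j then 1 else 0)) \<and>
     (\<forall>i<n. \<forall>j<n. A $$ (i, j) = (\<Sum>k<n. L ! k * q k i * q k j))"

lemma spectral_decomposition_5:
  assumes A: "symmetric_mat 5 A" "char_poly A = roots_poly L"
  obtains q where "spectral_decomposition 5 A L q"
proof -
  obtain g :: "5 \<Rightarrow> nat" where g: "index_bij g 5" by (rule index_bij_5)
  have "A \<in> carrier_mat 5 5" using A(1) by (simp add: symmetric_mat_def)
  then have "length L = 5" using degree_monic_char_poly[of A 5] A(2) by (auto simp: degree_roots_poly)
  show ?thesis
  proof (rule index_bij.symmetric_mat_decomposition_of_roots[OF g A])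
    fix q
    assume "\<And>k l. k < 5 \<Longrightarrow> l < 5 \<Longrightarrow> (\<Sum>i<5. q k i * q l i) = (if k = l then 1 else 0)"
      "\<And>i j. i < 5 \<Longrightarrow> j < 5 \<Longrightarrow> (\<Sum>k<5. q k i * q k j) = (if i = j then 1 else 0)"
      "\<And>i j. i < 5 \<Longrightarrow> j < 5 \<Longrightarrow> A $$ (i, j) = (\<Sum>k<5. L ! k * q k i * q k j)"
    then have "spectral_decomposition 5 A L q"
      unfolding spectral_decomposition_def using \<open>length L = 5\<close> by blast
    then show ?thesis by (rule that)
  qed
qed

text \<open>Gaussian elimination by induction on the equations: an unknown with nonzero coefficient
  in the new equation is expressed through the others and eliminated from the remaining
  equations.\<close>

lemma homogeneous_system_nontrivial_solution:
  fixes a :: "'k \<Rightarrow> 'i \<Rightarrow> real"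
  assumes "finite I" "finite K" "card I < card K"
  shows "\<exists>c. (\<exists>k\<in>K. c k \<noteq> 0) \<and> (\<forall>i\<in>I. (\<Sum>k\<in>K. c k * a k i) = 0)"
  using assms
proof (induction I arbitrary: K a rule: finite_induct)
  case empty
  then obtain k where "k \<in> K" by (metis card.empty equals0I less_irrefl)
  then show ?case by (intro exI[of _ "\<lambda>_. 1"]) auto
next
  case (insert i I)
  show ?case
  proof (cases "\<forall>k\<in>K. a k i = 0")
    case True
    have "card I < card K" using insert by simp
    from insert.IH[OF insert.prems(1) this, of a] True show ?thesis by (auto intro!: sum.neutral)
  next
    case False
    then obtain k0 where k0: "k0 \<in> K" "a k0 i \<noteq> 0" by blast
    let ?K = "K - {k0}"
    have fK: "finite ?K" "card I < card ?K" using insert k0 by auto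
    obtain c where c: "\<exists>k\<in>?K. c k \<noteq> 0"
      "\<forall>j\<in>I. (\<Sum>k\<in>?K. c k * (a k j - a k i / a k0 i * a k0 j)) = 0"
      using insert.IH[OF fK, of "\<lambda>k j. a k j - a k i / a k0 i * a k0 j"] by blast
    define s where "s = - (\<Sum>k\<in>?K. c k * a k i) / a k0 i"
    define c' where "c' = c(k0 := s)"
    have split: "(\<Sum>k\<in>K. c' k * a k j) = s * a k0 j + (\<Sum>k\<in>?K. c k * a k j)" for j
    proof -
      have "(\<Sum>k\<in>K. c' k * a k j) = c' k0 * a k0 j + (\<Sum>k\<in>?K. c' k * a k j)"
        by (rule sum.remove[OF insert.prems(1) k0(1)])
      also have "(\<Sum>k\<in>?K. c' k * a k j) = (\<Sum>k\<in>?K. c k * a k j)"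
        by (intro sum.cong) (auto simp: c'_def)
      finally show ?thesis by (simp add: c'_def)
    qed
    have "(\<Sum>k\<in>K. c' k * a k j) = 0" if "j \<in> insert i I" for j
    proof (cases "j = i")
      case True
      then show ?thesis using k0(2) by (simp add: split s_def)
    next
      case False
      then have "j \<in> I" using that by simp
      then have "(\<Sum>k\<in>?K. c k * a k j) = (\<Sum>k\<in>?K. c k * a k i) / a k0 i * a k0 j"
        using c(2) by (simp add: right_diff_distrib sum_subtractf sum_distrib_right sum_divide_distrib mult.assoc)
      then show ?thesis by (simp add: split s_def)
    qed
    moreover have "\<exists>k\<in>K. c' k \<noteq> 0" using c(1) by (auto simp: c'_def)
    ultimately show ?thesis by (intro exI[of _ c']) simp
  qed
qed

text \<open>Among the combinations of the orthonormal eigenvectors for \<open>c\<close>, vanishing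
  on \<open>I\<close> imposes fewer equations than there are coefficients.\<close>

lemma eigenvector_vanishing_on:
  assumes sd: "spectral_decomposition n A L q" and I: "finite I" "card I < count_list L c"
  obtains x :: "nat \<Rightarrow> real" where "\<exists>i<n. x i \<noteq> 0" "\<And>i. i \<in> I \<Longrightarrow> x i = 0"
    "\<And>i. i < n \<Longrightarrow> (\<Sum>j<n. A $$ (i, j) * x j) = c * x i"
proof -
  define K where "K = {k. k < n \<and> L ! k = c}"
  have len: "length L = n" using sd by (simp add: spectral_decomposition_def)
  have K: "finite K" "card K = count_list L c"
    using len by (auto simp: K_def count_list_eq_length_filter length_filter_conv_card eq_commute
        intro!: arg_cong[of _ _ card])
  obtain w where w: "\<exists>k\<in>K. w k \<noteq> 0" "\<forall>i\<in>I. (\<Sum>k\<in>K. w k * q k i) = 0"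
    using homogeneous_system_nontrivial_solution[of I K q] I K by auto
  define x where "x i = (\<Sum>k\<in>K. w k * q k i)" for i
  \<comment> \<open>Pairing with the eigenvectors recovers the coefficients \<open>w\<close>; this
    shows both that \<open>x\<close> is nonzero and that it is an eigenvector.\<close>
  have inner: "(\<Sum>i<n. q l i * x i) = (if l \<in> K then w l else 0)" if l: "l < n" for l
  proof -
    have "(\<Sum>i<n. q l i * x i) = (\<Sum>k\<in>K. \<Sum>i<n. w k * (q k i * q l i))"
      unfolding x_def sum_distrib_left by (subst sum.swap) (simp add: mult_ac)
    also have "\<dots> = (\<Sum>k\<in>K. if k = l then w l else 0)"
      using sd l by (intro sum.cong refl)
        (auto simp: K_def spectral_decomposition_def simp flip: sum_distrib_left)
    finally show ?thesis using K(1) by simp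
  qed
  show ?thesis
  proof (rule that[of x])
    obtain k where k: "k \<in> K" "w k \<noteq> 0" using w(1) by blast
    then have "(\<Sum>i<n. q k i * x i) \<noteq> 0" using inner by (simp add: K_def)
    then obtain i where "i < n" "q k i * x i \<noteq> 0" by (metis (no_types, lifting) lessThan_iff sum.not_neutral_contains_not_neutral)
    then show "\<exists>i<n. x i \<noteq> 0" by auto
  next
    fix i assume "i \<in> I" then show "x i = 0" using w(2) by (simp add: x_def)
  next
    fix i assume i: "i < n"
    have "(\<Sum>j<n. A $$ (i, j) * x j) = (\<Sum>j<n. \<Sum>k<n. L ! k * q k i * (q k j * x j))"
      using sd i by (intro sum.cong refl)
        (simp add: spectral_decomposition_def sum_distrib_right mult.assoc)
    also have "\<dots> = (\<Sum>k<n. L ! k * q k i * (\<Sum>j<n. q k j * x j))"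
      by (subst sum.swap) (simp add: sum_distrib_left)
    also have "\<dots> = (\<Sum>k<n. if k \<in> K then c * (w k * q k i) else 0)"
      by (intro sum.cong refl) (auto simp: inner K_def)
    also have "\<dots> = (\<Sum>k\<in>K. c * (w k * q k i))"
      by (simp add: K_def sum.If_cases Collect_conj_eq lessThan_def)
    also have "\<dots> = c * x i" by (simp add: x_def sum_distrib_left)
    finally show "(\<Sum>j<n. A $$ (i, j) * x j) = c * x i" .
  qed
qed

text \<open>\<open>A - c\<close> is a sum of rank one squares with weights
  \<open>L ! m - c \<ge> 0\<close>. A vanishing diagonal entry makes each summand vanish there,
  hence along the whole row, against the nonzero entry at \<open>(i, j)\<close>.\<close>

lemma diag_greater_min_eigenvalue:
  assumes sd: "spectral_decomposition n A L q" and c: "\<And>a. a \<in> set L \<Longrightarrow> c \<le> a"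
    and ij: "i < n" "j < n" "i \<noteq> j" "A $$ (i, j) \<noteq> 0"
  shows "c < A $$ (i, i)"
proof -
  have len: "length L = n" using sd by (simp add: spectral_decomposition_def)
  have shift: "A $$ (k, l) - (if k = l then c else 0) = (\<Sum>m<n. (L ! m - c) * q m k * q m l)"
    if "k < n" "l < n" for k l
  proof -
    have "(\<Sum>m<n. (L ! m - c) * q m k * q m l) = (\<Sum>m<n. L ! m * q m k * q m l) - c * (\<Sum>m<n. q m k * q m l)"
      by (simp add: left_diff_distrib sum_subtractf sum_distrib_left mult.assoc)
    then show ?thesis using sd that by (simp add: spectral_decomposition_def)
  qed
  have nn: "0 \<le> (L ! m - c) * q m i * q m i" if "m < n" for m
    using c[of "L ! m"] that len by (simp add: mult.assoc)
  have "A $$ (i, i) - c = (\<Sum>m<n. (L ! m - c) * q m i * q m i)" using shift[OF ij(1,1)] by simp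
  also have "\<dots> \<ge> 0" by (rule sum_nonneg) (simp only: nn lessThan_iff)
  finally have "A $$ (i, i) - c \<ge> 0" .
  moreover have "A $$ (i, i) - c \<noteq> 0"
  proof
    assume "A $$ (i, i) - c = 0"
    then have "(\<Sum>m<n. (L ! m - c) * q m i * q m i) = 0" using shift[OF ij(1,1)] by simp
    then have "\<forall>m\<in>{..<n}. (L ! m - c) * q m i * q m i = 0"
      using nn by (subst (asm) sum_nonneg_eq_0_iff) auto
    then have "A $$ (i, j) = 0" using shift[OF ij(1,2)] ij(3) by (simp add: sum.neutral)
    then show False using ij(4) by simp
  qed
  ultimately show ?thesis by simp
qed

text \<open>Each multiplication by \<open>A\<close> collapses, by orthonormality, to a
  multiplication of the coefficients by the eigenvalues.\<close>

lemma spectral_decomposition_powers: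
  assumes sd: "spectral_decomposition n A L q" and ij: "i < n" "j < n"
  shows "(\<Sum>l<n. A $$ (i, l) * A $$ (l, j)) = (\<Sum>k<n. (L ! k)\<^sup>2 * q k i * q k j)"
    and "(\<Sum>l<n. \<Sum>m<n. A $$ (i, m) * A $$ (m, l) * A $$ (l, j)) = (\<Sum>k<n. (L ! k) ^ 3 * q k i * q k j)"
proof -
  have mult: "(\<Sum>l<n. (\<Sum>k<n. f k * q k i * q k l) * A $$ (l, j)) = (\<Sum>k<n. f k * L ! k * q k i * q k j)"
    if ij: "i < n" "j < n" for f :: "nat \<Rightarrow> real" and i j
  proof -
    have "(\<Sum>l<n. (\<Sum>k<n. f k * q k i * q k l) * A $$ (l, j)) =
        (\<Sum>l<n. \<Sum>k<n. \<Sum>m<n. f k * q k i * q k l * (L ! m * q m l * q m j))"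
      using sd ij by (intro sum.cong refl) (simp add: spectral_decomposition_def sum_product)
    also have "\<dots> = (\<Sum>k<n. \<Sum>l<n. \<Sum>m<n. f k * q k i * q k l * (L ! m * q m l * q m j))"
      by (rule sum.swap)
    also have "\<dots> = (\<Sum>k<n. \<Sum>m<n. \<Sum>l<n. f k * q k i * q k l * (L ! m * q m l * q m j))"
      by (intro sum.cong refl sum.swap)
    also have "\<dots> = (\<Sum>k<n. \<Sum>m<n. f k * q k i * L ! m * q m j * (\<Sum>l<n. q k l * q m l))"
      by (simp add: sum_distrib_left mult_ac)
    also have "\<dots> = (\<Sum>k<n. \<Sum>m<n. if k = m then f k * q k i * L ! k * q k j else 0)"
      using sd by (intro sum.cong refl) (auto simp: spectral_decomposition_def)
    also have "\<dots> = (\<Sum>k<n. f k * L ! k * q k i * q k j)" by (simp add: mult_ac)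
    finally show ?thesis .
  qed
  have A: "A $$ (k, l) = (\<Sum>m<n. L ! m * q m k * q m l)" if "k < n" "l < n" for k l
    using sd that by (simp add: spectral_decomposition_def)
  have 2: "(\<Sum>l<n. A $$ (i, l) * A $$ (l, j)) = (\<Sum>k<n. (L ! k)\<^sup>2 * q k i * q k j)" if "i < n" "j < n" for i j
    using mult[OF that, of "\<lambda>k. L ! k"] A that by (simp add: power2_eq_square)
  show "(\<Sum>l<n. A $$ (i, l) * A $$ (l, j)) = (\<Sum>k<n. (L ! k)\<^sup>2 * q k i * q k j)" by (rule 2[OF ij])
  have "(\<Sum>l<n. \<Sum>m<n. A $$ (i, m) * A $$ (m, l) * A $$ (l, j)) =
      (\<Sum>l<n. (\<Sum>m<n. A $$ (i, m) * A $$ (m, l)) * A $$ (l, j))" by (simp add: sum_distrib_right)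
  also have "\<dots> = (\<Sum>l<n. (\<Sum>k<n. (L ! k)\<^sup>2 * q k i * q k l) * A $$ (l, j))"
    using 2[OF ij(1)] by simp
  also have "\<dots> = (\<Sum>k<n. (L ! k) ^ 3 * q k i * q k j)"
    unfolding mult[OF ij, of "\<lambda>k. (L ! k)\<^sup>2"] by (simp add: power3_eq_cube power2_eq_square mult_ac)
  finally show "(\<Sum>l<n. \<Sum>m<n. A $$ (i, m) * A $$ (m, l) * A $$ (l, j)) = (\<Sum>k<n. (L ! k) ^ 3 * q k i * q k j)" .
qed

text \<open>\<open>A\<close> is annihilated by the quadratic polynomial with roots \<open>a\<close>
  and \<open>b\<close>, so off the diagonal its square is a multiple of \<open>A\<close>.\<close>

lemma two_eigenvalues_square_entry:
  assumes sd: "spectral_decomposition n A L q" and L: "set L \<subseteq> {a, b}"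
    and ij: "i < n" "j < n" "i \<noteq> j" "A $$ (i, j) = 0"
  shows "(\<Sum>l<n. A $$ (i, l) * A $$ (l, j)) = 0"
proof -
  have len: "length L = n" using sd by (simp add: spectral_decomposition_def)
  have sq: "(L ! k)\<^sup>2 = (a + b) * L ! k - a * b" if "k < n" for k
  proof -
    have "L ! k \<in> set L" using that len by simp
    then have "L ! k = a \<or> L ! k = b" using L by blast
    then show ?thesis by (auto simp: power2_eq_square algebra_simps)
  qed
  have Aij: "A $$ (i, j) = (\<Sum>k<n. L ! k * q k i * q k j)"
    using sd ij by (simp add: spectral_decomposition_def)
  have "(\<Sum>k<n. (L ! k)\<^sup>2 * q k i * q k j) =
      (\<Sum>k<n. (a + b) * (L ! k * q k i * q k j) - a * b * (q k i * q k j))"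
    by (intro sum.cong refl) (simp add: sq left_diff_distrib mult.assoc)
  also have "\<dots> = (a + b) * A $$ (i, j) - a * b * (\<Sum>k<n. q k i * q k j)"
    unfolding Aij by (simp only: sum_subtractf sum_distrib_left)
  also have "\<dots> = 0" using sd ij by (simp add: spectral_decomposition_def)
  finally show ?thesis using spectral_decomposition_powers(1)[OF sd ij(1,2)] by simp
qed

text \<open>\<open>A\<close> is annihilated by a cubic polynomial, so off the diagonal its cube is a
  combination of its square and \<open>A\<close>.\<close>

lemma three_eigenvalues_cube_entry:
  assumes sd: "spectral_decomposition n A L q" and L: "set L \<subseteq> {a, b, c}"
    and ij: "i < n" "j < n" "i \<noteq> j" "A $$ (i, j) = 0" "(\<Sum>l<n. A $$ (i, l) * A $$ (l, j)) = 0"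
  shows "(\<Sum>l<n. \<Sum>m<n. A $$ (i, m) * A $$ (m, l) * A $$ (l, j)) = 0"
proof -
  have len: "length L = n" using sd by (simp add: spectral_decomposition_def)
  have cu: "(L ! k) ^ 3 = (a + b + c) * (L ! k)\<^sup>2 - (a * b + a * c + b * c) * L ! k + a * b * c" if "k < n" for k
  proof -
    have "L ! k \<in> set L" using that len by simp
    then have "L ! k = a \<or> L ! k = b \<or> L ! k = c" using L by blast
    then show ?thesis by (auto simp: power2_eq_square power3_eq_cube algebra_simps)
  qed
  have Aij: "A $$ (i, j) = (\<Sum>k<n. L ! k * q k i * q k j)"
    using sd ij by (simp add: spectral_decomposition_def)
  have "(\<Sum>k<n. (L ! k) ^ 3 * q k i * q k j) =
      (\<Sum>k<n. (a + b + c) * ((L ! k)\<^sup>2 * q k i * q k j) - (a * b + a * c + b * c) * (L ! k * q k i * q k j)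
        + a * b * c * (q k i * q k j))"
    by (intro sum.cong refl) (simp add: cu left_diff_distrib distrib_right mult.assoc)
  also have "\<dots> = (a + b + c) * (\<Sum>l<n. A $$ (i, l) * A $$ (l, j)) - (a * b + a * c + b * c) * A $$ (i, j)
      + a * b * c * (\<Sum>k<n. q k i * q k j)"
    unfolding Aij spectral_decomposition_powers(1)[OF sd ij(1,2)]
    by (simp only: sum.distrib sum_subtractf sum_distrib_left)
  also have "\<dots> = 0" using sd ij by (simp add: spectral_decomposition_def)
  finally show ?thesis using spectral_decomposition_powers(2)[OF sd ij(1,2)] by simp
qed

subsection \<open>Graphs given by edge lists\<close>

definition graph_of :: "(nat \<times> nat) list \<Rightarrow> graph" where
  "graph_of E = Graph 5 ((\<lambda>(u, v). {u, v}) ` set E)"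

definition adjacent :: "(nat \<times> nat) list \<Rightarrow> nat \<Rightarrow> nat \<Rightarrow> bool" where
  "adjacent E u v \<longleftrightarrow> (u, v) \<in> set E \<or> (v, u) \<in> set E"

lemma order_graph_of [simp]: "order_of (graph_of E) = 5"
  by (simp add: graph_of_def)

lemma edge_graph_of: "{u, v} \<in> edges (graph_of E) \<longleftrightarrow> adjacent E u v"
  by (force simp: graph_of_def adjacent_def doubleton_eq_iff)

lemma S_graph_of_D:
  assumes "A \<in> S_graph (graph_of E)"
  shows "symmetric_mat 5 A" "A \<in> carrier_mat 5 5"
    "i < 5 \<Longrightarrow> j < 5 \<Longrightarrow> i \<noteq> j \<Longrightarrow> A $$ (i, j) \<noteq> 0 \<longleftrightarrow> adjacent E i j"
    "i < 5 \<Longrightarrow> j < 5 \<Longrightarrow> A $$ (i, j) = A $$ (j, i)"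
proof -
  show s: "symmetric_mat 5 A" and c: "A \<in> carrier_mat 5 5"
    using assms by (auto simp: S_graph_def symmetric_mat_def)
  show "i < 5 \<Longrightarrow> j < 5 \<Longrightarrow> i \<noteq> j \<Longrightarrow> A $$ (i, j) \<noteq> 0 \<longleftrightarrow> adjacent E i j"
    using assms by (simp add: S_graph_def edge_graph_of)
  assume ij: "i < 5" "j < 5"
  have "transpose_mat A $$ (i, j) = A $$ (j, i)" using c ij by simp
  then show "A $$ (i, j) = A $$ (j, i)" using s by (simp add: symmetric_mat_def)
qed

text \<open>Colour-change rule of zero forcing: a vertex \<open>u\<close> of \<open>S\<close> forces
  its only neighbour outside \<open>S\<close>. The list of moves is an untrusted certificate, since
  an illegal move is skipped.\<close>

fun forced :: "(nat \<times> nat) list \<Rightarrow> nat list \<Rightarrow> (nat \<times> nat) list \<Rightarrow> nat list" where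
  "forced E S [] = S"
| "forced E S ((u, v) # st) =
     (if u \<in> set S \<and> adjacent E u v \<and> u < 5 \<and> v < 5 \<and> u \<noteq> v \<and>
        list_all (\<lambda>w. w = u \<or> w = v \<or> w \<in> set S \<or> \<not> adjacent E u w) [0, 1, 2, 3, 4]
      then forced E (v # S) st else forced E S st)"

lemma sum_5: "(\<Sum>k<5. f k) = f 0 + f 1 + f 2 + f 3 + (f (4::nat) :: real)"
  by (simp add: eval_nat_numeral)

lemma less_5: "(i :: nat) < 5 \<longleftrightarrow> i = 0 \<or> i = 1 \<or> i = 2 \<or> i = 3 \<or> i = 4"
  by auto

text \<open>If \<open>x\<close> vanishes at \<open>u\<close> and at all neighbours of
  \<open>u\<close> except \<open>v\<close>, then row \<open>u\<close> of the eigenvector equation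
  reduces to a nonzero multiple of \<open>x v\<close>.\<close>

lemma forced_zero:
  assumes A: "A \<in> S_graph (graph_of E)"
    and ev: "\<And>i. i < 5 \<Longrightarrow> (\<Sum>j<5. A $$ (i, j) * x j) = c * x i"
  shows "(\<And>i. i \<in> set S \<Longrightarrow> x i = 0) \<Longrightarrow> i \<in> set (forced E S st) \<Longrightarrow> x i = 0"
proof (induction st arbitrary: S)
  case (Cons e st)
  obtain u v where e: "e = (u, v)" by (cases e)
  let ?C = "u \<in> set S \<and> adjacent E u v \<and> u < 5 \<and> v < 5 \<and> u \<noteq> v \<and>
        list_all (\<lambda>w. w = u \<or> w = v \<or> w \<in> set S \<or> \<not> adjacent E u w) [0, 1, 2, 3, 4]"
  show ?case
  proof (cases ?C)
    case True
    have "A $$ (u, j) * x j = 0" if "j < 5" "j \<noteq> v" for j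
    proof (cases "j = u \<or> j \<in> set S")
      case in_S: True
      then have "x j = 0" using Cons.prems(1) True by blast
      then show ?thesis by simp
    next
      case False
      moreover have "j \<in> set [0, 1, 2, 3, 4]" using that(1) by (auto simp: less_5)
      ultimately have "\<not> adjacent E u j" using True that(2) unfolding list_all_iff by blast
      then show ?thesis using S_graph_of_D(3)[OF A, of u j] that(1) True False by auto
    qed
    then have "(\<Sum>j\<in>{..<5} - {v}. A $$ (u, j) * x j) = 0" by (intro sum.neutral) auto
    then have "(\<Sum>j<5. A $$ (u, j) * x j) = A $$ (u, v) * x v"
      using True by (subst sum.remove[of _ v]) auto
    moreover have "(\<Sum>j<5. A $$ (u, j) * x j) = 0" using ev[of u] True Cons.prems(1)[of u] by simp
    moreover have "A $$ (u, v) \<noteq> 0" using S_graph_of_D(3)[OF A, of u v] True by simp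
    ultimately have "x v = 0" by simp
    then have "x i = 0" if "i \<in> set (v # S)" for i using that Cons.prems(1) by auto
    moreover have "i \<in> set (forced E (v # S) st)" using Cons.prems(2) True by (simp add: e)
    ultimately show ?thesis using Cons.IH by blast
  next
    case False
    then have "i \<in> set (forced E S st)" using Cons.prems(2) unfolding e forced.simps by (simp only: if_False)
    then show ?thesis using Cons.IH[of S] Cons.prems(1) by blast
  qed
qed simp

lemma attains_spectral:
  assumes "order_of G = 5" "attains G m"
  obtains A ls q where "A \<in> S_graph G" "sorted_wrt (<) ls" "length ls = length m" "\<forall>k\<in>set m. 0 < k"
    "sum_list m = 5" "char_poly A = roots_poly (expand ls m)" "spectral_decomposition 5 A (expand ls m) q"
proof -
  obtain ls where ls: "sorted_wrt (<) ls" "length ls = length m" "\<forall>k\<in>set m. 0 < k" "sum_list m = 5"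
    "realizes G (expand ls m)" using assms(2) unfolding attains_iff(1)[OF assms(1)] by blast
  obtain A where A: "A \<in> S_graph G" "char_poly A = roots_poly (expand ls m)"
    using ls(5) unfolding realizes_def by blast
  have "symmetric_mat 5 A" using A(1) assms(1) by (simp add: S_graph_def)
  then obtain q where "spectral_decomposition 5 A (expand ls m) q" using spectral_decomposition_5[OF _ A(2)] by blast
  then show ?thesis using that A ls by blast
qed

lemma count_expand_nth:
  assumes "sorted_wrt (<) ls" "length ls = length m" "i < length m"
  shows "count_list (expand ls m) (ls ! i) = m ! i"
  using count_expand[OF assms(2) strict_imp_distinct[OF assms(1)]] assms(2,3) by (metis nth_map)

lemma zero_forcing_bound:
  assumes at: "attains (graph_of E) m" and zf: "{0, 1, 2, 3, 4} \<subseteq> set (forced E S st)" and k: "k \<in> set m"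
  shows "k \<le> length S"
proof (rule ccontr)
  assume neg: "\<not> k \<le> length S"
  obtain A ls q where A: "A \<in> S_graph (graph_of E)" and ls: "sorted_wrt (<) ls" "length ls = length m"
    and sd: "spectral_decomposition 5 A (expand ls m) q"
    by (rule attains_spectral[OF order_graph_of at]) (rule that)
  obtain i where i: "i < length m" "m ! i = k" using k by (metis in_set_conv_nth)
  have "card (set S) < count_list (expand ls m) (ls ! i)"
    using count_expand_nth[OF ls i(1)] i(2) neg card_length[of S] by linarith
  then obtain x where x: "\<exists>i<5. x i \<noteq> 0" "\<And>j. j \<in> set S \<Longrightarrow> x j = 0"
    "\<And>j. j < 5 \<Longrightarrow> (\<Sum>l<5. A $$ (j, l) * x l) = ls ! i * x j"
    by (rule eigenvector_vanishing_on[OF sd finite_set]) (rule that)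
  have "x j = 0" if "j < 5" for j
    using forced_zero[OF A x(3) x(2), where i = j and st = st] zf that by (auto simp: less_5)
  then show False using x(1) by blast
qed

text \<open>Eigenvalues are listed increasingly, so the head of \<open>m\<close> is the multiplicity
  of the least eigenvalue, to which \<open>diag_greater_min_eigenvalue\<close> applies.\<close>

lemma attains_hd:
  assumes at: "attains (graph_of E) m" and m: "m = k # m'"
  obtains A L q c where "A \<in> S_graph (graph_of E)" "spectral_decomposition 5 A L q"
    "count_list L c = k" "\<And>a. a \<in> set L \<Longrightarrow> c \<le> a"
    "\<And>i j. i < 5 \<Longrightarrow> j < 5 \<Longrightarrow> i \<noteq> j \<Longrightarrow> adjacent E i j \<Longrightarrow> c < A $$ (i, i)"
proof -
  obtain A ls q where A: "A \<in> S_graph (graph_of E)" and ls: "sorted_wrt (<) ls" "length ls = length m"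
    "\<forall>k\<in>set m. 0 < k"
    and sd: "spectral_decomposition 5 A (expand ls m) q"
    by (rule attains_spectral[OF order_graph_of at]) (rule that)
  obtain c ls' where c: "ls = c # ls'" using ls(2) m by (cases ls) auto
  have cnt: "count_list (expand ls m) c = k" using count_expand_nth[OF ls(1,2), of 0] by (simp add: c m)
  have min: "c \<le> a" if "a \<in> set (expand ls m)" for a
    using that set_expand[OF ls(2,3)] ls(1) by (auto simp: c)
  show ?thesis
  proof (rule that[OF A sd cnt min])
    fix i j assume ij: "i < (5::nat)" "j < 5" "i \<noteq> j" "adjacent E i j"
    then have "A $$ (i, j) \<noteq> 0" using S_graph_of_D(3)[OF A] by simp
    then show "c < A $$ (i, i)" using diag_greater_min_eigenvalue[OF sd min ij(1-3)] by blast
  qed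
qed

text \<open>\<open>A - c\<close> is positive semidefinite for the least eigenvalue \<open>c\<close>, with positive diagonal at
  non-isolated vertices, so a kernel vector vanishing on \<open>S\<close> also vanishes on \<open>R\<close>, where \<open>A - c\<close> is diagonal.\<close>

lemma first_multiplicity_bound:
  assumes at: "attains (graph_of E) (k # m)"
    and R: "\<And>i j. i \<in> set R \<Longrightarrow> j < 5 \<Longrightarrow> adjacent E i j \<Longrightarrow> j \<in> set S"
    and nb: "\<And>i. i \<in> set R \<Longrightarrow> i < 5 \<and> (\<exists>j<5. i \<noteq> j \<and> adjacent E i j)"
    and zf: "{0, 1, 2, 3, 4} \<subseteq> set (forced E (R @ S) st)"
  shows "k \<le> length S"
proof (rule ccontr)
  assume neg: "\<not> k \<le> length S"
  obtain A L q c where A: "A \<in> S_graph (graph_of E)" and sd: "spectral_decomposition 5 A L q"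
    and c: "count_list L c = k" and pd: "\<And>i j. i < 5 \<Longrightarrow> j < 5 \<Longrightarrow> i \<noteq> j \<Longrightarrow> adjacent E i j \<Longrightarrow> c < A $$ (i, i)"
    by (rule attains_hd[OF at refl]) (rule that)
  have "card (set S) < count_list L c" using c neg card_length[of S] by linarith
  then obtain x where x: "\<exists>i<5. x i \<noteq> 0" "\<And>j. j \<in> set S \<Longrightarrow> x j = 0"
    "\<And>j. j < 5 \<Longrightarrow> (\<Sum>l<5. A $$ (j, l) * x l) = c * x j"
    by (rule eigenvector_vanishing_on[OF sd finite_set]) (rule that)
  have "x i = 0" if i: "i \<in> set R" for i
  proof -
    obtain j where j: "i < 5" "j < 5" "i \<noteq> j" "adjacent E i j" using nb[OF i] by blast
    have "A $$ (i, l) * x l = 0" if "l < 5" "l \<noteq> i" for l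
      using R[OF i that(1)] x(2)[of l] S_graph_of_D(3)[OF A j(1) that(1)] that(2) by auto
    then have "(\<Sum>l\<in>{..<5} - {i}. A $$ (i, l) * x l) = 0" by (intro sum.neutral) auto
    then have "(\<Sum>l<5. A $$ (i, l) * x l) = A $$ (i, i) * x i"
      using j(1) by (subst sum.remove[of _ i]) auto
    then show ?thesis using x(3)[OF j(1)] pd[OF j] by simp
  qed
  then have z: "x i = 0" if "i \<in> set (R @ S)" for i using that x(2) by auto
  have "x j = 0" if "j < 5" for j
    using forced_zero[OF A x(3) z, where S = "R @ S" and i = j and st = st] zf that by (auto simp: less_5)
  then show False using x(1) by blast
qed


lemma compositions_of_5:
  assumes "sum_list m = (5 :: nat)" "\<forall>k\<in>set m. 0 < k"
  shows "m \<in> set [[5], [4,1], [1,4], [3,2], [2,3], [3,1,1], [1,3,1], [1,1,3], [2,2,1], [2,1,2], [1,2,2],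
    [2,1,1,1], [1,2,1,1], [1,1,2,1], [1,1,1,2], [1,1,1,1,1]]"
proof -
  have c0: "m = []" if "sum_list m = (0 :: nat)" "\<forall>k\<in>set m. 0 < k" for m
    using that by (cases m) auto
  have cons: "\<exists>k m'. m = k # m' \<and> 0 < k \<and> k + sum_list m' = n \<and> (\<forall>k\<in>set m'. 0 < k)"
    if "sum_list m = n" "\<forall>k\<in>set m. 0 < k" "0 < n" for m and n :: nat
    using that by (cases m) auto
  have c1: "m = [1]" if s: "sum_list m = (1 :: nat)" "\<forall>k\<in>set m. 0 < k" for m
  proof -
    obtain k m' where k: "m = k # m'" "0 < k" "k + sum_list m' = 1" "\<forall>k\<in>set m'. 0 < k"
      using cons[OF s] by auto
    then have "k = 1 \<and> sum_list m' = 0" by arith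
    then show ?thesis using k(1,4) c0[of m'] by auto
  qed
  have c2: "m \<in> {[2], [1,1]}" if s: "sum_list m = (2 :: nat)" "\<forall>k\<in>set m. 0 < k" for m
  proof -
    obtain k m' where k: "m = k # m'" "0 < k" "k + sum_list m' = 2" "\<forall>k\<in>set m'. 0 < k"
      using cons[OF s] by auto
    then consider "k = 1" "sum_list m' = 1" | "k = 2" "sum_list m' = 0" by arith
    then show ?thesis
    proof cases
      case 1
      show ?thesis using c1[OF 1(2) k(4)] k(1) 1(1) by auto
    next
      case 2
      show ?thesis using c0[OF 2(2) k(4)] k(1) 2(1) by auto
    qed
  qed
  have c3: "m \<in> {[3], [1,2], [2,1], [1,1,1]}" if s: "sum_list m = (3 :: nat)" "\<forall>k\<in>set m. 0 < k" for m
  proof -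
    obtain k m' where k: "m = k # m'" "0 < k" "k + sum_list m' = 3" "\<forall>k\<in>set m'. 0 < k"
      using cons[OF s] by auto
    then consider "k = 1" "sum_list m' = 2" | "k = 2" "sum_list m' = 1" | "k = 3" "sum_list m' = 0" by arith
    then show ?thesis
    proof cases
      case 1
      show ?thesis using c2[OF 1(2) k(4)] k(1) 1(1) by auto
    next
      case 2
      show ?thesis using c1[OF 2(2) k(4)] k(1) 2(1) by auto
    next
      case 3
      show ?thesis using c0[OF 3(2) k(4)] k(1) 3(1) by auto
    qed
  qed
  have c4: "m \<in> {[4], [3,1], [1,3], [2,2], [2,1,1], [1,2,1], [1,1,2], [1,1,1,1]}" if s: "sum_list m = (4 :: nat)" "\<forall>k\<in>set m. 0 < k" for m
  proof -
    obtain k m' where k: "m = k # m'" "0 < k" "k + sum_list m' = 4" "\<forall>k\<in>set m'. 0 < k"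
      using cons[OF s] by auto
    then consider "k = 1" "sum_list m' = 3" | "k = 2" "sum_list m' = 2" | "k = 3" "sum_list m' = 1" | "k = 4" "sum_list m' = 0" by arith
    then show ?thesis
    proof cases
      case 1
      show ?thesis using c3[OF 1(2) k(4)] k(1) 1(1) by auto
    next
      case 2
      show ?thesis using c2[OF 2(2) k(4)] k(1) 2(1) by auto
    next
      case 3
      show ?thesis using c1[OF 3(2) k(4)] k(1) 3(1) by auto
    next
      case 4
      show ?thesis using c0[OF 4(2) k(4)] k(1) 4(1) by auto
    qed
  qed
  obtain k m' where k: "m = k # m'" "0 < k" "k + sum_list m' = 5" "\<forall>k\<in>set m'. 0 < k"
    using cons[OF assms] by auto
  then consider "k = 1" "sum_list m' = 4" | "k = 2" "sum_list m' = 3" | "k = 3" "sum_list m' = 2" | "k = 4" "sum_list m' = 1" | "k = 5" "sum_list m' = 0" by arith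
  then show ?thesis
  proof cases
    case 1
    show ?thesis using c4[OF 1(2) k(4)] k(1) 1(1) by auto
  next
    case 2
    show ?thesis using c3[OF 2(2) k(4)] k(1) 2(1) by auto
  next
    case 3
    show ?thesis using c2[OF 3(2) k(4)] k(1) 3(1) by auto
  next
    case 4
    show ?thesis using c1[OF 4(2) k(4)] k(1) 4(1) by auto
  next
    case 5
    show ?thesis using c0[OF 5(2) k(4)] k(1) 5(1) by auto
  qed
qed

lemma attains_composition:
  assumes "attains (graph_of E) m"
  shows "m \<in> set [[5], [4,1], [1,4], [3,2], [2,3], [3,1,1], [1,3,1], [1,1,3], [2,2,1], [2,1,2], [1,2,2],
    [2,1,1,1], [1,2,1,1], [1,1,2,1], [1,1,1,2], [1,1,1,1,1]]"
  by (rule attains_spectral[OF order_graph_of assms]) (rule compositions_of_5)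

lemma S_graph_of_zero:
  assumes "A \<in> S_graph (graph_of E)" "i < 5" "j < 5" "i \<noteq> j" "\<not> adjacent E i j"
  shows "A $$ (i, j) = 0"
  using S_graph_of_D(3)[OF assms(1-4)] assms(5) by simp

lemma S_graph_of_nonzero:
  assumes "A \<in> S_graph (graph_of E)" "i < 5" "j < 5" "i \<noteq> j" "adjacent E i j"
  shows "A $$ (i, j) \<noteq> 0"
  using S_graph_of_D(3)[OF assms(1-4)] assms(5) by simp

text \<open>With at most two eigenvalues the \<open>(i, j)\<close> entry of the square vanishes, yet
  the unique path through \<open>k\<close> leaves a single nonzero product there.\<close>

lemma length_ge_3_of_unique_2_path:
  assumes at: "attains (graph_of E) m" and ij: "i < 5" "j < 5" "i \<noteq> j" "\<not> adjacent E i j"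
    and k: "k < 5" "i \<noteq> k" "k \<noteq> j" "adjacent E i k" "adjacent E k j"
    and uniq: "\<And>l. l < 5 \<Longrightarrow> adjacent E i l \<Longrightarrow> adjacent E l j \<Longrightarrow> l = k"
  shows "3 \<le> length m"
proof (rule ccontr)
  assume len: "\<not> 3 \<le> length m"
  obtain A ls q where A: "A \<in> S_graph (graph_of E)" and ls: "length ls = length m" "\<forall>k\<in>set m. 0 < k"
    and sd: "spectral_decomposition 5 A (expand ls m) q"
    by (rule attains_spectral[OF order_graph_of at]) (rule that)
  have "\<exists>a b. set ls \<subseteq> {a, b}"
  proof -
    have "ls = [] \<or> (\<exists>a. ls = [a]) \<or> (\<exists>a b. ls = [a, b])"
      using len ls(1) by (cases ls; cases "tl ls"; cases "tl (tl ls)") auto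
    then show ?thesis by (intro exI[of _ "hd ls"] exI[of _ "hd (tl ls)"]) auto
  qed
  then obtain a b where ab: "set (expand ls m) \<subseteq> {a, b}" using set_expand[OF ls] by auto
  have nz: "A $$ (i, k) \<noteq> 0" "A $$ (k, j) \<noteq> 0"
    using S_graph_of_nonzero[OF A ij(1) k(1,2,4)] S_graph_of_nonzero[OF A k(1) ij(2) k(3,5)] by auto
  have "A $$ (i, l) * A $$ (l, j) = 0" if l: "l < 5" "l \<noteq> k" for l
  proof (cases "l = i \<or> l = j")
    case True
    then show ?thesis using S_graph_of_zero[OF A ij] by auto
  next
    case False
    then have "\<not> adjacent E i l \<or> \<not> adjacent E l j" using uniq l by blast
    then show ?thesis using S_graph_of_zero[OF A ij(1) l(1)] S_graph_of_zero[OF A l(1) ij(2)] False by auto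
  qed
  then have "(\<Sum>l\<in>{..<5} - {k}. A $$ (i, l) * A $$ (l, j)) = 0" by (intro sum.neutral) auto
  then have "(\<Sum>l<5. A $$ (i, l) * A $$ (l, j)) = A $$ (i, k) * A $$ (k, j)"
    using k(1) by (subst sum.remove[of _ k]) auto
  moreover have "(\<Sum>l<5. A $$ (i, l) * A $$ (l, j)) = 0"
    by (rule two_eigenvalues_square_entry[OF sd ab ij(1-3) S_graph_of_zero[OF A ij]])
  ultimately show False using nz by simp
qed

section \<open>The connected graphs as edge lists, with their individual obstructions\<close>

definition E_P5 :: "(nat \<times> nat) list" where
  "E_P5 = [(0, 1), (1, 2), (2, 3), (3, 4)]"

definition E_S211 :: "(nat \<times> nat) list" where
  "E_S211 = [(0, 1), (0, 3), (0, 4), (1, 2)]"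

definition E_K14 :: "(nat \<times> nat) list" where
  "E_K14 = [(0, 1), (0, 2), (0, 3), (0, 4)]"

definition E_L32 :: "(nat \<times> nat) list" where
  "E_L32 = [(0, 1), (0, 2), (0, 3), (1, 2), (3, 4)]"

definition E_Bull :: "(nat \<times> nat) list" where
  "E_Bull = [(0, 1), (0, 2), (0, 3), (1, 2), (1, 4)]"

definition E_C5 :: "(nat \<times> nat) list" where
  "E_C5 = [(0, 1), (0, 4), (1, 2), (2, 3), (3, 4)]"

definition E_Campstool :: "(nat \<times> nat) list" where
  "E_Campstool = [(0, 1), (0, 2), (0, 3), (0, 4), (1, 2)]"

definition E_Banner :: "(nat \<times> nat) list" where
  "E_Banner = [(0, 1), (0, 3), (0, 4), (1, 2), (2, 3)]"

definition E_House :: "(nat \<times> nat) list" where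
  "E_House = [(0, 2), (0, 3), (0, 4), (1, 3), (1, 4), (2, 4)]"

definition E_Dart :: "(nat \<times> nat) list" where
  "E_Dart = [(0, 2), (0, 3), (1, 2), (1, 3), (2, 3), (2, 4)]"

definition E_Kite :: "(nat \<times> nat) list" where
  "E_Kite = [(0, 2), (0, 3), (0, 4), (1, 2), (1, 3), (2, 3)]"

definition E_Gem :: "(nat \<times> nat) list" where
  "E_Gem = [(0, 1), (0, 4), (1, 2), (1, 4), (2, 3), (2, 4), (3, 4)]"

definition E_Butterfly :: "(nat \<times> nat) list" where
  "E_Butterfly = [(0, 1), (0, 2), (0, 3), (0, 4), (1, 2), (3, 4)]"

definition E_K23 :: "(nat \<times> nat) list" where
  "E_K23 = [(0, 2), (0, 3), (0, 4), (1, 2), (1, 3), (1, 4)]"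

definition E_T5 :: "(nat \<times> nat) list" where
  "E_T5 = [(0, 1), (0, 2), (0, 3), (0, 4), (1, 2), (1, 3), (1, 4)]"

definition E_L41 :: "(nat \<times> nat) list" where
  "E_L41 = [(0, 1), (0, 2), (0, 3), (0, 4), (1, 2), (1, 3), (2, 3)]"

definition E_K4e :: "(nat \<times> nat) list" where
  "E_K4e = [(0, 2), (0, 3), (0, 4), (1, 2), (1, 3), (1, 4), (2, 3)]"

definition E_W5 :: "(nat \<times> nat) list" where
  "E_W5 = [(0, 1), (0, 3), (0, 4), (1, 2), (1, 4), (2, 3), (2, 4), (3, 4)]"

definition E_FullHouse :: "(nat \<times> nat) list" where
  "E_FullHouse = [(0, 1), (0, 2), (0, 3), (0, 4), (1, 2), (1, 3), (1, 4), (2, 3)]"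

definition E_K5e :: "(nat \<times> nat) list" where
  "E_K5e = [(0, 2), (0, 3), (0, 4), (1, 2), (1, 3), (1, 4), (2, 3), (2, 4), (3, 4)]"

definition E_K5 :: "(nat \<times> nat) list" where
  "E_K5 = [(0, 1), (0, 2), (0, 3), (0, 4), (1, 2), (1, 3), (1, 4), (2, 3), (2, 4), (3, 4)]"

text \<open>In this and the following bounds the first list is a zero forcing set and the second the
  sequence of forces that certifies it.\<close>

lemma multiplicity_P5: "attains (graph_of E_P5) m \<Longrightarrow> k \<in> set m \<Longrightarrow> k \<le> 1"
  using zero_forcing_bound[of E_P5 m "[0]" "[(0, 1), (1, 2), (2, 3), (3, 4)]" k]
  by (simp add: E_P5_def adjacent_def)

lemma multiplicity_S211: "attains (graph_of E_S211) m \<Longrightarrow> k \<in> set m \<Longrightarrow> k \<le> 2"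
  using zero_forcing_bound[of E_S211 m "[1, 3]" "[(3, 0), (0, 4), (1, 2)]" k]
  by (simp add: E_S211_def adjacent_def)

lemma multiplicity_K14: "attains (graph_of E_K14) m \<Longrightarrow> k \<in> set m \<Longrightarrow> k \<le> 3"
  using zero_forcing_bound[of E_K14 m "[1, 2, 3]" "[(1, 0), (0, 4)]" k]
  by (simp add: E_K14_def adjacent_def)

lemma multiplicity_L32: "attains (graph_of E_L32) m \<Longrightarrow> k \<in> set m \<Longrightarrow> k \<le> 2"
  using zero_forcing_bound[of E_L32 m "[0, 1]" "[(1, 2), (0, 3), (3, 4)]" k]
  by (simp add: E_L32_def adjacent_def)

lemma multiplicity_Bull: "attains (graph_of E_Bull) m \<Longrightarrow> k \<in> set m \<Longrightarrow> k \<le> 2"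
  using zero_forcing_bound[of E_Bull m "[0, 2]" "[(2, 1), (0, 3), (1, 4)]" k]
  by (simp add: E_Bull_def adjacent_def)

lemma multiplicity_C5: "attains (graph_of E_C5) m \<Longrightarrow> k \<in> set m \<Longrightarrow> k \<le> 2"
  using zero_forcing_bound[of E_C5 m "[0, 1]" "[(0, 4), (1, 2), (2, 3)]" k]
  by (simp add: E_C5_def adjacent_def)

lemma multiplicity_Campstool: "attains (graph_of E_Campstool) m \<Longrightarrow> k \<in> set m \<Longrightarrow> k \<le> 2"
  using zero_forcing_bound[of E_Campstool m "[1, 3]" "[(3, 0), (1, 2), (0, 4)]" k]
  by (simp add: E_Campstool_def adjacent_def)

lemma multiplicity_Banner: "attains (graph_of E_Banner) m \<Longrightarrow> k \<in> set m \<Longrightarrow> k \<le> 2"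
  using zero_forcing_bound[of E_Banner m "[0, 1]" "[(1, 2), (2, 3), (0, 4)]" k]
  by (simp add: E_Banner_def adjacent_def)

lemma multiplicity_House: "attains (graph_of E_House) m \<Longrightarrow> k \<in> set m \<Longrightarrow> k \<le> 2"
  using zero_forcing_bound[of E_House m "[0, 2]" "[(2, 4), (0, 3), (4, 1)]" k]
  by (simp add: E_House_def adjacent_def)

lemma multiplicity_Dart: "attains (graph_of E_Dart) m \<Longrightarrow> k \<in> set m \<Longrightarrow> k \<le> 2"
  using zero_forcing_bound[of E_Dart m "[0, 2]" "[(0, 3), (3, 1), (2, 4)]" k]
  by (simp add: E_Dart_def adjacent_def)

lemma multiplicity_Kite: "attains (graph_of E_Kite) m \<Longrightarrow> k \<in> set m \<Longrightarrow> k \<le> 2"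
  using zero_forcing_bound[of E_Kite m "[1, 2]" "[(1, 3), (2, 0), (0, 4)]" k]
  by (simp add: E_Kite_def adjacent_def)

lemma multiplicity_Gem: "attains (graph_of E_Gem) m \<Longrightarrow> k \<in> set m \<Longrightarrow> k \<le> 2"
  using zero_forcing_bound[of E_Gem m "[0, 1]" "[(0, 4), (1, 2), (2, 3)]" k]
  by (simp add: E_Gem_def adjacent_def)

lemma multiplicity_Butterfly: "attains (graph_of E_Butterfly) m \<Longrightarrow> k \<in> set m \<Longrightarrow> k \<le> 3"
  using zero_forcing_bound[of E_Butterfly m "[0, 1, 3]" "[(1, 2), (3, 4)]" k]
  by (simp add: E_Butterfly_def adjacent_def)

lemma multiplicity_K23: "attains (graph_of E_K23) m \<Longrightarrow> k \<in> set m \<Longrightarrow> k \<le> 3"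
  using zero_forcing_bound[of E_K23 m "[0, 2, 3]" "[(0, 4), (2, 1)]" k]
  by (simp add: E_K23_def adjacent_def)

lemma multiplicity_T5: "attains (graph_of E_T5) m \<Longrightarrow> k \<in> set m \<Longrightarrow> k \<le> 3"
  using zero_forcing_bound[of E_T5 m "[0, 2, 3]" "[(2, 1), (0, 4)]" k]
  by (simp add: E_T5_def adjacent_def)

lemma multiplicity_L41: "attains (graph_of E_L41) m \<Longrightarrow> k \<in> set m \<Longrightarrow> k \<le> 3"
  using zero_forcing_bound[of E_L41 m "[0, 1, 2]" "[(1, 3), (0, 4)]" k]
  by (simp add: E_L41_def adjacent_def)

lemma multiplicity_K4e: "attains (graph_of E_K4e) m \<Longrightarrow> k \<in> set m \<Longrightarrow> k \<le> 3"
  using zero_forcing_bound[of E_K4e m "[0, 1, 2]" "[(2, 3), (0, 4)]" k]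
  by (simp add: E_K4e_def adjacent_def)

lemma multiplicity_W5: "attains (graph_of E_W5) m \<Longrightarrow> k \<in> set m \<Longrightarrow> k \<le> 3"
  using zero_forcing_bound[of E_W5 m "[0, 1, 2]" "[(1, 4), (2, 3)]" k]
  by (simp add: E_W5_def adjacent_def)

lemma multiplicity_FullHouse: "attains (graph_of E_FullHouse) m \<Longrightarrow> k \<in> set m \<Longrightarrow> k \<le> 3"
  using zero_forcing_bound[of E_FullHouse m "[0, 1, 2]" "[(2, 3), (0, 4)]" k]
  by (simp add: E_FullHouse_def adjacent_def)

lemma multiplicity_K5e: "attains (graph_of E_K5e) m \<Longrightarrow> k \<in> set m \<Longrightarrow> k \<le> 3"
  using zero_forcing_bound[of E_K5e m "[0, 2, 3]" "[(0, 4), (2, 1)]" k]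
  by (simp add: E_K5e_def adjacent_def)

lemma multiplicity_K5: "attains (graph_of E_K5) m \<Longrightarrow> k \<in> set m \<Longrightarrow> k \<le> 4"
  using zero_forcing_bound[of E_K5 m "[0, 1, 2, 3]" "[(0, 4)]" k]
  by (simp add: E_K5_def adjacent_def)

text \<open>Here and below the first list consists of pairwise nonadjacent vertices whose neighbours
  all lie in the second. Semidefiniteness spreads zeros from the second to the first, which improves
  the zero forcing bound for extreme eigenvalues.\<close>

lemma first_multiplicity_K14: "attains (graph_of E_K14) (k # m) \<Longrightarrow> k \<le> 1"
  using first_multiplicity_bound[of E_K14 k m "[1, 2, 3, 4]" "[0]" "[]"]
  by (fastforce simp: E_K14_def adjacent_def less_5)

lemma first_multiplicity_S211: "attains (graph_of E_S211) (k # m) \<Longrightarrow> k \<le> 1"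
  using first_multiplicity_bound[of E_S211 k m "[3, 4]" "[0]" "[(0, 1), (1, 2)]"]
  by (fastforce simp: E_S211_def adjacent_def less_5)

lemma first_multiplicity_K23: "attains (graph_of E_K23) (k # m) \<Longrightarrow> k \<le> 2"
  using first_multiplicity_bound[of E_K23 k m "[2, 3, 4]" "[0, 1]" "[]"]
  by (fastforce simp: E_K23_def adjacent_def less_5)

lemma first_multiplicity_T5: "attains (graph_of E_T5) (k # m) \<Longrightarrow> k \<le> 2"
  using first_multiplicity_bound[of E_T5 k m "[2, 3, 4]" "[0, 1]" "[]"]
  by (fastforce simp: E_T5_def adjacent_def less_5)

lemma length_Butterfly: "attains (graph_of E_Butterfly) m \<Longrightarrow> 3 \<le> length m"
  by (erule length_ge_3_of_unique_2_path[where i = 1 and j = 3 and k = 0])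
    (auto simp: E_Butterfly_def adjacent_def)

lemma length_L41: "attains (graph_of E_L41) m \<Longrightarrow> 3 \<le> length m"
  by (erule length_ge_3_of_unique_2_path[where i = 4 and j = 1 and k = 0])
    (auto simp: E_L41_def adjacent_def)


text \<open>At most three eigenvalues would make the cube a combination of the square,
  \<open>A\<close> and the identity, all of which vanish at \<open>(i, j)\<close>.\<close>

lemma length_ge_4_of_cube_entry:
  assumes at: "attains (graph_of E) m" and ij: "i < 5" "j < 5" "i \<noteq> j" "\<not> adjacent E i j"
    and sq: "\<And>A. A \<in> S_graph (graph_of E) \<Longrightarrow> (\<Sum>l<5. A $$ (i, l) * A $$ (l, j)) = 0"
    and cube: "\<And>A. A \<in> S_graph (graph_of E) \<Longrightarrow>
      (\<Sum>l<5. \<Sum>k<5. A $$ (i, k) * A $$ (k, l) * A $$ (l, j)) \<noteq> 0"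
  shows "4 \<le> length m"
proof (rule ccontr)
  assume len: "\<not> 4 \<le> length m"
  obtain A ls q where A: "A \<in> S_graph (graph_of E)" and ls: "length ls = length m" "\<forall>k\<in>set m. 0 < k"
    and sd: "spectral_decomposition 5 A (expand ls m) q"
    by (rule attains_spectral[OF order_graph_of at]) (rule that)
  have "ls = [] \<or> (\<exists>a. ls = [a]) \<or> (\<exists>a b. ls = [a, b]) \<or> (\<exists>a b c. ls = [a, b, c])"
    using len ls(1) by (cases ls; cases "tl ls"; cases "tl (tl ls)"; cases "tl (tl (tl ls))") auto
  then have "\<exists>a b c. set ls \<subseteq> {a, b, c}"
    by (intro exI[of _ "hd ls"] exI[of _ "hd (tl ls)"] exI[of _ "hd (tl (tl ls))"]) auto
  then obtain a b c where abc: "set (expand ls m) \<subseteq> {a, b, c}" using set_expand[OF ls] by auto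
  show False
    using three_eigenvalues_cube_entry[OF sd abc ij(1-3) S_graph_of_zero[OF A ij] sq[OF A]] cube[OF A] by blast
qed

text \<open>Vertices 4 and 1 are at distance three, and 4, 3, 0, 1 is the only path of that length
  between them.\<close>

lemma length_L32: "attains (graph_of E_L32) m \<Longrightarrow> 4 \<le> length m"
proof (erule length_ge_4_of_cube_entry[where i = 4 and j = 1])
  fix A assume A: "A \<in> S_graph (graph_of E_L32)"
  note z = S_graph_of_zero[OF A] and nz = S_graph_of_nonzero[OF A]
  have "A $$ (4, 0) = 0" "A $$ (4, 1) = 0" "A $$ (4, 2) = 0" "A $$ (3, 1) = 0" "A $$ (3, 2) = 0"
    by (rule z; simp add: E_L32_def adjacent_def)+
  moreover have "A $$ (4, 3) \<noteq> 0" "A $$ (3, 0) \<noteq> 0" "A $$ (0, 1) \<noteq> 0"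
    by (rule nz; simp add: E_L32_def adjacent_def)+
  ultimately show "(\<Sum>l<5. A $$ (4, l) * A $$ (l, 1)) = 0"
    "(\<Sum>l<5. \<Sum>k<5. A $$ (4, k) * A $$ (k, l) * A $$ (l, 1)) \<noteq> 0"
    by (simp_all add: sum_5)
qed (simp_all add: E_L32_def adjacent_def)

text \<open>The two pendant vertices are at distance three, and the only path of that length uses
  the triangle edge \<open>{0, 1}\<close>.\<close>

lemma length_Bull: "attains (graph_of E_Bull) m \<Longrightarrow> 4 \<le> length m"
proof (erule length_ge_4_of_cube_entry[where i = 3 and j = 4])
  fix A assume A: "A \<in> S_graph (graph_of E_Bull)"
  note z = S_graph_of_zero[OF A] and nz = S_graph_of_nonzero[OF A]
  have "A $$ (3, 1) = 0" "A $$ (3, 2) = 0" "A $$ (3, 4) = 0" "A $$ (0, 4) = 0" "A $$ (2, 4) = 0"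
    by (rule z; simp add: E_Bull_def adjacent_def)+
  moreover have "A $$ (3, 0) \<noteq> 0" "A $$ (0, 1) \<noteq> 0" "A $$ (1, 4) \<noteq> 0"
    by (rule nz; simp add: E_Bull_def adjacent_def)+
  ultimately show "(\<Sum>l<5. A $$ (3, l) * A $$ (l, 4)) = 0"
    "(\<Sum>l<5. \<Sum>k<5. A $$ (3, k) * A $$ (k, l) * A $$ (l, 4)) \<noteq> 0"
    by (simp_all add: sum_5)
qed (simp_all add: E_Bull_def adjacent_def)

text \<open>With eigenvalues \<open>a, a, b, c, c\<close> the matrix \<open>(A - a)(A - c)\<close> is a negative multiple of
  \<open>w w\<^sup>T\<close>. Its entries at vertices of distance two are products of consecutive edge entries, so the
  product of all five of them is positive on one side and nonpositive on the other.\<close>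

lemma not_attains_C5_212: "\<not> attains (graph_of E_C5) [2, 1, 2]"
proof
  assume "attains (graph_of E_C5) [2, 1, 2]"
  then obtain A ls q where A: "A \<in> S_graph (graph_of E_C5)" and ls: "sorted_wrt (<) ls" "length ls = length [2, 1, 2::nat]"
    and sd: "spectral_decomposition 5 A (expand ls [2, 1, 2]) q"
    by (rule attains_spectral[OF order_graph_of]) (rule that)
  obtain a b c where abc: "ls = [a, b, c]"
    using ls(2) by (cases ls; cases "tl ls"; cases "tl (tl ls)"; cases "tl (tl (tl ls))") auto
  have ord: "a < b" "b < c" using ls(1) by (auto simp: abc)
  have sd': "spectral_decomposition 5 A [a, a, b, c, c] q" using sd by (simp add: abc eval_nat_numeral)
  \<comment> \<open>\<open>- K\<close> is the value of \<open>(x - a) * (x - c)\<close> at the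
    simple eigenvalue \<open>b\<close>; at the double ones it vanishes, which leaves only the term
    of \<open>q 2\<close>.\<close>
  define K where "K = (b - a) * (c - b)"
  have K: "K > 0" using ord by (simp add: K_def)
  have entry: "(\<Sum>l<5. A $$ (i, l) * A $$ (l, j)) = - K * (q 2 i * q 2 j)"
    if ij: "i < 5" "j < 5" "i \<noteq> j" "\<not> adjacent E_C5 i j" for i j
  proof -
    have "(\<Sum>l<5. A $$ (i, l) * A $$ (l, j)) = (\<Sum>k<5. ([a, a, b, c, c] ! k)\<^sup>2 * q k i * q k j)"
      by (rule spectral_decomposition_powers(1)[OF sd' ij(1,2)])
    moreover have "(\<Sum>k<5. [a, a, b, c, c] ! k * q k i * q k j) = 0"
      using sd' ij(1,2) S_graph_of_zero[OF A ij] by (simp add: spectral_decomposition_def)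
    moreover have "(\<Sum>k<5. q k i * q k j) = 0"
      using sd' ij by (simp add: spectral_decomposition_def)
    moreover have "(\<Sum>k<5. ([a, a, b, c, c] ! k)\<^sup>2 * q k i * q k j) =
        (a + c) * (\<Sum>k<5. [a, a, b, c, c] ! k * q k i * q k j) - a * c * (\<Sum>k<5. q k i * q k j)
          - K * (q 2 i * q 2 j)"
      unfolding sum_5 K_def by (simp add: power2_eq_square algebra_simps)
    ultimately show ?thesis by simp
  qed
  define p where "p i = q 2 i" for i
  note z = S_graph_of_zero[OF A] and nz = S_graph_of_nonzero[OF A]
  have z': "A $$ (0, 2) = 0" "A $$ (0, 3) = 0" "A $$ (1, 3) = 0" "A $$ (1, 4) = 0" "A $$ (2, 4) = 0"
    "A $$ (2, 0) = 0" "A $$ (3, 0) = 0" "A $$ (3, 1) = 0" "A $$ (4, 1) = 0" "A $$ (4, 2) = 0"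
    by (rule z; simp add: E_C5_def adjacent_def)+
  have nz': "A $$ (0, 1) \<noteq> 0" "A $$ (1, 2) \<noteq> 0" "A $$ (2, 3) \<noteq> 0" "A $$ (3, 4) \<noteq> 0" "A $$ (4, 0) \<noteq> 0"
    by (rule nz; simp add: E_C5_def adjacent_def)+
  have e: "A $$ (0, 1) * A $$ (1, 2) = - K * (p 0 * p 2)" "A $$ (1, 2) * A $$ (2, 3) = - K * (p 1 * p 3)"
    "A $$ (2, 3) * A $$ (3, 4) = - K * (p 2 * p 4)" "A $$ (3, 4) * A $$ (4, 0) = - K * (p 3 * p 0)"
    "A $$ (4, 0) * A $$ (0, 1) = - K * (p 4 * p 1)"
    using entry[of 0 2] entry[of 1 3] entry[of 2 4] entry[of 3 0] entry[of 4 1]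
    by (simp_all add: sum_5 z' p_def E_C5_def adjacent_def del: One_nat_def)
  \<comment> \<open>Each edge entry occurs in two of the five products of consecutive entries, and
    each \<open>p i\<close> occurs twice on the other side; the five factors \<open>- K\<close>
    leave an odd sign.\<close>
  have "(A $$ (0, 1) * A $$ (1, 2) * A $$ (2, 3) * A $$ (3, 4) * A $$ (4, 0))\<^sup>2 =
      (A $$ (0, 1) * A $$ (1, 2)) * (A $$ (1, 2) * A $$ (2, 3)) * (A $$ (2, 3) * A $$ (3, 4)) *
      (A $$ (3, 4) * A $$ (4, 0)) * (A $$ (4, 0) * A $$ (0, 1))"
    by (simp only: power2_eq_square mult_ac)
  also have "\<dots> = - (K ^ 5 * (p 0 * p 1 * p 2 * p 3 * p 4)\<^sup>2)"
    unfolding e by (simp add: eval_nat_numeral mult_ac)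
  finally have "(A $$ (0, 1) * A $$ (1, 2) * A $$ (2, 3) * A $$ (3, 4) * A $$ (4, 0))\<^sup>2 =
      - (K ^ 5 * (p 0 * p 1 * p 2 * p 3 * p 4)\<^sup>2)" .
  moreover have "(A $$ (0, 1) * A $$ (1, 2) * A $$ (2, 3) * A $$ (3, 4) * A $$ (4, 0))\<^sup>2 > 0"
    using nz' by simp
  moreover have "K ^ 5 * (p 0 * p 1 * p 2 * p 3 * p 4)\<^sup>2 \<ge> 0" using K by simp
  ultimately show False by linarith
qed

text \<open>A kernel vector of \<open>A - c\<close> vanishing at the centre, for an extreme eigenvalue \<open>c\<close>, vanishes at
  both leaves; orthogonality to row 0 then fixes its direction independently of \<open>c\<close>.\<close>

lemma not_attains_Campstool_212: "\<not> attains (graph_of E_Campstool) [2, 1, 2]"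
proof
  assume "attains (graph_of E_Campstool) [2, 1, 2]"
  then obtain A ls q where A: "A \<in> S_graph (graph_of E_Campstool)" and ls: "sorted_wrt (<) ls" "length ls = length [2, 1, 2::nat]"
    and sd: "spectral_decomposition 5 A (expand ls [2, 1, 2]) q" and cp: "char_poly A = roots_poly (expand ls [2, 1, 2])"
    by (rule attains_spectral[OF order_graph_of]) (rule that)
  obtain a b c where abc: "ls = [a, b, c]"
    using ls(2) by (cases ls; cases "tl ls"; cases "tl (tl ls)"; cases "tl (tl (tl ls))") auto
  have ord: "a < b" "b < c" using ls(1) by (auto simp: abc)
  have L: "expand ls [2, 1, 2] = [a, a, b, c, c]" by (simp add: abc eval_nat_numeral)
  have sd': "spectral_decomposition 5 A [a, a, b, c, c] q" using sd unfolding L .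
  have mA: "- A \<in> S_graph (graph_of E_Campstool)" by (rule S_graph_uminus[OF A])
  note cA = S_graph_of_D(2)[OF A]
  \<comment> \<open>The largest eigenvalue of \<open>A\<close> is handled as the least eigenvalue of
    \<open>- A\<close>.\<close>
  obtain q' where sdm: "spectral_decomposition 5 (- A) [- a, - a, - b, - c, - c] q'"
  proof -
    obtain g :: "5 \<Rightarrow> nat" where g: "index_bij g 5" by (rule index_bij_5)
    have "char_poly (- A) = roots_poly [- a, - a, - b, - c, - c]"
      using index_bij.char_poly_uminus[OF g S_graph_of_D(1)[OF A] cp] unfolding L list.map .
    then show ?thesis using spectral_decomposition_5[OF S_graph_of_D(1)[OF mA]] that by blast
  qed
  note z = S_graph_of_zero[OF A] and nz = S_graph_of_nonzero[OF A]
  have z': "A $$ (3, 1) = 0" "A $$ (3, 2) = 0" "A $$ (3, 4) = 0" "A $$ (4, 1) = 0" "A $$ (4, 2) = 0" "A $$ (4, 3) = 0"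
    "A $$ (1, 3) = 0" "A $$ (1, 4) = 0"
    by (rule z; simp add: E_Campstool_def adjacent_def)+
  have nz': "A $$ (0, 1) \<noteq> 0" "A $$ (0, 2) \<noteq> 0" "A $$ (3, 0) \<noteq> 0" "A $$ (4, 0) \<noteq> 0"
    by (rule nz; simp add: E_Campstool_def adjacent_def)+
  have min: "a \<le> d" if "d \<in> set [a, a, b, c, c]" for d using that ord by auto
  have max: "- c \<le> d" if "d \<in> set [- a, - a, - b, - c, - c]" for d using that ord by auto
  have lo: "a < A $$ (3, 3)" "a < A $$ (4, 4)"
    by (rule diag_greater_min_eigenvalue[OF sd' min, of _ 0]; use nz' in simp)+
  have "- c < (- A) $$ (3, 3)" "- c < (- A) $$ (4, 4)"
    by (rule diag_greater_min_eigenvalue[OF sdm max, of _ 0]; use nz' cA in simp)+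
  then have hi: "A $$ (3, 3) < c" "A $$ (4, 4) < c" using cA by simp_all
  \<comment> \<open>Eliminating \<open>x 1\<close> and \<open>x 2\<close> from rows 0 and 1 gives an
    equation whose left side does not involve \<open>e\<close>; applied to both double eigenvalues
    \<open>a\<close> and \<open>c\<close> it forces them to be equal.\<close>
  have key: "A $$ (1, 1) * A $$ (0, 2) - A $$ (1, 2) * A $$ (0, 1) = e * A $$ (0, 2)"
    if cnt: "count_list [a, a, b, c, c] e = 2" and ne: "A $$ (3, 3) \<noteq> e" "A $$ (4, 4) \<noteq> e" for e
  proof -
    have c1: "card {0 :: nat} < count_list [a, a, b, c, c] e" using cnt by simp
    obtain x where x: "\<exists>i<5. x i \<noteq> 0" "\<And>j. j \<in> {0} \<Longrightarrow> x j = 0"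
      "\<And>j. j < 5 \<Longrightarrow> (\<Sum>l<5. A $$ (j, l) * x l) = e * x j"
      by (rule eigenvector_vanishing_on[OF sd' _ c1]) (simp, rule that)
    have x0: "x 0 = 0" using x(2) by simp
    have x3: "x 3 = 0" using x(3)[of 3] ne(1) by (simp add: sum_5 z' x0 del: One_nat_def)
    have x4: "x 4 = 0" using x(3)[of 4] ne(2) by (simp add: sum_5 z' x0 del: One_nat_def)
    have r0: "A $$ (0, 1) * x 1 + A $$ (0, 2) * x 2 = 0" using x(3)[of 0] by (simp add: sum_5 z' x0 x3 x4 del: One_nat_def)
    have r1: "A $$ (1, 1) * x 1 + A $$ (1, 2) * x 2 = e * x 1" using x(3)[of 1] by (simp add: sum_5 z' x0 x3 x4 del: One_nat_def)
    have x1: "x 1 \<noteq> 0"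
    proof
      assume "x 1 = 0"
      then have "x 2 = 0" using r0 nz' by simp
      then show False using x(1) x0 x3 x4 \<open>x 1 = 0\<close> by (auto simp: less_5)
    qed
    have "(A $$ (1, 1) * A $$ (0, 2) - A $$ (1, 2) * A $$ (0, 1) - e * A $$ (0, 2)) * x 1 =
        A $$ (0, 2) * (A $$ (1, 1) * x 1 + A $$ (1, 2) * x 2 - e * x 1)
          - A $$ (1, 2) * (A $$ (0, 1) * x 1 + A $$ (0, 2) * x 2)"
      by (simp add: algebra_simps del: One_nat_def)
    also have "\<dots> = 0" unfolding r0 r1 by simp
    finally have "(A $$ (1, 1) * A $$ (0, 2) - A $$ (1, 2) * A $$ (0, 1) - e * A $$ (0, 2)) * x 1 = 0" .
    then show ?thesis using x1 by simp
  qed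
  have "count_list [a, a, b, c, c] a = 2" "count_list [a, a, b, c, c] c = 2" using ord by auto
  then have "a * A $$ (0, 2) = c * A $$ (0, 2)" using key[of a] key[of c] lo hi by simp
  then show False using nz'(2) ord by simp
qed

section \<open>Failure of the strong multiplicity property\<close>

text \<open>If all columns of \<open>X\<close> are eigenvectors for one \<open>c\<close>, then
  \<open>A X = c X = X A\<close> and \<open>A ^ k X = c ^ k X\<close>, so the zero diagonal of
  \<open>X\<close> settles the commutator and all trace conditions at once.\<close>

lemma not_SMP_if_eigenmatrix:
  fixes x :: "nat \<Rightarrow> nat \<Rightarrow> real"
  assumes A: "A \<in> carrier_mat n n" and sA: "\<And>i j. i < n \<Longrightarrow> j < n \<Longrightarrow> A $$ (i, j) = A $$ (j, i)"
    and x: "\<And>i j. i < n \<Longrightarrow> j < n \<Longrightarrow> x i j = x j i" "\<And>i. i < n \<Longrightarrow> x i i = 0"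
      "\<And>i j. i < n \<Longrightarrow> j < n \<Longrightarrow> A $$ (i, j) \<noteq> 0 \<Longrightarrow> x i j = 0"
      "\<And>i j. i < n \<Longrightarrow> j < n \<Longrightarrow> (\<Sum>k<n. A $$ (i, k) * x k j) = c * x i j"
    and nz: "i < n" "j < n" "x i j \<noteq> 0"
  shows "\<not> SMP n A"
proof
  assume "SMP n A"
  then have sp: "strong_property n {2..n - 1} A" by (simp add: SMP_strong_property)
  let ?X = "Matrix.mat n n (\<lambda>(i, j). x i j)"
  have cX: "?X \<in> carrier_mat n n" by simp
  have AX: "A * ?X = c \<cdot>\<^sub>m ?X"
    using A x(4) by (intro eq_matI) (auto simp: scalar_prod_def atLeast0LessThan)
  have pow: "A ^\<^sub>m k * ?X = c ^ k \<cdot>\<^sub>m ?X" for k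
  proof (induction k)
    case 0
    have "A ^\<^sub>m 0 * ?X = ?X" using A left_mult_one_mat[OF cX] by simp
    then show ?case by (simp add: smult_mat_def) (intro eq_matI; simp)
  next
    case (Suc k)
    have ck: "A ^\<^sub>m k \<in> carrier_mat n n" using A by (rule pow_carrier_mat)
    have "A ^\<^sub>m Suc k * ?X = A ^\<^sub>m k * (A * ?X)" using assoc_mult_mat[OF ck A cX] by simp
    also have "\<dots> = c \<cdot>\<^sub>m (A ^\<^sub>m k * ?X)" unfolding AX by (rule mult_smult_distrib[OF ck cX])
    finally show ?case unfolding Suc by (intro eq_matI) auto
  qed
  have tr: "mat_trace (A ^\<^sub>m k * ?X) = 0" for k
    unfolding pow mat_trace_def using x(2) by (simp add: sum.neutral)
  have comm: "(\<Sum>k<n. A $$ (i, k) * x k j) = (\<Sum>k<n. x i k * A $$ (k, j))" if ij: "i < n" "j < n" for i j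
  proof -
    have "(\<Sum>k<n. x i k * A $$ (k, j)) = (\<Sum>k<n. A $$ (j, k) * x k i)"
      using ij x(1) sA by (intro sum.cong) (auto simp: mult.commute)
    then show ?thesis using x(4)[OF ij] x(4)[OF ij(2,1)] x(1)[OF ij] by simp
  qed
  have "x i j = 0"
    by (rule strong_property_D[OF A sp x(1-3) comm tr nz(1,2)])
  then show False using nz(3) by simp
qed

text \<open>A triple eigenvalue puts \<open>c\<close> on all leaves, and leaf vectors orthogonal to
  the edge weights are then eigenvectors for \<open>c\<close>. A symmetric matrix with columns of
  this kind can be supported on a 4-cycle of leaves, with alternating signs.\<close>

lemma not_SMP_K14:
  assumes A: "A \<in> S_graph (graph_of E_K14)" and cp: "char_poly A = roots_poly L" and cnt: "count_list L c = 3"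
  shows "\<not> SMP 5 A"
proof -
  obtain q where sd: "spectral_decomposition 5 A L q" by (rule spectral_decomposition_5[OF S_graph_of_D(1)[OF A] cp])
  have z: "A $$ (i, j) = 0" if "i \<in> {1,2,3,4}" "j \<in> {1,2,3,4}" "i \<noteq> j" for i j
    using S_graph_of_zero[OF A, of i j] that by (auto simp: E_K14_def adjacent_def)
  have nz: "A $$ (0, i) \<noteq> 0" "A $$ (i, 0) \<noteq> 0" if "i \<in> {1,2,3,4}" for i
    using S_graph_of_nonzero[OF A, of 0 i] S_graph_of_nonzero[OF A, of i 0] that
    by (auto simp: E_K14_def adjacent_def)
  \<comment> \<open>If leaf \<open>i\<close> had a different diagonal entry, a kernel vector of
    \<open>A - c\<close> vanishing at the leaves \<open>j\<close> and \<open>k\<close> would vanish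
    at the centre, then at \<open>i\<close>, then at \<open>l\<close>; so the multiplicity would be
    at most two.\<close>
  have diag: "A $$ (i, i) = c" if p: "distinct [i, j, k, l]" "{i, j, k, l} = {1, 2, 3, 4}" for i j k l
  proof (rule ccontr)
    assume ne: "A $$ (i, i) \<noteq> c"
    have in4: "i \<in> {1,2,3,4}" "j \<in> {1,2,3,4}" "k \<in> {1,2,3,4}" "l \<in> {1,2,3,4}" using p(2) by auto
    have "m < 5 \<and> m \<noteq> 0" if "m \<in> {1, 2, 3, 4}" for m :: nat using that by auto
    from this[OF in4(1)] this[OF in4(2)] this[OF in4(3)] this[OF in4(4)]
    have lt: "i < 5" "j < 5" "k < 5" "l < 5" "i \<noteq> 0" "j \<noteq> 0" "k \<noteq> 0" "l \<noteq> 0" by blast+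
    have S: "(\<Sum>m<5. f m) = f 0 + f i + f j + f k + f l" for f :: "nat \<Rightarrow> real"
    proof -
      have "{..<5} = insert 0 {1, 2, 3, 4 :: nat}" by auto
      then have "{..<5} = {0, i, j, k, l}" using p(2) by simp
      then show ?thesis using p(1) lt by (simp add: add.assoc)
    qed
    have cc: "card {j, k} < count_list L c" using cnt p(1) by simp
    obtain x where x: "\<exists>i<5. x i \<noteq> 0" "\<And>m. m \<in> {j, k} \<Longrightarrow> x m = 0"
      "\<And>m. m < 5 \<Longrightarrow> (\<Sum>l<5. A $$ (m, l) * x l) = c * x m"
      by (rule eigenvector_vanishing_on[OF sd _ cc]) (simp, rule that)
    have xj: "x j = 0" "x k = 0" using x(2) by auto
    have "A $$ (j, 0) * x 0 = 0"
      using x(3)[OF lt(2)] z[OF in4(2,1)] z[OF in4(2,4)] p(1) by (simp add: S xj)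
    then have x0: "x 0 = 0" using nz in4 by simp
    have "A $$ (i, i) * x i = c * x i"
      using x(3)[OF lt(1)] z[OF in4(1,4)] p(1) by (simp add: S xj x0)
    then have xi: "x i = 0" using ne by simp
    have "A $$ (0, l) * x l = 0" using x(3)[of 0] by (simp add: S xj x0 xi)
    then have xl: "x l = 0" using nz in4 by simp
    have "{..<5} = insert 0 {1, 2, 3, 4 :: nat}" by auto
    then have U: "{..<5} = {0, i, j, k, l}" using p(2) by simp
    have "x m = 0" if "m < 5" for m
    proof -
      have "m \<in> {..<5}" using that by simp
      then have "m \<in> {0, i, j, k, l}" unfolding U .
      then show ?thesis by (elim insertE emptyE) (simp_all add: x0 xi xj xl)
    qed
    then show False using x(1) by blast
  qed
  have d: "A $$ (1, 1) = c" "A $$ (2, 2) = c" "A $$ (3, 3) = c" "A $$ (4, 4) = c"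
    using diag[of 1 2 3 4] diag[of 2 1 3 4] diag[of 3 1 2 4] diag[of 4 1 2 3]
    by (simp_all add: insert_commute del: One_nat_def)
  \<comment> \<open>The signs make every row of \<open>w\<close> sum to zero over the leaves;
    dividing by the edge weights turns this into orthogonality to row 0.\<close>
  define w :: "nat \<Rightarrow> nat \<Rightarrow> real" where
    "w = (\<lambda>i j. if {i, j} = {1, 2} \<or> {i, j} = {3, 4} then 1 else if {i, j} = {1, 3} \<or> {i, j} = {2, 4} then - 1 else 0)"
  define x where "x i j = w i j / (A $$ (0, i) * A $$ (0, j))" for i j
  have z': "A $$ (1, 2) = 0" "A $$ (1, 3) = 0" "A $$ (1, 4) = 0" "A $$ (2, 1) = 0" "A $$ (2, 3) = 0" "A $$ (2, 4) = 0"
    "A $$ (3, 1) = 0" "A $$ (3, 2) = 0" "A $$ (3, 4) = 0" "A $$ (4, 1) = 0" "A $$ (4, 2) = 0" "A $$ (4, 3) = 0"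
    by (rule z; simp)+
  have nz': "A $$ (0, 1) \<noteq> 0" "A $$ (0, 2) \<noteq> 0" "A $$ (0, 3) \<noteq> 0" "A $$ (0, 4) \<noteq> 0"
    by (rule nz; simp)+
  show ?thesis
  proof (rule not_SMP_if_eigenmatrix[OF S_graph_of_D(2)[OF A] S_graph_of_D(4)[OF A], of x c 1 2])
    show "x i j = x j i" for i j by (simp add: x_def w_def insert_commute mult.commute)
    show "x i i = 0" for i by (simp add: x_def w_def doubleton_eq_iff)
    show "x i j = 0" if "i < 5" "j < 5" "A $$ (i, j) \<noteq> 0" for i j
      using that z' by (auto simp: less_5 x_def w_def doubleton_eq_iff)
    show "(\<Sum>k<5. A $$ (i, k) * x k j) = c * x i j" if "i < 5" "j < 5" for i j
      using that z' d nz' unfolding less_5 sum_5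
      by (elim disjE; simp add: x_def w_def doubleton_eq_iff del: One_nat_def)
    show "x 1 2 \<noteq> 0" using nz' by (simp add: x_def w_def)
  qed simp_all
qed

text \<open>An eigenvector vanishing at the centre and at one further vertex of a triangle vanishes
  on that triangle, so multiplicity three yields an eigenvector \<open>u\<close> supported in
  \<open>{1, 2}\<close> and another \<open>v\<close> supported in \<open>{3, 4}\<close>. Their
  symmetrized product lives on the non-edges between the triangles.\<close>

lemma not_SMP_Butterfly:
  assumes A: "A \<in> S_graph (graph_of E_Butterfly)" and cp: "char_poly A = roots_poly L" and cnt: "count_list L c = 3"
  shows "\<not> SMP 5 A"
proof -
  obtain q where sd: "spectral_decomposition 5 A L q" by (rule spectral_decomposition_5[OF S_graph_of_D(1)[OF A] cp])
  have z: "A $$ (1, 3) = 0" "A $$ (1, 4) = 0" "A $$ (2, 3) = 0" "A $$ (2, 4) = 0"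
    "A $$ (3, 1) = 0" "A $$ (4, 1) = 0" "A $$ (3, 2) = 0" "A $$ (4, 2) = 0"
    by (rule S_graph_of_zero[OF A]; simp add: E_Butterfly_def adjacent_def)+
  have ker: "\<exists>x. (\<exists>i<5. x i \<noteq> 0) \<and> (\<forall>i\<in>{0, k}. x i = 0) \<and>
      (\<forall>i<5. (\<Sum>l<5. A $$ (i, l) * x l) = c * x i)" if "k \<noteq> 0" for k
  proof -
    have cc: "card {0, k} < count_list L c" using cnt that by simp
    obtain x where "\<exists>i<5. x i \<noteq> 0" "\<And>i. i \<in> {0, k} \<Longrightarrow> x i = 0"
      "\<And>i. i < 5 \<Longrightarrow> (\<Sum>l<5. A $$ (i, l) * x l) = c * x i"
      by (rule eigenvector_vanishing_on[OF sd _ cc]) (simp, blast)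
    then show ?thesis by blast
  qed
  obtain u where u: "\<exists>i<5. u i \<noteq> 0" "u 0 = 0" "u 3 = 0" "\<And>i. i < 5 \<Longrightarrow> (\<Sum>l<5. A $$ (i, l) * u l) = c * u i"
    using ker[of 3] by auto
  obtain v where v: "\<exists>i<5. v i \<noteq> 0" "v 0 = 0" "v 1 = 0" "\<And>i. i < 5 \<Longrightarrow> (\<Sum>l<5. A $$ (i, l) * v l) = c * v i"
    using ker[of 1] by auto
  have nz: "A $$ (3, 4) \<noteq> 0" "A $$ (1, 2) \<noteq> 0"
    by (rule S_graph_of_nonzero[OF A]; simp add: E_Butterfly_def adjacent_def)+
  have u4: "u 4 = 0" using u(4)[of 3] nz by (simp add: sum_5 u(2,3) z del: One_nat_def)
  have v2: "v 2 = 0" using v(4)[of 1] nz by (simp add: sum_5 v(2,3) z del: One_nat_def)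
  obtain i where i: "i < 5" "u i \<noteq> 0" using u(1) by blast
  obtain j where j: "j < 5" "v j \<noteq> 0" using v(1) by blast
  have iu: "i = 1 \<or> i = 2" using i u(2,3) u4 unfolding less_5 by metis
  have jv: "j = 3 \<or> j = 4" using j v(2,3) v2 unfolding less_5 by metis
  define x where "x i j = u i * v j + v i * u j" for i j
  have d: "u k = 0 \<or> v k = 0" if "k < 5" for k using that u(2,3) u4 v(2,3) v2 unfolding less_5 by metis
  show ?thesis
  proof (rule not_SMP_if_eigenmatrix[OF S_graph_of_D(2)[OF A] S_graph_of_D(4)[OF A], of x c i j])
    show "x i j = x j i" for i j by (simp add: x_def mult.commute add.commute)
    show "x k k = 0" if "k < 5" for k using d[OF that] by (auto simp: x_def)
    show "x i j = 0" if "i < 5" "j < 5" "A $$ (i, j) \<noteq> 0" for i j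
      using that z u(2,3) u4 v(2,3) v2 unfolding less_5 by (elim disjE) (simp_all add: x_def del: One_nat_def)
    show "(\<Sum>k<5. A $$ (i, k) * x k j) = c * x i j" if "i < 5" "j < 5" for i j
    proof -
      have "(\<Sum>k<5. A $$ (i, k) * x k j) = (\<Sum>k<5. A $$ (i, k) * u k) * v j + (\<Sum>k<5. A $$ (i, k) * v k) * u j"
        by (simp add: x_def sum_distrib_right sum.distrib distrib_left mult.assoc)
      also have "\<dots> = c * x i j" using u(4)[OF that(1)] v(4)[OF that(1)] by (simp add: x_def algebra_simps)
      finally show ?thesis .
    qed
    show "x i j \<noteq> 0" using i j iu jv u(2,3) u4 v(2,3) v2 by (auto simp: x_def)
  qed (use i j in simp_all)
qed

lemma not_attains_SMP:
  assumes at: "attains_SMP (graph_of E) m" and m: "3 \<in> set m"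
    and H: "\<And>A L c. A \<in> S_graph (graph_of E) \<Longrightarrow> char_poly A = roots_poly L \<Longrightarrow> count_list L c = 3 \<Longrightarrow> \<not> SMP 5 A"
  shows False
proof -
  obtain A where A: "A \<in> S_graph (graph_of E)" "mult_list A = m" "SMP 5 A"
    using at unfolding attains_SMP_def by auto
  obtain i where i: "i < length m" "m ! i = 3" using m by (metis in_set_conv_nth)
  show False
  proof (rule mult_list_eq_imp_expand[OF S_graph_of_D(1)[OF A(1)] A(2)])
    fix ls assume ls: "sorted_wrt (<) ls" "length ls = length m" and cp: "char_poly A = roots_poly (expand ls m)"
    have "count_list (expand ls m) (ls ! i) = 3" using count_expand_nth[OF ls i(1)] i(2) by simp
    then show False using H[OF A(1) cp] A(3) by blast
  qed
qed

section \<open>Matrices given by rows\<close>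

lemma det_Suc:
  "Determinant.det (Matrix.mat (Suc n) (Suc n) (\<lambda>(i, j). f i j)) =
     (\<Sum>j<Suc n. (- 1) ^ j * f 0 j *
        Determinant.det (Matrix.mat n n (\<lambda>(a, b). f (Suc a) (if b < j then b else Suc b)) :: 'a::comm_ring_1 mat))"
proof -
  let ?M = "Matrix.mat (Suc n) (Suc n) (\<lambda>(i, j). f i j)"
  have del: "mat_delete ?M 0 j = Matrix.mat n n (\<lambda>(a, b). f (Suc a) (if b < j then b else Suc b))" for j
    by (intro eq_matI) (auto simp: mat_delete_def)
  have "Determinant.det ?M = (\<Sum>j<Suc n. ?M $$ (0, j) * cofactor ?M 0 j)"
    by (rule laplace_expansion_row) auto
  also have "\<dots> = (\<Sum>j<Suc n. (- 1) ^ j * f 0 j *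
      Determinant.det (Matrix.mat n n (\<lambda>(a, b). f (Suc a) (if b < j then b else Suc b))))"
    by (intro sum.cong refl) (simp add: cofactor_def del mult_ac)
  finally show ?thesis .
qed

lemma det_0: "Determinant.det (Matrix.mat 0 0 f :: 'a::comm_ring_1 mat) = 1"
  by (simp add: det_dim_zero)

definition det2 :: "(nat \<Rightarrow> nat \<Rightarrow> real) \<Rightarrow> nat \<Rightarrow> nat \<Rightarrow> nat \<Rightarrow> nat \<Rightarrow> real" where
  "det2 f i j a b = f i a * f j b - f i b * f j a"

definition det3 :: "(nat \<Rightarrow> nat \<Rightarrow> real) \<Rightarrow> nat \<Rightarrow> nat \<Rightarrow> nat \<Rightarrow> nat \<Rightarrow> nat \<Rightarrow> nat \<Rightarrow> real" where
  "det3 f i j k a b c = f i a * det2 f j k b c - f i b * det2 f j k a c + f i c * det2 f j k a b"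

definition det4 :: "(nat \<Rightarrow> nat \<Rightarrow> real) \<Rightarrow> nat \<Rightarrow> nat \<Rightarrow> nat \<Rightarrow> nat \<Rightarrow> nat \<Rightarrow> nat \<Rightarrow> nat \<Rightarrow> nat \<Rightarrow> real" where
  "det4 f i j k l a b c d = f i a * det3 f j k l b c d - f i b * det3 f j k l a c d
     + f i c * det3 f j k l a b d - f i d * det3 f j k l a b c"

lemma det_3: "Determinant.det (Matrix.mat 3 3 (\<lambda>(i, j). f i j)) = det3 f 0 1 2 0 1 2"
  by (simp add: numeral_3_eq_3 det_Suc det_0 det3_def det2_def numeral_2_eq_2 algebra_simps)

lemma det_4: "Determinant.det (Matrix.mat 4 4 (\<lambda>(i, j). f i j)) = det4 f 0 1 2 3 0 1 2 3"
proof -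
  have "(4 :: nat) = Suc 3" by simp
  then show ?thesis
    by (simp only: det_Suc det_3)
      (simp add: det4_def det3_def det2_def eval_nat_numeral algebra_simps)
qed

lemma det_5: "Determinant.det (Matrix.mat 5 5 (\<lambda>(i, j). f i j)) =
  f 0 0 * det4 f 1 2 3 4 1 2 3 4 - f 0 1 * det4 f 1 2 3 4 0 2 3 4 + f 0 2 * det4 f 1 2 3 4 0 1 3 4
    - f 0 3 * det4 f 1 2 3 4 0 1 2 4 + f 0 4 * det4 f 1 2 3 4 0 1 2 3"
proof -
  have "(5 :: nat) = Suc 4" by simp
  then show ?thesis
    by (simp only: det_Suc det_4)
      (simp add: det4_def det3_def det2_def eval_nat_numeral)
qed

definition mat_rows :: "nat \<Rightarrow> real list list \<Rightarrow> real mat" where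
  "mat_rows n R = Matrix.mat n n (\<lambda>(i, j). R ! i ! j)"

definition graph_on :: "nat \<Rightarrow> (nat \<times> nat) list \<Rightarrow> graph" where
  "graph_on n E = Graph n ((\<lambda>(u, v). {u, v}) ` set E)"

lemma graph_of_graph_on: "graph_of E = graph_on 5 E"
  by (simp add: graph_of_def graph_on_def)

lemma mat_rows_carrier [simp]: "mat_rows n R \<in> carrier_mat n n"
  by (simp add: mat_rows_def)

lemma dim_mat_rows [simp]: "dim_row (mat_rows n R) = n" "dim_col (mat_rows n R) = n"
  by (simp_all add: mat_rows_def)

lemma mat_rows_index [simp]: "i < n \<Longrightarrow> j < n \<Longrightarrow> mat_rows n R $$ (i, j) = R ! i ! j"
  by (simp add: mat_rows_def)

lemma mat_rows_S_graph:
  assumes "\<forall>i<n. \<forall>j<n. R ! i ! j = R ! j ! i"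
    and "\<forall>i<n. \<forall>j<n. i \<noteq> j \<longrightarrow> (R ! i ! j \<noteq> 0) = adjacent E i j"
  shows "mat_rows n R \<in> S_graph (graph_on n E)"
proof -
  have "{i, j} \<in> edges (graph_on n E) \<longleftrightarrow> adjacent E i j" for i j
    using edge_graph_of[of i j E] by (simp add: graph_of_def graph_on_def)
  moreover have "symmetric_mat n (mat_rows n R)"
    using assms(1) by (auto simp: symmetric_mat_def intro!: eq_matI)
  ultimately show ?thesis using assms(2) by (auto simp: S_graph_def graph_on_def)
qed

lemma char_poly_mat_rows:
  assumes "\<And>x. Determinant.det (Matrix.mat n n (\<lambda>(i, j). (if i = j then x else 0) - R ! i ! j)) = (\<Prod>a\<leftarrow>L. x - a)"
  shows "char_poly (mat_rows n R) = roots_poly L"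
proof -
  have "poly (char_poly (mat_rows n R)) x = poly (roots_poly L) x" for x
  proof -
    have "- char_matrix (mat_rows n R) x = Matrix.mat n n (\<lambda>(i, j). (if i = j then x else 0) - R ! i ! j)"
      by (intro eq_matI) (auto simp: char_matrix_def mat_rows_def)
    then show ?thesis using assms by (simp add: char_poly_matrix[OF mat_rows_carrier] poly_roots_poly)
  qed
  then show ?thesis by (simp add: poly_eq_poly_eq_iff[symmetric] fun_eq_iff)
qed

lemma SSP_mat_rows:
  assumes H: "\<And>x. (\<And>i j. i < n \<Longrightarrow> j < n \<Longrightarrow> x i j = x j i) \<Longrightarrow> (\<And>i. i < n \<Longrightarrow> x i i = 0) \<Longrightarrow>
      (\<And>i j. i < n \<Longrightarrow> j < n \<Longrightarrow> R ! i ! j \<noteq> 0 \<Longrightarrow> x i j = 0) \<Longrightarrow>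
      (\<And>i j. i < n \<Longrightarrow> j < n \<Longrightarrow> (\<Sum>k<n. R ! i ! k * x k j) = (\<Sum>k<n. x i k * R ! k ! j)) \<Longrightarrow>
      \<forall>i<n. \<forall>j<n. x i j = (0 :: real)"
  shows "SSP n (mat_rows n R)"
proof (rule SSP_I[OF mat_rows_carrier])
  fix x :: "nat \<Rightarrow> nat \<Rightarrow> real"
  assume x: "\<And>i j. i < n \<Longrightarrow> j < n \<Longrightarrow> x i j = x j i" "\<And>i. i < n \<Longrightarrow> x i i = 0"
      "\<And>i j. i < n \<Longrightarrow> j < n \<Longrightarrow> mat_rows n R $$ (i, j) \<noteq> 0 \<Longrightarrow> x i j = 0"
      "\<And>i j. i < n \<Longrightarrow> j < n \<Longrightarrow>
        (\<Sum>k<n. mat_rows n R $$ (i, k) * x k j) = (\<Sum>k<n. x i k * mat_rows n R $$ (k, j))"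
  show "\<forall>i<n. \<forall>j<n. x i j = 0"
    by (rule H[OF x(1,2)]) (use x(3,4) in simp_all)
qed

lemma realizes_SSP_mat_rows:
  assumes "mat_rows n R \<in> S_graph (graph_on n E)" "char_poly (mat_rows n R) = roots_poly L" "SSP n (mat_rows n R)"
  shows "realizes_SSP (graph_on n E) L"
  unfolding realizes_SSP_def
  by (rule bexI[OF _ assms(1)]) (use assms(2,3) in \<open>simp add: graph_on_def\<close>)

lemma less_3: "(i :: nat) < 3 \<longleftrightarrow> i = 0 \<or> i = 1 \<or> i = 2"
  by auto

lemma less_4: "(i :: nat) < 4 \<longleftrightarrow> i = 0 \<or> i = 1 \<or> i = 2 \<or> i = 3"
  by auto

lemma sum_4: "(\<Sum>k<4. f k) = f 0 + f 1 + f 2 + (f (3::nat) :: real)"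
  by (simp add: eval_nat_numeral)

lemma all_less_5: "(\<forall>i<(5::nat). P i) \<longleftrightarrow> P 0 \<and> P 1 \<and> P 2 \<and> P 3 \<and> P 4"
  by (auto simp: less_5)

lemma all_less_4: "(\<forall>i<(4::nat). P i) \<longleftrightarrow> P 0 \<and> P 1 \<and> P 2 \<and> P 3"
  by (auto simp: less_4)

lemma all_less_3: "(\<forall>i<(3::nat). P i) \<longleftrightarrow> P 0 \<and> P 1 \<and> P 2"
  by (auto simp: less_3)

lemma realizes_SSP_isolated_graph_on:
  assumes E: "\<forall>(u, v) \<in> set E. u < n \<and> v < n \<and> u \<noteq> v"
    and real: "realizes_SSP (graph_on n E) L" and c: "c \<notin> set L"
  shows "realizes_SSP (graph_on (Suc n) E) (L @ [c])"
proof -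
  have "simple_graph (graph_on n E)"
    using E by (auto simp: simple_graph_def graph_on_def card_insert_if)
  moreover have "graph_on n E \<uplus>\<^sub>G complete_graph 1 = graph_on (Suc n) E"
    by (simp add: disjoint_union_def complete_graph_def graph_on_def)
  ultimately show ?thesis using realizes_SSP_isolated[OF _ real c] by simp
qed

section \<open>Explicit matrices with prescribed spectrum\<close>

definition E_k4 :: "(nat \<times> nat) list" where "E_k4 = [(0, 1), (0, 2), (0, 3), (1, 2), (1, 3), (2, 3)]"
definition E_c4 :: "(nat \<times> nat) list" where "E_c4 = [(0, 1), (0, 3), (1, 2), (2, 3)]"
definition E_k3 :: "(nat \<times> nat) list" where "E_k3 = [(0, 1), (0, 2), (1, 2)]"
definition E_k13 :: "(nat \<times> nat) list" where "E_k13 = [(0, 1), (0, 2), (0, 3)]"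

text \<open>The matrix is \<open>a I + t J\<close> with the all-ones matrix \<open>J\<close>, whose
  nonzero eigenvalue is the order. A complete graph has no non-edges, so the only test matrix is
  zero. \<open>K_4\<close> and \<open>K_5\<close> follow the same scheme.\<close>

lemma K3_realizes:
  assumes "a \<noteq> b" shows "realizes_SSP (graph_on 3 E_k3) [a, a, b]"
proof -
  define t where "t = (b - a) / 3"
  have t: "t \<noteq> 0" "b = a + 3 * t" using assms by (simp_all add: t_def field_simps)
  let ?R = "[[a + t, t, t], [t, a + t, t], [t, t, a + t]]"
  show ?thesis
  proof (rule realizes_SSP_mat_rows[of _ ?R])
    show "mat_rows 3 ?R \<in> S_graph (graph_on 3 E_k3)"
      by (rule mat_rows_S_graph) (simp_all add: all_less_3 E_k3_def adjacent_def t(1))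
    show "char_poly (mat_rows 3 ?R) = roots_poly [a, a, b]"
      by (rule char_poly_mat_rows) (simp add: det_3 det3_def det2_def t(2) algebra_simps)
    show "SSP 3 (mat_rows 3 ?R)"
      by (rule SSP_mat_rows) (simp add: less_3, use t(1) in auto)
  qed
qed

lemma K4_realizes:
  assumes "a \<noteq> b" shows "realizes_SSP (graph_on 4 E_k4) [a, a, a, b]"
proof -
  define t where "t = (b - a) / 4"
  have t: "t \<noteq> 0" "b = a + 4 * t" using assms by (simp_all add: t_def field_simps)
  let ?R = "[[a + t, t, t, t], [t, a + t, t, t], [t, t, a + t, t], [t, t, t, a + t]]"
  show ?thesis
  proof (rule realizes_SSP_mat_rows[of _ ?R])
    show "mat_rows 4 ?R \<in> S_graph (graph_on 4 E_k4)"
      by (rule mat_rows_S_graph) (simp_all add: all_less_4 E_k4_def adjacent_def t(1))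
    show "char_poly (mat_rows 4 ?R) = roots_poly [a, a, a, b]"
      by (rule char_poly_mat_rows) (simp add: det_4 det4_def det3_def det2_def t(2) algebra_simps)
    show "SSP 4 (mat_rows 4 ?R)"
      by (rule SSP_mat_rows) (simp add: less_4, use t(1) in auto)
  qed
qed

lemma K5_realizes:
  assumes "a \<noteq> b" shows "realizes_SSP (graph_on 5 E_K5) [a, a, a, a, b]"
proof -
  define t where "t = (b - a) / 5"
  have t: "t \<noteq> 0" "b = a + 5 * t" using assms by (simp_all add: t_def field_simps)
  let ?R = "[[a + t, t, t, t, t], [t, a + t, t, t, t], [t, t, a + t, t, t], [t, t, t, a + t, t], [t, t, t, t, a + t]]"
  show ?thesis
  proof (rule realizes_SSP_mat_rows[of _ ?R])
    show "mat_rows 5 ?R \<in> S_graph (graph_on 5 E_K5)"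
      by (rule mat_rows_S_graph) (simp_all add: all_less_5 E_K5_def adjacent_def t(1))
    show "char_poly (mat_rows 5 ?R) = roots_poly [a, a, a, a, b]"
      by (rule char_poly_mat_rows) (simp add: det_5 det4_def det3_def det2_def t(2) algebra_simps)
    show "SSP 5 (mat_rows 5 ?R)"
      by (rule SSP_mat_rows) (simp add: less_5, use t(1) in auto)
  qed
qed

text \<open>The shift by \<open>a\<close> is the Gram matrix of \<open>(p, 0), (t, t), (0, r), (t, -t)\<close>.\<close>

lemma C4_realizes:
  assumes "a < b" "b \<le> c" shows "realizes_SSP (graph_on 4 E_c4) [a, a, b, c]"
proof -
  \<comment> \<open>The two coordinate rows of the Gram vectors are orthogonal, with squared norms
    \<open>p\<^sup>2 + 2 * t\<^sup>2 = b - a\<close> and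
    \<open>r\<^sup>2 + 2 * t\<^sup>2 = c - a\<close>, the nonzero eigenvalues of the shifted matrix;
    \<open>b \<le> c\<close> makes \<open>r\<close> positive.\<close>
  define t p r where "t = sqrt ((b - a) / 4)" and "p = sqrt ((b - a) / 2)" and "r = sqrt (c - a - (b - a) / 2)"
  have sq: "t\<^sup>2 = (b - a) / 4" "p\<^sup>2 = (b - a) / 2" "r\<^sup>2 = c - a - (b - a) / 2"
    using assms by (simp_all add: t_def p_def r_def)
  have pos: "t > 0" "p > 0" "r > 0" using assms by (simp_all add: t_def p_def r_def)
  have bc: "b = a + p\<^sup>2 + 2 * t\<^sup>2" "c = a + r\<^sup>2 + 2 * t\<^sup>2" unfolding sq by (simp_all add: field_simps)
  let ?R = "[[a + p\<^sup>2, p * t, 0, p * t], [p * t, a + 2 * t\<^sup>2, r * t, 0], [0, r * t, a + r\<^sup>2, - (r * t)],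
    [p * t, 0, - (r * t), a + 2 * t\<^sup>2]]"
  show ?thesis
  proof (rule realizes_SSP_mat_rows[of _ ?R])
    show "mat_rows 4 ?R \<in> S_graph (graph_on 4 E_c4)"
      using pos by (intro mat_rows_S_graph) (simp_all add: all_less_4 E_c4_def adjacent_def)
    show "char_poly (mat_rows 4 ?R) = roots_poly [a, a, b, c]"
      unfolding bc by (rule char_poly_mat_rows)
        (simp add: det_4 det4_def det3_def det2_def power2_eq_square algebra_simps)
    show "SSP 4 (mat_rows 4 ?R)"
    proof (rule SSP_mat_rows)
      fix x :: "nat \<Rightarrow> nat \<Rightarrow> real"
      assume s: "\<And>i j. i < 4 \<Longrightarrow> j < 4 \<Longrightarrow> x i j = x j i" and d: "\<And>i. i < 4 \<Longrightarrow> x i i = 0"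
        and e: "\<And>i j. i < 4 \<Longrightarrow> j < 4 \<Longrightarrow> ?R ! i ! j \<noteq> 0 \<Longrightarrow> x i j = 0"
        and c: "\<And>i j. i < 4 \<Longrightarrow> j < 4 \<Longrightarrow> (\<Sum>k<4. ?R ! i ! k * x k j) = (\<Sum>k<4. x i k * ?R ! k ! j)"
      have z: "x 0 1 = 0" "x 0 3 = 0" "x 1 2 = 0" "x 2 3 = 0"
        using e[of 0 1] e[of 0 3] e[of 1 2] e[of 2 3] pos by simp_all
      have sy: "x 1 0 = x 0 1" "x 2 0 = x 0 2" "x 3 0 = x 0 3" "x 2 1 = x 1 2" "x 3 1 = x 1 3" "x 3 2 = x 2 3"
        by (rule s; simp)+
      have dd: "x 0 0 = 0" "x 1 1 = 0" "x 2 2 = 0" "x 3 3 = 0" by (rule d; simp)+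
      have "p * x 1 3 = r * x 0 2"
        using c[of 0 1] pos by (simp add: sum_4 z sy dd algebra_simps del: One_nat_def)
      moreover have "p * (t * x 1 3) = - (r * (t * x 0 2))"
        using c[of 0 3] by (simp add: sum_4 z sy dd algebra_simps del: One_nat_def)
      then have "t * (p * x 1 3 + r * x 0 2) = 0" by (simp add: algebra_simps del: mult_eq_0_iff)
      then have "p * x 1 3 + r * x 0 2 = 0" using pos by simp
      ultimately have "p * x 1 3 = 0" "r * x 0 2 = 0" by linarith+
      then have "x 1 3 = 0" "x 0 2 = 0" using pos by simp_all
      then show "\<forall>i<4. \<forall>j<4. x i j = 0" unfolding all_less_4 using z sy dd by simp
    qed
  qed
qed

text \<open>Equal leaf entries \<open>b\<close> give the double eigenvalue on leaf vectors of sum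
  zero. The trace \<open>a + c\<close> and the determinant \<open>a * c\<close> of the remaining
  two-dimensional block fix the centre entry and \<open>3 * t\<^sup>2\<close>.\<close>

lemma K13_realizes:
  assumes "a < b" "b < c" shows "realizes_SSP (graph_on 4 E_k13) [b, b, a, c]"
proof -
  define t where "t = sqrt ((b - a) * (c - b) / 3)"
  have t: "t > 0" and sq: "3 * (t * t) = (b - a) * (c - b)" using assms by (simp_all add: t_def flip: power2_eq_square)
  let ?R = "[[a + c - b, t, t, t], [t, b, 0, 0], [t, 0, b, 0], [t, 0, 0, b]]"
  show ?thesis
  proof (rule realizes_SSP_mat_rows[of _ ?R])
    show "mat_rows 4 ?R \<in> S_graph (graph_on 4 E_k13)"
      using t by (intro mat_rows_S_graph) (simp_all add: all_less_4 E_k13_def adjacent_def)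
    show "char_poly (mat_rows 4 ?R) = roots_poly [b, b, a, c]"
    proof (rule char_poly_mat_rows)
      fix x
      have "Determinant.det (Matrix.mat 4 4 (\<lambda>(i, j). (if i = j then x else 0) - ?R ! i ! j)) =
        (x - b)\<^sup>2 * ((x - (a + c - b)) * (x - b) - 3 * (t * t))"
        by (simp add: det_4 det4_def det3_def det2_def power2_eq_square algebra_simps)
      then show "Determinant.det (Matrix.mat 4 4 (\<lambda>(i, j). (if i = j then x else 0) - ?R ! i ! j)) =
        (\<Prod>a\<leftarrow>[b, b, a, c]. x - a)"
        unfolding sq by (simp add: power2_eq_square algebra_simps)
    qed
    show "SSP 4 (mat_rows 4 ?R)"
    proof (rule SSP_mat_rows)
      fix x :: "nat \<Rightarrow> nat \<Rightarrow> real"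
      assume s: "\<And>i j. i < 4 \<Longrightarrow> j < 4 \<Longrightarrow> x i j = x j i" and d: "\<And>i. i < 4 \<Longrightarrow> x i i = 0"
        and e: "\<And>i j. i < 4 \<Longrightarrow> j < 4 \<Longrightarrow> ?R ! i ! j \<noteq> 0 \<Longrightarrow> x i j = 0"
        and c: "\<And>i j. i < 4 \<Longrightarrow> j < 4 \<Longrightarrow> (\<Sum>k<4. ?R ! i ! k * x k j) = (\<Sum>k<4. x i k * ?R ! k ! j)"
      have z: "x 0 1 = 0" "x 0 2 = 0" "x 0 3 = 0"
        using e[of 0 1] e[of 0 2] e[of 0 3] t by simp_all
      have sy: "x 1 0 = x 0 1" "x 2 0 = x 0 2" "x 3 0 = x 0 3" "x 2 1 = x 1 2" "x 3 1 = x 1 3" "x 3 2 = x 2 3"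
        by (rule s; simp)+
      have dd: "x 0 0 = 0" "x 1 1 = 0" "x 2 2 = 0" "x 3 3 = 0" by (rule d; simp)+
      have "t * (x 1 2 + x 1 3) = 0" "t * (x 1 2 + x 2 3) = 0" "t * (x 1 3 + x 2 3) = 0"
        using c[of 0 1] c[of 0 2] c[of 0 3] by (simp_all add: sum_4 z sy dd algebra_simps del: One_nat_def mult_eq_0_iff mult_cancel_left mult_cancel_right)
      then have "x 1 2 + x 1 3 = 0" "x 1 2 + x 2 3 = 0" "x 1 3 + x 2 3 = 0" using t by simp_all
      then have "x 1 2 = 0" "x 1 3 = 0" "x 2 3 = 0" by linarith+
      then show "\<forall>i<4. \<forall>j<4. x i j = 0" unfolding all_less_4 using z sy dd by simp
    qed
  qed
qed

text \<open>The shift by \<open>a\<close> is the Gram matrix of \<open>(p, 0), (0, r), (3t, 3t), (4t, 4t), (5t, -5t)\<close>.\<close>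

lemma K4e_realizes:
  assumes "a < b" "b \<le> c" shows "realizes_SSP (graph_on 5 E_K4e) [a, a, a, b, c]"
proof -
  \<comment> \<open>The triple 3, 4, 5 makes the two coordinate rows orthogonal, since 9 + 16 = 25.
    The last three vectors contribute \<open>50 * t\<^sup>2 = (b - a) / 2\<close> to both squared
    norms, and \<open>p\<close> and \<open>r\<close> supply the rest of \<open>b - a\<close> and
    \<open>c - a\<close>.\<close>
  define t p r where "t = sqrt ((b - a) / 100)" and "p = sqrt ((b - a) / 2)" and "r = sqrt (c - a - (b - a) / 2)"
  have sq: "t\<^sup>2 = (b - a) / 100" "p\<^sup>2 = (b - a) / 2" "r\<^sup>2 = c - a - (b - a) / 2"
    using assms by (simp_all add: t_def p_def r_def)
  have pos: "t > 0" "p > 0" "r > 0" using assms by (simp_all add: t_def p_def r_def)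
  have bc: "b = a + p\<^sup>2 + 50 * t\<^sup>2" "c = a + r\<^sup>2 + 50 * t\<^sup>2" unfolding sq by (simp_all add: field_simps)
  let ?R = "[[a + p\<^sup>2, 0, 3 * p * t, 4 * p * t, 5 * p * t], [0, a + r\<^sup>2, 3 * r * t, 4 * r * t, - 5 * r * t],
    [3 * p * t, 3 * r * t, a + 18 * t\<^sup>2, 24 * t\<^sup>2, 0], [4 * p * t, 4 * r * t, 24 * t\<^sup>2, a + 32 * t\<^sup>2, 0],
    [5 * p * t, - 5 * r * t, 0, 0, a + 50 * t\<^sup>2]]"
  show ?thesis
  proof (rule realizes_SSP_mat_rows[of _ ?R])
    show "mat_rows 5 ?R \<in> S_graph (graph_on 5 E_K4e)"
      using pos by (intro mat_rows_S_graph) (simp_all add: all_less_5 E_K4e_def adjacent_def)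
    show "char_poly (mat_rows 5 ?R) = roots_poly [a, a, a, b, c]"
      unfolding bc by (rule char_poly_mat_rows)
        (simp add: det_5 det4_def det3_def det2_def power2_eq_square algebra_simps)
    show "SSP 5 (mat_rows 5 ?R)"
    proof (rule SSP_mat_rows)
      fix x :: "nat \<Rightarrow> nat \<Rightarrow> real"
      assume s: "\<And>i j. i < 5 \<Longrightarrow> j < 5 \<Longrightarrow> x i j = x j i" and d: "\<And>i. i < 5 \<Longrightarrow> x i i = 0"
        and e: "\<And>i j. i < 5 \<Longrightarrow> j < 5 \<Longrightarrow> ?R ! i ! j \<noteq> 0 \<Longrightarrow> x i j = 0"
        and c: "\<And>i j. i < 5 \<Longrightarrow> j < 5 \<Longrightarrow> (\<Sum>k<5. ?R ! i ! k * x k j) = (\<Sum>k<5. x i k * ?R ! k ! j)"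
      have z: "x 0 2 = 0" "x 0 3 = 0" "x 0 4 = 0" "x 1 2 = 0" "x 1 3 = 0" "x 1 4 = 0" "x 2 3 = 0"
        using e[of 0 2] e[of 0 3] e[of 0 4] e[of 1 2] e[of 1 3] e[of 1 4] e[of 2 3] pos by simp_all
      have sy: "x 1 0 = x 0 1" "x 2 0 = x 0 2" "x 3 0 = x 0 3" "x 4 0 = x 0 4" "x 2 1 = x 1 2"
        "x 3 1 = x 1 3" "x 4 1 = x 1 4" "x 3 2 = x 2 3" "x 4 2 = x 2 4" "x 4 3 = x 3 4"
        by (rule s; simp)+
      have dd: "x 0 0 = 0" "x 1 1 = 0" "x 2 2 = 0" "x 3 3 = 0" "x 4 4 = 0" by (rule d; simp)+
      have "t * (5 * p * x 2 4 - 3 * r * x 0 1) = 0" "t * (5 * r * x 2 4 + 3 * p * x 0 1) = 0"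
        "t * (5 * p * x 3 4 - 4 * r * x 0 1) = 0"
        using c[of 0 2] c[of 1 2] c[of 0 3] by (simp_all add: sum_5 z sy dd algebra_simps del: One_nat_def mult_eq_0_iff mult_cancel_left mult_cancel_right)
      then have q: "5 * p * x 2 4 - 3 * r * x 0 1 = 0" "5 * r * x 2 4 + 3 * p * x 0 1 = 0" "5 * p * x 3 4 - 4 * r * x 0 1 = 0"
        using pos by simp_all
      \<comment> \<open>Eliminating \<open>x 2 4\<close> from the first two relations leaves a
        positive multiple of \<open>x 0 1\<close>.\<close>
      have "3 * (p\<^sup>2 + r\<^sup>2) * x 0 1 = p * (5 * r * x 2 4 + 3 * p * x 0 1) - r * (5 * p * x 2 4 - 3 * r * x 0 1)"
        by (simp add: power2_eq_square algebra_simps)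
      also have "\<dots> = 0" unfolding q by simp
      finally have "3 * (p\<^sup>2 + r\<^sup>2) * x 0 1 = 0" .
      moreover have "3 * (p\<^sup>2 + r\<^sup>2) > 0" using pos by (simp add: add_pos_pos)
      ultimately have x01: "x 0 1 = 0" by (metis less_irrefl mult_eq_0_iff)
      then have "x 2 4 = 0" "x 3 4 = 0" using q(1,3) pos by simp_all
      then show "\<forall>i<5. \<forall>j<5. x i j = 0" unfolding all_less_5 using z sy dd x01 by simp
    qed
  qed
qed


lemma IVT_root:
  fixes f :: "real \<Rightarrow> real"
  assumes "continuous_on {a..b} f" "a \<le> b" "f a * f b < 0"
  obtains y where "a < y" "y < b" "f y = 0"
proof -
  have "\<exists>y. a \<le> y \<and> y \<le> b \<and> f y = 0"
  proof (cases "f a < 0")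
    case True
    then have "f b > 0" using assms(3) by (simp add: mult_less_0_iff)
    then show ?thesis using IVT'[of f a 0 b] True assms(1,2) by auto
  next
    case False
    then have "f a > 0" "f b < 0" using assms(3) by (auto simp: mult_less_0_iff)
    then show ?thesis using IVT2'[of f b 0 a] assms(1,2) by auto
  qed
  then obtain y where y: "a \<le> y" "y \<le> b" "f y = 0" by blast
  moreover have "y \<noteq> a" "y \<noteq> b" using assms(3) y(3) by auto
  ultimately show ?thesis using that[of y] by simp
qed

text \<open>After shifting by the middle eigenvalue \<open>b\<close> the quotient by the three twin vertices is
  \<open>[[t p\<^sup>2, 0, p], [0, - t r\<^sup>2, r], [3 p, 3 r, 0]]\<close>, which is singular. The choice
  \<open>p\<^sup>2 - r\<^sup>2 = P / 6\<close> leaves one equation for \<open>w = r\<^sup>2\<close> and makes \<open>p\<^sup>2 \<noteq> r\<^sup>2\<close>, as SSP needs.\<close>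

lemma K23_realizes:
  assumes "a < b" "b < c" shows "realizes_SSP (graph_on 5 E_K23) [b, b, b, a, c]"
proof -
  define s P t where "s = a + c - 2 * b" and "P = (b - a) * (c - b)" and "t = 6 * s / P"
  have P: "P > 0" using assms by (simp add: P_def)
  \<comment> \<open>In the variable \<open>x - b\<close> the quadratic factor must have coefficients
    \<open>- s\<close> and \<open>- P\<close>. The value of \<open>t\<close> settles the first when
    \<open>p\<^sup>2 - r\<^sup>2 = P / 6\<close>, and \<open>f w = 0\<close> is the second with
    \<open>r\<^sup>2 = w\<close>.\<close>
  define f where "f w = t\<^sup>2 * w * (w + P / 6) + 6 * w - P / 2" for w
  have cont: "continuous_on {0..P / 6} f" unfolding f_def by (intro continuous_intros)
  have "f (P / 6) \<ge> P / 2" using P by (simp add: f_def)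
  moreover have "f 0 < 0" using P by (simp add: f_def)
  ultimately have "f 0 * f (P / 6) < 0" using P by (simp add: mult_neg_pos)
  from IVT_root[OF cont _ this] obtain w where w: "0 < w" "f w = 0" using P by auto
  define p r where "p = sqrt (w + P / 6)" and "r = sqrt w"
  have pos: "p > 0" "r > 0" using w P by (simp_all add: p_def r_def add_pos_pos)
  have sq: "p * p = w + P / 6" "r * r = w" using w P by (simp_all add: p_def r_def)
  have tr: "t * (p * p - r * r) = s" using P by (simp add: sq t_def)
  have e2: "t\<^sup>2 * (p * p) * (r * r) + 3 * (p * p) + 3 * (r * r) = P"
    using w(2) unfolding sq f_def by (simp add: algebra_simps)
  have ne: "p * p - r * r \<noteq> 0" using P by (simp add: sq)
  let ?R = "[[b + t * (p * p), 0, p, p, p], [0, b - t * (r * r), r, r, r], [p, r, b, 0, 0], [p, r, 0, b, 0], [p, r, 0, 0, b]]"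
  show ?thesis
  proof (rule realizes_SSP_mat_rows[of _ ?R])
    show "mat_rows 5 ?R \<in> S_graph (graph_on 5 E_K23)"
      using pos by (intro mat_rows_S_graph) (simp_all add: all_less_5 E_K23_def adjacent_def)
    show "char_poly (mat_rows 5 ?R) = roots_poly [b, b, b, a, c]"
    proof (rule char_poly_mat_rows)
      fix x
      have "Determinant.det (Matrix.mat 5 5 (\<lambda>(i, j). (if i = j then x else 0) - ?R ! i ! j)) =
        (x - b) ^ 3 * ((x - b)\<^sup>2 - t * (p * p - r * r) * (x - b) - (t\<^sup>2 * (p * p) * (r * r) + 3 * (p * p) + 3 * (r * r)))"
        by (simp add: det_5 det4_def det3_def det2_def power2_eq_square power3_eq_cube algebra_simps)
      then show "Determinant.det (Matrix.mat 5 5 (\<lambda>(i, j). (if i = j then x else 0) - ?R ! i ! j)) =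
        (\<Prod>a\<leftarrow>[b, b, b, a, c]. x - a)"
        unfolding tr e2 unfolding s_def P_def by (simp add: power2_eq_square power3_eq_cube algebra_simps)
    qed
    show "SSP 5 (mat_rows 5 ?R)"
    proof (rule SSP_mat_rows)
      fix x :: "nat \<Rightarrow> nat \<Rightarrow> real"
      assume s: "\<And>i j. i < 5 \<Longrightarrow> j < 5 \<Longrightarrow> x i j = x j i" and d: "\<And>i. i < 5 \<Longrightarrow> x i i = 0"
        and e: "\<And>i j. i < 5 \<Longrightarrow> j < 5 \<Longrightarrow> ?R ! i ! j \<noteq> 0 \<Longrightarrow> x i j = 0"
        and c: "\<And>i j. i < 5 \<Longrightarrow> j < 5 \<Longrightarrow> (\<Sum>k<5. ?R ! i ! k * x k j) = (\<Sum>k<5. x i k * ?R ! k ! j)"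
      have z: "x 0 2 = 0" "x 0 3 = 0" "x 0 4 = 0" "x 1 2 = 0" "x 1 3 = 0" "x 1 4 = 0"
        using e[of 0 2] e[of 0 3] e[of 0 4] e[of 1 2] e[of 1 3] e[of 1 4] pos by simp_all
      have sy: "x 1 0 = x 0 1" "x 2 0 = x 0 2" "x 3 0 = x 0 3" "x 4 0 = x 0 4" "x 2 1 = x 1 2"
        "x 3 1 = x 1 3" "x 4 1 = x 1 4" "x 3 2 = x 2 3" "x 4 2 = x 2 4" "x 4 3 = x 3 4"
        by (rule s; simp)+
      have dd: "x 0 0 = 0" "x 1 1 = 0" "x 2 2 = 0" "x 3 3 = 0" "x 4 4 = 0" by (rule d; simp)+
      have q: "p * (x 2 3 + x 2 4) - r * x 0 1 = 0" "r * (x 2 3 + x 2 4) - p * x 0 1 = 0"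
        "p * (x 2 3 + x 3 4) - r * x 0 1 = 0" "p * (x 2 4 + x 3 4) - r * x 0 1 = 0"
        using c[of 0 2] c[of 1 2] c[of 0 3] c[of 0 4]
        by (simp_all add: sum_5 z sy dd algebra_simps del: One_nat_def mult_eq_0_iff mult_cancel_left mult_cancel_right)
      have "(p * p - r * r) * x 0 1 = r * (p * (x 2 3 + x 2 4) - r * x 0 1) - p * (r * (x 2 3 + x 2 4) - p * x 0 1)"
        by (simp add: algebra_simps)
      also have "\<dots> = 0" unfolding q by simp
      finally have x01: "x 0 1 = 0" using ne by simp
      have "x 2 3 + x 2 4 = 0" "x 2 3 + x 3 4 = 0" "x 2 4 + x 3 4 = 0"
        using q(1,3,4) x01 pos by simp_all
      then have "x 2 3 = 0" "x 2 4 = 0" "x 3 4 = 0" by linarith+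
      then show "\<forall>i<5. \<forall>j<5. x i j = 0" unfolding all_less_5 using z sy dd x01 by simp
    qed
  qed
qed

lemma realizes_mat_rows:
  assumes "mat_rows n R \<in> S_graph (graph_on n E)" "char_poly (mat_rows n R) = roots_poly L"
  shows "realizes (graph_on n E) L"
  using assms unfolding realizes_def by blast

text \<open>The scheme of \<open>K13_realizes\<close> with four leaves, stopping at
  \<open>realizes\<close>: by \<open>not_SMP_K14\<close> no such matrix has the strong
  property.\<close>

lemma K14_realizes:
  assumes "a < b" "b < c" shows "realizes (graph_on 5 E_K14) [b, b, b, a, c]"
proof -
  define t where "t = sqrt ((b - a) * (c - b) / 4)"
  have t: "t > 0" and sq: "4 * (t * t) = (b - a) * (c - b)" using assms by (simp_all add: t_def flip: power2_eq_square)
  let ?R = "[[a + c - b, t, t, t, t], [t, b, 0, 0, 0], [t, 0, b, 0, 0], [t, 0, 0, b, 0], [t, 0, 0, 0, b]]"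
  show ?thesis
  proof (rule realizes_mat_rows[of _ ?R])
    show "mat_rows 5 ?R \<in> S_graph (graph_on 5 E_K14)"
      using t by (intro mat_rows_S_graph) (simp_all add: all_less_5 E_K14_def adjacent_def)
    show "char_poly (mat_rows 5 ?R) = roots_poly [b, b, b, a, c]"
    proof (rule char_poly_mat_rows)
      fix x
      have "Determinant.det (Matrix.mat 5 5 (\<lambda>(i, j). (if i = j then x else 0) - ?R ! i ! j)) =
        (x - b) ^ 3 * ((x - (a + c - b)) * (x - b) - 4 * (t * t))"
        by (simp add: det_5 det4_def det3_def det2_def power3_eq_cube algebra_simps)
      then show "Determinant.det (Matrix.mat 5 5 (\<lambda>(i, j). (if i = j then x else 0) - ?R ! i ! j)) =
        (\<Prod>a\<leftarrow>[b, b, b, a, c]. x - a)"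
        unfolding sq by (simp add: power3_eq_cube algebra_simps)
    qed
  qed
qed

text \<open>The coefficients \<open>B, C\<close> are determined by evaluating both sides at \<open>z = x\<close> and \<open>z = y\<close>.\<close>

lemma arrow_3_coefficients:
  fixes x y :: real
  assumes "l1 < x" "x < l2" "l2 < y" "y < l3"
  obtains a B C where "B > 0" "C > 0"
    "\<And>z. (z - a) * (z - x) * (z - y) - B * (z - y) - C * (z - x) = (z - l1) * (z - l2) * (z - l3)"
proof (rule that)
  define a where "a = l1 + l2 + l3 - x - y"
  define B where "B = (x - l1) * (x - l2) * (x - l3) / (y - x)"
  define C where "C = (y - l1) * (y - l2) * (l3 - y) / (y - x)"
  show "B > 0" using assms unfolding B_def
    by (intro divide_pos_pos mult_neg_neg mult_pos_neg) auto
  show "C > 0" using assms unfolding C_def by (intro divide_pos_pos mult_pos_pos) auto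
  have d: "y - x \<noteq> 0" using assms by simp
  have B: "(y - x) * B = (x - l1) * (x - l2) * (x - l3)" and C: "(y - x) * C = (y - l1) * (y - l2) * (l3 - y)"
    using d by (simp_all add: B_def C_def)
  fix z
  have "(y - x) * ((z - a) * (z - x) * (z - y) - B * (z - y) - C * (z - x)) =
      (y - x) * ((z - a) * (z - x) * (z - y)) - ((y - x) * B) * (z - y) - ((y - x) * C) * (z - x)"
    by (simp add: algebra_simps)
  also have "\<dots> = (y - x) * ((z - l1) * (z - l2) * (z - l3))"
    unfolding B C a_def by (simp add: algebra_simps)
  finally show "(z - a) * (z - x) * (z - y) - B * (z - y) - C * (z - x) = (z - l1) * (z - l2) * (z - l3)"
    using d by simp
qed

text \<open>On the triangle edge \<open>{1, 2}\<close> the vector \<open>(1, -1)\<close> is an eigenvector for \<open>k1\<close> that is invisible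
  from the centre, and on \<open>{3, 4}\<close> likewise for \<open>k2\<close>; what remains is an arrow matrix.\<close>

lemma Butterfly_realizes:
  assumes l: "l1 < l2" "l2 < l3" and k: "2 * k1 \<noteq> l1 + l2" "2 * k2 \<noteq> l2 + l3"
  shows "realizes (graph_on 5 E_Butterfly) [k1, k2, l1, l2, l3]"
    and "k1 \<noteq> k2 \<Longrightarrow> realizes_SSP (graph_on 5 E_Butterfly) [k1, k2, l1, l2, l3]"
proof -
  \<comment> \<open>Midpoints interlace strictly with the three eigenvalues, as
    \<open>arrow_3_coefficients\<close> demands; the hypotheses on \<open>k1\<close> and
    \<open>k2\<close> say that they avoid these midpoints, so the entries at the edges
    \<open>{1, 2}\<close> and \<open>{3, 4}\<close> are nonzero.\<close>
  define x y where "x = (l1 + l2) / 2" and "y = (l2 + l3) / 2"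
  have xy: "l1 < x" "x < l2" "l2 < y" "y < l3" using l by (simp_all add: x_def y_def)
  obtain a B C where BC: "B > 0" "C > 0" and ar:
    "\<And>z. (z - a) * (z - x) * (z - y) - B * (z - y) - C * (z - x) = (z - l1) * (z - l2) * (z - l3)"
    by (rule arrow_3_coefficients[OF xy]) (rule that)
  define b c where "b = sqrt (B / 2)" and "c = sqrt (C / 2)"
  have pos: "b > 0" "c > 0" "x \<noteq> k1" "y \<noteq> k2" using BC k by (auto simp: b_def c_def x_def y_def)
  have sq: "2 * (b * b) = B" "2 * (c * c) = C" using BC by (simp_all add: b_def c_def)
  let ?R = "[[a, b, b, c, c], [b, (k1 + x) / 2, (x - k1) / 2, 0, 0], [b, (x - k1) / 2, (k1 + x) / 2, 0, 0],
    [c, 0, 0, (k2 + y) / 2, (y - k2) / 2], [c, 0, 0, (y - k2) / 2, (k2 + y) / 2]]"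
  have S: "mat_rows 5 ?R \<in> S_graph (graph_on 5 E_Butterfly)"
    using pos by (intro mat_rows_S_graph) (simp_all add: all_less_5 E_Butterfly_def adjacent_def)
  have cp: "char_poly (mat_rows 5 ?R) = roots_poly [k1, k2, l1, l2, l3]"
  proof (rule char_poly_mat_rows)
    fix z
    have "Determinant.det (Matrix.mat 5 5 (\<lambda>(i, j). (if i = j then z else 0) - ?R ! i ! j)) =
      (z - k1) * (z - k2) * ((z - a) * (z - x) * (z - y) - 2 * (b * b) * (z - y) - 2 * (c * c) * (z - x))"
      by (simp add: det_5 det4_def det3_def det2_def field_simps)
    then show "Determinant.det (Matrix.mat 5 5 (\<lambda>(i, j). (if i = j then z else 0) - ?R ! i ! j)) =
      (\<Prod>a\<leftarrow>[k1, k2, l1, l2, l3]. z - a)"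
      unfolding sq ar by simp
  qed
  show "realizes (graph_on 5 E_Butterfly) [k1, k2, l1, l2, l3]" by (rule realizes_mat_rows[OF S cp])
  assume kk: "k1 \<noteq> k2"
  show "realizes_SSP (graph_on 5 E_Butterfly) [k1, k2, l1, l2, l3]"
  proof (rule realizes_SSP_mat_rows[OF S cp])
    show "SSP 5 (mat_rows 5 ?R)"
    proof (rule SSP_mat_rows)
      fix x :: "nat \<Rightarrow> nat \<Rightarrow> real"
      assume s: "\<And>i j. i < 5 \<Longrightarrow> j < 5 \<Longrightarrow> x i j = x j i" and d: "\<And>i. i < 5 \<Longrightarrow> x i i = 0"
        and e: "\<And>i j. i < 5 \<Longrightarrow> j < 5 \<Longrightarrow> ?R ! i ! j \<noteq> 0 \<Longrightarrow> x i j = 0"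
        and cm: "\<And>i j. i < 5 \<Longrightarrow> j < 5 \<Longrightarrow> (\<Sum>k<5. ?R ! i ! k * x k j) = (\<Sum>k<5. x i k * ?R ! k ! j)"
      have z: "x 0 1 = 0" "x 0 2 = 0" "x 0 3 = 0" "x 0 4 = 0" "x 1 2 = 0" "x 3 4 = 0"
        using e[of 0 1] e[of 0 2] e[of 0 3] e[of 0 4] e[of 1 2] e[of 3 4] pos by simp_all
      have sy: "x 1 0 = x 0 1" "x 2 0 = x 0 2" "x 3 0 = x 0 3" "x 4 0 = x 0 4" "x 2 1 = x 1 2"
        "x 3 1 = x 1 3" "x 4 1 = x 1 4" "x 3 2 = x 2 3" "x 4 2 = x 2 4" "x 4 3 = x 3 4"
        by (rule s; simp)+
      have dd: "x 0 0 = 0" "x 1 1 = 0" "x 2 2 = 0" "x 3 3 = 0" "x 4 4 = 0" by (rule d; simp)+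
      have "b * (x 1 3 + x 2 3) = 0" "b * (x 1 4 + x 2 4) = 0" "c * (x 1 3 + x 1 4) = 0"
        using cm[of 0 3] cm[of 0 4] cm[of 0 1]
        by (simp_all add: sum_5 z sy dd algebra_simps del: One_nat_def mult_eq_0_iff mult_cancel_left mult_cancel_right)
      then have r: "x 2 3 = - x 1 3" "x 1 4 = - x 1 3" "x 2 4 = x 1 3" using pos by simp_all
      \<comment> \<open>By \<open>r\<close> the test matrix is a multiple of the symmetrized product
        of the two antisymmetric eigenvectors; commuting with \<open>A\<close> compares their
        eigenvalues \<open>k1\<close> and \<open>k2\<close>.\<close>
      have "(k1 + y') / 2 * x 1 3 + (y' - k1) / 2 * x 2 3 = (k2 + w') / 2 * x 1 3 + (w' - k2) / 2 * x 1 4 \<Longrightarrow> (k1 - k2) * x 1 3 = 0" for y' w'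
        unfolding r by (simp add: field_simps)
      then have "(k1 - k2) * x 1 3 = 0"
        using cm[of 1 3] by (simp add: sum_5 z sy dd mult.commute del: One_nat_def mult_eq_0_iff)
      then have "x 1 3 = 0" using kk by simp
      then show "\<forall>i<5. \<forall>j<5. x i j = 0" unfolding all_less_5 using z sy dd r by simp
    qed
  qed
qed

text \<open>Starting from a star matrix with spectrum \<open>b, b, b, a, c\<close>, the edge
  \<open>{1, 2}\<close> changes only the eigenvalue of the vector antisymmetric in 1 and 2, moving
  it from \<open>b\<close> to \<open>a\<close>.\<close>

lemma Campstool_realizes:
  assumes "a < b" "b < c" shows "realizes_SSP (graph_on 5 E_Campstool) [a, a, b, b, c]"
proof -
  define t where "t = sqrt ((b - a) * (c - b) / 4)"
  have pos: "t > 0" "b - a > 0" and sq: "4 * (t * t) = (b - a) * (c - b)" using assms by (simp_all add: t_def flip: power2_eq_square)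
  let ?R = "[[a + c - b, t, t, t, t], [t, (a + b) / 2, (b - a) / 2, 0, 0], [t, (b - a) / 2, (a + b) / 2, 0, 0],
    [t, 0, 0, b, 0], [t, 0, 0, 0, b]]"
  show ?thesis
  proof (rule realizes_SSP_mat_rows[of _ ?R])
    show "mat_rows 5 ?R \<in> S_graph (graph_on 5 E_Campstool)"
      using pos by (intro mat_rows_S_graph) (simp_all add: all_less_5 E_Campstool_def adjacent_def)
    show "char_poly (mat_rows 5 ?R) = roots_poly [a, a, b, b, c]"
    proof (rule char_poly_mat_rows)
      fix x
      have "Determinant.det (Matrix.mat 5 5 (\<lambda>(i, j). (if i = j then x else 0) - ?R ! i ! j)) =
        (x - a) * (x - b)\<^sup>2 * ((x - (a + c - b)) * (x - b) - 4 * (t * t))"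
        by (simp add: det_5 det4_def det3_def det2_def power2_eq_square field_simps)
      then show "Determinant.det (Matrix.mat 5 5 (\<lambda>(i, j). (if i = j then x else 0) - ?R ! i ! j)) =
        (\<Prod>a\<leftarrow>[a, a, b, b, c]. x - a)"
        unfolding sq by (simp add: power2_eq_square algebra_simps)
    qed
    show "SSP 5 (mat_rows 5 ?R)"
    proof (rule SSP_mat_rows)
      fix x :: "nat \<Rightarrow> nat \<Rightarrow> real"
      assume s: "\<And>i j. i < 5 \<Longrightarrow> j < 5 \<Longrightarrow> x i j = x j i" and d: "\<And>i. i < 5 \<Longrightarrow> x i i = 0"
        and e: "\<And>i j. i < 5 \<Longrightarrow> j < 5 \<Longrightarrow> ?R ! i ! j \<noteq> 0 \<Longrightarrow> x i j = 0"
        and c: "\<And>i j. i < 5 \<Longrightarrow> j < 5 \<Longrightarrow> (\<Sum>k<5. ?R ! i ! k * x k j) = (\<Sum>k<5. x i k * ?R ! k ! j)"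
      have z: "x 0 1 = 0" "x 0 2 = 0" "x 0 3 = 0" "x 0 4 = 0" "x 1 2 = 0"
        using e[of 0 1] e[of 0 2] e[of 0 3] e[of 0 4] e[of 1 2] pos by simp_all
      have sy: "x 1 0 = x 0 1" "x 2 0 = x 0 2" "x 3 0 = x 0 3" "x 4 0 = x 0 4" "x 2 1 = x 1 2"
        "x 3 1 = x 1 3" "x 4 1 = x 1 4" "x 3 2 = x 2 3" "x 4 2 = x 2 4" "x 4 3 = x 3 4"
        by (rule s; simp)+
      have dd: "x 0 0 = 0" "x 1 1 = 0" "x 2 2 = 0" "x 3 3 = 0" "x 4 4 = 0" by (rule d; simp)+
      have "t * (x 1 3 + x 2 3 + x 3 4) = 0" "t * (x 1 4 + x 2 4 + x 3 4) = 0" "t * (x 1 3 + x 1 4) = 0"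
        using c[of 0 3] c[of 0 4] c[of 0 1]
        by (simp_all add: sum_5 z sy dd algebra_simps del: One_nat_def mult_eq_0_iff mult_cancel_left mult_cancel_right)
      then have q: "x 1 3 + x 2 3 + x 3 4 = 0" "x 1 4 + x 2 4 + x 3 4 = 0" "x 1 3 + x 1 4 = 0" using pos by simp_all
      have h: "(b - a) * (v - u) = 0" if "(a + b) * u / 2 + (b - a) * v / 2 = b * u" for u v
        using that by (simp add: field_simps)
      have "(b - a) * (x 2 3 - x 1 3) = 0" "(b - a) * (x 2 4 - x 1 4) = 0"
        by (rule h, use c[of 1 3] c[of 1 4] in \<open>simp add: sum_5 z sy dd mult.commute del: One_nat_def\<close>)+
      then have "x 2 3 = x 1 3" "x 2 4 = x 1 4" using pos by simp_all
      then have "x 1 3 = 0" "x 1 4 = 0" "x 2 3 = 0" "x 2 4 = 0" "x 3 4 = 0" using q by linarith+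
      then show "\<forall>i<5. \<forall>j<5. x i j = 0" unfolding all_less_5 using z sy dd by simp
    qed
  qed
qed

text \<open>A cycle with a reflection that fixes vertex 4 up to sign. With \<open>y = (q - s)\<close> and \<open>y' = q + s\<close> the
  symmetric part is \<open>[[p, r], [r, y']]\<close> and the antisymmetric part is the Jacobi matrix with diagonal
  \<open>y, p, e\<close> and squared off-diagonal entries \<open>r\<^sup>2, 2 t\<^sup>2\<close>, all shifted by \<open>d\<close>. Both are singular.\<close>

lemma C5_family:
  fixes p r y y' e t :: real
  assumes nz: "r \<noteq> 0" "t \<noteq> 0" "y \<noteq> y'" and r: "r * r = p * y'"
    and sing: "p * y * e = r * r * e + 2 * (t * t) * y"
    and x: "x2 + x3 = p + y + e" "x2 * x3 = p * y + p * e + y * e - r * r - 2 * (t * t)"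
    and ssp: "(y - e) * (y' - y) + 2 * (t * t) \<noteq> 0 \<or> (p - y') * (2 * (t * t)) + r * r * (y' - y) \<noteq> 0"
  shows "realizes_SSP (graph_on 5 E_C5) [d, d + (p + y'), d, d + x2, d + x3]"
proof -
  define q s where "q = (y + y') / 2" and "s = (y' - y) / 2"
  have pos: "r \<noteq> 0" "t \<noteq> 0" "s \<noteq> 0" using nz by (simp_all add: s_def)
  have yy: "y = q - s" "y' = q + s" by (simp_all add: q_def s_def field_simps)
  let ?R = "[[d + p, r, 0, 0, t], [r, d + q, s, 0, 0], [0, s, d + q, r, 0], [0, 0, r, d + p, - t], [t, 0, 0, - t, d + e]]"
  show ?thesis
  proof (rule realizes_SSP_mat_rows[of _ ?R])
    show "mat_rows 5 ?R \<in> S_graph (graph_on 5 E_C5)"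
      using pos by (intro mat_rows_S_graph) (simp_all add: all_less_5 E_C5_def adjacent_def)
    show "char_poly (mat_rows 5 ?R) = roots_poly [d, d + (p + y'), d, d + x2, d + x3]"
    proof (rule char_poly_mat_rows)
      fix x
      define z where "z = x - d"
      have sh: "x - (d + u) = z - u" for u by (simp add: z_def)
      have m1: "(z - p) * (z - y') - r * r = z * (z - (p + y'))" unfolding r by (simp add: algebra_simps)
      have m2: "(z - p) * (z - y) * (z - e) - r * r * (z - e) - 2 * (t * t) * (z - y) = z * (z - x2) * (z - x3)"
      proof -
        have "(z - p) * (z - y) * (z - e) - r * r * (z - e) - 2 * (t * t) * (z - y) =
          z * (z * z - (p + y + e) * z + (p * y + p * e + y * e - r * r - 2 * (t * t)))
            - (p * y * e - (r * r * e + 2 * (t * t) * y))" by (simp add: algebra_simps)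
        also have "\<dots> = z * (z - x2) * (z - x3)" unfolding sing x[symmetric] by (simp add: algebra_simps)
        finally show ?thesis .
      qed
      have m3: "Determinant.det (Matrix.mat 5 5 (\<lambda>(i, j). (if i = j then x else 0) - ?R ! i ! j)) =
        ((z - p) * (z - y') - r * r) * ((z - p) * (z - y) * (z - e) - r * r * (z - e) - 2 * (t * t) * (z - y))"
        unfolding yy det_5 det4_def det3_def det2_def by (simp add: sh) (simp add: algebra_simps)
      show "Determinant.det (Matrix.mat 5 5 (\<lambda>(i, j). (if i = j then x else 0) - ?R ! i ! j)) =
        (\<Prod>a\<leftarrow>[d, d + (p + y'), d, d + x2, d + x3]. x - a)"
        unfolding m3 m1 m2 by (simp add: sh z_def[symmetric] mult_ac)
    qed
    show "SSP 5 (mat_rows 5 ?R)"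
    proof (rule SSP_mat_rows)
      fix x :: "nat \<Rightarrow> nat \<Rightarrow> real"
      assume s: "\<And>i j. i < 5 \<Longrightarrow> j < 5 \<Longrightarrow> x i j = x j i" and d0: "\<And>i. i < 5 \<Longrightarrow> x i i = 0"
        and e: "\<And>i j. i < 5 \<Longrightarrow> j < 5 \<Longrightarrow> ?R ! i ! j \<noteq> 0 \<Longrightarrow> x i j = 0"
        and c: "\<And>i j. i < 5 \<Longrightarrow> j < 5 \<Longrightarrow> (\<Sum>k<5. ?R ! i ! k * x k j) = (\<Sum>k<5. x i k * ?R ! k ! j)"
      have z: "x 0 1 = 0" "x 0 4 = 0" "x 1 2 = 0" "x 2 3 = 0" "x 3 4 = 0"
        using e[of 0 1] e[of 0 4] e[of 1 2] e[of 2 3] e[of 3 4] pos by simp_all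
      have sy: "x 1 0 = x 0 1" "x 2 0 = x 0 2" "x 3 0 = x 0 3" "x 4 0 = x 0 4" "x 2 1 = x 1 2"
        "x 3 1 = x 1 3" "x 4 1 = x 1 4" "x 3 2 = x 2 3" "x 4 2 = x 2 4" "x 4 3 = x 3 4"
        by (rule s; simp)+
      have dd: "x 0 0 = 0" "x 1 1 = 0" "x 2 2 = 0" "x 3 3 = 0" "x 4 4 = 0" by (rule d0; simp)+
      have e1: "t * x 1 4 = s * x 0 2" and e2: "r * x 0 2 = r * x 1 3" and e3: "s * x 1 3 + t * x 2 4 = 0"
        and e4: "r * x 2 4 = t * x 0 3" and e5: "p * x 0 2 + t * x 2 4 = q * x 0 2 + r * x 0 3"
        and e6: "q * x 1 4 + s * x 2 4 + t * x 1 3 = e * x 1 4"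
        using c[of 0 1] c[of 1 2] c[of 2 3] c[of 3 4] c[of 0 2] c[of 1 4]
        by (simp_all add: sum_5 z sy dd algebra_simps del: One_nat_def mult_eq_0_iff mult_cancel_left mult_cancel_right)
      have x13: "x 1 3 = x 0 2" using e2 pos by simp
      have z1: "q * x 1 4 + s * x 2 4 + t * x 1 3 - e * x 1 4 = 0" and z2: "t * x 1 4 - s * x 0 2 = 0"
        and z4: "x 1 3 - x 0 2 = 0" and z5: "p * x 0 2 + t * x 2 4 - (q * x 0 2 + r * x 0 3) = 0"
        and z6: "r * x 2 4 - t * x 0 3 = 0"
        using e1 e4 e5 e6 x13 by simp_all
      \<comment> \<open>The multipliers in this and the next combination eliminate every unknown
        except \<open>x 0 2\<close>; the coefficients that remain are the two expressions in
        \<open>ssp\<close>.\<close>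
      have "((y - e) * (y' - y) + 2 * (t * t)) * x 0 2 = 2 * t * (q * x 1 4 + s * x 2 4 + t * x 1 3 - e * x 1 4)
          - 2 * (q - e) * (t * x 1 4 - s * x 0 2) - 2 * s * (s * x 1 3 + t * x 2 4) + 2 * (s * s - t * t) * (x 1 3 - x 0 2)"
        unfolding yy by (simp add: algebra_simps)
      also have "\<dots> = 0" unfolding z1 z2 e3 z4 by simp
      finally have 1: "((y - e) * (y' - y) + 2 * (t * t)) * x 0 2 = 0" .
      have "((p - y') * (2 * (t * t)) + r * r * (y' - y)) * x 0 2 = 2 * t * t * (p * x 0 2 + t * x 2 4 - (q * x 0 2 + r * x 0 3))
          - 2 * r * t * (r * x 2 4 - t * x 0 3) - 2 * (t * t - r * r) * (s * x 1 3 + t * x 2 4) + 2 * s * (t * t - r * r) * (x 1 3 - x 0 2)"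
        unfolding yy by (simp add: algebra_simps)
      also have "\<dots> = 0" unfolding z5 z6 e3 z4 by simp
      finally have 2: "((p - y') * (2 * (t * t)) + r * r * (y' - y)) * x 0 2 = 0" .
      have x02: "x 0 2 = 0" using 1 2 ssp by (metis mult_eq_0_iff)
      then have "x 1 4 = 0" "x 2 4 = 0" using e1 e3 x13 pos by simp_all
      moreover have "x 0 3 = 0" using e4 \<open>x 2 4 = 0\<close> pos by simp
      ultimately show "\<forall>i<5. \<forall>j<5. x i j = 0" unfolding all_less_5 using z sy dd x02 x13 by simp
    qed
  qed
qed

text \<open>Eliminating \<open>e\<close> and \<open>t\<close> from the conditions of \<open>C5_family\<close> leaves a cubic equation for \<open>y\<close>.\<close>

lemma C5_realizes_of_root:
  fixes p y y' :: real
  assumes p: "p > 0" "y' > 0" and y: "y \<noteq> 0" and e: "e = x2 + x3 - p - y"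
    and root: "p * y * (y - y') + (p * y' + y\<^sup>2) * e - x2 * x3 * y = 0"
    and t2: "p * e * (y - y') / y > 0"
    and ssp: "y\<^sup>2 \<noteq> e * (y + p) \<or> e * (p - y') \<noteq> y * y'"
  shows "realizes_SSP (graph_on 5 E_C5) [d, d + (p + y'), d, d + x2, d + x3]"
proof -
  \<comment> \<open>\<open>T\<close> stands for \<open>2 * (t * t)\<close>, solved from the
    singularity condition of \<open>C5_family\<close> with \<open>r * r = p * y'\<close>.\<close>
  define T where "T = p * e * (y - y') / y"
  define r t where "r = sqrt (p * y')" and "t = sqrt (T / 2)"
  have r: "r * r = p * y'" "r \<noteq> 0" using p by (simp_all add: r_def)
  have "T > 0" using t2 by (simp add: T_def)
  then have "t * t = T / 2" and t: "t \<noteq> 0" by (simp_all add: t_def)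
  then have tt: "2 * (t * t) = p * e * (y - y') / y" by (simp add: T_def)
  have ne: "y \<noteq> y'" using t2 by auto
  have tty: "2 * (t * t) * y = p * e * (y - y')" unfolding tt using y by simp
  show ?thesis
  proof (rule C5_family[OF r(2) t ne r(1)])
    show "p * y * e = r * r * e + 2 * (t * t) * y" unfolding tty r(1) by (simp add: algebra_simps)
    show "x2 + x3 = p + y + e" by (simp add: e)
    have "x2 * x3 * y = (p * y + p * e + y * e - r * r - 2 * (t * t)) * y"
      unfolding left_diff_distrib tty r(1) using root by (simp add: algebra_simps power2_eq_square)
    then show "x2 * x3 = p * y + p * e + y * e - r * r - 2 * (t * t)" using y by simp
    \<comment> \<open>Multiplied by \<open>y\<close>, both coefficients required by
      \<open>C5_family\<close> contain the factor \<open>y' - y\<close>; what is left are the two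
      alternatives in \<open>ssp\<close>.\<close>
    have "y * ((y - e) * (y' - y) + 2 * (t * t)) = (y' - y) * (y\<^sup>2 - e * (y + p))"
      unfolding distrib_left mult.commute[of y "2 * (t * t)"] tty by (simp add: algebra_simps power2_eq_square)
    moreover have "y * ((p - y') * (2 * (t * t)) + r * r * (y' - y)) = p * ((y' - y) * (y * y' - e * (p - y')))"
    proof -
      have "y * ((p - y') * (2 * (t * t)) + r * r * (y' - y)) = (p - y') * (2 * (t * t) * y) + y * (r * r) * (y' - y)"
        by (simp add: algebra_simps)
      then show ?thesis unfolding tty r(1) by (simp add: algebra_simps)
    qed
    ultimately show "(y - e) * (y' - y) + 2 * (t * t) \<noteq> 0 \<or> (p - y') * (2 * (t * t)) + r * r * (y' - y) \<noteq> 0"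
      using ssp ne p by (metis eq_iff_diff_eq_0 less_irrefl mult_eq_0_iff)
  qed
qed

text \<open>In the next three lemmas the second factor of the shifted cubic is located by its signs at
  \<open>y = y'\<close> and \<open>y = C\<close>, where \<open>C = x2 + x3 - p\<close> is the sum of \<open>y\<close> and \<open>e\<close>.\<close>

lemma C5_realizes_221:
  assumes "a < b" "b < c" shows "realizes_SSP (graph_on 5 E_C5) [a, b, a, b, c]"
proof -
  define \<beta> x3 g where "\<beta> = b - a" and "x3 = c - a" and "g = c - b"
  have bg: "\<beta> > 0" "g > 0" "x3 = \<beta> + g" using assms by (simp_all add: \<beta>_def x3_def g_def)
  \<comment> \<open>Small enough for \<open>f y'\<close> below to be positive: its two negative
    terms amount to at most a half and a sixteenth of \<open>\<beta> * g\<close>.\<close>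
  define p where "p = min \<beta> g / 4"
  have p: "p > 0" "p \<le> \<beta> / 4" "p \<le> g / 4" using bg by (simp_all add: p_def)
  define y' C where "y' = \<beta> - p" and "C = \<beta> + x3 - p"
  have y': "y' > 0" "p < y'" "y' < C" using p bg by (simp_all add: y'_def C_def)
  \<comment> \<open>Here \<open>p + y'\<close> equals the root \<open>x2 = \<beta>\<close>, so
    \<open>y = y'\<close> solves the cubic; that solution would make \<open>t\<close> zero, and
    \<open>f\<close> is the quadratic factor left after removing it.\<close>
  define f where "f y = - (y\<^sup>2 - (x3 + p) * y + p * C)" for y
  have cont: "continuous_on {y'..C} f" unfolding f_def by (intro continuous_intros)
  have "f y' = \<beta> * g - 2 * (p * g) - p * p"
    by (simp add: f_def y'_def C_def bg(3) power2_eq_square algebra_simps)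
  moreover have "p * g \<le> \<beta> / 4 * g" by (rule mult_right_mono) (use p bg in simp_all)
  moreover have "p * p \<le> \<beta> / 4 * (g / 4)" by (rule mult_mono) (use p bg in simp_all)
  moreover have "\<beta> * g > 0" using bg by simp
  ultimately have "f y' > 0" by simp
  moreover have "f C = - (C * (\<beta> - p))"
    by (simp add: f_def C_def power2_eq_square algebra_simps)
  then have "f C < 0" using y' p bg by (simp add: y'_def)
  ultimately have "f y' * f C < 0" by (rule mult_pos_neg)
  from IVT_root[OF cont less_imp_le[OF y'(3)] this] obtain y where y: "y' < y" "y < C" "f y = 0" by blast
  define e where "e = C - y"
  have e: "e > 0" "y > 0" using y y' by (simp_all add: e_def)
  have "realizes_SSP (graph_on 5 E_C5) [a, a + (p + y'), a, a + \<beta>, a + x3]"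
  proof (rule C5_realizes_of_root[where y = y and e = e])
    show "e = \<beta> + x3 - p - y" by (simp add: e_def C_def)
    have "p * y * (y - y') + (p * y' + y\<^sup>2) * e - \<beta> * x3 * y = (y - y') * f y"
      by (simp add: f_def e_def C_def y'_def power2_eq_square algebra_simps)
    then show "p * y * (y - y') + (p * y' + y\<^sup>2) * e - \<beta> * x3 * y = 0" using y(3) by simp
    show "0 < p * e * (y - y') / y" using p e y by simp
    \<comment> \<open>The second alternative of \<open>ssp\<close> holds by signs, thanks to
      \<open>p < y'\<close>.\<close>
    have "e * (p - y') < 0" "y * y' > 0" using e y' by (simp_all add: mult_pos_neg)
    then show "y\<^sup>2 \<noteq> e * (y + p) \<or> e * (p - y') \<noteq> y * y'" by linarith
  qed (use p y' e in simp_all)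
  then show ?thesis by (simp add: y'_def \<beta>_def x3_def)
qed

lemma C5_realizes_2111:
  assumes "l1 < l2" "l2 < l3" "l3 < l4" shows "realizes_SSP (graph_on 5 E_C5) [l1, l3, l1, l2, l4]"
proof -
  define x2 \<beta> x3 where "x2 = l2 - l1" and "\<beta> = l3 - l1" and "x3 = l4 - l1"
  have o: "0 < x2" "x2 < \<beta>" "\<beta> < x3" using assms by (simp_all add: x2_def \<beta>_def x3_def)
  \<comment> \<open>This \<open>p\<close> gives \<open>2 * p < x2\<close>, hence
    \<open>p < y'\<close>, and \<open>p * (T - \<beta>) < x2 * x3\<close>, which makes the cubic
    negative at \<open>C\<close>.\<close>
  define T p where "T = x2 + x3" and "p = x2 * x3 / (2 * T)"
  have T: "T > 0" "\<beta> < T" using o by (simp_all add: T_def)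
  have pT: "2 * (p * T) = x2 * x3" using T by (simp add: p_def)
  have p0: "p > 0" using o T by (simp add: p_def)
  have "2 * (p * T) < x2 * T" unfolding pT using o by (simp add: T_def)
  then have "(2 * p) * T < x2 * T" by simp
  then have p: "2 * p < x2" using T by simp
  define y' C where "y' = \<beta> - p" and "C = T - p"
  have y': "y' > 0" "p < y'" "y' < C" using p p0 o T by (simp_all add: y'_def C_def)
  define f where "f y = p * y * (y - y') + (p * y' + y\<^sup>2) * (C - y) - x2 * x3 * y" for y
  have cont: "continuous_on {y'..C} f" unfolding f_def by (intro continuous_intros)
  have "f y' = y' * ((\<beta> - x2) * (x3 - \<beta>))"
    by (simp add: f_def y'_def C_def T_def power2_eq_square algebra_simps)
  then have 1: "f y' > 0" using y' o by simp
  have "f C = C * (p * (T - \<beta>) - x2 * x3)"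
    by (simp add: f_def y'_def C_def power2_eq_square algebra_simps)
  moreover have "p * (T - \<beta>) < x2 * x3"
  proof -
    have "p * (T - \<beta>) \<le> p * T" using p0 o by simp
    then show ?thesis using pT p0 T by (smt (verit) mult_pos_pos)
  qed
  ultimately have "f C < 0" using y' by (simp add: mult_pos_neg)
  with 1 have "f y' * f C < 0" by (rule mult_pos_neg)
  from IVT_root[OF cont less_imp_le[OF y'(3)] this] obtain y where y: "y' < y" "y < C" "f y = 0" by blast
  define e where "e = C - y"
  have e: "e > 0" "y > 0" using y y' by (simp_all add: e_def)
  have "realizes_SSP (graph_on 5 E_C5) [l1, l1 + (p + y'), l1, l1 + x2, l1 + x3]"
  proof (rule C5_realizes_of_root[where y = y and e = e])
    show "e = x2 + x3 - p - y" by (simp add: e_def C_def T_def)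
    show "p * y * (y - y') + (p * y' + y\<^sup>2) * e - x2 * x3 * y = 0" using y(3) by (simp add: f_def e_def)
    show "0 < p * e * (y - y') / y" using p0 e y by simp
    have "e * (p - y') < 0" "y * y' > 0" using e y' by (simp_all add: mult_pos_neg)
    then show "y\<^sup>2 \<noteq> e * (y + p) \<or> e * (p - y') \<noteq> y * y'" by linarith
  qed (use p0 y' e in simp_all)
  then show ?thesis by (simp add: y'_def \<beta>_def x2_def x3_def)
qed

lemma C5_realizes_1211:
  assumes "l1 < l2" "l2 < l3" "l3 < l4" shows "realizes_SSP (graph_on 5 E_C5) [l2, l4, l2, l1, l3]"
proof -
  define n \<beta> x3 where "n = l2 - l1" and "\<beta> = l4 - l2" and "x3 = l3 - l2"
  have o: "0 < n" "0 < x3" "x3 < \<beta>" using assms by (simp_all add: n_def \<beta>_def x3_def)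
  \<comment> \<open>The shift is now by the inner eigenvalue \<open>l2\<close>, so one root,
    \<open>- n\<close>, is negative and the sum \<open>T\<close> of the two roots has no definite
    sign; hence the case distinction below.\<close>
  define T where "T = x3 - n"
  have T: "T < \<beta>" using o by (simp add: T_def)
  have nx: "n * x3 > 0" "\<beta> - T > 0" using o T by simp_all
  \<comment> \<open>Half of the smallest of the bounds \<open>\<beta>\<close>,
    \<open>n * x3 / (\<beta> - T)\<close> and, if \<open>T\<close> is positive, \<open>T\<close>;
    the last one keeps \<open>C\<close> positive in that case.\<close>
  define p where "p = (if T > 0 then min (min \<beta> T) (n * x3 / (\<beta> - T)) / 2 else min \<beta> (n * x3 / (\<beta> - T)) / 2)"
  have p: "p > 0" "p < \<beta>" using o nx by (auto simp: p_def min_def)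
  have "(if T > 0 then min (min \<beta> T) u / 2 else min \<beta> u / 2) \<le> u / 2" for u by auto
  then have "p \<le> n * x3 / (\<beta> - T) / 2" unfolding p_def .
  also have "\<dots> < n * x3 / (\<beta> - T)"
  proof -
    have "u / 2 < u" if "u > 0" for u :: real using that by simp
    then show ?thesis using divide_pos_pos[OF nx] by blast
  qed
  finally have pb: "p * (\<beta> - T) < n * x3" using nx by (simp add: pos_less_divide_eq)
  define y' C where "y' = \<beta> - p" and "C = T - p"
  have y': "y' > 0" "C < y'" using p T by (simp_all add: y'_def C_def)
  define f where "f y = p * y * (y - y') + (p * y' + y\<^sup>2) * (C - y) + n * x3 * y" for y
  have cont: "continuous_on A f" for A unfolding f_def by (intro continuous_intros)
  have fC: "f C = C * (n * x3 - p * (\<beta> - T))"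
    by (simp add: f_def y'_def C_def power2_eq_square algebra_simps)
  have "\<exists>y. f y = 0 \<and> (C - y) * (y - y') / y > 0 \<and> y \<noteq> 0 \<and> y\<^sup>2 \<noteq> (C - y) * (y + p)"
  proof (cases "T > 0")
    case True
    then have "p < T" using o by (auto simp: p_def min_def)
    then have C: "C > 0" by (simp add: C_def)
    have "f C > 0" unfolding fC using C pb by simp
    moreover have "f y' = - (y' * ((\<beta> + n) * (\<beta> - x3)))"
      by (simp add: f_def y'_def C_def T_def power2_eq_square algebra_simps)
    then have "f y' < 0" using y' o by simp
    ultimately have "f C * f y' < 0" by (rule mult_pos_neg)
    from IVT_root[OF cont less_imp_le[OF y'(2)] this] obtain y where y: "C < y" "y < y'" "f y = 0" by blast
    have "(C - y) * (y - y') > 0" using y by (intro mult_neg_neg) simp_all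
    moreover have "y > 0" using y C by simp
    moreover have "(C - y) * (y + p) < 0" using y C p by (intro mult_neg_pos) simp_all
    then have "(C - y) * (y + p) < y\<^sup>2" by (rule less_le_trans) simp
    ultimately show ?thesis using y(3) by (intro exI[of _ y] conjI divide_pos_pos) simp_all
  next
    case False
    then have C: "C < 0" using p by (simp add: C_def)
    have "f C < 0" unfolding fC using C pb by (simp add: mult_neg_pos)
    \<comment> \<open>The root is now sought to the left of \<open>C\<close>, where \<open>y\<close>
      and \<open>y - y'\<close> are negative and \<open>C - y\<close> is positive. \<open>M\<close>
      exceeds 1 and \<open>n * x3\<close>, which suffices for \<open>f\<close> to be positive at
      \<open>C - M\<close>.\<close>
    define M where "M = n * x3 + 1"
    have M: "M \<ge> 1" "n * x3 \<le> M" using nx by (simp_all add: M_def)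
    define w where "w = M - C"
    have w: "w > 0" "w \<ge> 1" using M C by (simp_all add: w_def)
    have "f (C - M) = p * w * (w + y') + p * y' * M + w * (w * M - n * x3)"
      by (simp add: f_def w_def power2_eq_square algebra_simps)
    moreover have "p * w * (w + y') > 0" "p * y' * M > 0" using p w y' M by simp_all
    moreover have "1 * M \<le> w * M" by (rule mult_right_mono) (use w M in simp_all)
    then have "w * M \<ge> n * x3" using M(2) by linarith
    then have "w * (w * M - n * x3) \<ge> 0" using w by simp
    ultimately have "f (C - M) > 0" by linarith
    then have "f (C - M) * f C < 0" using \<open>f C < 0\<close> by (rule mult_pos_neg)
    then obtain y where y: "C - M < y" "y < C" "f y = 0"
      using IVT_root[OF cont, of "C - M" C] M by auto
    have "(C - y) * ((y - y') / y) > 0" using y C y' by (intro mult_pos_pos divide_neg_neg) simp_all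
    moreover have "C \<le> - p" using False by (simp add: C_def)
    then have "(C - y) * (y + p) < 0" using y by (intro mult_pos_neg) simp_all
    then have "(C - y) * (y + p) < y\<^sup>2" by (rule less_le_trans) simp
    ultimately show ?thesis using y C by (intro exI[of _ y]) (simp add: less_imp_neq)
  qed
  then obtain y where y: "f y = 0" "(C - y) * (y - y') / y > 0" "y \<noteq> 0" "y\<^sup>2 \<noteq> (C - y) * (y + p)" by blast
  have "realizes_SSP (graph_on 5 E_C5) [l2, l2 + (p + y'), l2, l2 + (- n), l2 + x3]"
  proof (rule C5_realizes_of_root[where y = y and e = "C - y"])
    show "C - y = - n + x3 - p - y" by (simp add: C_def T_def)
    show "p * y * (y - y') + (p * y' + y\<^sup>2) * (C - y) - - n * x3 * y = 0" using y(1) by (simp add: f_def)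
    have "p * ((C - y) * (y - y') / y) > 0" by (rule mult_pos_pos[OF p(1) y(2)])
    then show "0 < p * (C - y) * (y - y') / y" by (simp add: mult.assoc)
  qed (use p y' y in simp_all)
  then show ?thesis by (simp add: y'_def \<beta>_def n_def x3_def)
qed

subsection \<open>Arbitrary spectra for the minimal graphs\<close>

lemma realizes_perm:
  assumes "mset L = mset L'"
  shows "realizes G L \<Longrightarrow> realizes G L'" "realizes_SSP G L \<Longrightarrow> realizes_SSP G L'"
  using realizes_cong[OF assms] by simp_all

lemma realizes_SSP_isolated_4:
  assumes "realizes_SSP (graph_on 4 E) L" "\<forall>(u, v) \<in> set E. u < 4 \<and> v < 4 \<and> u \<noteq> v" "c \<notin> set L"
    "mset (L @ [c]) = mset L'"
  shows "realizes_SSP (graph_of E) L'"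
  using realizes_perm(2)[OF assms(4)] realizes_SSP_isolated_graph_on[OF assms(2,1,3)]
  by (simp add: graph_of_graph_on)

lemma realizes_SSP_isolated_3:
  assumes "realizes_SSP (graph_on 3 E) L" "\<forall>(u, v) \<in> set E. u < 3 \<and> v < 3 \<and> u \<noteq> v" "b \<notin> set L" "c \<notin> set (L @ [b])"
    "mset (L @ [b] @ [c]) = mset L'"
  shows "realizes_SSP (graph_of E) L'"
proof (rule realizes_SSP_isolated_4[where L = "L @ [b]" and c = c])
  show "realizes_SSP (graph_on 4 E) (L @ [b])"
    using realizes_SSP_isolated_graph_on[OF assms(2,1,3)] by simp
  show "\<forall>(u, v) \<in> set E. u < 4 \<and> v < 4 \<and> u \<noteq> v" using assms(2) by fastforce
qed (use assms(4,5) in simp_all)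

lemma arbitrary_SSP_2:
  assumes "\<And>a b. a < b \<Longrightarrow> realizes_SSP G (expand [a, b] m)" "length m = 2"
  shows "arbitrary_SSP G m"
  unfolding arbitrary_SSP_def using assms by (auto simp: length_Suc_conv numeral_2_eq_2)

lemma arbitrary_3:
  assumes "length m = 3"
  shows "(\<And>a b c. a < b \<Longrightarrow> b < c \<Longrightarrow> realizes_SSP G (expand [a, b, c] m)) \<Longrightarrow> arbitrary_SSP G m"
    "(\<And>a b c. a < b \<Longrightarrow> b < c \<Longrightarrow> realizes G (expand [a, b, c] m)) \<Longrightarrow> arbitrary G m"
  unfolding arbitrary_SSP_def arbitrary_def using assms by (auto simp: length_Suc_conv numeral_3_eq_3)

lemma arbitrary_SSP_4:
  assumes "\<And>a b c d. a < b \<Longrightarrow> b < c \<Longrightarrow> c < d \<Longrightarrow> realizes_SSP G (expand [a, b, c, d] m)" "length m = 4"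
  shows "arbitrary_SSP G m"
  unfolding arbitrary_SSP_def
proof (intro allI impI, elim conjE)
  fix ls :: "real list" assume ls: "length ls = length m" "sorted_wrt (<) ls"
  then obtain a b c d where "ls = [a, b, c, d]" using assms(2) by (auto simp: length_Suc_conv eval_nat_numeral)
  then show "realizes_SSP G (expand ls m)" using assms(1) ls(2) by simp
qed

definition E_e :: "(nat \<times> nat) list" where "E_e = []"

text \<open>A diagonal matrix grown by one isolated vertex at a time; distinct eigenvalues are what
  adding an isolated vertex asks for.\<close>

lemma arbitrary_SSP_e: "arbitrary_SSP (graph_of E_e) [1, 1, 1, 1, 1]"
  unfolding arbitrary_SSP_def
proof (intro allI impI, elim conjE)
  fix ls :: "real list" assume ls: "length ls = length [1, 1, 1, 1, 1 :: nat]" "sorted_wrt (<) ls"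
  have "distinct ls \<Longrightarrow> realizes_SSP (graph_on (length ls) []) ls"
  proof (induction ls rule: rev_induct)
    case Nil
    have "mat_rows 0 [] \<in> S_graph (graph_on 0 [])" by (rule mat_rows_S_graph) simp_all
    moreover have "char_poly (mat_rows 0 []) = roots_poly []" by (rule char_poly_mat_rows) (simp add: det_dim_zero)
    moreover have "SSP 0 (mat_rows 0 [])" by (rule SSP_mat_rows) simp
    ultimately show ?case using realizes_SSP_mat_rows[of 0 "[]" "[]" "[]"] by simp
  next
    case (snoc c L)
    then show ?case using realizes_SSP_isolated_graph_on[of "[]" "length L" L c] by simp
  qed
  moreover have "expand ls [1, 1, 1, 1, 1] = ls" using ls(1) by (auto simp: length_Suc_conv eval_nat_numeral)
  moreover have "length ls = 5" using ls(1) by simp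
  ultimately show "realizes_SSP (graph_of E_e) (expand ls [1, 1, 1, 1, 1])"
    using strict_imp_distinct[OF ls(2)] by (simp add: graph_of_graph_on E_e_def)
qed

lemma arbitrary_SSP_K5: "arbitrary_SSP (graph_of E_K5) [4, 1]"
  by (rule arbitrary_SSP_2) (use K5_realizes in \<open>simp_all add: graph_of_graph_on eval_nat_numeral\<close>)

text \<open>One Gram family serves both lists, because its two larger eigenvalues may
  coincide.\<close>

lemma arbitrary_SSP_K4e: "arbitrary_SSP (graph_of E_K4e) [3, 2]" "arbitrary_SSP (graph_of E_K4e) [3, 1, 1]"
proof -
  show "arbitrary_SSP (graph_of E_K4e) [3, 2]"
  proof (rule arbitrary_SSP_2)
    fix a b :: real assume "a < b"
    from K4e_realizes[OF this order_refl]
    show "realizes_SSP (graph_of E_K4e) (expand [a, b] [3, 2])" by (simp add: graph_of_graph_on eval_nat_numeral)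
  qed simp
  show "arbitrary_SSP (graph_of E_K4e) [3, 1, 1]"
  proof (rule arbitrary_3(1))
    fix a b c :: real assume "a < b" "b < c"
    from K4e_realizes[OF this(1) less_imp_le[OF this(2)]]
    show "realizes_SSP (graph_of E_K4e) (expand [a, b, c] [3, 1, 1])" by (simp add: graph_of_graph_on eval_nat_numeral)
  qed simp
qed

lemma arbitrary_SSP_k4: "arbitrary_SSP (graph_of E_k4) [3, 1, 1]" "arbitrary_SSP (graph_of E_k4) [1, 3, 1]"
proof -
  show "arbitrary_SSP (graph_of E_k4) [3, 1, 1]"
  proof (rule arbitrary_3(1))
    fix a b c :: real assume o: "a < b" "b < c"
    show "realizes_SSP (graph_of E_k4) (expand [a, b, c] [3, 1, 1])"
      by (rule realizes_SSP_isolated_4[OF K4_realizes[of a b], of c]) (use o in \<open>auto simp: E_k4_def eval_nat_numeral\<close>)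
  qed simp
  show "arbitrary_SSP (graph_of E_k4) [1, 3, 1]"
  proof (rule arbitrary_3(1))
    fix a b c :: real assume o: "a < b" "b < c"
    show "realizes_SSP (graph_of E_k4) (expand [a, b, c] [1, 3, 1])"
      by (rule realizes_SSP_isolated_4[OF K4_realizes[of b a], of c]) (use o in \<open>auto simp: E_k4_def eval_nat_numeral\<close>)
  qed simp
qed

text \<open>The isolated vertex takes a simple eigenvalue of the list, chosen so that a double
  eigenvalue is the least of the four left for the cycle, as \<open>C4_realizes\<close>
  requires.\<close>

lemma arbitrary_SSP_c4: "arbitrary_SSP (graph_of E_c4) [2, 1, 2]" "arbitrary_SSP (graph_of E_c4) [2, 2, 1]"
  "arbitrary_SSP (graph_of E_c4) [2, 1, 1, 1]" "arbitrary_SSP (graph_of E_c4) [1, 2, 1, 1]"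
proof -
  show "arbitrary_SSP (graph_of E_c4) [2, 1, 2]"
  proof (rule arbitrary_3(1))
    fix a b c :: real assume o: "a < b" "b < c"
    show "realizes_SSP (graph_of E_c4) (expand [a, b, c] [2, 1, 2])"
      by (rule realizes_SSP_isolated_4[OF C4_realizes[of a c c], of b]) (use o in \<open>auto simp: E_c4_def eval_nat_numeral\<close>)
  qed simp
  show "arbitrary_SSP (graph_of E_c4) [2, 2, 1]"
  proof (rule arbitrary_3(1))
    fix a b c :: real assume o: "a < b" "b < c"
    show "realizes_SSP (graph_of E_c4) (expand [a, b, c] [2, 2, 1])"
      by (rule realizes_SSP_isolated_4[OF C4_realizes[of a b b], of c]) (use o in \<open>auto simp: E_c4_def eval_nat_numeral\<close>)
  qed simp
  show "arbitrary_SSP (graph_of E_c4) [2, 1, 1, 1]"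
  proof (rule arbitrary_SSP_4)
    fix a b c d :: real assume o: "a < b" "b < c" "c < d"
    show "realizes_SSP (graph_of E_c4) (expand [a, b, c, d] [2, 1, 1, 1])"
      by (rule realizes_SSP_isolated_4[OF C4_realizes[of a b c], of d]) (use o in \<open>auto simp: E_c4_def eval_nat_numeral\<close>)
  qed simp
  show "arbitrary_SSP (graph_of E_c4) [1, 2, 1, 1]"
  proof (rule arbitrary_SSP_4)
    fix a b c d :: real assume o: "a < b" "b < c" "c < d"
    show "realizes_SSP (graph_of E_c4) (expand [a, b, c, d] [1, 2, 1, 1])"
      by (rule realizes_SSP_isolated_4[OF C4_realizes[of b c d], of a]) (use o in \<open>auto simp: E_c4_def eval_nat_numeral\<close>)
  qed simp
qed

lemma arbitrary_SSP_k3: "arbitrary_SSP (graph_of E_k3) [2, 1, 1, 1]" "arbitrary_SSP (graph_of E_k3) [1, 2, 1, 1]"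
proof -
  show "arbitrary_SSP (graph_of E_k3) [2, 1, 1, 1]"
  proof (rule arbitrary_SSP_4)
    fix a b c d :: real assume o: "a < b" "b < c" "c < d"
    show "realizes_SSP (graph_of E_k3) (expand [a, b, c, d] [2, 1, 1, 1])"
      by (rule realizes_SSP_isolated_3[OF K3_realizes[of a b], of c d]) (use o in \<open>auto simp: E_k3_def eval_nat_numeral\<close>)
  qed simp
  show "arbitrary_SSP (graph_of E_k3) [1, 2, 1, 1]"
  proof (rule arbitrary_SSP_4)
    fix a b c d :: real assume o: "a < b" "b < c" "c < d"
    show "realizes_SSP (graph_of E_k3) (expand [a, b, c, d] [1, 2, 1, 1])"
      by (rule realizes_SSP_isolated_3[OF K3_realizes[of b a], of c d]) (use o in \<open>auto simp: E_k3_def eval_nat_numeral\<close>)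
  qed simp
qed

lemma arbitrary_SSP_k13: "arbitrary_SSP (graph_of E_k13) [1, 2, 1, 1]"
proof (rule arbitrary_SSP_4)
  fix a b c d :: real assume o: "a < b" "b < c" "c < d"
  show "realizes_SSP (graph_of E_k13) (expand [a, b, c, d] [1, 2, 1, 1])"
    by (rule realizes_SSP_isolated_4[OF K13_realizes[of a b c], of d]) (use o in \<open>auto simp: E_k13_def eval_nat_numeral\<close>)
qed simp

lemma arbitrary_SSP_K23: "arbitrary_SSP (graph_of E_K23) [1, 3, 1]"
proof (rule arbitrary_3(1))
  fix a b c :: real assume o: "a < b" "b < c"
  show "realizes_SSP (graph_of E_K23) (expand [a, b, c] [1, 3, 1])"
    by (rule realizes_perm(2)[OF _ K23_realizes[OF o, folded graph_of_graph_on]]) (simp add: eval_nat_numeral)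
qed simp

lemma arbitrary_K14: "arbitrary (graph_of E_K14) [1, 3, 1]"
proof (rule arbitrary_3(2))
  fix a b c :: real assume o: "a < b" "b < c"
  show "realizes (graph_of E_K14) (expand [a, b, c] [1, 3, 1])"
    by (rule realizes_perm(1)[OF _ K14_realizes[OF o, folded graph_of_graph_on]]) (simp add: eval_nat_numeral)
qed simp

lemma arbitrary_Butterfly: "arbitrary_SSP (graph_of E_Butterfly) [2, 1, 2]"
  "arbitrary (graph_of E_Butterfly) [1, 3, 1]" "arbitrary (graph_of E_Butterfly) [3, 1, 1]"
proof -
  show "arbitrary_SSP (graph_of E_Butterfly) [2, 1, 2]"
  proof (rule arbitrary_3(1))
    fix a b c :: real assume o: "a < b" "b < c"
    have "realizes_SSP (graph_of E_Butterfly) [a, c, a, b, c]"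
      unfolding graph_of_graph_on by (rule Butterfly_realizes(2)[OF o]) (use o in simp_all)
    then show "realizes_SSP (graph_of E_Butterfly) (expand [a, b, c] [2, 1, 2])"
      by (rule realizes_perm(2)[rotated]) (simp add: eval_nat_numeral)
  qed simp
  show "arbitrary (graph_of E_Butterfly) [1, 3, 1]"
  proof (rule arbitrary_3(2))
    fix a b c :: real assume o: "a < b" "b < c"
    have "realizes (graph_of E_Butterfly) [b, b, a, b, c]"
      unfolding graph_of_graph_on by (rule Butterfly_realizes(1)[OF o]) (use o in simp_all)
    then show "realizes (graph_of E_Butterfly) (expand [a, b, c] [1, 3, 1])"
      by (rule realizes_perm(1)[rotated]) (simp add: eval_nat_numeral)
  qed simp
  show "arbitrary (graph_of E_Butterfly) [3, 1, 1]"
  proof (rule arbitrary_3(2))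
    fix a b c :: real assume o: "a < b" "b < c"
    have "realizes (graph_of E_Butterfly) [a, a, a, b, c]"
      unfolding graph_of_graph_on by (rule Butterfly_realizes(1)[OF o]) (use o in simp_all)
    then show "realizes (graph_of E_Butterfly) (expand [a, b, c] [3, 1, 1])"
      by (rule realizes_perm(1)[rotated]) (simp add: eval_nat_numeral)
  qed simp
qed

lemma arbitrary_SSP_Campstool: "arbitrary_SSP (graph_of E_Campstool) [2, 2, 1]"
proof (rule arbitrary_3(1))
  fix a b c :: real assume o: "a < b" "b < c"
  show "realizes_SSP (graph_of E_Campstool) (expand [a, b, c] [2, 2, 1])"
    using Campstool_realizes[OF o] by (simp add: graph_of_graph_on eval_nat_numeral)
qed simp

lemma arbitrary_SSP_C5: "arbitrary_SSP (graph_of E_C5) [2, 2, 1]" "arbitrary_SSP (graph_of E_C5) [2, 1, 1, 1]"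
  "arbitrary_SSP (graph_of E_C5) [1, 2, 1, 1]"
proof -
  show "arbitrary_SSP (graph_of E_C5) [2, 2, 1]"
  proof (rule arbitrary_3(1))
    fix a b c :: real assume o: "a < b" "b < c"
    show "realizes_SSP (graph_of E_C5) (expand [a, b, c] [2, 2, 1])"
      by (rule realizes_perm(2)[OF _ C5_realizes_221[OF o, folded graph_of_graph_on]]) (simp add: eval_nat_numeral)
  qed simp
  show "arbitrary_SSP (graph_of E_C5) [2, 1, 1, 1]"
  proof (rule arbitrary_SSP_4)
    fix a b c d :: real assume o: "a < b" "b < c" "c < d"
    show "realizes_SSP (graph_of E_C5) (expand [a, b, c, d] [2, 1, 1, 1])"
      by (rule realizes_perm(2)[OF _ C5_realizes_2111[OF o, folded graph_of_graph_on]]) (simp add: eval_nat_numeral)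
  qed simp
  show "arbitrary_SSP (graph_of E_C5) [1, 2, 1, 1]"
  proof (rule arbitrary_SSP_4)
    fix a b c d :: real assume o: "a < b" "b < c" "c < d"
    show "realizes_SSP (graph_of E_C5) (expand [a, b, c, d] [1, 2, 1, 1])"
      by (rule realizes_perm(2)[OF _ C5_realizes_1211[OF o, folded graph_of_graph_on]]) (simp add: eval_nat_numeral)
  qed simp
qed

section \<open>The named graphs as edge lists\<close>

lemma complete_graph_simps:
  "complete_graph 1 = Graph 1 {}"
  "complete_graph 3 = Graph 3 {{0, 1}, {0, 2}, {1, 2}}"
  "complete_graph 4 = Graph 4 {{0, 1}, {0, 2}, {0, 3}, {1, 2}, {1, 3}, {2, 3}}"
  "complete_graph 5 = Graph 5 {{0, 1}, {0, 2}, {0, 3}, {0, 4}, {1, 2}, {1, 3}, {1, 4}, {2, 3}, {2, 4}, {3, 4}}"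
  unfolding complete_graph_def graph.inject
  by (intro conjI refl equalityI subsetI; (elim CollectE exE conjE insertE emptyE;
      force simp: less_3 less_4 less_5 doubleton_eq_iff))+

lemma path_graph_simps:
  "path_graph 4 = Graph 4 {{0, 1}, {1, 2}, {2, 3}}" "path_graph 5 = Graph 5 {{0, 1}, {1, 2}, {2, 3}, {3, 4}}"
proof -
  have e: "{{i, Suc i} | i. Suc i < n} = (\<lambda>i. {i, Suc i}) ` set [0..<n - 1]" for n by auto
  show "path_graph 4 = Graph 4 {{0, 1}, {1, 2}, {2, 3}}" "path_graph 5 = Graph 5 {{0, 1}, {1, 2}, {2, 3}, {3, 4}}"
    unfolding path_graph_def e by (simp_all add: upt_rec set_eq_subset doubleton_eq_iff)
qed

lemma cycle_graph_simps:
  "cycle_graph 4 = Graph 4 {{0, 1}, {1, 2}, {2, 3}, {0, 3}}"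
  "cycle_graph 5 = Graph 5 {{0, 1}, {1, 2}, {2, 3}, {3, 4}, {0, 4}}"
proof -
  have e: "{{i, Suc i mod n} | i. i < n} = (\<lambda>i. {i, Suc i mod n}) ` set [0..<n]" for n by auto
  show "cycle_graph 4 = Graph 4 {{0, 1}, {1, 2}, {2, 3}, {0, 3}}"
    "cycle_graph 5 = Graph 5 {{0, 1}, {1, 2}, {2, 3}, {3, 4}, {0, 4}}"
    unfolding cycle_graph_def e by (simp_all add: upt_rec set_eq_subset doubleton_eq_iff)
qed

lemma complete_bipartite_simps:
  "complete_bipartite 1 3 = Graph 4 {{0, 1}, {0, 2}, {0, 3}}"
  "complete_bipartite 1 4 = Graph 5 {{0, 1}, {0, 2}, {0, 3}, {0, 4}}"
  "complete_bipartite 2 3 = Graph 5 {{0, 2}, {0, 3}, {0, 4}, {1, 2}, {1, 3}, {1, 4}}"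
proof -
  have e: "{{i, j} | i j. i < p \<and> p \<le> j \<and> j < p + q} =
    (\<Union>i\<in>set [0..<p]. (\<lambda>j. {i, j}) ` set [p..<p + q])" for p q :: nat by (auto, blast)
  show "complete_bipartite 1 3 = Graph 4 {{0, 1}, {0, 2}, {0, 3}}"
    "complete_bipartite 1 4 = Graph 5 {{0, 1}, {0, 2}, {0, 3}, {0, 4}}"
    "complete_bipartite 2 3 = Graph 5 {{0, 2}, {0, 3}, {0, 4}, {1, 2}, {1, 3}, {1, 4}}"
    unfolding complete_bipartite_def e by (simp_all add: upt_rec set_eq_subset doubleton_eq_iff)
qed

lemma T_5_simp: "T_5 = Graph 5 {{0, 1}, {0, 2}, {0, 3}, {0, 4}, {1, 2}, {1, 3}, {1, 4}}"
proof -
  have e: "{{i, j} | i j. i < (p::nat) \<and> a \<le> j \<and> j < b} = (\<Union>i\<in>set [0..<p]. (\<lambda>j. {i, j}) ` set [a..<b])" for p a b by (auto, blast)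
  have e': "{{i, j} | i j. c \<le> i \<and> i < (p::nat) \<and> a \<le> j \<and> j < b} = (\<Union>i\<in>set [c..<p]. (\<lambda>j. {i, j}) ` set [a..<b])" for p a b c by (auto, blast)
  show ?thesis unfolding T_5_def complete_tripartite_def e e' by (simp add: upt_rec set_eq_subset doubleton_eq_iff)
qed

lemma two_subsets_5: "{e :: nat set. e \<subseteq> {..<5} \<and> card e = 2} = edges (complete_graph 5)"
  by (auto simp: complete_graph_def card_2_iff)

lemma add_vertex_simp: "add_vertex (Graph n E) N = Graph (Suc n) (E \<union> (\<lambda>v. {v, n}) ` N)"
  by (auto simp: add_vertex_def)

lemma add_dominating_simp: "add_dominating (Graph n E) = Graph (Suc n) (E \<union> (\<lambda>v. {v, n}) ` set [0..<n])"
  by (auto simp: add_vertex_simp add_dominating_def)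

lemma isolated_simp: "Graph n E \<uplus>\<^sub>G Graph k {} = Graph (n + k) E"
  by (simp add: disjoint_union_def)

lemmas construction_simps = graph_of_def add_vertex_simp add_pendant_def delete_edge_def subdivide_edge_def
  add_dominating_simp numeral_2_eq_2[symmetric]

lemma table_graphs:
  "path_graph 5 = graph_of E_P5" "generalized_star [2,1,1] = graph_of E_S211"
  "complete_bipartite 1 4 = graph_of E_K14" "L_3_2 = graph_of E_L32" "Bull = graph_of E_Bull"
  "cycle_graph 5 = graph_of E_C5" "Campstool = graph_of E_Campstool" "Banner = graph_of E_Banner"
  "House = graph_of E_House" "Dart = graph_of E_Dart" "Kite = graph_of E_Kite" "Gem = graph_of E_Gem"
  "Butterfly = graph_of E_Butterfly" "complete_bipartite 2 3 = graph_of E_K23" "T_5 = graph_of E_T5"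
  "L_4_1 = graph_of E_L41" "K_4_e = graph_of E_K4e" "W_5 = graph_of E_W5" "Full_House = graph_of E_FullHouse"
  "K_5_minus_e = graph_of E_K5e" "complete_graph 5 = graph_of E_K5"
proof -
  have a2: "attach_path (Graph n E) v 2 = Graph (Suc (Suc n)) (insert {Suc n, n} (insert {v, n} E))" for n E v
    by (simp add: numeral_2_eq_2 add_pendant_def add_vertex_simp insert_commute)
  have a1: "attach_path (Graph n E) v 1 = Graph (Suc n) (insert {v, n} E)" for n E v
    by (simp add: add_pendant_def add_vertex_simp insert_commute)
  show "path_graph 5 = graph_of E_P5" by (simp add: path_graph_simps graph_of_def E_P5_def)
  show "generalized_star [2,1,1] = graph_of E_S211"
    unfolding generalized_star_def foldl.simps complete_graph_simps a2 a1
    by (simp add: graph_of_def E_S211_def set_eq_subset doubleton_eq_iff)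
  show "complete_bipartite 1 4 = graph_of E_K14" by (simp only: complete_bipartite_simps) (simp add: graph_of_def E_K14_def)
  show "L_3_2 = graph_of E_L32" unfolding L_3_2_def complete_graph_simps a2
    by (simp add: graph_of_def E_L32_def set_eq_subset doubleton_eq_iff)
  show "Bull = graph_of E_Bull" unfolding Bull_def complete_graph_simps
    by (simp add: construction_simps E_Bull_def set_eq_subset doubleton_eq_iff)
  show "cycle_graph 5 = graph_of E_C5"
    by (simp add: cycle_graph_simps graph_of_def E_C5_def set_eq_subset doubleton_eq_iff)
  show "Campstool = graph_of E_Campstool" unfolding Campstool_def complete_graph_simps
    by (simp add: construction_simps E_Campstool_def set_eq_subset doubleton_eq_iff)
  show "Banner = graph_of E_Banner" unfolding Banner_def cycle_graph_simps
    by (simp add: construction_simps E_Banner_def set_eq_subset doubleton_eq_iff)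
  show "House = graph_of E_House"
    unfolding House_def graph_complement_def path_graph_simps graph.sel two_subsets_5 complete_graph_simps
    by (simp add: graph_of_def E_House_def set_eq_subset doubleton_eq_iff insert_Diff_if)
  show "Dart = graph_of E_Dart" unfolding Dart_def complete_graph_simps
    by (simp add: construction_simps E_Dart_def set_eq_subset doubleton_eq_iff insert_Diff_if)
  show "Kite = graph_of E_Kite" unfolding Kite_def complete_graph_simps
    by (simp add: construction_simps E_Kite_def set_eq_subset doubleton_eq_iff insert_Diff_if)
  show "Gem = graph_of E_Gem" unfolding Gem_def path_graph_simps
    by (simp add: construction_simps E_Gem_def set_eq_subset doubleton_eq_iff upt_rec)
  show "Butterfly = graph_of E_Butterfly"
    by (simp add: Butterfly_def graph_of_def E_Butterfly_def set_eq_subset doubleton_eq_iff)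
  show "complete_bipartite 2 3 = graph_of E_K23" by (simp only: complete_bipartite_simps) (simp add: graph_of_def E_K23_def)
  show "T_5 = graph_of E_T5" by (simp add: T_5_simp graph_of_def E_T5_def)
  show "L_4_1 = graph_of E_L41" unfolding L_4_1_def complete_graph_simps
    by (simp add: construction_simps E_L41_def set_eq_subset doubleton_eq_iff)
  show "K_4_e = graph_of E_K4e" unfolding K_4_e_def complete_graph_simps
    by (simp add: construction_simps E_K4e_def set_eq_subset doubleton_eq_iff insert_Diff_if)
  show "W_5 = graph_of E_W5" unfolding W_5_def cycle_graph_simps
    by (simp add: construction_simps E_W5_def set_eq_subset doubleton_eq_iff upt_rec)
  show "Full_House = graph_of E_FullHouse" unfolding Full_House_def complete_graph_simps
    by (simp add: construction_simps E_FullHouse_def set_eq_subset doubleton_eq_iff)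
  show "K_5_minus_e = graph_of E_K5e" unfolding K_5_minus_e_def complete_graph_simps
    by (simp add: construction_simps E_K5e_def set_eq_subset doubleton_eq_iff insert_Diff_if)
  show "complete_graph 5 = graph_of E_K5" unfolding complete_graph_simps by (simp add: graph_of_def E_K5_def)
qed

lemma table_isolated_graphs:
  "complete_graph 4 \<uplus>\<^sub>G complete_graph 1 = graph_of E_k4"
  "cycle_graph 4 \<uplus>\<^sub>G complete_graph 1 = graph_of E_c4"
  "complete_graph 3 \<uplus>\<^sub>G copies 2 (complete_graph 1) = graph_of E_k3"
  "complete_bipartite 1 3 \<uplus>\<^sub>G complete_graph 1 = graph_of E_k13"
  "copies 5 (complete_graph 1) = graph_of E_e"
proof -
  have c: "copies k (complete_graph 1) = Graph k {}" for k
    unfolding copies_def complete_graph_simps by (induction k) (simp_all add: isolated_simp)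
  show "complete_graph 4 \<uplus>\<^sub>G complete_graph 1 = graph_of E_k4"
    "cycle_graph 4 \<uplus>\<^sub>G complete_graph 1 = graph_of E_c4"
    "complete_graph 3 \<uplus>\<^sub>G copies 2 (complete_graph 1) = graph_of E_k3"
    "complete_bipartite 1 3 \<uplus>\<^sub>G complete_graph 1 = graph_of E_k13"
    "copies 5 (complete_graph 1) = graph_of E_e"
    unfolding c unfolding complete_graph_simps cycle_graph_simps complete_bipartite_simps isolated_simp
    by (simp_all add: graph_of_def E_k4_def E_c4_def E_k3_def E_k13_def E_e_def set_eq_subset doubleton_eq_iff)
qed

section \<open>Classification of the graphs of order five\<close>

definition E_k4e :: "(nat \<times> nat) list" where "E_k4e = [(0, 2), (0, 3), (1, 2), (1, 3), (2, 3)]"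
definition E_paw :: "(nat \<times> nat) list" where "E_paw = [(0, 1), (0, 2), (0, 3), (1, 2)]"
definition E_p4 :: "(nat \<times> nat) list" where "E_p4 = [(0, 1), (1, 2), (2, 3)]"
definition E_k3k2 :: "(nat \<times> nat) list" where "E_k3k2 = [(0, 1), (0, 2), (1, 2), (3, 4)]"
definition E_p3k2 :: "(nat \<times> nat) list" where "E_p3k2 = [(0, 1), (1, 2), (3, 4)]"
definition E_p3 :: "(nat \<times> nat) list" where "E_p3 = [(0, 1), (1, 2)]"
definition E_k2k2 :: "(nat \<times> nat) list" where "E_k2k2 = [(0, 1), (2, 3)]"
definition E_k2 :: "(nat \<times> nat) list" where "E_k2 = [(0, 1)]"

lemmas edge_list_defs = E_P5_def E_S211_def E_K14_def E_L32_def E_Bull_def E_C5_def E_Campstool_def E_Banner_def E_House_def E_Dart_def E_Kite_def E_Gem_def E_Butterfly_def E_K23_def E_T5_def E_L41_def E_K4e_def E_W5_def E_FullHouse_def E_K5e_def E_K5_def E_k4_def E_c4_def E_k4e_def E_paw_def E_k13_def E_p4_def E_k3k2_def E_p3k2_def E_k3_def E_p3_def E_k2k2_def E_k2_def E_e_def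

definition conn_reps :: "(nat \<times> nat) list list" where
  "conn_reps = [E_P5, E_S211, E_K14, E_L32, E_Bull, E_C5, E_Campstool, E_Banner, E_House, E_Dart, E_Kite, E_Gem, E_Butterfly, E_K23, E_T5, E_L41, E_K4e, E_W5, E_FullHouse, E_K5e, E_K5]"

definition disc_reps :: "(nat \<times> nat) list list" where
  "disc_reps = [E_k4, E_c4, E_k4e, E_paw, E_k13, E_p4, E_k3k2, E_p3k2, E_k3, E_p3, E_k2k2, E_k2, E_e]"

text \<open>A list of length five that contains 0 to 4 is a permutation by counting, see
  \<open>bij_perm_list\<close>.\<close>

definition perm_list :: "nat list \<Rightarrow> bool" where
  "perm_list p \<longleftrightarrow> length p = 5 \<and> list_all (\<lambda>k. k \<in> set p) [0, 1, 2, 3, 4]"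

text \<open>Evaluable, so that embeddings can be supplied as certificates \<open>p\<close>, the list
  of images of 0 to 4.\<close>

definition maps_into :: "nat list \<Rightarrow> (nat \<times> nat) list \<Rightarrow> (nat \<times> nat) list \<Rightarrow> bool" where
  "maps_into p E E' \<longleftrightarrow> perm_list p \<and> list_all (\<lambda>(u, v). adjacent E' (p ! u) (p ! v)) E"

definition maps_onto :: "nat list \<Rightarrow> (nat \<times> nat) list \<Rightarrow> (nat \<times> nat) list \<Rightarrow> bool" where
  "maps_onto p E E' \<longleftrightarrow> maps_into p E E' \<and>
     list_all (\<lambda>(u, v). list_ex (\<lambda>(a, b). p ! a = u \<and> p ! b = v \<or> p ! a = v \<and> p ! b = u) E) E'"

lemma bij_perm_list:
  assumes "perm_list p" shows "bij_betw ((!) p) {..<5} {..<5}"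
proof -
  have len: "length p = 5" and sub: "{..<5} \<subseteq> set p" using assms by (auto simp: perm_list_def less_5)
  have "card {..<5 :: nat} \<le> card (set p)" by (rule card_mono) (use sub in auto)
  then have c: "card (set p) = length p" using len card_length[of p] by simp
  then have "distinct p" by (rule card_distinct)
  moreover have "set p = {..<5}" by (rule card_subset_eq[symmetric]) (use sub c len in auto)
  ultimately show ?thesis using len by (intro bij_betw_nth) auto
qed

lemma image_edges_graph_of: "(`) f ` edges (graph_of E) = (\<lambda>(u, v). {f u, f v}) ` set E"
  unfolding graph_of_def graph.sel image_image by (rule image_cong) auto

lemma embeds_graph_of:
  assumes "maps_into p E E'" shows "embeds (graph_of E) (graph_of E')"
proof -
  have "(`) ((!) p) ` edges (graph_of E) \<subseteq> edges (graph_of E')"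
    unfolding image_edges_graph_of using assms by (auto simp: maps_into_def list_all_iff edge_graph_of)
  then show ?thesis using bij_perm_list[of p] assms unfolding embeds_def maps_into_def by auto
qed

lemma graph_iso_graph_of:
  assumes "maps_onto p E E'" shows "graph_of E \<simeq>\<^sub>G graph_of E'"
proof -
  have "(`) ((!) p) ` edges (graph_of E) \<subseteq> edges (graph_of E')"
    unfolding image_edges_graph_of using assms by (auto simp: maps_onto_def maps_into_def list_all_iff edge_graph_of)
  moreover have "edges (graph_of E') \<subseteq> (`) ((!) p) ` edges (graph_of E)"
  proof
    fix e assume "e \<in> edges (graph_of E')"
    then obtain u v where e: "e = {u, v}" "(u, v) \<in> set E'" by (auto simp: graph_of_def)
    have "list_ex (\<lambda>(a, b). p ! a = u \<and> p ! b = v \<or> p ! a = v \<and> p ! b = u) E"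
      using assms e(2) by (auto simp: maps_onto_def list_all_iff)
    then obtain a b where "(a, b) \<in> set E" "p ! a = u \<and> p ! b = v \<or> p ! a = v \<and> p ! b = u"
      by (auto simp: list_ex_iff)
    then show "e \<in> (`) ((!) p) ` edges (graph_of E)"
      unfolding image_edges_graph_of e by (intro image_eqI[of _ _ "(a, b)"]) auto
  qed
  ultimately show ?thesis
    unfolding graph_iso_def using bij_perm_list[of p] assms
    by (intro exI[of _ "(!) p"]) (auto simp: maps_onto_def maps_into_def)
qed

definition all_pairs :: "(nat \<times> nat) list" where
  "all_pairs = [(0, 1), (0, 2), (0, 3), (0, 4), (1, 2), (1, 3), (1, 4), (2, 3), (2, 4), (3, 4)]"

text \<open>Entries of a certificate: the added edge, the resulting graph up to isomorphism, the isomorphism.\<close>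

definition extension_row :: "(nat \<times> nat) list \<Rightarrow> ((nat \<times> nat) \<times> (nat \<times> nat) list \<times> nat list) list \<Rightarrow> bool" where
  "extension_row E rw \<longleftrightarrow>
     list_all (\<lambda>(u, v). (u, v) \<in> set E \<or> list_ex (\<lambda>(e, _). e = (u, v)) rw) all_pairs \<and>
     list_all (\<lambda>(e, E', p). maps_onto p (e # E) E') rw"

definition reps :: "(nat \<times> nat) list list" where "reps = conn_reps @ disc_reps"

definition extension_closed :: "(nat \<times> nat) list \<Rightarrow> bool" where
  "extension_closed E \<longleftrightarrow> (\<forall>(u, v) \<in> set all_pairs. (u, v) \<in> set E \<or>
     (\<exists>E' \<in> set reps. graph_of ((u, v) # E) \<simeq>\<^sub>G graph_of E'))"

lemma extension_closedI:
  assumes "extension_row E rw" "list_all (\<lambda>(_, E', _). E' \<in> set reps) rw"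
  shows "extension_closed E"
  unfolding extension_closed_def
proof (intro ballI)
  fix e assume "e \<in> set all_pairs"
  moreover obtain u v where e: "e = (u, v)" by (cases e)
  ultimately have uv: "(u, v) \<in> set all_pairs" by simp
  have "\<exists>E' \<in> set reps. graph_of ((u, v) # E) \<simeq>\<^sub>G graph_of E'" if "(u, v) \<notin> set E"
  proof -
  have "list_ex (\<lambda>(e, _). e = (u, v)) rw"
    using assms(1) uv that unfolding extension_row_def list_all_iff by blast
  then obtain E' p where "((u, v), E', p) \<in> set rw" by (auto simp: list_ex_iff)
  then have "maps_onto p ((u, v) # E) E'" "E' \<in> set reps"
    using assms by (auto simp: extension_row_def list_all_iff)
  then show ?thesis using graph_iso_graph_of by blast
  qed
  then show "case e of (u, v) \<Rightarrow> (u, v) \<in> set E \<or>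
      (\<exists>E' \<in> set reps. graph_of ((u, v) # E) \<simeq>\<^sub>G graph_of E')" unfolding e by auto
qed

text \<open>One row per representative, in the order of \<open>reps\<close>, which
  \<open>extension_closed_reps\<close> relies on; the complete graph has an empty row.\<close>

definition extension_table :: "((nat \<times> nat) list \<times> ((nat \<times> nat) \<times> (nat \<times> nat) list \<times> nat list) list) list" where
  "extension_table =
   [(E_P5, [((0, 2), E_L32, [1, 2, 0, 3, 4]), ((0, 3), E_Banner, [1, 2, 3, 0, 4]),
      ((0, 4), E_C5, [0, 1, 2, 3, 4]), ((1, 3), E_Bull, [3, 0, 2, 1, 4]),
      ((1, 4), E_Banner, [4, 0, 1, 2, 3]), ((2, 4), E_L32, [4, 3, 0, 1, 2])]),
    (E_S211, [((0, 2), E_Campstool, [0, 1, 2, 3, 4]), ((1, 3), E_Bull, [0, 1, 4, 2, 3]),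
      ((1, 4), E_Bull, [0, 1, 4, 3, 2]), ((2, 3), E_Banner, [0, 1, 2, 3, 4]),
      ((2, 4), E_Banner, [0, 1, 2, 4, 3]), ((3, 4), E_L32, [0, 3, 4, 1, 2])]),
    (E_K14, [((1, 2), E_Campstool, [0, 1, 2, 3, 4]), ((1, 3), E_Campstool, [0, 1, 3, 2, 4]),
      ((1, 4), E_Campstool, [0, 1, 3, 4, 2]), ((2, 3), E_Campstool, [0, 3, 1, 2, 4]),
      ((2, 4), E_Campstool, [0, 3, 1, 4, 2]), ((3, 4), E_Campstool, [0, 3, 4, 1, 2])]),
    (E_L32, [((0, 4), E_Butterfly, [0, 1, 2, 3, 4]), ((1, 3), E_Kite, [2, 3, 1, 0, 4]),
      ((1, 4), E_House, [0, 4, 2, 3, 1]), ((2, 3), E_Kite, [2, 1, 3, 0, 4]),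
      ((2, 4), E_House, [0, 2, 4, 3, 1])]),
    (E_Bull, [((0, 4), E_Dart, [2, 3, 0, 4, 1]), ((1, 3), E_Dart, [3, 2, 0, 1, 4]),
      ((2, 3), E_Kite, [2, 0, 3, 1, 4]), ((2, 4), E_Kite, [0, 2, 3, 4, 1]),
      ((3, 4), E_House, [0, 4, 2, 3, 1])]),
    (E_C5, [((0, 2), E_House, [0, 2, 4, 1, 3]), ((0, 3), E_House, [0, 3, 1, 4, 2]),
      ((1, 3), E_House, [1, 4, 2, 0, 3]), ((1, 4), E_House, [2, 0, 3, 1, 4]),
      ((2, 4), E_House, [1, 3, 0, 2, 4])]),
    (E_Campstool, [((1, 3), E_Dart, [2, 3, 0, 1, 4]), ((1, 4), E_Dart, [2, 3, 0, 4, 1]),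
      ((2, 3), E_Dart, [2, 0, 3, 1, 4]), ((2, 4), E_Dart, [2, 0, 3, 4, 1]),
      ((3, 4), E_Butterfly, [0, 1, 2, 3, 4])]),
    (E_Banner, [((0, 2), E_Dart, [2, 0, 3, 1, 4]), ((1, 3), E_Kite, [0, 2, 1, 3, 4]),
      ((1, 4), E_House, [0, 4, 1, 3, 2]), ((2, 4), E_K23, [0, 2, 1, 3, 4]),
      ((3, 4), E_House, [0, 3, 1, 4, 2])]),
    (E_House, [((0, 1), E_Gem, [4, 1, 3, 0, 2]), ((1, 2), E_K4e, [0, 1, 2, 4, 3]),
      ((2, 3), E_K4e, [2, 4, 3, 0, 1]), ((3, 4), E_Gem, [1, 3, 0, 2, 4])]),
    (E_Dart, [((0, 1), E_L41, [1, 2, 0, 3, 4]), ((0, 4), E_Gem, [1, 3, 4, 2, 0]),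
      ((1, 4), E_Gem, [0, 2, 4, 1, 3]), ((3, 4), E_T5, [2, 3, 0, 1, 4])]),
    (E_Kite, [((0, 1), E_L41, [0, 1, 2, 3, 4]), ((1, 4), E_K4e, [0, 1, 2, 3, 4]),
      ((2, 4), E_Gem, [1, 3, 4, 2, 0]), ((3, 4), E_Gem, [1, 3, 2, 4, 0])]),
    (E_Gem, [((0, 2), E_FullHouse, [2, 3, 0, 4, 1]), ((0, 3), E_W5, [0, 1, 2, 3, 4]),
      ((1, 3), E_FullHouse, [4, 0, 2, 3, 1])]),
    (E_Butterfly, [((1, 3), E_Gem, [4, 1, 0, 2, 3]), ((1, 4), E_Gem, [4, 1, 0, 3, 2]),
      ((2, 3), E_Gem, [4, 0, 1, 2, 3]), ((2, 4), E_Gem, [4, 0, 1, 3, 2])]),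
    (E_K23, [((0, 1), E_T5, [0, 1, 2, 3, 4]), ((2, 3), E_K4e, [0, 1, 2, 3, 4]),
      ((2, 4), E_K4e, [0, 1, 2, 4, 3]), ((3, 4), E_K4e, [0, 1, 4, 2, 3])]),
    (E_T5, [((2, 3), E_FullHouse, [0, 1, 2, 3, 4]), ((2, 4), E_FullHouse, [0, 1, 2, 4, 3]),
      ((3, 4), E_FullHouse, [0, 1, 4, 2, 3])]),
    (E_L41, [((1, 4), E_FullHouse, [0, 1, 2, 3, 4]), ((2, 4), E_FullHouse, [0, 2, 1, 3, 4]),
      ((3, 4), E_FullHouse, [0, 2, 3, 1, 4])]),
    (E_K4e, [((0, 1), E_FullHouse, [0, 1, 2, 3, 4]), ((2, 4), E_W5, [0, 2, 4, 1, 3]),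
      ((3, 4), E_W5, [0, 2, 1, 4, 3])]),
    (E_W5, [((0, 2), E_K5e, [2, 0, 3, 1, 4]), ((1, 3), E_K5e, [0, 2, 1, 3, 4])]),
    (E_FullHouse, [((2, 4), E_K5e, [2, 3, 4, 0, 1]), ((3, 4), E_K5e, [2, 3, 0, 4, 1])]),
    (E_K5e, [((0, 1), E_K5, [0, 1, 2, 3, 4])]),
    (E_K5, []),
    (E_k4, [((0, 4), E_L41, [0, 1, 2, 3, 4]), ((1, 4), E_L41, [1, 0, 2, 3, 4]),
      ((2, 4), E_L41, [1, 2, 0, 3, 4]), ((3, 4), E_L41, [1, 2, 3, 0, 4])]),
    (E_c4, [((0, 2), E_k4e, [2, 0, 3, 1, 4]), ((0, 4), E_Banner, [0, 1, 2, 3, 4]),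
      ((1, 3), E_k4e, [0, 2, 1, 3, 4]), ((1, 4), E_Banner, [1, 0, 3, 2, 4]),
      ((2, 4), E_Banner, [2, 1, 0, 3, 4]), ((3, 4), E_Banner, [1, 2, 3, 0, 4])]),
    (E_k4e, [((0, 1), E_k4, [0, 1, 2, 3, 4]), ((0, 4), E_Kite, [0, 1, 2, 3, 4]),
      ((1, 4), E_Kite, [1, 0, 2, 3, 4]), ((2, 4), E_Dart, [0, 1, 2, 3, 4]),
      ((3, 4), E_Dart, [0, 1, 3, 2, 4])]),
    (E_paw, [((0, 4), E_Campstool, [0, 1, 2, 3, 4]), ((1, 3), E_k4e, [2, 3, 0, 1, 4]),
      ((1, 4), E_Bull, [0, 1, 2, 3, 4]), ((2, 3), E_k4e, [2, 0, 3, 1, 4]),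
      ((2, 4), E_Bull, [0, 2, 1, 3, 4]), ((3, 4), E_L32, [0, 1, 2, 3, 4])]),
    (E_k13, [((0, 4), E_K14, [0, 1, 2, 3, 4]), ((1, 2), E_paw, [0, 1, 2, 3, 4]),
      ((1, 3), E_paw, [0, 1, 3, 2, 4]), ((1, 4), E_S211, [0, 1, 3, 4, 2]),
      ((2, 3), E_paw, [0, 3, 1, 2, 4]), ((2, 4), E_S211, [0, 3, 1, 4, 2]),
      ((3, 4), E_S211, [0, 3, 4, 1, 2])]),
    (E_p4, [((0, 2), E_paw, [1, 2, 0, 3, 4]), ((0, 3), E_c4, [0, 1, 2, 3, 4]),
      ((0, 4), E_P5, [1, 2, 3, 4, 0]), ((1, 3), E_paw, [3, 0, 1, 2, 4]),
      ((1, 4), E_S211, [3, 0, 1, 2, 4]), ((2, 4), E_S211, [2, 1, 0, 3, 4]),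
      ((3, 4), E_P5, [0, 1, 2, 3, 4])]),
    (E_k3k2, [((0, 3), E_L32, [0, 1, 2, 3, 4]), ((0, 4), E_L32, [0, 1, 2, 4, 3]),
      ((1, 3), E_L32, [1, 0, 2, 3, 4]), ((1, 4), E_L32, [1, 0, 2, 4, 3]),
      ((2, 3), E_L32, [1, 2, 0, 3, 4]), ((2, 4), E_L32, [1, 2, 0, 4, 3])]),
    (E_p3k2, [((0, 2), E_k3k2, [0, 1, 2, 3, 4]), ((0, 3), E_P5, [2, 1, 0, 3, 4]),
      ((0, 4), E_P5, [2, 1, 0, 4, 3]), ((1, 3), E_S211, [3, 0, 4, 1, 2]),
      ((1, 4), E_S211, [3, 0, 4, 2, 1]), ((2, 3), E_P5, [0, 1, 2, 3, 4]),
      ((2, 4), E_P5, [0, 1, 2, 4, 3])]),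
    (E_k3, [((0, 3), E_paw, [0, 1, 2, 3, 4]), ((0, 4), E_paw, [0, 1, 2, 4, 3]),
      ((1, 3), E_paw, [1, 0, 2, 3, 4]), ((1, 4), E_paw, [1, 0, 2, 4, 3]),
      ((2, 3), E_paw, [1, 2, 0, 3, 4]), ((2, 4), E_paw, [1, 2, 0, 4, 3]),
      ((3, 4), E_k3k2, [0, 1, 2, 3, 4])]),
    (E_p3, [((0, 2), E_k3, [0, 1, 2, 3, 4]), ((0, 3), E_p4, [1, 2, 3, 0, 4]),
      ((0, 4), E_p4, [1, 2, 3, 4, 0]), ((1, 3), E_k13, [1, 0, 2, 3, 4]),
      ((1, 4), E_k13, [1, 0, 2, 4, 3]), ((2, 3), E_p4, [0, 1, 2, 3, 4]),
      ((2, 4), E_p4, [0, 1, 2, 4, 3]), ((3, 4), E_p3k2, [0, 1, 2, 3, 4])]),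
    (E_k2k2, [((0, 2), E_p4, [1, 0, 2, 3, 4]), ((0, 3), E_p4, [1, 0, 3, 2, 4]),
      ((0, 4), E_p3k2, [1, 0, 3, 4, 2]), ((1, 2), E_p4, [0, 1, 2, 3, 4]),
      ((1, 3), E_p4, [0, 1, 3, 2, 4]), ((1, 4), E_p3k2, [0, 1, 3, 4, 2]),
      ((2, 4), E_p3k2, [3, 4, 1, 0, 2]), ((3, 4), E_p3k2, [3, 4, 0, 1, 2])]),
    (E_k2, [((0, 2), E_p3, [1, 0, 2, 3, 4]), ((0, 3), E_p3, [1, 0, 3, 2, 4]),
      ((0, 4), E_p3, [1, 0, 3, 4, 2]), ((1, 2), E_p3, [0, 1, 2, 3, 4]),
      ((1, 3), E_p3, [0, 1, 3, 2, 4]), ((1, 4), E_p3, [0, 1, 3, 4, 2]),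
      ((2, 3), E_k2k2, [0, 1, 2, 3, 4]), ((2, 4), E_k2k2, [0, 1, 2, 4, 3]),
      ((3, 4), E_k2k2, [0, 1, 4, 2, 3])]),
    (E_e, [((0, 1), E_k2, [0, 1, 2, 3, 4]), ((0, 2), E_k2, [0, 2, 1, 3, 4]),
      ((0, 3), E_k2, [0, 2, 3, 1, 4]), ((0, 4), E_k2, [0, 2, 3, 4, 1]),
      ((1, 2), E_k2, [2, 0, 1, 3, 4]), ((1, 3), E_k2, [2, 0, 3, 1, 4]),
      ((1, 4), E_k2, [2, 0, 3, 4, 1]), ((2, 3), E_k2, [2, 3, 0, 1, 4]),
      ((2, 4), E_k2, [2, 3, 0, 4, 1]), ((3, 4), E_k2, [2, 3, 4, 0, 1])])]"

lemma extension_table_valid: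
  "list_all (\<lambda>(E, rw). extension_row E rw \<and> list_all (\<lambda>(_, E', _). E' \<in> set reps) rw) extension_table"
  by code_simp

lemma extension_closed_reps:
  assumes "E \<in> set reps" shows "extension_closed E"
proof -
  have "reps = map fst extension_table"
    by (simp add: reps_def conn_reps_def disc_reps_def extension_table_def)
  then have "E \<in> set (map fst extension_table)" using assms by (simp only:)
  then obtain rw where rw: "(E, rw) \<in> set extension_table" by auto
  from bspec[OF extension_table_valid[unfolded list_all_iff] rw]
  have "extension_row E rw" "list_all (\<lambda>(_, E', _). E' \<in> set reps) rw"
    by (simp_all add: list_all_iff)
  then show ?thesis by (rule extension_closedI)
qed

lemma edge_in_all_pairs:
  assumes "e \<subseteq> {..<5}" "card e = 2"
  obtains u v where "(u, v) \<in> set all_pairs" "e = {u, v}"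
proof -
  obtain x y where xy: "e = {x, y}" "x < y"
  proof -
    obtain a b where ab: "e = {a, b}" "a \<noteq> b" using assms(2) by (auto simp: card_2_iff)
    show thesis
    proof (cases "a < b")
      case True
      then show ?thesis by (rule that[OF ab(1)])
    next
      case False
      then have "b < a" "e = {b, a}" using ab by auto
      then show ?thesis using that by simp
    qed
  qed
  have "x \<in> set [0, 1, 2, 3, 4]" "y \<in> set [0, 1, 2, 3, 4]"
    using assms(1) xy(1) less_5[of x] less_5[of y] by auto
  moreover have "list_all (\<lambda>u. list_all (\<lambda>v. u < v \<longrightarrow> (u, v) \<in> set all_pairs) [0, 1, 2, 3, 4]) [0, 1, 2, 3, 4]"
    by (simp add: all_pairs_def)
  ultimately have "(x, y) \<in> set all_pairs" using xy(2) by (simp only: list_all_iff)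
  then show ?thesis using xy(1) by (rule that)
qed

theorem order_5_classification:
  assumes sim: "simple_graph G" and n: "order_of G = 5"
  obtains E where "E \<in> set reps" "G \<simeq>\<^sub>G graph_of E"
proof -
  have all: "e \<subseteq> {..<5} \<and> card e = 2" if "e \<in> edges G" for e using sim that n by (auto simp: simple_graph_def)
  have "edges G \<subseteq> Pow {..<5}" using all by blast
  then have fin: "finite (edges G)" by (rule finite_subset) simp
  have "\<exists>E \<in> set reps. Graph 5 F \<simeq>\<^sub>G graph_of E" if "finite F" "F \<subseteq> edges G" for F
    using that
  proof (induction F rule: finite_induct)
    case empty
    have "Graph 5 {} = graph_of E_e" by (simp add: graph_of_def E_e_def)
    moreover have "E_e \<in> set reps" by (simp add: reps_def disc_reps_def)
    ultimately show ?case using graph_iso_refl[of "graph_of E_e"] by auto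
  next
    case (insert e F)
    then obtain E where E: "E \<in> set reps" "Graph 5 F \<simeq>\<^sub>G graph_of E" by auto
    then obtain f where f: "bij_betw f {..<5} {..<5}" "edges (graph_of E) = (`) f ` F"
      unfolding graph_iso_def by (elim exE conjE) (rule that, simp_all)
    have e: "e \<subseteq> {..<5}" "card e = 2" using all insert.prems by auto
    have "f ` e \<subseteq> {..<5}" using f(1) e(1) by (auto simp: bij_betw_def)
    moreover have "card (f ` e) = 2"
      using card_image[OF inj_on_subset[OF bij_betw_imp_inj_on[OF f(1)] e(1)]] e(2) by simp
    ultimately obtain u v where uv: "(u, v) \<in> set all_pairs" "f ` e = {u, v}"
      by (rule edge_in_all_pairs)
    \<comment> \<open>The bijection taking \<open>F\<close> to the edges of \<open>E\<close> also
      takes the enlarged edge set to those of \<open>E\<close> with the image of \<open>e\<close>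
      added.\<close>
    have iso: "Graph 5 (insert e F) \<simeq>\<^sub>G graph_of ((u, v) # E)"
      unfolding graph_iso_def
    proof (intro exI[of _ f] conjI)
      show "edges (graph_of ((u, v) # E)) = (`) f ` edges (Graph 5 (insert e F))"
        using f(2) uv(2) by (simp add: graph_of_def)
    qed (use f(1) in simp)
    show ?case
    proof (cases "(u, v) \<in> set E")
      case True
      then have "graph_of ((u, v) # E) = graph_of E" by (auto simp: graph_of_def)
      then show ?thesis using iso E(1) by auto
    next
      case False
      then obtain E' where "E' \<in> set reps" "graph_of ((u, v) # E) \<simeq>\<^sub>G graph_of E'"
        using extension_closed_reps[OF E(1)] uv(1) unfolding extension_closed_def by blast
      then show ?thesis using graph_iso_trans[OF iso] by blast
    qed
  qed
  from this[OF fin subset_refl] obtain E where "E \<in> set reps" "Graph 5 (edges G) \<simeq>\<^sub>G graph_of E" by blast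
  moreover have "Graph 5 (edges G) = G" using n by (cases G) simp
  ultimately show ?thesis using that by simp
qed

section \<open>Connectedness\<close>

lemma connected_graphI:
  assumes f: "\<And>v. v < order_of G \<Longrightarrow> (0, v) \<in> {(x, y). {x, y} \<in> edges G}\<^sup>*"
  shows "connected_graph G"
  unfolding connected_graph_def
proof (intro ballI)
  let ?R = "{(x, y). {x, y} \<in> edges G}"
  fix u v assume "u \<in> verts G" "v \<in> verts G"
  then have "(0, u) \<in> ?R\<^sup>*" "(0, v) \<in> ?R\<^sup>*" using f by simp_all
  moreover have "sym (?R\<^sup>*)" by (intro sym_rtrancl) (auto simp: sym_def insert_commute)
  ultimately show "(u, v) \<in> ?R\<^sup>*" by (meson rtrancl_trans symD)
qed

text \<open>A search from \<open>S\<close> that tries candidates in the given order; a vertex may be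
  listed again, so that a second sweep catches what the first one met too early.\<close>

fun reached :: "(nat \<times> nat) list \<Rightarrow> nat list \<Rightarrow> nat list \<Rightarrow> nat list" where
  "reached E S [] = S"
| "reached E S (v # vs) = (if list_ex (\<lambda>u. adjacent E u v) S then reached E (v # S) vs else reached E S vs)"

lemma reached_sound:
  "(\<And>v. v \<in> set S \<Longrightarrow> (0, v) \<in> {(x, y). {x, y} \<in> edges (graph_of E)}\<^sup>*) \<Longrightarrow> v \<in> set (reached E S vs) \<Longrightarrow>
    (0, v) \<in> {(x, y). {x, y} \<in> edges (graph_of E)}\<^sup>*"
proof (induction vs arbitrary: S)
  case (Cons w vs)
  show ?case
  proof (cases "list_ex (\<lambda>u. adjacent E u w) S")
    case True
    then obtain u where u: "u \<in> set S" "adjacent E u w" by (auto simp: list_ex_iff)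
    then have "(u, w) \<in> {(x, y). {x, y} \<in> edges (graph_of E)}" by (simp add: edge_graph_of)
    with Cons.prems(1)[OF u(1)] have "(0, w) \<in> {(x, y). {x, y} \<in> edges (graph_of E)}\<^sup>*"
      by (rule rtrancl_into_rtrancl)
    then have "\<And>v. v \<in> set (w # S) \<Longrightarrow> (0, v) \<in> {(x, y). {x, y} \<in> edges (graph_of E)}\<^sup>*" using Cons.prems(1) by auto
    moreover have "v \<in> set (reached E (w # S) vs)" using Cons.prems(2) True by simp
    ultimately show ?thesis by (rule Cons.IH)
  next
    case False
    then have "v \<in> set (reached E S vs)" using Cons.prems(2) by simp
    with Cons.prems(1) show ?thesis by (rule Cons.IH)
  qed
qed simp

lemma connected_if_reached:
  assumes "{1, 2, 3, 4} \<subseteq> set (reached E [0] vs)"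
  shows "connected_graph (graph_of E)"
proof (rule connected_graphI)
  fix v assume "v < order_of (graph_of E)"
  then have "v = 0 \<or> v \<in> set (reached E [0] vs)" using assms by (auto simp: less_5)
  then show "(0, v) \<in> {(x, y). {x, y} \<in> edges (graph_of E)}\<^sup>*"
    using reached_sound[of "[0]" E v vs] by auto
qed

lemma connected_conn_reps:
  assumes "E \<in> set conn_reps" shows "connected_graph (graph_of E)"
proof -
  have "list_all (\<lambda>E. {1, 2, 3, 4} \<subseteq> set (reached E [0] [1, 2, 3, 4, 1, 2, 3, 4])) conn_reps"
    by code_simp
  then have "{1, 2, 3, 4} \<subseteq> set (reached E [0] [1, 2, 3, 4, 1, 2, 3, 4])" using assms by (simp only: list_all_iff)
  then show ?thesis by (rule connected_if_reached)
qed

lemma not_connected_if_closed: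
  assumes S: "\<forall>(u, v) \<in> set E. u \<in> S \<longleftrightarrow> v \<in> S" and uv: "u < 5" "u \<in> S" "v < 5" "v \<notin> S"
  shows "\<not> connected_graph (graph_of E)"
proof
  let ?R = "{(x, y). {x, y} \<in> edges (graph_of E)}"
  assume "connected_graph (graph_of E)"
  then have "(u, v) \<in> ?R\<^sup>*" using uv by (simp add: connected_graph_def)
  then have "v \<in> S"
  proof (induction rule: rtrancl_induct)
    case (step y z)
    then show ?case using S by (auto simp: edge_graph_of adjacent_def)
  qed (rule uv(2))
  then show False using uv(4) by simp
qed

lemma not_connected_disc_reps:
  assumes "E \<in> set disc_reps" shows "\<not> connected_graph (graph_of E)"
proof -
  \<comment> \<open>Disconnected representatives are numbered so that vertex 4 is isolated or the
    last two vertices are separated from the first three.\<close>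
  have "list_all (\<lambda>E. list_all (\<lambda>(u, v). u \<in> {0, 1, 2, 3} \<longleftrightarrow> v \<in> {0, 1, 2, 3 :: nat}) E \<or>
      list_all (\<lambda>(u, v). u \<in> {0, 1, 2} \<longleftrightarrow> v \<in> {0, 1, 2 :: nat}) E) disc_reps"
    by (simp add: disc_reps_def edge_list_defs)
  then have "list_all (\<lambda>(u, v). u \<in> {0, 1, 2, 3} \<longleftrightarrow> v \<in> {0, 1, 2, 3 :: nat}) E \<or>
      list_all (\<lambda>(u, v). u \<in> {0, 1, 2} \<longleftrightarrow> v \<in> {0, 1, 2 :: nat}) E"
    using assms by (simp only: list_all_iff)
  then show ?thesis
  proof
    assume "list_all (\<lambda>(u, v). u \<in> {0, 1, 2, 3} \<longleftrightarrow> v \<in> {0, 1, 2, 3 :: nat}) E"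
    then show ?thesis by (intro not_connected_if_closed[of E "{0, 1, 2, 3}" 0 4]) (simp_all only: list_all_iff, simp_all)
  next
    assume "list_all (\<lambda>(u, v). u \<in> {0, 1, 2} \<longleftrightarrow> v \<in> {0, 1, 2 :: nat}) E"
    then show ?thesis by (intro not_connected_if_closed[of E "{0, 1, 2}" 0 4]) (simp_all only: list_all_iff, simp_all)
  qed
qed

section \<open>Attained lists\<close>

definition valid_edges :: "(nat \<times> nat) list \<Rightarrow> bool" where
  "valid_edges E \<longleftrightarrow> list_all (\<lambda>(u, v). u < 5 \<and> v < 5 \<and> u \<noteq> v) E"

lemma simple_graph_of:
  assumes "valid_edges E" shows "simple_graph (graph_of E)"
  unfolding simple_graph_def
proof
  fix e assume "e \<in> edges (graph_of E)"
  then obtain u v where e: "e = {u, v}" "(u, v) \<in> set E" by (auto simp: graph_of_def)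
  then have "u < 5 \<and> v < 5 \<and> u \<noteq> v" using assms by (auto simp: valid_edges_def list_all_iff)
  then show "e \<subseteq> verts (graph_of E) \<and> card e = 2" by (simp add: e)
qed

lemma valid_edges_reps:
  assumes "E \<in> set reps" shows "valid_edges E"
proof -
  have "list_all valid_edges reps"
    by (simp add: valid_edges_def reps_def conn_reps_def disc_reps_def edge_list_defs)
  then show ?thesis using assms by (simp only: list_all_iff)
qed

lemma simple_graph_reps: "E \<in> set reps \<Longrightarrow> simple_graph (graph_of E)"
  by (intro simple_graph_of valid_edges_reps)

text \<open>In a certificate \<open>(E, H, p)\<close> the list \<open>p\<close> exhibits inside
  \<open>E\<close> a copy of some \<open>H\<close> that already realizes every spectrum.\<close>

lemma arbitrary_SSP_cover:
  assumes cov: "list_all (\<lambda>(E, H, p). H \<in> set Hs \<and> maps_into p H E) cs"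
    and Hs: "list_all (\<lambda>E. arbitrary_SSP (graph_of E) m) Hs" and reps: "set Hs \<subseteq> set reps"
  shows "list_all (\<lambda>(E, _, _). arbitrary_SSP (graph_of E) m) cs"
  unfolding list_all_iff
proof (intro ballI)
  fix x assume x: "x \<in> set cs"
  obtain E H p where e: "x = (E, H, p)" by (cases x)
  have H: "H \<in> set Hs" "maps_into p H E" using cov x by (auto simp: list_all_iff e)
  have "simple_graph (graph_of H)" by (rule simple_graph_reps) (use H(1) reps in blast)
  moreover have "arbitrary_SSP (graph_of H) m" using Hs H(1) by (simp add: list_all_iff)
  ultimately show "case x of (E, _, _) \<Rightarrow> arbitrary_SSP (graph_of E) m"
    unfolding e prod.case by (intro arbitrary_SSP_embeds[OF _ _ embeds_graph_of[OF H(2)]]) simp_all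
qed

text \<open>A bound on the head of every attained list bounds the last entry too, by reversal; the
  empty list is set apart because its \<open>hd\<close> and \<open>last\<close> are
  unspecified.\<close>

lemma hd_last_bound:
  assumes "\<And>k m. attains (graph_of E) (k # m) \<Longrightarrow> k \<le> b" and at: "attains (graph_of E) m"
  shows "m = [] \<or> hd m \<le> b \<and> last m \<le> b"
proof (cases "m = []")
  case False
  have "attains (graph_of E) (rev m)" using attains_rev(1)[of "graph_of E" m] at by simp
  moreover have "rev m = last m # rev (butlast m)"
    using arg_cong[OF append_butlast_last_id[OF False], of rev] by simp
  ultimately have "last m \<le> b" using assms(1) by simp
  moreover have "hd m \<le> b" by (rule assms(1)[of "hd m" "tl m"]) (simp add: False at)
  ultimately show ?thesis by blast
qed simp

text \<open>Positive claims are kept up to reversal, since negation supplies the other half; failure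
  of the SMP is recorded for both orders.\<close>

definition attained_lists :: "(nat \<times> nat) list \<Rightarrow> nat list list \<Rightarrow> nat list list \<Rightarrow> bool" where
  "attained_lists E ms starred \<longleftrightarrow>
     (\<forall>m. attains (graph_of E) m \<longrightarrow> m \<in> with_reversals ms \<union> with_reversals starred) \<and>
     (\<forall>m \<in> set ms. arbitrary_SSP (graph_of E) m) \<and>
     (\<forall>m \<in> set starred. arbitrary (graph_of E) m \<and>
        \<not> attains_SMP (graph_of E) m \<and> \<not> attains_SMP (graph_of E) (rev m)) \<and>
     (\<forall>m \<in> set (ms @ starred). (\<forall>k \<in> set m. 0 < k) \<and> sum_list m = 5)"

lemma attained_listsI:
  assumes "\<And>m. attains (graph_of E) m \<Longrightarrow> m \<in> with_reversals ms \<union> with_reversals starred"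
    and "list_all (arbitrary_SSP (graph_of E)) ms"
    and "list_all (\<lambda>m. arbitrary (graph_of E) m \<and>
        \<not> attains_SMP (graph_of E) m \<and> \<not> attains_SMP (graph_of E) (rev m)) starred"
    and "list_all (\<lambda>m. list_all (\<lambda>k. 0 < k) m \<and> sum_list m = 5) (ms @ starred)"
  shows "attained_lists E ms starred"
  unfolding attained_lists_def
proof (intro conjI allI impI)
  show "m \<in> with_reversals ms \<union> with_reversals starred" if "attains (graph_of E) m" for m
    by (rule assms(1)) (rule that)
qed (use assms(2-4) in \<open>simp_all only: list_all_iff\<close>)

text \<open>Only the sixteen compositions of five can occur, so an evaluable necessary condition
  \<open>P\<close> leaves a finite check.\<close>

lemma attained_lists_bound:
  assumes at: "attains (graph_of E) m" and P: "P m"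
    and all: "list_all (\<lambda>m. P m \<longrightarrow> m \<in> set (ms @ map rev ms @ starred @ map rev starred))
      [[5], [4,1], [1,4], [3,2], [2,3], [3,1,1], [1,3,1], [1,1,3], [2,2,1], [2,1,2], [1,2,2],
       [2,1,1,1], [1,2,1,1], [1,1,2,1], [1,1,1,2], [1,1,1,1,1]]"
  shows "m \<in> with_reversals ms \<union> with_reversals starred"
proof -
  have "P m \<longrightarrow> m \<in> set (ms @ map rev ms @ starred @ map rev starred)"
    by (rule bspec[OF all[unfolded list_all_iff] attains_composition[OF at]])
  then show ?thesis using P unfolding with_reversals_def set_append set_map by blast
qed

lemma attains_SSP_imp_SMP:
  assumes "attains_SSP G m" shows "attains_SMP G m"
proof -
  obtain A where "A \<in> S_graph G" "mult_list A = m" "SSP (order_of G) A"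
    using assms unfolding attains_SSP_def by blast
  then show ?thesis unfolding attains_SMP_def using SSP_imp_SMP[of "order_of G" A] by blast
qed

lemma not_attains_SSP:
  assumes al: "attained_lists E ms starred" and m: "m \<notin> with_reversals ms"
  shows "\<not> attains_SSP (graph_of E) m"
proof
  assume at: "attains_SSP (graph_of E) m"
  then have "m \<in> with_reversals starred"
    using al m attains_SSP_imp_attains unfolding attained_lists_def by blast
  then have "\<not> attains_SMP (graph_of E) m" using al by (auto simp: attained_lists_def with_reversals_def)
  then show False using attains_SSP_imp_SMP[OF at] by blast
qed

lemma attained_lists_iso:
  assumes al: "attained_lists E ms starred" and E: "E \<in> set reps"
    and sim: "simple_graph G" and iso: "G \<simeq>\<^sub>G graph_of E"
  shows "{m. attains G m} = with_reversals ms \<union> with_reversals starred"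
    and "\<forall>m. attains G m \<longrightarrow> spectrally_arbitrary m G"
    and "\<forall>m \<in> with_reversals ms. attains_SSP G m"
    and "\<forall>m \<in> with_reversals starred. \<not> attains_SMP G m \<and> \<not> attains_SSP G m"
proof -
  have iso': "graph_of E \<simeq>\<^sub>G G" by (rule graph_iso_sym[OF iso sim])
  note simE = simple_graph_reps[OF E]
  have arb: "arbitrary (graph_of E) m" and pos: "\<forall>k \<in> set m. 0 < k" and sum: "sum_list m = 5"
    if "m \<in> with_reversals ms \<union> with_reversals starred" for m
  proof -
    have base: "arbitrary (graph_of E) m \<and> (\<forall>k \<in> set m. 0 < k) \<and> sum_list m = 5" if "m \<in> set ms \<union> set starred" for m
      using al that arbitrary_SSP_imp_arbitrary unfolding attained_lists_def by auto
    have "m \<in> set ms \<union> set starred \<or> rev m \<in> set ms \<union> set starred"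
      using that by (auto simp: with_reversals_def)
    then have "arbitrary (graph_of E) m \<and> (\<forall>k \<in> set m. 0 < k) \<and> sum_list m = 5"
    proof
      assume "rev m \<in> set ms \<union> set starred"
      from base[OF this] show ?thesis
        using arbitrary_rev(1)[of "graph_of E" "rev m"] by simp
    qed (rule base)
    then show "arbitrary (graph_of E) m" "\<forall>k \<in> set m. 0 < k" "sum_list m = 5" by blast+
  qed
  have sub: "m \<in> with_reversals ms \<union> with_reversals starred" if "attains G m" for m
    using al attains_iso(1)[OF iso sim that] unfolding attained_lists_def by blast
  have sup: "attains G m" if "m \<in> with_reversals ms \<union> with_reversals starred" for m
    by (rule attains_iso(1)[OF iso' simE])
      (rule arbitrary_imp_attains(1)[OF order_graph_of pos[OF that] sum[OF that] arb[OF that]])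
  show "{m. attains G m} = with_reversals ms \<union> with_reversals starred" using sub sup by blast
  show "\<forall>m. attains G m \<longrightarrow> spectrally_arbitrary m G"
  proof (intro allI impI)
    fix m assume "attains G m"
    then have m: "m \<in> with_reversals ms \<union> with_reversals starred" by (rule sub)
    show "spectrally_arbitrary m G"
      by (rule attains_iso(4)[OF iso' simE]) (rule arbitrary_imp_spectrally_arbitrary[OF pos[OF m] arb[OF m]])
  qed
  show "\<forall>m \<in> with_reversals ms. attains_SSP G m"
  proof
    fix m assume m: "m \<in> with_reversals ms"
    have base: "attains_SSP (graph_of E) m" if "m \<in> set ms" for m
      by (rule arbitrary_imp_attains(2)) (use al that in \<open>auto simp: attained_lists_def\<close>)
    have "m \<in> set ms \<or> rev m \<in> set ms" using m by (auto simp: with_reversals_def)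
    then have "attains_SSP (graph_of E) m" using base attains_rev(2)[of "graph_of E" m] by auto
    then show "attains_SSP G m" by (rule attains_iso(2)[OF iso' simE])
  qed
  show "\<forall>m \<in> with_reversals starred. \<not> attains_SMP G m \<and> \<not> attains_SSP G m"
  proof
    fix m assume "m \<in> with_reversals starred"
    then have "\<not> attains_SMP (graph_of E) m" using al by (auto simp: attained_lists_def with_reversals_def)
    then have "\<not> attains_SMP G m" using attains_iso(3)[OF iso sim] by blast
    then show "\<not> attains_SMP G m \<and> \<not> attains_SSP G m" using attains_SSP_imp_SMP by blast
  qed
qed

section \<open>Minimal graphs\<close>

text \<open>A minimal \<open>G\<close> contains a copy of some \<open>H\<close> from
  \<open>Hs\<close>, which must be all of \<open>G\<close>. Conversely, a proper subgraph of a copy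
  of \<open>H\<close> misses an edge, hence embeds in \<open>H\<close> with one edge deleted, and
  attainment would pass up to that graph.\<close>

lemma minimal_iff:
  assumes sim: "simple_graph G" and n: "order_of G = 5"
    and Hs: "\<And>H. H \<in> set Hs \<Longrightarrow> simple_graph (graph_of H) \<and> attains_SSP (graph_of H) m"
    and cov: "\<And>E. E \<in> set reps \<Longrightarrow> attains_SSP (graph_of E) m \<Longrightarrow> \<exists>H \<in> set Hs. embeds (graph_of H) (graph_of E)"
    and min: "\<And>H e. H \<in> set Hs \<Longrightarrow> e \<in> set H \<Longrightarrow> \<not> attains_SSP (graph_of (removeAll e H)) m"
  shows "minimal_attaining_SSP G m \<longleftrightarrow> (\<exists>H \<in> set Hs. G \<simeq>\<^sub>G graph_of H)"
proof
  assume mi: "minimal_attaining_SSP G m"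
  obtain E where E: "E \<in> set reps" "G \<simeq>\<^sub>G graph_of E" using order_5_classification[OF sim n] by blast
  have "attains_SSP (graph_of E) m"
    using attains_iso(2)[OF E(2) sim] mi unfolding minimal_attaining_SSP_def by blast
  from cov[OF E(1) this] obtain H where H: "H \<in> set Hs" "embeds (graph_of H) (graph_of E)" by blast
  obtain f where f: "bij_betw f {..<5} {..<5}" "(`) f ` edges (graph_of H) \<subseteq> edges (graph_of E)"
    using H(2) unfolding embeds_def order_graph_of by (elim conjE exE) (rule that)
  have "graph_of E \<simeq>\<^sub>G G" by (rule graph_iso_sym[OF E(2) sim])
  then obtain g where g: "bij_betw g {..<5} {..<5}" "edges G = (`) g ` edges (graph_of E)"
    unfolding graph_iso_def order_graph_of n by (elim conjE exE) (rule that)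
  let ?F = "(`) (g \<circ> f) ` edges (graph_of H)"
  have "?F = (`) g ` (`) f ` edges (graph_of H)" by (simp add: image_comp image_image)
  then have sub: "?F \<subseteq> edges G" using f(2) g(2) by (simp only: image_mono)
  have iso: "graph_of H \<simeq>\<^sub>G Graph 5 ?F"
    unfolding graph_iso_def using bij_betw_trans[OF f(1) g(1)] by (intro exI[of _ "g \<circ> f"]) simp
  have "attains_SSP (Graph 5 ?F) m" by (rule attains_iso(2)[OF iso]) (use Hs[OF H(1)] in blast)+
  then have "\<not> ?F \<subset> edges G" using mi n unfolding minimal_attaining_SSP_def by auto
  then have "?F = edges G" using sub by blast
  then have "Graph 5 ?F = G" using n by (cases G) simp
  then have "G \<simeq>\<^sub>G graph_of H" using graph_iso_sym[OF iso] Hs[OF H(1)] by simp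
  then show "\<exists>H \<in> set Hs. G \<simeq>\<^sub>G graph_of H" using H(1) by blast
next
  assume "\<exists>H \<in> set Hs. G \<simeq>\<^sub>G graph_of H"
  then obtain H where H: "H \<in> set Hs" "G \<simeq>\<^sub>G graph_of H" by blast
  have iso': "graph_of H \<simeq>\<^sub>G G" by (rule graph_iso_sym[OF H(2) sim])
  obtain f where f: "bij_betw f {..<5} {..<5}" "edges (graph_of H) = (`) f ` edges G"
    using H(2) unfolding graph_iso_def order_graph_of n by (elim conjE exE) (rule that)
  have "\<not> attains_SSP (Graph 5 F) m" if F: "F \<subset> edges G" for F
  proof
    assume at: "attains_SSP (Graph 5 F) m"
    have "edges G \<subseteq> Pow {..<5}" using sim n by (auto simp: simple_graph_def)
    \<comment> \<open>Injectivity on edges ensures that the image of an edge missing from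
      \<open>F\<close> is missing from the image of \<open>F\<close>.\<close>
    then have inj: "inj_on ((`) f) (edges G)"
      using inj_on_image_Pow[OF bij_betw_imp_inj_on[OF f(1)]] by (rule inj_on_subset[rotated])
    obtain e where e: "e \<in> edges G" "e \<notin> F" using F by blast
    have "f ` e \<in> (`) f ` F \<longleftrightarrow> e \<in> F" by (rule inj_on_image_mem_iff[OF inj e(1)]) (use F in blast)
    then have "f ` e \<notin> (`) f ` F" using e(2) by simp
    moreover have "f ` e \<in> edges (graph_of H)" using e(1) f(2) by blast
    then obtain u v where "(u, v) \<in> set H" "f ` e = {u, v}" by (auto simp: graph_of_def)
    moreover have "(`) f ` F \<subseteq> edges (graph_of H)" unfolding f(2) using F by blast
    ultimately have uv: "(u, v) \<in> set H" "{u, v} \<notin> (`) f ` F" "(`) f ` F \<subseteq> edges (graph_of H)"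
      by simp_all
    have "edges (graph_of H) - {{u, v}} \<subseteq> edges (graph_of (removeAll (u, v) H))"
      by (auto simp: graph_of_def)
    then have "(`) f ` F \<subseteq> edges (graph_of (removeAll (u, v) H))" using uv by blast
    then have "embeds (Graph 5 F) (graph_of (removeAll (u, v) H))"
      unfolding embeds_def using f(1) by auto
    moreover have "simple_graph (Graph 5 F)" using F sim n by (auto simp: simple_graph_def)
    ultimately have "attains_SSP (graph_of (removeAll (u, v) H)) m"
      by (intro attains_SSP_embeds[OF _ _ _ at]) simp_all
    then show False using min[OF H(1) uv(1)] by blast
  qed
  moreover have "attains_SSP G m" by (rule attains_iso(2)[OF iso']) (use Hs[OF H(1)] in blast)+
  ultimately show "minimal_attaining_SSP G m" unfolding minimal_attaining_SSP_def n by blast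
qed

text \<open>Each representative is listed in \<open>good\<close>, as containing a member of
  \<open>Hs\<close>, or in \<open>bad\<close>, as contained in a failing graph of \<open>bs\<close>;
  \<open>mins\<close> places every edge-deleted member of \<open>Hs\<close> inside a graph of
  \<open>bs\<close>. Failure is inherited by subgraphs, so it is assumed for \<open>bs\<close>
  alone.\<close>

lemma minimal_iff_certificate:
  assumes sim: "simple_graph G" and n: "order_of G = 5" and m: "list_all (\<lambda>k. 0 < k) m" "sum_list m = 5"
    and arb: "list_all (\<lambda>E. arbitrary_SSP (graph_of E) m) Hs"
    and good: "list_all (\<lambda>(E, H, p). H \<in> set Hs \<and> maps_into p H E) good"
    and bs: "list_all (\<lambda>B. \<not> attains_SSP (graph_of B) m) bs"
    and bad: "list_all (\<lambda>(E, B, p). B \<in> set bs \<and> maps_into p E B) bad"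
    and mins: "list_all (\<lambda>(H, certs). list_all2 (\<lambda>e (B, p). B \<in> set bs \<and> maps_into p (removeAll e H) B) H certs) mins"
    and Hs: "map fst mins = Hs" "list_all (\<lambda>H. H \<in> set reps) Hs"
    and all: "list_all (\<lambda>E. E \<in> set (map fst good @ map fst bad)) reps"
  shows "minimal_attaining_SSP G m \<longleftrightarrow> (\<exists>H \<in> set Hs. G \<simeq>\<^sub>G graph_of H)"
proof (rule minimal_iff[OF sim n])
  fix H assume H: "H \<in> set Hs"
  then have "simple_graph (graph_of H)" using Hs(2) simple_graph_reps by (auto simp: list_all_iff)
  moreover have "attains_SSP (graph_of H) m"
    by (rule arbitrary_imp_attains(2)) (use m arb H in \<open>auto simp: list_all_iff\<close>)
  ultimately show "simple_graph (graph_of H) \<and> attains_SSP (graph_of H) m" ..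
next
  have no: "\<not> attains_SSP (graph_of E) m" if "B \<in> set bs" "maps_into p E B" "valid_edges E" for E B p
    using attains_SSP_embeds[OF _ simple_graph_of[OF that(3)] embeds_graph_of[OF that(2)]] bs that(1)
    by (auto simp: list_all_iff)
  fix E assume E: "E \<in> set reps" and at: "attains_SSP (graph_of E) m"
  have "E \<in> fst ` set good \<or> E \<in> fst ` set bad" using all E by (auto simp: list_all_iff)
  then show "\<exists>H \<in> set Hs. embeds (graph_of H) (graph_of E)"
  proof
    assume "E \<in> fst ` set good"
    then obtain H p where "H \<in> set Hs" "maps_into p H E" using good by (fastforce simp: list_all_iff)
    then show ?thesis using embeds_graph_of by blast
  next
    assume "E \<in> fst ` set bad"
    then obtain B p where "B \<in> set bs" "maps_into p E B" using bad by (fastforce simp: list_all_iff)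
    then show ?thesis using no[OF _ _ valid_edges_reps[OF E]] at by blast
  qed
next
  fix H e assume H: "H \<in> set Hs" "e \<in> set H"
  then obtain certs where certs: "(H, certs) \<in> set mins" using Hs(1) by auto
  then have "list_all2 (\<lambda>e (B, p). B \<in> set bs \<and> maps_into p (removeAll e H) B) H certs"
    using mins by (auto simp: list_all_iff)
  moreover obtain i where i: "i < length H" "H ! i = e" using H(2) by (auto simp: in_set_conv_nth)
  ultimately have c: "case certs ! i of (B, p) \<Rightarrow> B \<in> set bs \<and> maps_into p (removeAll e H) B"
    by (auto dest: list_all2_nthD)
  obtain B p where "certs ! i = (B, p)" by (cases "certs ! i")
  with c have B: "B \<in> set bs" "maps_into p (removeAll e H) B" by simp_all
  have "valid_edges H" using H(1) Hs(2)
    by (auto simp: list_all_iff valid_edges_reps)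
  then have "valid_edges (removeAll e H)" by (auto simp: valid_edges_def list_all_iff)
  then have "simple_graph (graph_of (removeAll e H))" by (rule simple_graph_of)
  from attains_SSP_embeds[OF _ this embeds_graph_of[OF B(2)]]
  show "\<not> attains_SSP (graph_of (removeAll e H)) m" using bs B(1) by (auto simp: list_all_iff)
qed

section \<open>Copies of the minimal graphs inside the other graphs\<close>

lemma cover_41: "list_all (\<lambda>(E, H, p). H \<in> set [E_K5] \<and> maps_into p H E)
   [(E_K5, E_K5, [0, 1, 2, 3, 4])]"
  by (simp add: maps_into_def perm_list_def adjacent_def edge_list_defs)

lemma arbitrary_SSP_41:
  "list_all (\<lambda>E. arbitrary_SSP (graph_of E) [4,1]) [E_K5]"
  "list_all (\<lambda>E. arbitrary_SSP (graph_of E) [4,1])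
     [E_K5]"
proof -
  show *: "list_all (\<lambda>E. arbitrary_SSP (graph_of E) [4,1]) [E_K5]"
    by (simp add: arbitrary_SSP_K5 del: One_nat_def)
  show "list_all (\<lambda>E. arbitrary_SSP (graph_of E) [4,1])
     [E_K5]"
    using arbitrary_SSP_cover[OF cover_41 *] by (simp add: reps_def conn_reps_def disc_reps_def del: One_nat_def)
qed

lemma cover_32: "list_all (\<lambda>(E, H, p). H \<in> set [E_K4e] \<and> maps_into p H E)
   [(E_K4e, E_K4e, [0, 1, 2, 3, 4]), (E_W5, E_K4e, [0, 2, 1, 4, 3]),
    (E_FullHouse, E_K4e, [0, 1, 2, 3, 4]), (E_K5e, E_K4e, [0, 1, 2, 3, 4]),
    (E_K5, E_K4e, [0, 1, 2, 3, 4])]"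
  by (simp add: maps_into_def perm_list_def adjacent_def edge_list_defs)

lemma arbitrary_SSP_32:
  "list_all (\<lambda>E. arbitrary_SSP (graph_of E) [3,2]) [E_K4e]"
  "list_all (\<lambda>E. arbitrary_SSP (graph_of E) [3,2])
     [E_K4e, E_W5, E_FullHouse, E_K5e, E_K5]"
proof -
  show *: "list_all (\<lambda>E. arbitrary_SSP (graph_of E) [3,2]) [E_K4e]"
    by (simp add: arbitrary_SSP_K4e(1) del: One_nat_def)
  show "list_all (\<lambda>E. arbitrary_SSP (graph_of E) [3,2])
     [E_K4e, E_W5, E_FullHouse, E_K5e, E_K5]"
    using arbitrary_SSP_cover[OF cover_32 *] by (simp add: reps_def conn_reps_def disc_reps_def del: One_nat_def)
qed

lemma cover_311: "list_all (\<lambda>(E, H, p). H \<in> set [E_k4, E_K4e] \<and> maps_into p H E)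
   [(E_L41, E_k4, [0, 1, 2, 3, 4]), (E_K4e, E_K4e, [0, 1, 2, 3, 4]),
    (E_W5, E_K4e, [0, 2, 1, 4, 3]), (E_FullHouse, E_k4, [0, 1, 2, 3, 4]),
    (E_K5e, E_k4, [0, 2, 3, 4, 1]), (E_K5, E_k4, [0, 1, 2, 3, 4]), (E_k4, E_k4, [0, 1, 2, 3, 4])]"
  by (simp add: maps_into_def perm_list_def adjacent_def edge_list_defs)

text \<open>The second list keeps only the connected graphs of \<open>cover_311\<close>; the full
  cover returns as the \<open>good\<close> part of the minimality certificate.\<close>

lemma arbitrary_SSP_311:
  "list_all (\<lambda>E. arbitrary_SSP (graph_of E) [3,1,1]) [E_k4, E_K4e]"
  "list_all (\<lambda>E. arbitrary_SSP (graph_of E) [3,1,1])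
     [E_L41, E_K4e, E_W5, E_FullHouse, E_K5e, E_K5]"
proof -
  show *: "list_all (\<lambda>E. arbitrary_SSP (graph_of E) [3,1,1]) [E_k4, E_K4e]"
    by (simp add: arbitrary_SSP_k4(1) arbitrary_SSP_K4e(2) del: One_nat_def)
  show "list_all (\<lambda>E. arbitrary_SSP (graph_of E) [3,1,1])
     [E_L41, E_K4e, E_W5, E_FullHouse, E_K5e, E_K5]"
    using arbitrary_SSP_cover[OF cover_311 *] by (simp add: reps_def conn_reps_def disc_reps_def del: One_nat_def)
qed

lemma cover_131: "list_all (\<lambda>(E, H, p). H \<in> set [E_k4, E_K23] \<and> maps_into p H E)
   [(E_K23, E_K23, [0, 1, 2, 3, 4]), (E_T5, E_K23, [0, 1, 2, 3, 4]),
    (E_L41, E_k4, [0, 1, 2, 3, 4]), (E_K4e, E_K23, [0, 1, 2, 3, 4]),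
    (E_W5, E_K23, [0, 2, 1, 3, 4]), (E_FullHouse, E_k4, [0, 1, 2, 3, 4]),
    (E_K5e, E_k4, [0, 2, 3, 4, 1]), (E_K5, E_k4, [0, 1, 2, 3, 4]), (E_k4, E_k4, [0, 1, 2, 3, 4])]"
  by (simp add: maps_into_def perm_list_def adjacent_def edge_list_defs)

lemma arbitrary_SSP_131:
  "list_all (\<lambda>E. arbitrary_SSP (graph_of E) [1,3,1]) [E_k4, E_K23]"
  "list_all (\<lambda>E. arbitrary_SSP (graph_of E) [1,3,1])
     [E_K23, E_T5, E_L41, E_K4e, E_W5, E_FullHouse, E_K5e, E_K5]"
proof -
  show *: "list_all (\<lambda>E. arbitrary_SSP (graph_of E) [1,3,1]) [E_k4, E_K23]"
    by (simp add: arbitrary_SSP_k4(2) arbitrary_SSP_K23 del: One_nat_def)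
  show "list_all (\<lambda>E. arbitrary_SSP (graph_of E) [1,3,1])
     [E_K23, E_T5, E_L41, E_K4e, E_W5, E_FullHouse, E_K5e, E_K5]"
    using arbitrary_SSP_cover[OF cover_131 *] by (simp add: reps_def conn_reps_def disc_reps_def del: One_nat_def)
qed

lemma cover_212: "list_all (\<lambda>(E, H, p). H \<in> set [E_c4, E_Butterfly] \<and> maps_into p H E)
   [(E_Banner, E_c4, [0, 1, 2, 3, 4]), (E_House, E_c4, [0, 3, 1, 4, 2]),
    (E_Dart, E_c4, [0, 2, 1, 3, 4]), (E_Kite, E_c4, [0, 2, 1, 3, 4]),
    (E_Gem, E_c4, [0, 1, 2, 4, 3]), (E_Butterfly, E_Butterfly, [0, 1, 2, 3, 4]),
    (E_K23, E_c4, [0, 2, 1, 3, 4]), (E_T5, E_c4, [0, 2, 1, 3, 4]), (E_L41, E_c4, [0, 1, 2, 3, 4]),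
    (E_K4e, E_c4, [0, 2, 1, 3, 4]), (E_W5, E_c4, [0, 1, 2, 3, 4]),
    (E_FullHouse, E_c4, [0, 1, 2, 3, 4]), (E_K5e, E_c4, [0, 2, 1, 3, 4]),
    (E_K5, E_c4, [0, 1, 2, 3, 4]), (E_k4, E_c4, [0, 1, 2, 3, 4]), (E_c4, E_c4, [0, 1, 2, 3, 4]),
    (E_k4e, E_c4, [0, 2, 1, 3, 4])]"
  by (simp add: maps_into_def perm_list_def adjacent_def edge_list_defs)

lemma arbitrary_SSP_212:
  "list_all (\<lambda>E. arbitrary_SSP (graph_of E) [2,1,2]) [E_c4, E_Butterfly]"
  "list_all (\<lambda>E. arbitrary_SSP (graph_of E) [2,1,2])
     [E_Banner, E_House, E_Dart, E_Kite, E_Gem, E_Butterfly, E_K23, E_T5, E_L41, E_K4e, E_W5, E_FullHouse, E_K5e, E_K5]"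
proof -
  show *: "list_all (\<lambda>E. arbitrary_SSP (graph_of E) [2,1,2]) [E_c4, E_Butterfly]"
    by (simp add: arbitrary_SSP_c4(1) arbitrary_Butterfly(1) del: One_nat_def)
  show "list_all (\<lambda>E. arbitrary_SSP (graph_of E) [2,1,2])
     [E_Banner, E_House, E_Dart, E_Kite, E_Gem, E_Butterfly, E_K23, E_T5, E_L41, E_K4e, E_W5, E_FullHouse, E_K5e, E_K5]"
    using arbitrary_SSP_cover[OF cover_212 *] by (simp add: reps_def conn_reps_def disc_reps_def del: One_nat_def)
qed

lemma cover_221: "list_all (\<lambda>(E, H, p). H \<in> set [E_c4, E_C5, E_Campstool] \<and> maps_into p H E)
   [(E_C5, E_C5, [0, 1, 2, 3, 4]), (E_Campstool, E_Campstool, [0, 1, 2, 3, 4]),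
    (E_Banner, E_c4, [0, 1, 2, 3, 4]), (E_House, E_c4, [0, 3, 1, 4, 2]),
    (E_Dart, E_c4, [0, 2, 1, 3, 4]), (E_Kite, E_c4, [0, 2, 1, 3, 4]),
    (E_Gem, E_c4, [0, 1, 2, 4, 3]), (E_Butterfly, E_Campstool, [0, 1, 2, 3, 4]),
    (E_K23, E_c4, [0, 2, 1, 3, 4]), (E_T5, E_c4, [0, 2, 1, 3, 4]), (E_L41, E_c4, [0, 1, 2, 3, 4]),
    (E_K4e, E_c4, [0, 2, 1, 3, 4]), (E_W5, E_c4, [0, 1, 2, 3, 4]),
    (E_FullHouse, E_c4, [0, 1, 2, 3, 4]), (E_K5e, E_c4, [0, 2, 1, 3, 4]),
    (E_K5, E_c4, [0, 1, 2, 3, 4]), (E_k4, E_c4, [0, 1, 2, 3, 4]), (E_c4, E_c4, [0, 1, 2, 3, 4]),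
    (E_k4e, E_c4, [0, 2, 1, 3, 4])]"
  by (simp add: maps_into_def perm_list_def adjacent_def edge_list_defs)

lemma arbitrary_SSP_221:
  "list_all (\<lambda>E. arbitrary_SSP (graph_of E) [2,2,1]) [E_c4, E_C5, E_Campstool]"
  "list_all (\<lambda>E. arbitrary_SSP (graph_of E) [2,2,1])
     [E_C5, E_Campstool, E_Banner, E_House, E_Dart, E_Kite, E_Gem, E_Butterfly, E_K23, E_T5, E_L41, E_K4e, E_W5, E_FullHouse, E_K5e, E_K5]"
proof -
  show *: "list_all (\<lambda>E. arbitrary_SSP (graph_of E) [2,2,1]) [E_c4, E_C5, E_Campstool]"
    by (simp add: arbitrary_SSP_c4(2) arbitrary_SSP_C5(1) arbitrary_SSP_Campstool del: One_nat_def)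
  show "list_all (\<lambda>E. arbitrary_SSP (graph_of E) [2,2,1])
     [E_C5, E_Campstool, E_Banner, E_House, E_Dart, E_Kite, E_Gem, E_Butterfly, E_K23, E_T5, E_L41, E_K4e, E_W5, E_FullHouse, E_K5e, E_K5]"
    using arbitrary_SSP_cover[OF cover_221 *] by (simp add: reps_def conn_reps_def disc_reps_def del: One_nat_def)
qed

lemma cover_2111: "list_all (\<lambda>(E, H, p). H \<in> set [E_c4, E_C5, E_k3] \<and> maps_into p H E)
   [(E_L32, E_k3, [0, 1, 2, 3, 4]), (E_Bull, E_k3, [0, 1, 2, 3, 4]), (E_C5, E_C5, [0, 1, 2, 3, 4]),
    (E_Campstool, E_k3, [0, 1, 2, 3, 4]), (E_Banner, E_c4, [0, 1, 2, 3, 4]),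
    (E_House, E_c4, [0, 3, 1, 4, 2]), (E_Dart, E_c4, [0, 2, 1, 3, 4]),
    (E_Kite, E_c4, [0, 2, 1, 3, 4]), (E_Gem, E_c4, [0, 1, 2, 4, 3]),
    (E_Butterfly, E_k3, [0, 1, 2, 3, 4]), (E_K23, E_c4, [0, 2, 1, 3, 4]),
    (E_T5, E_c4, [0, 2, 1, 3, 4]), (E_L41, E_c4, [0, 1, 2, 3, 4]), (E_K4e, E_c4, [0, 2, 1, 3, 4]),
    (E_W5, E_c4, [0, 1, 2, 3, 4]), (E_FullHouse, E_c4, [0, 1, 2, 3, 4]),
    (E_K5e, E_c4, [0, 2, 1, 3, 4]), (E_K5, E_c4, [0, 1, 2, 3, 4]), (E_k4, E_c4, [0, 1, 2, 3, 4]),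
    (E_c4, E_c4, [0, 1, 2, 3, 4]), (E_k4e, E_c4, [0, 2, 1, 3, 4]), (E_paw, E_k3, [0, 1, 2, 3, 4]),
    (E_k3k2, E_k3, [0, 1, 2, 3, 4]), (E_k3, E_k3, [0, 1, 2, 3, 4])]"
  by (simp add: maps_into_def perm_list_def adjacent_def edge_list_defs)

lemma arbitrary_SSP_2111:
  "list_all (\<lambda>E. arbitrary_SSP (graph_of E) [2,1,1,1]) [E_c4, E_C5, E_k3]"
  "list_all (\<lambda>E. arbitrary_SSP (graph_of E) [2,1,1,1])
     [E_L32, E_Bull, E_C5, E_Campstool, E_Banner, E_House, E_Dart, E_Kite, E_Gem, E_Butterfly, E_K23, E_T5, E_L41, E_K4e, E_W5, E_FullHouse, E_K5e, E_K5]"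
proof -
  show *: "list_all (\<lambda>E. arbitrary_SSP (graph_of E) [2,1,1,1]) [E_c4, E_C5, E_k3]"
    by (simp add: arbitrary_SSP_c4(3) arbitrary_SSP_C5(2) arbitrary_SSP_k3(1) del: One_nat_def)
  show "list_all (\<lambda>E. arbitrary_SSP (graph_of E) [2,1,1,1])
     [E_L32, E_Bull, E_C5, E_Campstool, E_Banner, E_House, E_Dart, E_Kite, E_Gem, E_Butterfly, E_K23, E_T5, E_L41, E_K4e, E_W5, E_FullHouse, E_K5e, E_K5]"
    using arbitrary_SSP_cover[OF cover_2111 *] by (simp add: reps_def conn_reps_def disc_reps_def del: One_nat_def)
qed

lemma cover_1211: "list_all (\<lambda>(E, H, p). H \<in> set [E_c4, E_C5, E_k3, E_k13] \<and> maps_into p H E)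
   [(E_S211, E_k13, [0, 1, 3, 4, 2]), (E_K14, E_k13, [0, 1, 2, 3, 4]),
    (E_L32, E_k3, [0, 1, 2, 3, 4]), (E_Bull, E_k3, [0, 1, 2, 3, 4]), (E_C5, E_C5, [0, 1, 2, 3, 4]),
    (E_Campstool, E_k3, [0, 1, 2, 3, 4]), (E_Banner, E_c4, [0, 1, 2, 3, 4]),
    (E_House, E_c4, [0, 3, 1, 4, 2]), (E_Dart, E_c4, [0, 2, 1, 3, 4]),
    (E_Kite, E_c4, [0, 2, 1, 3, 4]), (E_Gem, E_c4, [0, 1, 2, 4, 3]),
    (E_Butterfly, E_k3, [0, 1, 2, 3, 4]), (E_K23, E_c4, [0, 2, 1, 3, 4]),
    (E_T5, E_c4, [0, 2, 1, 3, 4]), (E_L41, E_c4, [0, 1, 2, 3, 4]), (E_K4e, E_c4, [0, 2, 1, 3, 4]),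
    (E_W5, E_c4, [0, 1, 2, 3, 4]), (E_FullHouse, E_c4, [0, 1, 2, 3, 4]),
    (E_K5e, E_c4, [0, 2, 1, 3, 4]), (E_K5, E_c4, [0, 1, 2, 3, 4]), (E_k4, E_c4, [0, 1, 2, 3, 4]),
    (E_c4, E_c4, [0, 1, 2, 3, 4]), (E_k4e, E_c4, [0, 2, 1, 3, 4]), (E_paw, E_k3, [0, 1, 2, 3, 4]),
    (E_k13, E_k13, [0, 1, 2, 3, 4]), (E_k3k2, E_k3, [0, 1, 2, 3, 4]),
    (E_k3, E_k3, [0, 1, 2, 3, 4])]"
  by (simp add: maps_into_def perm_list_def adjacent_def edge_list_defs)

lemma arbitrary_SSP_1211:
  "list_all (\<lambda>E. arbitrary_SSP (graph_of E) [1,2,1,1]) [E_c4, E_C5, E_k3, E_k13]"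
  "list_all (\<lambda>E. arbitrary_SSP (graph_of E) [1,2,1,1])
     [E_S211, E_K14, E_L32, E_Bull, E_C5, E_Campstool, E_Banner, E_House, E_Dart, E_Kite, E_Gem, E_Butterfly, E_K23, E_T5, E_L41, E_K4e, E_W5, E_FullHouse, E_K5e, E_K5]"
proof -
  show *: "list_all (\<lambda>E. arbitrary_SSP (graph_of E) [1,2,1,1]) [E_c4, E_C5, E_k3, E_k13]"
    by (simp add: arbitrary_SSP_c4(4) arbitrary_SSP_C5(3) arbitrary_SSP_k3(2) arbitrary_SSP_k13 del: One_nat_def)
  show "list_all (\<lambda>E. arbitrary_SSP (graph_of E) [1,2,1,1])
     [E_S211, E_K14, E_L32, E_Bull, E_C5, E_Campstool, E_Banner, E_House, E_Dart, E_Kite, E_Gem, E_Butterfly, E_K23, E_T5, E_L41, E_K4e, E_W5, E_FullHouse, E_K5e, E_K5]"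
    using arbitrary_SSP_cover[OF cover_1211 *] by (simp add: reps_def conn_reps_def disc_reps_def del: One_nat_def)
qed

lemma cover_11111: "list_all (\<lambda>(E, H, p). H \<in> set [E_e] \<and> maps_into p H E)
   [(E_P5, E_e, [0, 1, 2, 3, 4]), (E_S211, E_e, [0, 1, 2, 3, 4]), (E_K14, E_e, [0, 1, 2, 3, 4]),
    (E_L32, E_e, [0, 1, 2, 3, 4]), (E_Bull, E_e, [0, 1, 2, 3, 4]), (E_C5, E_e, [0, 1, 2, 3, 4]),
    (E_Campstool, E_e, [0, 1, 2, 3, 4]), (E_Banner, E_e, [0, 1, 2, 3, 4]),
    (E_House, E_e, [0, 1, 2, 3, 4]), (E_Dart, E_e, [0, 1, 2, 3, 4]),
    (E_Kite, E_e, [0, 1, 2, 3, 4]), (E_Gem, E_e, [0, 1, 2, 3, 4]),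
    (E_Butterfly, E_e, [0, 1, 2, 3, 4]), (E_K23, E_e, [0, 1, 2, 3, 4]),
    (E_T5, E_e, [0, 1, 2, 3, 4]), (E_L41, E_e, [0, 1, 2, 3, 4]), (E_K4e, E_e, [0, 1, 2, 3, 4]),
    (E_W5, E_e, [0, 1, 2, 3, 4]), (E_FullHouse, E_e, [0, 1, 2, 3, 4]),
    (E_K5e, E_e, [0, 1, 2, 3, 4]), (E_K5, E_e, [0, 1, 2, 3, 4]), (E_k4, E_e, [0, 1, 2, 3, 4]),
    (E_c4, E_e, [0, 1, 2, 3, 4]), (E_k4e, E_e, [0, 1, 2, 3, 4]), (E_paw, E_e, [0, 1, 2, 3, 4]),
    (E_k13, E_e, [0, 1, 2, 3, 4]), (E_p4, E_e, [0, 1, 2, 3, 4]), (E_k3k2, E_e, [0, 1, 2, 3, 4]),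
    (E_p3k2, E_e, [0, 1, 2, 3, 4]), (E_k3, E_e, [0, 1, 2, 3, 4]), (E_p3, E_e, [0, 1, 2, 3, 4]),
    (E_k2k2, E_e, [0, 1, 2, 3, 4]), (E_k2, E_e, [0, 1, 2, 3, 4]), (E_e, E_e, [0, 1, 2, 3, 4])]"
  by (simp add: maps_into_def perm_list_def adjacent_def edge_list_defs)

lemma arbitrary_SSP_11111:
  "list_all (\<lambda>E. arbitrary_SSP (graph_of E) [1,1,1,1,1]) [E_e]"
  "list_all (\<lambda>E. arbitrary_SSP (graph_of E) [1,1,1,1,1])
     [E_P5, E_S211, E_K14, E_L32, E_Bull, E_C5, E_Campstool, E_Banner, E_House, E_Dart, E_Kite, E_Gem, E_Butterfly, E_K23, E_T5, E_L41, E_K4e, E_W5, E_FullHouse, E_K5e, E_K5]"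
proof -
  show *: "list_all (\<lambda>E. arbitrary_SSP (graph_of E) [1,1,1,1,1]) [E_e]"
    by (simp add: arbitrary_SSP_e del: One_nat_def)
  show "list_all (\<lambda>E. arbitrary_SSP (graph_of E) [1,1,1,1,1])
     [E_P5, E_S211, E_K14, E_L32, E_Bull, E_C5, E_Campstool, E_Banner, E_House, E_Dart, E_Kite, E_Gem, E_Butterfly, E_K23, E_T5, E_L41, E_K4e, E_W5, E_FullHouse, E_K5e, E_K5]"
    using arbitrary_SSP_cover[OF cover_11111 *] by (simp add: reps_def conn_reps_def disc_reps_def del: One_nat_def)
qed

lemmas arbitrary_SSP_lists =
  arbitrary_SSP_11111(2) arbitrary_SSP_1211(2) arbitrary_SSP_2111(2) arbitrary_SSP_221(2) arbitrary_SSP_212(2) arbitrary_SSP_131(2) arbitrary_SSP_311(2) arbitrary_SSP_32(2) arbitrary_SSP_41(2)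

section \<open>The attained lists of each connected graph\<close>

lemma attained_lists_P5:
  "attained_lists E_P5 [[1,1,1,1,1]] []"
proof (rule attained_listsI)
  fix m assume at: "attains (graph_of E_P5) m"
  have bound: "list_all (\<lambda>k. k \<le> 1) m" unfolding list_all_iff by (intro ballI multiplicity_P5[OF at])
  show "m \<in> with_reversals [[1,1,1,1,1]] \<union> with_reversals []"
  proof (rule attained_lists_bound[OF at])
    show "list_all (\<lambda>k. k \<le> 1) m" by (intro conjI bound)
  qed code_simp
next
  show "list_all (arbitrary_SSP (graph_of E_P5)) [[1,1,1,1,1]]"
    using arbitrary_SSP_lists by (simp del: One_nat_def)
next
  show "list_all (\<lambda>m. arbitrary (graph_of E_P5) m \<and> \<not> attains_SMP (graph_of E_P5) m \<and> \<not> attains_SMP (graph_of E_P5) (rev m)) []"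
    by simp
qed (simp_all)

lemma attained_lists_S211:
  "attained_lists E_S211 [[1,1,1,1,1], [1,2,1,1]] []"
proof (rule attained_listsI)
  fix m assume at: "attains (graph_of E_S211) m"
  have bound: "list_all (\<lambda>k. k \<le> 2) m" unfolding list_all_iff by (intro ballI multiplicity_S211[OF at])
  show "m \<in> with_reversals [[1,1,1,1,1], [1,2,1,1]] \<union> with_reversals []"
  proof (rule attained_lists_bound[OF at])
    show "list_all (\<lambda>k. k \<le> 2) m \<and> (m = [] \<or> hd m \<le> 1 \<and> last m \<le> 1)" by (intro conjI bound hd_last_bound[OF first_multiplicity_S211 at])
  qed code_simp
next
  show "list_all (arbitrary_SSP (graph_of E_S211)) [[1,1,1,1,1], [1,2,1,1]]"
    using arbitrary_SSP_lists by (simp del: One_nat_def)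
next
  show "list_all (\<lambda>m. arbitrary (graph_of E_S211) m \<and> \<not> attains_SMP (graph_of E_S211) m \<and> \<not> attains_SMP (graph_of E_S211) (rev m)) []"
    by simp
qed (simp_all)

text \<open>Simple extreme eigenvalues leave \<open>[1, 3, 1]\<close> as the only list with an entry
  3, and that one is starred.\<close>

lemma attained_lists_K14:
  "attained_lists E_K14 [[1,1,1,1,1], [1,2,1,1]] [[1,3,1]]"
proof (rule attained_listsI)
  fix m assume at: "attains (graph_of E_K14) m"
  have bound: "list_all (\<lambda>k. k \<le> 3) m" unfolding list_all_iff by (intro ballI multiplicity_K14[OF at])
  show "m \<in> with_reversals [[1,1,1,1,1], [1,2,1,1]] \<union> with_reversals [[1,3,1]]"
  proof (rule attained_lists_bound[OF at])
    show "list_all (\<lambda>k. k \<le> 3) m \<and> (m = [] \<or> hd m \<le> 1 \<and> last m \<le> 1)" by (intro conjI bound hd_last_bound[OF first_multiplicity_K14 at])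
  qed code_simp
next
  show "list_all (arbitrary_SSP (graph_of E_K14)) [[1,1,1,1,1], [1,2,1,1]]"
    using arbitrary_SSP_lists by (simp del: One_nat_def)
next
  show "list_all (\<lambda>m. arbitrary (graph_of E_K14) m \<and> \<not> attains_SMP (graph_of E_K14) m \<and> \<not> attains_SMP (graph_of E_K14) (rev m)) [[1,3,1]]"
  proof -
    have "\<not> attains_SMP (graph_of E_K14) m" if "3 \<in> set m" for m
    proof
      assume "attains_SMP (graph_of E_K14) m"
      then show False using that by (rule not_attains_SMP) (erule not_SMP_K14, assumption+)
    qed
    then show ?thesis by (simp add: arbitrary_K14 del: One_nat_def)
  qed
qed (simp_all)

text \<open>The multiplicity bound still allows \<open>[2, 2, 1]\<close> and
  \<open>[2, 1, 2]\<close>; the need for four distinct eigenvalues removes them.\<close>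

lemma attained_lists_L32:
  "attained_lists E_L32 [[1,1,1,1,1], [1,2,1,1], [2,1,1,1]] []"
proof (rule attained_listsI)
  fix m assume at: "attains (graph_of E_L32) m"
  have bound: "list_all (\<lambda>k. k \<le> 2) m" unfolding list_all_iff by (intro ballI multiplicity_L32[OF at])
  show "m \<in> with_reversals [[1,1,1,1,1], [1,2,1,1], [2,1,1,1]] \<union> with_reversals []"
  proof (rule attained_lists_bound[OF at])
    show "list_all (\<lambda>k. k \<le> 2) m \<and> 4 \<le> length m" by (intro conjI bound length_L32[OF at])
  qed code_simp
next
  show "list_all (arbitrary_SSP (graph_of E_L32)) [[1,1,1,1,1], [1,2,1,1], [2,1,1,1]]"
    using arbitrary_SSP_lists by (simp del: One_nat_def)
next
  show "list_all (\<lambda>m. arbitrary (graph_of E_L32) m \<and> \<not> attains_SMP (graph_of E_L32) m \<and> \<not> attains_SMP (graph_of E_L32) (rev m)) []"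
    by simp
qed (simp_all)

lemma attained_lists_Bull:
  "attained_lists E_Bull [[1,1,1,1,1], [1,2,1,1], [2,1,1,1]] []"
proof (rule attained_listsI)
  fix m assume at: "attains (graph_of E_Bull) m"
  have bound: "list_all (\<lambda>k. k \<le> 2) m" unfolding list_all_iff by (intro ballI multiplicity_Bull[OF at])
  show "m \<in> with_reversals [[1,1,1,1,1], [1,2,1,1], [2,1,1,1]] \<union> with_reversals []"
  proof (rule attained_lists_bound[OF at])
    show "list_all (\<lambda>k. k \<le> 2) m \<and> 4 \<le> length m" by (intro conjI bound length_Bull[OF at])
  qed code_simp
next
  show "list_all (arbitrary_SSP (graph_of E_Bull)) [[1,1,1,1,1], [1,2,1,1], [2,1,1,1]]"
    using arbitrary_SSP_lists by (simp del: One_nat_def)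
next
  show "list_all (\<lambda>m. arbitrary (graph_of E_Bull) m \<and> \<not> attains_SMP (graph_of E_Bull) m \<and> \<not> attains_SMP (graph_of E_Bull) (rev m)) []"
    by simp
qed (simp_all)

text \<open>Among the lists with entries at most two only \<open>[2, 1, 2]\<close> is not attained,
  so it is excluded by its own argument.\<close>

lemma attained_lists_C5:
  "attained_lists E_C5 [[1,1,1,1,1], [1,2,1,1], [2,1,1,1], [2,2,1]] []"
proof (rule attained_listsI)
  fix m assume at: "attains (graph_of E_C5) m"
  have bound: "list_all (\<lambda>k. k \<le> 2) m" unfolding list_all_iff by (intro ballI multiplicity_C5[OF at])
  have ne: "m \<noteq> [2,1,2]" using not_attains_C5_212 at by auto
  show "m \<in> with_reversals [[1,1,1,1,1], [1,2,1,1], [2,1,1,1], [2,2,1]] \<union> with_reversals []"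
  proof (rule attained_lists_bound[OF at])
    show "list_all (\<lambda>k. k \<le> 2) m \<and> m \<noteq> [2,1,2]" by (intro conjI bound ne)
  qed code_simp
next
  show "list_all (arbitrary_SSP (graph_of E_C5)) [[1,1,1,1,1], [1,2,1,1], [2,1,1,1], [2,2,1]]"
    using arbitrary_SSP_lists by (simp del: One_nat_def)
next
  show "list_all (\<lambda>m. arbitrary (graph_of E_C5) m \<and> \<not> attains_SMP (graph_of E_C5) m \<and> \<not> attains_SMP (graph_of E_C5) (rev m)) []"
    by simp
qed (simp_all)

lemma attained_lists_Campstool:
  "attained_lists E_Campstool [[1,1,1,1,1], [1,2,1,1], [2,1,1,1], [2,2,1]] []"
proof (rule attained_listsI)
  fix m assume at: "attains (graph_of E_Campstool) m"
  have bound: "list_all (\<lambda>k. k \<le> 2) m" unfolding list_all_iff by (intro ballI multiplicity_Campstool[OF at])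
  have ne: "m \<noteq> [2,1,2]" using not_attains_Campstool_212 at by auto
  show "m \<in> with_reversals [[1,1,1,1,1], [1,2,1,1], [2,1,1,1], [2,2,1]] \<union> with_reversals []"
  proof (rule attained_lists_bound[OF at])
    show "list_all (\<lambda>k. k \<le> 2) m \<and> m \<noteq> [2,1,2]" by (intro conjI bound ne)
  qed code_simp
next
  show "list_all (arbitrary_SSP (graph_of E_Campstool)) [[1,1,1,1,1], [1,2,1,1], [2,1,1,1], [2,2,1]]"
    using arbitrary_SSP_lists by (simp del: One_nat_def)
next
  show "list_all (\<lambda>m. arbitrary (graph_of E_Campstool) m \<and> \<not> attains_SMP (graph_of E_Campstool) m \<and> \<not> attains_SMP (graph_of E_Campstool) (rev m)) []"
    by simp
qed (simp_all)

lemma attained_lists_Banner: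
  "attained_lists E_Banner [[1,1,1,1,1], [1,2,1,1], [2,1,1,1], [2,2,1], [2,1,2]] []"
proof (rule attained_listsI)
  fix m assume at: "attains (graph_of E_Banner) m"
  have bound: "list_all (\<lambda>k. k \<le> 2) m" unfolding list_all_iff by (intro ballI multiplicity_Banner[OF at])
  show "m \<in> with_reversals [[1,1,1,1,1], [1,2,1,1], [2,1,1,1], [2,2,1], [2,1,2]] \<union> with_reversals []"
  proof (rule attained_lists_bound[OF at])
    show "list_all (\<lambda>k. k \<le> 2) m" by (intro conjI bound)
  qed code_simp
next
  show "list_all (arbitrary_SSP (graph_of E_Banner)) [[1,1,1,1,1], [1,2,1,1], [2,1,1,1], [2,2,1], [2,1,2]]"
    using arbitrary_SSP_lists by (simp del: One_nat_def)
next
  show "list_all (\<lambda>m. arbitrary (graph_of E_Banner) m \<and> \<not> attains_SMP (graph_of E_Banner) m \<and> \<not> attains_SMP (graph_of E_Banner) (rev m)) []"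
    by simp
qed (simp_all)

lemma attained_lists_House:
  "attained_lists E_House [[1,1,1,1,1], [1,2,1,1], [2,1,1,1], [2,2,1], [2,1,2]] []"
proof (rule attained_listsI)
  fix m assume at: "attains (graph_of E_House) m"
  have bound: "list_all (\<lambda>k. k \<le> 2) m" unfolding list_all_iff by (intro ballI multiplicity_House[OF at])
  show "m \<in> with_reversals [[1,1,1,1,1], [1,2,1,1], [2,1,1,1], [2,2,1], [2,1,2]] \<union> with_reversals []"
  proof (rule attained_lists_bound[OF at])
    show "list_all (\<lambda>k. k \<le> 2) m" by (intro conjI bound)
  qed code_simp
next
  show "list_all (arbitrary_SSP (graph_of E_House)) [[1,1,1,1,1], [1,2,1,1], [2,1,1,1], [2,2,1], [2,1,2]]"
    using arbitrary_SSP_lists by (simp del: One_nat_def)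
next
  show "list_all (\<lambda>m. arbitrary (graph_of E_House) m \<and> \<not> attains_SMP (graph_of E_House) m \<and> \<not> attains_SMP (graph_of E_House) (rev m)) []"
    by simp
qed (simp_all)

lemma attained_lists_Dart:
  "attained_lists E_Dart [[1,1,1,1,1], [1,2,1,1], [2,1,1,1], [2,2,1], [2,1,2]] []"
proof (rule attained_listsI)
  fix m assume at: "attains (graph_of E_Dart) m"
  have bound: "list_all (\<lambda>k. k \<le> 2) m" unfolding list_all_iff by (intro ballI multiplicity_Dart[OF at])
  show "m \<in> with_reversals [[1,1,1,1,1], [1,2,1,1], [2,1,1,1], [2,2,1], [2,1,2]] \<union> with_reversals []"
  proof (rule attained_lists_bound[OF at])
    show "list_all (\<lambda>k. k \<le> 2) m" by (intro conjI bound)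
  qed code_simp
next
  show "list_all (arbitrary_SSP (graph_of E_Dart)) [[1,1,1,1,1], [1,2,1,1], [2,1,1,1], [2,2,1], [2,1,2]]"
    using arbitrary_SSP_lists by (simp del: One_nat_def)
next
  show "list_all (\<lambda>m. arbitrary (graph_of E_Dart) m \<and> \<not> attains_SMP (graph_of E_Dart) m \<and> \<not> attains_SMP (graph_of E_Dart) (rev m)) []"
    by simp
qed (simp_all)

lemma attained_lists_Kite:
  "attained_lists E_Kite [[1,1,1,1,1], [1,2,1,1], [2,1,1,1], [2,2,1], [2,1,2]] []"
proof (rule attained_listsI)
  fix m assume at: "attains (graph_of E_Kite) m"
  have bound: "list_all (\<lambda>k. k \<le> 2) m" unfolding list_all_iff by (intro ballI multiplicity_Kite[OF at])
  show "m \<in> with_reversals [[1,1,1,1,1], [1,2,1,1], [2,1,1,1], [2,2,1], [2,1,2]] \<union> with_reversals []"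
  proof (rule attained_lists_bound[OF at])
    show "list_all (\<lambda>k. k \<le> 2) m" by (intro conjI bound)
  qed code_simp
next
  show "list_all (arbitrary_SSP (graph_of E_Kite)) [[1,1,1,1,1], [1,2,1,1], [2,1,1,1], [2,2,1], [2,1,2]]"
    using arbitrary_SSP_lists by (simp del: One_nat_def)
next
  show "list_all (\<lambda>m. arbitrary (graph_of E_Kite) m \<and> \<not> attains_SMP (graph_of E_Kite) m \<and> \<not> attains_SMP (graph_of E_Kite) (rev m)) []"
    by simp
qed (simp_all)

lemma attained_lists_Gem:
  "attained_lists E_Gem [[1,1,1,1,1], [1,2,1,1], [2,1,1,1], [2,2,1], [2,1,2]] []"
proof (rule attained_listsI)
  fix m assume at: "attains (graph_of E_Gem) m"
  have bound: "list_all (\<lambda>k. k \<le> 2) m" unfolding list_all_iff by (intro ballI multiplicity_Gem[OF at])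
  show "m \<in> with_reversals [[1,1,1,1,1], [1,2,1,1], [2,1,1,1], [2,2,1], [2,1,2]] \<union> with_reversals []"
  proof (rule attained_lists_bound[OF at])
    show "list_all (\<lambda>k. k \<le> 2) m" by (intro conjI bound)
  qed code_simp
next
  show "list_all (arbitrary_SSP (graph_of E_Gem)) [[1,1,1,1,1], [1,2,1,1], [2,1,1,1], [2,2,1], [2,1,2]]"
    using arbitrary_SSP_lists by (simp del: One_nat_def)
next
  show "list_all (\<lambda>m. arbitrary (graph_of E_Gem) m \<and> \<not> attains_SMP (graph_of E_Gem) m \<and> \<not> attains_SMP (graph_of E_Gem) (rev m)) []"
    by simp
qed (simp_all)

text \<open>The length bound removes \<open>[3, 2]\<close> and its reversal; every other list with
  largest entry 3 is attained but starred.\<close>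

lemma attained_lists_Butterfly:
  "attained_lists E_Butterfly [[1,1,1,1,1], [1,2,1,1], [2,1,1,1], [2,2,1], [2,1,2]] [[1,3,1], [3,1,1]]"
proof (rule attained_listsI)
  fix m assume at: "attains (graph_of E_Butterfly) m"
  have bound: "list_all (\<lambda>k. k \<le> 3) m" unfolding list_all_iff by (intro ballI multiplicity_Butterfly[OF at])
  show "m \<in> with_reversals [[1,1,1,1,1], [1,2,1,1], [2,1,1,1], [2,2,1], [2,1,2]] \<union> with_reversals [[1,3,1], [3,1,1]]"
  proof (rule attained_lists_bound[OF at])
    show "list_all (\<lambda>k. k \<le> 3) m \<and> 3 \<le> length m" by (intro conjI bound length_Butterfly[OF at])
  qed code_simp
next
  show "list_all (arbitrary_SSP (graph_of E_Butterfly)) [[1,1,1,1,1], [1,2,1,1], [2,1,1,1], [2,2,1], [2,1,2]]"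
    using arbitrary_SSP_lists by (simp del: One_nat_def)
next
  show "list_all (\<lambda>m. arbitrary (graph_of E_Butterfly) m \<and> \<not> attains_SMP (graph_of E_Butterfly) m \<and> \<not> attains_SMP (graph_of E_Butterfly) (rev m)) [[1,3,1], [3,1,1]]"
  proof -
    have "\<not> attains_SMP (graph_of E_Butterfly) m" if "3 \<in> set m" for m
    proof
      assume "attains_SMP (graph_of E_Butterfly) m"
      then show False using that by (rule not_attains_SMP) (erule not_SMP_Butterfly, assumption+)
    qed
    then show ?thesis by (simp add: arbitrary_Butterfly(2,3) del: One_nat_def)
  qed
qed (simp_all)

text \<open>The sharper bound at the extreme eigenvalues allows an entry 3 only in the
  middle.\<close>

lemma attained_lists_K23:
  "attained_lists E_K23 [[1,1,1,1,1], [1,2,1,1], [2,1,1,1], [2,2,1], [2,1,2], [1,3,1]] []"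
proof (rule attained_listsI)
  fix m assume at: "attains (graph_of E_K23) m"
  have bound: "list_all (\<lambda>k. k \<le> 3) m" unfolding list_all_iff by (intro ballI multiplicity_K23[OF at])
  show "m \<in> with_reversals [[1,1,1,1,1], [1,2,1,1], [2,1,1,1], [2,2,1], [2,1,2], [1,3,1]] \<union> with_reversals []"
  proof (rule attained_lists_bound[OF at])
    show "list_all (\<lambda>k. k \<le> 3) m \<and> (m = [] \<or> hd m \<le> 2 \<and> last m \<le> 2)" by (intro conjI bound hd_last_bound[OF first_multiplicity_K23 at])
  qed code_simp
next
  show "list_all (arbitrary_SSP (graph_of E_K23)) [[1,1,1,1,1], [1,2,1,1], [2,1,1,1], [2,2,1], [2,1,2], [1,3,1]]"
    using arbitrary_SSP_lists by (simp del: One_nat_def)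
next
  show "list_all (\<lambda>m. arbitrary (graph_of E_K23) m \<and> \<not> attains_SMP (graph_of E_K23) m \<and> \<not> attains_SMP (graph_of E_K23) (rev m)) []"
    by simp
qed (simp_all)

lemma attained_lists_T5:
  "attained_lists E_T5 [[1,1,1,1,1], [1,2,1,1], [2,1,1,1], [2,2,1], [2,1,2], [1,3,1]] []"
proof (rule attained_listsI)
  fix m assume at: "attains (graph_of E_T5) m"
  have bound: "list_all (\<lambda>k. k \<le> 3) m" unfolding list_all_iff by (intro ballI multiplicity_T5[OF at])
  show "m \<in> with_reversals [[1,1,1,1,1], [1,2,1,1], [2,1,1,1], [2,2,1], [2,1,2], [1,3,1]] \<union> with_reversals []"
  proof (rule attained_lists_bound[OF at])
    show "list_all (\<lambda>k. k \<le> 3) m \<and> (m = [] \<or> hd m \<le> 2 \<and> last m \<le> 2)" by (intro conjI bound hd_last_bound[OF first_multiplicity_T5 at])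
  qed code_simp
next
  show "list_all (arbitrary_SSP (graph_of E_T5)) [[1,1,1,1,1], [1,2,1,1], [2,1,1,1], [2,2,1], [2,1,2], [1,3,1]]"
    using arbitrary_SSP_lists by (simp del: One_nat_def)
next
  show "list_all (\<lambda>m. arbitrary (graph_of E_T5) m \<and> \<not> attains_SMP (graph_of E_T5) m \<and> \<not> attains_SMP (graph_of E_T5) (rev m)) []"
    by simp
qed (simp_all)

lemma attained_lists_L41:
  "attained_lists E_L41 [[1,1,1,1,1], [1,2,1,1], [2,1,1,1], [2,2,1], [2,1,2], [1,3,1], [3,1,1]] []"
proof (rule attained_listsI)
  fix m assume at: "attains (graph_of E_L41) m"
  have bound: "list_all (\<lambda>k. k \<le> 3) m" unfolding list_all_iff by (intro ballI multiplicity_L41[OF at])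
  show "m \<in> with_reversals [[1,1,1,1,1], [1,2,1,1], [2,1,1,1], [2,2,1], [2,1,2], [1,3,1], [3,1,1]] \<union> with_reversals []"
  proof (rule attained_lists_bound[OF at])
    show "list_all (\<lambda>k. k \<le> 3) m \<and> 3 \<le> length m" by (intro conjI bound length_L41[OF at])
  qed code_simp
next
  show "list_all (arbitrary_SSP (graph_of E_L41)) [[1,1,1,1,1], [1,2,1,1], [2,1,1,1], [2,2,1], [2,1,2], [1,3,1], [3,1,1]]"
    using arbitrary_SSP_lists by (simp del: One_nat_def)
next
  show "list_all (\<lambda>m. arbitrary (graph_of E_L41) m \<and> \<not> attains_SMP (graph_of E_L41) m \<and> \<not> attains_SMP (graph_of E_L41) (rev m)) []"
    by simp
qed (simp_all)

text \<open>Here the zero forcing bound is the whole obstruction: every composition of five with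
  entries at most three is attained.\<close>

lemma attained_lists_K4e:
  "attained_lists E_K4e [[1,1,1,1,1], [1,2,1,1], [2,1,1,1], [2,2,1], [2,1,2], [1,3,1], [3,1,1], [3,2]] []"
proof (rule attained_listsI)
  fix m assume at: "attains (graph_of E_K4e) m"
  have bound: "list_all (\<lambda>k. k \<le> 3) m" unfolding list_all_iff by (intro ballI multiplicity_K4e[OF at])
  show "m \<in> with_reversals [[1,1,1,1,1], [1,2,1,1], [2,1,1,1], [2,2,1], [2,1,2], [1,3,1], [3,1,1], [3,2]] \<union> with_reversals []"
  proof (rule attained_lists_bound[OF at])
    show "list_all (\<lambda>k. k \<le> 3) m" by (intro conjI bound)
  qed code_simp
next
  show "list_all (arbitrary_SSP (graph_of E_K4e)) [[1,1,1,1,1], [1,2,1,1], [2,1,1,1], [2,2,1], [2,1,2], [1,3,1], [3,1,1], [3,2]]"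
    using arbitrary_SSP_lists by (simp del: One_nat_def)
next
  show "list_all (\<lambda>m. arbitrary (graph_of E_K4e) m \<and> \<not> attains_SMP (graph_of E_K4e) m \<and> \<not> attains_SMP (graph_of E_K4e) (rev m)) []"
    by simp
qed (simp_all)

lemma attained_lists_W5:
  "attained_lists E_W5 [[1,1,1,1,1], [1,2,1,1], [2,1,1,1], [2,2,1], [2,1,2], [1,3,1], [3,1,1], [3,2]] []"
proof (rule attained_listsI)
  fix m assume at: "attains (graph_of E_W5) m"
  have bound: "list_all (\<lambda>k. k \<le> 3) m" unfolding list_all_iff by (intro ballI multiplicity_W5[OF at])
  show "m \<in> with_reversals [[1,1,1,1,1], [1,2,1,1], [2,1,1,1], [2,2,1], [2,1,2], [1,3,1], [3,1,1], [3,2]] \<union> with_reversals []"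
  proof (rule attained_lists_bound[OF at])
    show "list_all (\<lambda>k. k \<le> 3) m" by (intro conjI bound)
  qed code_simp
next
  show "list_all (arbitrary_SSP (graph_of E_W5)) [[1,1,1,1,1], [1,2,1,1], [2,1,1,1], [2,2,1], [2,1,2], [1,3,1], [3,1,1], [3,2]]"
    using arbitrary_SSP_lists by (simp del: One_nat_def)
next
  show "list_all (\<lambda>m. arbitrary (graph_of E_W5) m \<and> \<not> attains_SMP (graph_of E_W5) m \<and> \<not> attains_SMP (graph_of E_W5) (rev m)) []"
    by simp
qed (simp_all)

lemma attained_lists_FullHouse:
  "attained_lists E_FullHouse [[1,1,1,1,1], [1,2,1,1], [2,1,1,1], [2,2,1], [2,1,2], [1,3,1], [3,1,1], [3,2]] []"
proof (rule attained_listsI)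
  fix m assume at: "attains (graph_of E_FullHouse) m"
  have bound: "list_all (\<lambda>k. k \<le> 3) m" unfolding list_all_iff by (intro ballI multiplicity_FullHouse[OF at])
  show "m \<in> with_reversals [[1,1,1,1,1], [1,2,1,1], [2,1,1,1], [2,2,1], [2,1,2], [1,3,1], [3,1,1], [3,2]] \<union> with_reversals []"
  proof (rule attained_lists_bound[OF at])
    show "list_all (\<lambda>k. k \<le> 3) m" by (intro conjI bound)
  qed code_simp
next
  show "list_all (arbitrary_SSP (graph_of E_FullHouse)) [[1,1,1,1,1], [1,2,1,1], [2,1,1,1], [2,2,1], [2,1,2], [1,3,1], [3,1,1], [3,2]]"
    using arbitrary_SSP_lists by (simp del: One_nat_def)
next
  show "list_all (\<lambda>m. arbitrary (graph_of E_FullHouse) m \<and> \<not> attains_SMP (graph_of E_FullHouse) m \<and> \<not> attains_SMP (graph_of E_FullHouse) (rev m)) []"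
    by simp
qed (simp_all)

lemma attained_lists_K5e:
  "attained_lists E_K5e [[1,1,1,1,1], [1,2,1,1], [2,1,1,1], [2,2,1], [2,1,2], [1,3,1], [3,1,1], [3,2]] []"
proof (rule attained_listsI)
  fix m assume at: "attains (graph_of E_K5e) m"
  have bound: "list_all (\<lambda>k. k \<le> 3) m" unfolding list_all_iff by (intro ballI multiplicity_K5e[OF at])
  show "m \<in> with_reversals [[1,1,1,1,1], [1,2,1,1], [2,1,1,1], [2,2,1], [2,1,2], [1,3,1], [3,1,1], [3,2]] \<union> with_reversals []"
  proof (rule attained_lists_bound[OF at])
    show "list_all (\<lambda>k. k \<le> 3) m" by (intro conjI bound)
  qed code_simp
next
  show "list_all (arbitrary_SSP (graph_of E_K5e)) [[1,1,1,1,1], [1,2,1,1], [2,1,1,1], [2,2,1], [2,1,2], [1,3,1], [3,1,1], [3,2]]"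
    using arbitrary_SSP_lists by (simp del: One_nat_def)
next
  show "list_all (\<lambda>m. arbitrary (graph_of E_K5e) m \<and> \<not> attains_SMP (graph_of E_K5e) m \<and> \<not> attains_SMP (graph_of E_K5e) (rev m)) []"
    by simp
qed (simp_all)

lemma attained_lists_K5:
  "attained_lists E_K5 [[1,1,1,1,1], [1,2,1,1], [2,1,1,1], [2,2,1], [2,1,2], [1,3,1], [3,1,1], [3,2], [4,1]] []"
proof (rule attained_listsI)
  fix m assume at: "attains (graph_of E_K5) m"
  have bound: "list_all (\<lambda>k. k \<le> 4) m" unfolding list_all_iff by (intro ballI multiplicity_K5[OF at])
  show "m \<in> with_reversals [[1,1,1,1,1], [1,2,1,1], [2,1,1,1], [2,2,1], [2,1,2], [1,3,1], [3,1,1], [3,2], [4,1]] \<union> with_reversals []"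
  proof (rule attained_lists_bound[OF at])
    show "list_all (\<lambda>k. k \<le> 4) m" by (intro conjI bound)
  qed code_simp
next
  show "list_all (arbitrary_SSP (graph_of E_K5)) [[1,1,1,1,1], [1,2,1,1], [2,1,1,1], [2,2,1], [2,1,2], [1,3,1], [3,1,1], [3,2], [4,1]]"
    using arbitrary_SSP_lists by (simp del: One_nat_def)
next
  show "list_all (\<lambda>m. arbitrary (graph_of E_K5) m \<and> \<not> attains_SMP (graph_of E_K5) m \<and> \<not> attains_SMP (graph_of E_K5) (rev m)) []"
    by simp
qed (simp_all)

lemmas attained_lists_intros =
  attained_lists_P5 attained_lists_S211 attained_lists_K14 attained_lists_L32 attained_lists_Bull attained_lists_C5 attained_lists_Campstool attained_lists_Banner attained_lists_House attained_lists_Dart attained_lists_Kite attained_lists_Gem attained_lists_Butterfly attained_lists_K23 attained_lists_T5 attained_lists_L41 attained_lists_K4e attained_lists_W5 attained_lists_FullHouse attained_lists_K5e attained_lists_K5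

section \<open>The minimal graphs for each list\<close>

lemma minimal_41:
  assumes "simple_graph G" "order_of G = 5"
  shows "minimal_attaining_SSP G [4,1] \<longleftrightarrow> (\<exists>H \<in> set [E_K5]. G \<simeq>\<^sub>G graph_of H)"
proof (rule minimal_iff_certificate[OF assms _ _ arbitrary_SSP_41(1) cover_41])
  let ?bs = "[E_P5, E_S211, E_K14, E_L32, E_Bull, E_C5, E_Campstool, E_Banner, E_House, E_Dart, E_Kite, E_Gem, E_Butterfly, E_K23, E_T5, E_L41, E_K4e, E_W5, E_FullHouse, E_K5e]"
  let ?bad = "[(E_P5, E_P5, [0, 1, 2, 3, 4]), (E_S211, E_S211, [0, 1, 2, 3, 4]),
      (E_K14, E_K14, [0, 1, 2, 3, 4]), (E_L32, E_L32, [0, 1, 2, 3, 4]),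
      (E_Bull, E_Bull, [0, 1, 2, 3, 4]), (E_C5, E_C5, [0, 1, 2, 3, 4]),
      (E_Campstool, E_Campstool, [0, 1, 2, 3, 4]), (E_Banner, E_Banner, [0, 1, 2, 3, 4]),
      (E_House, E_House, [0, 1, 2, 3, 4]), (E_Dart, E_Dart, [0, 1, 2, 3, 4]),
      (E_Kite, E_Kite, [0, 1, 2, 3, 4]), (E_Gem, E_Gem, [0, 1, 2, 3, 4]),
      (E_Butterfly, E_Butterfly, [0, 1, 2, 3, 4]), (E_K23, E_K23, [0, 1, 2, 3, 4]),
      (E_T5, E_T5, [0, 1, 2, 3, 4]), (E_L41, E_L41, [0, 1, 2, 3, 4]),
      (E_K4e, E_K4e, [0, 1, 2, 3, 4]), (E_W5, E_W5, [0, 1, 2, 3, 4]),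
      (E_FullHouse, E_FullHouse, [0, 1, 2, 3, 4]), (E_K5e, E_K5e, [0, 1, 2, 3, 4]),
      (E_k4, E_K5e, [0, 2, 3, 4, 1]), (E_c4, E_K5e, [0, 2, 1, 3, 4]),
      (E_k4e, E_K5e, [0, 1, 2, 3, 4]), (E_paw, E_K5e, [0, 2, 3, 4, 1]),
      (E_k13, E_K5e, [0, 2, 3, 4, 1]), (E_p4, E_K5e, [0, 2, 1, 3, 4]),
      (E_k3k2, E_K5e, [0, 2, 3, 1, 4]), (E_p3k2, E_K5e, [0, 2, 1, 3, 4]),
      (E_k3, E_K5e, [0, 2, 3, 1, 4]), (E_p3, E_K5e, [0, 2, 1, 3, 4]),
      (E_k2k2, E_K5e, [0, 2, 1, 3, 4]), (E_k2, E_K5e, [0, 2, 1, 3, 4]),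
      (E_e, E_K5e, [0, 1, 2, 3, 4])] :: ((nat \<times> nat) list \<times> (nat \<times> nat) list \<times> nat list) list"
  show "list_all (\<lambda>B. \<not> attains_SSP (graph_of B) [4,1]) ?bs"
    by (simp del: One_nat_def, (intro conjI)?;
        rule not_attains_SSP, rule attained_lists_intros, simp add: with_reversals_def)
  show "list_all (\<lambda>(E, B, p). B \<in> set ?bs \<and> maps_into p E B) ?bad"
    by (simp add: maps_into_def perm_list_def adjacent_def edge_list_defs)
  show "list_all (\<lambda>(H, certs). list_all2 (\<lambda>e (B, p). B \<in> set ?bs \<and> maps_into p (removeAll e H) B) H certs)
     [(E_K5, [(E_K5e, [0, 1, 2, 3, 4]), (E_K5e, [0, 2, 1, 3, 4]), (E_K5e, [0, 2, 3, 1, 4]), (E_K5e, [0, 2, 3, 4, 1]), (E_K5e, [2, 0, 1, 3, 4]), (E_K5e, [2, 0, 3, 1, 4]), (E_K5e, [2, 0, 3, 4, 1]), (E_K5e, [2, 3, 0, 1, 4]), (E_K5e, [2, 3, 0, 4, 1]), (E_K5e, [2, 3, 4, 0, 1])])]"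
    by (simp add: maps_into_def perm_list_def adjacent_def edge_list_defs)
qed (simp_all add: reps_def conn_reps_def disc_reps_def)

lemma minimal_32:
  assumes "simple_graph G" "order_of G = 5"
  shows "minimal_attaining_SSP G [3,2] \<longleftrightarrow> (\<exists>H \<in> set [E_K4e]. G \<simeq>\<^sub>G graph_of H)"
proof (rule minimal_iff_certificate[OF assms _ _ arbitrary_SSP_32(1) cover_32])
  let ?bs = "[E_P5, E_S211, E_K14, E_L32, E_Bull, E_C5, E_Campstool, E_Banner, E_House, E_Dart, E_Kite, E_Gem, E_Butterfly, E_K23, E_T5, E_L41]"
  let ?bad = "[(E_P5, E_P5, [0, 1, 2, 3, 4]), (E_S211, E_S211, [0, 1, 2, 3, 4]),
      (E_K14, E_K14, [0, 1, 2, 3, 4]), (E_L32, E_L32, [0, 1, 2, 3, 4]),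
      (E_Bull, E_Bull, [0, 1, 2, 3, 4]), (E_C5, E_C5, [0, 1, 2, 3, 4]),
      (E_Campstool, E_Campstool, [0, 1, 2, 3, 4]), (E_Banner, E_Banner, [0, 1, 2, 3, 4]),
      (E_House, E_House, [0, 1, 2, 3, 4]), (E_Dart, E_Dart, [0, 1, 2, 3, 4]),
      (E_Kite, E_Kite, [0, 1, 2, 3, 4]), (E_Gem, E_Gem, [0, 1, 2, 3, 4]),
      (E_Butterfly, E_Butterfly, [0, 1, 2, 3, 4]), (E_K23, E_K23, [0, 1, 2, 3, 4]),
      (E_T5, E_T5, [0, 1, 2, 3, 4]), (E_L41, E_L41, [0, 1, 2, 3, 4]), (E_k4, E_L41, [0, 1, 2, 3, 4]),
      (E_c4, E_L41, [0, 1, 2, 3, 4]), (E_k4e, E_L41, [0, 1, 2, 3, 4]),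
      (E_paw, E_L41, [0, 1, 2, 3, 4]), (E_k13, E_L41, [0, 1, 2, 3, 4]),
      (E_p4, E_L41, [0, 1, 2, 3, 4]), (E_k3k2, E_L41, [1, 2, 3, 0, 4]),
      (E_p3k2, E_L41, [1, 0, 4, 2, 3]), (E_k3, E_L41, [0, 1, 2, 3, 4]),
      (E_p3, E_L41, [0, 1, 2, 3, 4]), (E_k2k2, E_L41, [0, 1, 2, 3, 4]),
      (E_k2, E_L41, [0, 1, 2, 3, 4]), (E_e, E_L41, [0, 1, 2, 3, 4])] :: ((nat \<times> nat) list \<times> (nat \<times> nat) list \<times> nat list) list"
  show "list_all (\<lambda>B. \<not> attains_SSP (graph_of B) [3,2]) ?bs"
    by (simp del: One_nat_def, (intro conjI)?;
        rule not_attains_SSP, rule attained_lists_intros, simp add: with_reversals_def)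
  show "list_all (\<lambda>(E, B, p). B \<in> set ?bs \<and> maps_into p E B) ?bad"
    by (simp add: maps_into_def perm_list_def adjacent_def edge_list_defs)
  show "list_all (\<lambda>(H, certs). list_all2 (\<lambda>e (B, p). B \<in> set ?bs \<and> maps_into p (removeAll e H) B) H certs)
     [(E_K4e, [(E_House, [1, 0, 2, 4, 3]), (E_House, [1, 0, 4, 2, 3]), (E_Kite, [1, 0, 2, 3, 4]), (E_House, [0, 1, 2, 4, 3]), (E_House, [0, 1, 4, 2, 3]), (E_Kite, [0, 1, 2, 3, 4]), (E_K23, [0, 1, 2, 3, 4])])]"
    by (simp add: maps_into_def perm_list_def adjacent_def edge_list_defs)
qed (simp_all add: reps_def conn_reps_def disc_reps_def)

lemma minimal_311:
  assumes "simple_graph G" "order_of G = 5"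
  shows "minimal_attaining_SSP G [3,1,1] \<longleftrightarrow> (\<exists>H \<in> set [E_k4, E_K4e]. G \<simeq>\<^sub>G graph_of H)"
proof (rule minimal_iff_certificate[OF assms _ _ arbitrary_SSP_311(1) cover_311])
  let ?bs = "[E_P5, E_S211, E_K14, E_L32, E_Bull, E_C5, E_Campstool, E_Banner, E_House, E_Dart, E_Kite, E_Gem, E_Butterfly, E_K23, E_T5]"
  let ?bad = "[(E_P5, E_P5, [0, 1, 2, 3, 4]), (E_S211, E_S211, [0, 1, 2, 3, 4]),
      (E_K14, E_K14, [0, 1, 2, 3, 4]), (E_L32, E_L32, [0, 1, 2, 3, 4]),
      (E_Bull, E_Bull, [0, 1, 2, 3, 4]), (E_C5, E_C5, [0, 1, 2, 3, 4]),
      (E_Campstool, E_Campstool, [0, 1, 2, 3, 4]), (E_Banner, E_Banner, [0, 1, 2, 3, 4]),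
      (E_House, E_House, [0, 1, 2, 3, 4]), (E_Dart, E_Dart, [0, 1, 2, 3, 4]),
      (E_Kite, E_Kite, [0, 1, 2, 3, 4]), (E_Gem, E_Gem, [0, 1, 2, 3, 4]),
      (E_Butterfly, E_Butterfly, [0, 1, 2, 3, 4]), (E_K23, E_K23, [0, 1, 2, 3, 4]),
      (E_T5, E_T5, [0, 1, 2, 3, 4]), (E_c4, E_T5, [0, 2, 1, 3, 4]), (E_k4e, E_T5, [2, 3, 0, 1, 4]),
      (E_paw, E_T5, [0, 1, 2, 3, 4]), (E_k13, E_T5, [0, 1, 2, 3, 4]), (E_p4, E_T5, [0, 2, 1, 3, 4]),
      (E_k3k2, E_Butterfly, [0, 1, 2, 3, 4]), (E_p3k2, E_T5, [2, 0, 3, 1, 4]),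
      (E_k3, E_T5, [0, 1, 2, 3, 4]), (E_p3, E_T5, [0, 1, 2, 3, 4]), (E_k2k2, E_T5, [0, 2, 1, 3, 4]),
      (E_k2, E_T5, [0, 1, 2, 3, 4]), (E_e, E_T5, [0, 1, 2, 3, 4])] :: ((nat \<times> nat) list \<times> (nat \<times> nat) list \<times> nat list) list"
  show "list_all (\<lambda>B. \<not> attains_SSP (graph_of B) [3,1,1]) ?bs"
    by (simp del: One_nat_def, (intro conjI)?;
        rule not_attains_SSP, rule attained_lists_intros, simp add: with_reversals_def)
  show "list_all (\<lambda>(E, B, p). B \<in> set ?bs \<and> maps_into p E B) ?bad"
    by (simp add: maps_into_def perm_list_def adjacent_def edge_list_defs)
  show "list_all (\<lambda>(H, certs). list_all2 (\<lambda>e (B, p). B \<in> set ?bs \<and> maps_into p (removeAll e H) B) H certs)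
     [(E_k4, [(E_Dart, [0, 1, 2, 3, 4]), (E_Dart, [0, 2, 1, 3, 4]), (E_Dart, [0, 2, 3, 1, 4]), (E_Dart, [2, 0, 1, 3, 4]), (E_Dart, [2, 0, 3, 1, 4]), (E_Dart, [2, 3, 0, 1, 4])]),
      (E_K4e, [(E_House, [1, 0, 2, 4, 3]), (E_House, [1, 0, 4, 2, 3]), (E_Kite, [1, 0, 2, 3, 4]), (E_House, [0, 1, 2, 4, 3]), (E_House, [0, 1, 4, 2, 3]), (E_Kite, [0, 1, 2, 3, 4]), (E_K23, [0, 1, 2, 3, 4])])]"
    by (simp add: maps_into_def perm_list_def adjacent_def edge_list_defs)
qed (simp_all add: reps_def conn_reps_def disc_reps_def)

lemma minimal_131:
  assumes "simple_graph G" "order_of G = 5"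
  shows "minimal_attaining_SSP G [1,3,1] \<longleftrightarrow> (\<exists>H \<in> set [E_k4, E_K23]. G \<simeq>\<^sub>G graph_of H)"
proof (rule minimal_iff_certificate[OF assms _ _ arbitrary_SSP_131(1) cover_131])
  let ?bs = "[E_P5, E_S211, E_K14, E_L32, E_Bull, E_C5, E_Campstool, E_Banner, E_House, E_Dart, E_Kite, E_Gem, E_Butterfly]"
  let ?bad = "[(E_P5, E_P5, [0, 1, 2, 3, 4]), (E_S211, E_S211, [0, 1, 2, 3, 4]),
      (E_K14, E_K14, [0, 1, 2, 3, 4]), (E_L32, E_L32, [0, 1, 2, 3, 4]),
      (E_Bull, E_Bull, [0, 1, 2, 3, 4]), (E_C5, E_C5, [0, 1, 2, 3, 4]),
      (E_Campstool, E_Campstool, [0, 1, 2, 3, 4]), (E_Banner, E_Banner, [0, 1, 2, 3, 4]),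
      (E_House, E_House, [0, 1, 2, 3, 4]), (E_Dart, E_Dart, [0, 1, 2, 3, 4]),
      (E_Kite, E_Kite, [0, 1, 2, 3, 4]), (E_Gem, E_Gem, [0, 1, 2, 3, 4]),
      (E_Butterfly, E_Butterfly, [0, 1, 2, 3, 4]), (E_c4, E_Gem, [0, 1, 2, 4, 3]),
      (E_k4e, E_Gem, [0, 2, 1, 4, 3]), (E_paw, E_Butterfly, [0, 1, 2, 3, 4]),
      (E_k13, E_Butterfly, [0, 1, 2, 3, 4]), (E_p4, E_Butterfly, [1, 0, 3, 4, 2]),
      (E_k3k2, E_Butterfly, [0, 1, 2, 3, 4]), (E_p3k2, E_Butterfly, [0, 1, 2, 3, 4]),
      (E_k3, E_Butterfly, [0, 1, 2, 3, 4]), (E_p3, E_Butterfly, [0, 1, 2, 3, 4]),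
      (E_k2k2, E_Butterfly, [0, 1, 3, 4, 2]), (E_k2, E_Butterfly, [0, 1, 2, 3, 4]),
      (E_e, E_Butterfly, [0, 1, 2, 3, 4])] :: ((nat \<times> nat) list \<times> (nat \<times> nat) list \<times> nat list) list"
  show "list_all (\<lambda>B. \<not> attains_SSP (graph_of B) [1,3,1]) ?bs"
    by (simp del: One_nat_def, (intro conjI)?;
        rule not_attains_SSP, rule attained_lists_intros, simp add: with_reversals_def)
  show "list_all (\<lambda>(E, B, p). B \<in> set ?bs \<and> maps_into p E B) ?bad"
    by (simp add: maps_into_def perm_list_def adjacent_def edge_list_defs)
  show "list_all (\<lambda>(H, certs). list_all2 (\<lambda>e (B, p). B \<in> set ?bs \<and> maps_into p (removeAll e H) B) H certs)
     [(E_k4, [(E_Dart, [0, 1, 2, 3, 4]), (E_Dart, [0, 2, 1, 3, 4]), (E_Dart, [0, 2, 3, 1, 4]), (E_Dart, [2, 0, 1, 3, 4]), (E_Dart, [2, 0, 3, 1, 4]), (E_Dart, [2, 3, 0, 1, 4])]),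
      (E_K23, [(E_Banner, [2, 0, 4, 1, 3]), (E_Banner, [2, 0, 1, 4, 3]), (E_Banner, [2, 0, 1, 3, 4]), (E_Banner, [0, 2, 4, 1, 3]), (E_Banner, [0, 2, 1, 4, 3]), (E_Banner, [0, 2, 1, 3, 4])])]"
    by (simp add: maps_into_def perm_list_def adjacent_def edge_list_defs)
qed (simp_all add: reps_def conn_reps_def disc_reps_def)

lemma minimal_212:
  assumes "simple_graph G" "order_of G = 5"
  shows "minimal_attaining_SSP G [2,1,2] \<longleftrightarrow> (\<exists>H \<in> set [E_c4, E_Butterfly]. G \<simeq>\<^sub>G graph_of H)"
proof (rule minimal_iff_certificate[OF assms _ _ arbitrary_SSP_212(1) cover_212])
  let ?bs = "[E_P5, E_S211, E_K14, E_L32, E_Bull, E_C5, E_Campstool]"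
  let ?bad = "[(E_P5, E_P5, [0, 1, 2, 3, 4]), (E_S211, E_S211, [0, 1, 2, 3, 4]),
      (E_K14, E_K14, [0, 1, 2, 3, 4]), (E_L32, E_L32, [0, 1, 2, 3, 4]),
      (E_Bull, E_Bull, [0, 1, 2, 3, 4]), (E_C5, E_C5, [0, 1, 2, 3, 4]),
      (E_Campstool, E_Campstool, [0, 1, 2, 3, 4]), (E_paw, E_Campstool, [0, 1, 2, 3, 4]),
      (E_k13, E_Campstool, [0, 1, 2, 3, 4]), (E_p4, E_Campstool, [1, 2, 0, 3, 4]),
      (E_k3k2, E_L32, [0, 1, 2, 3, 4]), (E_p3k2, E_Campstool, [3, 0, 4, 1, 2]),
      (E_k3, E_Campstool, [0, 1, 2, 3, 4]), (E_p3, E_Campstool, [0, 1, 2, 3, 4]),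
      (E_k2k2, E_Campstool, [0, 3, 1, 2, 4]), (E_k2, E_Campstool, [0, 1, 2, 3, 4]),
      (E_e, E_Campstool, [0, 1, 2, 3, 4])] :: ((nat \<times> nat) list \<times> (nat \<times> nat) list \<times> nat list) list"
  show "list_all (\<lambda>B. \<not> attains_SSP (graph_of B) [2,1,2]) ?bs"
    by (simp del: One_nat_def, (intro conjI)?;
        rule not_attains_SSP, rule attained_lists_intros, simp add: with_reversals_def)
  show "list_all (\<lambda>(E, B, p). B \<in> set ?bs \<and> maps_into p E B) ?bad"
    by (simp add: maps_into_def perm_list_def adjacent_def edge_list_defs)
  show "list_all (\<lambda>(H, certs). list_all2 (\<lambda>e (B, p). B \<in> set ?bs \<and> maps_into p (removeAll e H) B) H certs)
     [(E_c4, [(E_P5, [0, 3, 2, 1, 4]), (E_P5, [0, 1, 2, 3, 4]), (E_P5, [1, 0, 3, 2, 4]), (E_P5, [1, 2, 3, 0, 4])]),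
      (E_Butterfly, [(E_L32, [0, 4, 3, 1, 2]), (E_L32, [0, 3, 4, 1, 2]), (E_L32, [0, 1, 2, 4, 3]), (E_L32, [0, 1, 2, 3, 4]), (E_Campstool, [0, 3, 4, 1, 2]), (E_Campstool, [0, 1, 2, 3, 4])])]"
    by (simp add: maps_into_def perm_list_def adjacent_def edge_list_defs)
qed (simp_all add: reps_def conn_reps_def disc_reps_def)

lemma minimal_221:
  assumes "simple_graph G" "order_of G = 5"
  shows "minimal_attaining_SSP G [2,2,1] \<longleftrightarrow> (\<exists>H \<in> set [E_c4, E_C5, E_Campstool]. G \<simeq>\<^sub>G graph_of H)"
proof (rule minimal_iff_certificate[OF assms _ _ arbitrary_SSP_221(1) cover_221])
  let ?bs = "[E_P5, E_S211, E_K14, E_L32, E_Bull]"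
  let ?bad = "[(E_P5, E_P5, [0, 1, 2, 3, 4]), (E_S211, E_S211, [0, 1, 2, 3, 4]),
      (E_K14, E_K14, [0, 1, 2, 3, 4]), (E_L32, E_L32, [0, 1, 2, 3, 4]),
      (E_Bull, E_Bull, [0, 1, 2, 3, 4]), (E_paw, E_Bull, [0, 1, 2, 3, 4]),
      (E_k13, E_Bull, [0, 1, 2, 3, 4]), (E_p4, E_Bull, [0, 2, 1, 4, 3]),
      (E_k3k2, E_L32, [0, 1, 2, 3, 4]), (E_p3k2, E_Bull, [2, 0, 3, 1, 4]),
      (E_k3, E_Bull, [0, 1, 2, 3, 4]), (E_p3, E_Bull, [0, 1, 2, 3, 4]),
      (E_k2k2, E_Bull, [0, 2, 1, 4, 3]), (E_k2, E_Bull, [0, 1, 2, 3, 4]),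
      (E_e, E_Bull, [0, 1, 2, 3, 4])] :: ((nat \<times> nat) list \<times> (nat \<times> nat) list \<times> nat list) list"
  show "list_all (\<lambda>B. \<not> attains_SSP (graph_of B) [2,2,1]) ?bs"
    by (simp del: One_nat_def, (intro conjI)?;
        rule not_attains_SSP, rule attained_lists_intros, simp add: with_reversals_def)
  show "list_all (\<lambda>(E, B, p). B \<in> set ?bs \<and> maps_into p E B) ?bad"
    by (simp add: maps_into_def perm_list_def adjacent_def edge_list_defs)
  show "list_all (\<lambda>(H, certs). list_all2 (\<lambda>e (B, p). B \<in> set ?bs \<and> maps_into p (removeAll e H) B) H certs)
     [(E_c4, [(E_P5, [0, 3, 2, 1, 4]), (E_P5, [0, 1, 2, 3, 4]), (E_P5, [1, 0, 3, 2, 4]), (E_P5, [1, 2, 3, 0, 4])]),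
      (E_C5, [(E_P5, [0, 4, 3, 2, 1]), (E_P5, [0, 1, 2, 3, 4]), (E_P5, [1, 0, 4, 3, 2]), (E_P5, [2, 1, 0, 4, 3]), (E_P5, [1, 2, 3, 4, 0])]),
      (E_Campstool, [(E_S211, [0, 2, 1, 3, 4]), (E_S211, [0, 1, 2, 3, 4]), (E_L32, [0, 1, 2, 4, 3]), (E_L32, [0, 1, 2, 3, 4]), (E_K14, [0, 1, 2, 3, 4])])]"
    by (simp add: maps_into_def perm_list_def adjacent_def edge_list_defs)
qed (simp_all add: reps_def conn_reps_def disc_reps_def)

text \<open>The failing representatives are exactly the forests, each of which embeds in one of the
  three trees of order five.\<close>

lemma minimal_2111:
  assumes "simple_graph G" "order_of G = 5"
  shows "minimal_attaining_SSP G [2,1,1,1] \<longleftrightarrow> (\<exists>H \<in> set [E_c4, E_C5, E_k3]. G \<simeq>\<^sub>G graph_of H)"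
proof (rule minimal_iff_certificate[OF assms _ _ arbitrary_SSP_2111(1) cover_2111])
  let ?bs = "[E_P5, E_S211, E_K14]"
  let ?bad = "[(E_P5, E_P5, [0, 1, 2, 3, 4]), (E_S211, E_S211, [0, 1, 2, 3, 4]),
      (E_K14, E_K14, [0, 1, 2, 3, 4]), (E_k13, E_K14, [0, 1, 2, 3, 4]),
      (E_p4, E_S211, [2, 1, 0, 3, 4]), (E_p3k2, E_S211, [3, 0, 4, 1, 2]),
      (E_p3, E_K14, [1, 0, 2, 3, 4]), (E_k2k2, E_S211, [0, 3, 1, 2, 4]),
      (E_k2, E_K14, [0, 1, 2, 3, 4]), (E_e, E_K14, [0, 1, 2, 3, 4])] :: ((nat \<times> nat) list \<times> (nat \<times> nat) list \<times> nat list) list"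
  show "list_all (\<lambda>B. \<not> attains_SSP (graph_of B) [2,1,1,1]) ?bs"
    by (simp del: One_nat_def, (intro conjI)?;
        rule not_attains_SSP, rule attained_lists_intros, simp add: with_reversals_def)
  show "list_all (\<lambda>(E, B, p). B \<in> set ?bs \<and> maps_into p E B) ?bad"
    by (simp add: maps_into_def perm_list_def adjacent_def edge_list_defs)
  show "list_all (\<lambda>(H, certs). list_all2 (\<lambda>e (B, p). B \<in> set ?bs \<and> maps_into p (removeAll e H) B) H certs)
     [(E_c4, [(E_P5, [0, 3, 2, 1, 4]), (E_P5, [0, 1, 2, 3, 4]), (E_P5, [1, 0, 3, 2, 4]), (E_P5, [1, 2, 3, 0, 4])]),
      (E_C5, [(E_P5, [0, 4, 3, 2, 1]), (E_P5, [0, 1, 2, 3, 4]), (E_P5, [1, 0, 4, 3, 2]), (E_P5, [2, 1, 0, 4, 3]), (E_P5, [1, 2, 3, 4, 0])]),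
      (E_k3, [(E_P5, [0, 2, 1, 3, 4]), (E_P5, [0, 1, 2, 3, 4]), (E_P5, [1, 0, 2, 3, 4])])]"
    by (simp add: maps_into_def perm_list_def adjacent_def edge_list_defs)
qed (simp_all add: reps_def conn_reps_def disc_reps_def)

text \<open>The failing representatives are exactly the disjoint unions of paths, and all of them
  embed in \<open>E_P5\<close>.\<close>

lemma minimal_1211:
  assumes "simple_graph G" "order_of G = 5"
  shows "minimal_attaining_SSP G [1,2,1,1] \<longleftrightarrow> (\<exists>H \<in> set [E_c4, E_C5, E_k3, E_k13]. G \<simeq>\<^sub>G graph_of H)"
proof (rule minimal_iff_certificate[OF assms _ _ arbitrary_SSP_1211(1) cover_1211])
  let ?bs = "[E_P5]"
  let ?bad = "[(E_P5, E_P5, [0, 1, 2, 3, 4]), (E_p4, E_P5, [0, 1, 2, 3, 4]), (E_p3k2, E_P5, [0, 1, 2, 3, 4]),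
      (E_p3, E_P5, [0, 1, 2, 3, 4]), (E_k2k2, E_P5, [0, 1, 2, 3, 4]), (E_k2, E_P5, [0, 1, 2, 3, 4]),
      (E_e, E_P5, [0, 1, 2, 3, 4])] :: ((nat \<times> nat) list \<times> (nat \<times> nat) list \<times> nat list) list"
  show "list_all (\<lambda>B. \<not> attains_SSP (graph_of B) [1,2,1,1]) ?bs"
    by (simp del: One_nat_def, (intro conjI)?;
        rule not_attains_SSP, rule attained_lists_intros, simp add: with_reversals_def)
  show "list_all (\<lambda>(E, B, p). B \<in> set ?bs \<and> maps_into p E B) ?bad"
    by (simp add: maps_into_def perm_list_def adjacent_def edge_list_defs)
  show "list_all (\<lambda>(H, certs). list_all2 (\<lambda>e (B, p). B \<in> set ?bs \<and> maps_into p (removeAll e H) B) H certs)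
     [(E_c4, [(E_P5, [0, 3, 2, 1, 4]), (E_P5, [0, 1, 2, 3, 4]), (E_P5, [1, 0, 3, 2, 4]), (E_P5, [1, 2, 3, 0, 4])]),
      (E_C5, [(E_P5, [0, 4, 3, 2, 1]), (E_P5, [0, 1, 2, 3, 4]), (E_P5, [1, 0, 4, 3, 2]), (E_P5, [2, 1, 0, 4, 3]), (E_P5, [1, 2, 3, 4, 0])]),
      (E_k3, [(E_P5, [0, 2, 1, 3, 4]), (E_P5, [0, 1, 2, 3, 4]), (E_P5, [1, 0, 2, 3, 4])]),
      (E_k13, [(E_P5, [1, 3, 0, 2, 4]), (E_P5, [1, 0, 3, 2, 4]), (E_P5, [1, 0, 2, 3, 4])])]"
    by (simp add: maps_into_def perm_list_def adjacent_def edge_list_defs)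
qed (simp_all add: reps_def conn_reps_def disc_reps_def)

text \<open>Every graph contains the empty one, so no graph fails and the failure certificates are
  empty.\<close>

lemma minimal_11111:
  assumes "simple_graph G" "order_of G = 5"
  shows "minimal_attaining_SSP G [1,1,1,1,1] \<longleftrightarrow> (\<exists>H \<in> set [E_e]. G \<simeq>\<^sub>G graph_of H)"
proof (rule minimal_iff_certificate[OF assms _ _ arbitrary_SSP_11111(1) cover_11111])
  let ?bs = "[]"
  let ?bad = "[] :: ((nat \<times> nat) list \<times> (nat \<times> nat) list \<times> nat list) list"
  show "list_all (\<lambda>B. \<not> attains_SSP (graph_of B) [1,1,1,1,1]) ?bs"
    by (simp del: One_nat_def, (intro conjI)?;
        rule not_attains_SSP, rule attained_lists_intros, simp add: with_reversals_def)
  show "list_all (\<lambda>(E, B, p). B \<in> set ?bs \<and> maps_into p E B) ?bad"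
    by (simp add: maps_into_def perm_list_def adjacent_def edge_list_defs)
  show "list_all (\<lambda>(H, certs). list_all2 (\<lambda>e (B, p). B \<in> set ?bs \<and> maps_into p (removeAll e H) B) H certs)
     [(E_e, [])]"
    by (simp add: maps_into_def perm_list_def adjacent_def edge_list_defs)
qed (simp_all add: reps_def conn_reps_def disc_reps_def)

section \<open>Assembly of the two tables\<close>

definition connected_data :: "((nat \<times> nat) list list \<times> nat list list \<times> nat list list) list" where
  "connected_data =
    [([E_P5],
       [[1,1,1,1,1]], []),
     ([E_S211],
       [[1,1,1,1,1], [1,2,1,1]], []),
     ([E_K14],
       [[1,1,1,1,1], [1,2,1,1]], [[1,3,1]]),
     ([E_L32, E_Bull],
       [[1,1,1,1,1], [1,2,1,1], [2,1,1,1]], []),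
     ([E_C5, E_Campstool],
       [[1,1,1,1,1], [1,2,1,1], [2,1,1,1], [2,2,1]], []),
     ([E_Banner, E_House, E_Dart, E_Kite, E_Gem],
       [[1,1,1,1,1], [1,2,1,1], [2,1,1,1], [2,2,1], [2,1,2]], []),
     ([E_Butterfly],
       [[1,1,1,1,1], [1,2,1,1], [2,1,1,1], [2,2,1], [2,1,2]], [[1,3,1], [3,1,1]]),
     ([E_K23, E_T5],
       [[1,1,1,1,1], [1,2,1,1], [2,1,1,1], [2,2,1], [2,1,2], [1,3,1]], []),
     ([E_L41],
       [[1,1,1,1,1], [1,2,1,1], [2,1,1,1], [2,2,1], [2,1,2], [1,3,1], [3,1,1]], []),
     ([E_K4e, E_W5, E_FullHouse, E_K5e],
       [[1,1,1,1,1], [1,2,1,1], [2,1,1,1], [2,2,1], [2,1,2], [1,3,1], [3,1,1], [3,2]], []),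
     ([E_K5],
       [[1,1,1,1,1], [1,2,1,1], [2,1,1,1], [2,2,1], [2,1,2], [1,3,1], [3,1,1], [3,2], [4,1]], [])]"

definition minimal_data :: "(nat list \<times> (nat \<times> nat) list list) list" where
  "minimal_data =
    [([4,1], [E_K5]),
     ([3,2], [E_K4e]),
     ([3,1,1], [E_k4, E_K4e]),
     ([1,3,1], [E_k4, E_K23]),
     ([2,1,2], [E_c4, E_Butterfly]),
     ([2,2,1], [E_c4, E_C5, E_Campstool]),
     ([2,1,1,1], [E_c4, E_C5, E_k3]),
     ([1,2,1,1], [E_c4, E_C5, E_k3, E_k13]),
     ([1,1,1,1,1], [E_e])]"

lemmas minimal_iffs = minimal_41 minimal_32 minimal_311 minimal_131 minimal_212 minimal_221 minimal_2111 minimal_1211 minimal_11111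

lemma minimal_table_data: "minimal_table = map (\<lambda>(m, Hs). (m, map graph_of Hs)) minimal_data"
  by (simp add: minimal_table_def minimal_data_def table_graphs table_isolated_graphs del: One_nat_def)

lemma connected_table_data:
  "connected_table = map (\<lambda>(Es, ms, starred). (map graph_of Es, ms, starred)) connected_data"
  by (simp add: connected_table_def connected_data_def table_graphs del: One_nat_def)

lemma connected_graph_iso:
  assumes iso: "G \<simeq>\<^sub>G H" and conn: "connected_graph G"
  shows "connected_graph H"
  unfolding connected_graph_def
proof (intro ballI)
  let ?R = "\<lambda>G. {(x, y). {x, y} \<in> edges G}"
  obtain f where f: "bij_betw f (verts G) (verts H)" "edges H = (`) f ` edges G"
    using iso unfolding graph_iso_def by (elim exE conjE) (rule that)
  fix u v assume "u \<in> verts H" "v \<in> verts H"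
  then obtain x y where xy: "x \<in> verts G" "y \<in> verts G" "u = f x" "v = f y"
    using bij_betw_imp_surj_on[OF f(1)] by blast
  have edge: "(f a, f b) \<in> ?R H" if "(a, b) \<in> ?R G" for a b
  proof -
    have "f ` {a, b} \<in> edges H" using that f(2) by blast
    then show ?thesis by simp
  qed
  have "(x, y) \<in> (?R G)\<^sup>*" using conn xy(1,2) unfolding connected_graph_def by blast
  then have "(f x, f y) \<in> (?R H)\<^sup>*"
  proof (induction rule: rtrancl_induct)
    case (step b c)
    show ?case by (rule rtrancl_into_rtrancl[OF step.IH edge[OF step.hyps(2)]])
  qed simp
  then show "(u, v) \<in> (?R H)\<^sup>*" using xy(3,4) by simp
qed

lemma conn_reps_connected_data: "conn_reps = concat (map fst connected_data)"
  by (simp add: conn_reps_def connected_data_def)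

lemma connected_iff:
  assumes sim: "simple_graph G" and n: "order_of G = 5"
  shows "connected_graph G \<longleftrightarrow> (\<exists>E \<in> set conn_reps. G \<simeq>\<^sub>G graph_of E)"
proof
  assume conn: "connected_graph G"
  obtain E where E: "E \<in> set reps" "G \<simeq>\<^sub>G graph_of E" using order_5_classification[OF sim n] by blast
  then have "E \<notin> set disc_reps" using not_connected_disc_reps connected_graph_iso[OF E(2) conn] by blast
  then show "\<exists>E \<in> set conn_reps. G \<simeq>\<^sub>G graph_of E" using E by (auto simp: reps_def)
next
  assume "\<exists>E \<in> set conn_reps. G \<simeq>\<^sub>G graph_of E"
  then obtain E where E: "E \<in> set conn_reps" "G \<simeq>\<^sub>G graph_of E" by blast
  show "connected_graph G"
    by (rule connected_graph_iso[OF graph_iso_sym[OF E(2) sim] connected_conn_reps[OF E(1)]])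
qed

lemma attained_lists_connected_data:
  "\<forall>(Es, ms, starred) \<in> set connected_data. \<forall>E \<in> set Es. attained_lists E ms starred"
  by (simp add: connected_data_def attained_lists_intros del: One_nat_def)

lemma minimal_attaining_SSP_rev:
  "order_of G = 5 \<Longrightarrow> minimal_attaining_SSP G (rev m) = minimal_attaining_SSP G m"
  by (simp add: minimal_attaining_SSP_def attains_rev(2))

lemma minimal_minimal_data:
  assumes "simple_graph G" "order_of G = 5"
  shows "\<forall>(m, Hs) \<in> set minimal_data. minimal_attaining_SSP G m \<longleftrightarrow> (\<exists>H \<in> set Hs. G \<simeq>\<^sub>G graph_of H)"
  by (simp add: minimal_data_def minimal_iffs[OF assms] del: One_nat_def)

theorem theorem3p6:
  shows "(\<forall>(m, Hs) \<in> set minimal_table. \<forall>m' \<in> {m, rev m}. \<forall>G.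
            simple_graph G \<and> order_of G = 5 \<longrightarrow>
              (minimal_attaining_SSP G m' \<longleftrightarrow> (\<exists>H \<in> set Hs. G \<simeq>\<^sub>G H)))
       \<and> (\<forall>G. simple_graph G \<and> order_of G = 5 \<longrightarrow>
            (connected_graph G \<longleftrightarrow>
               (\<exists>(Hs, _, _) \<in> set connected_table. \<exists>H \<in> set Hs. G \<simeq>\<^sub>G H)))
       \<and> (\<forall>(Hs, ms, ms_star) \<in> set connected_table. \<forall>H \<in> set Hs. \<forall>G.
            simple_graph G \<and> order_of G = 5 \<and> G \<simeq>\<^sub>G H \<longrightarrow>
              {m. attains G m} = with_reversals ms \<union> with_reversals ms_star
            \<and> (\<forall>m. attains G m \<longrightarrow> spectrally_arbitrary m G)
            \<and> (\<forall>m \<in> with_reversals ms. attains_SSP G m)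
            \<and> (\<forall>m \<in> with_reversals ms_star. \<not> attains_SMP G m \<and> \<not> attains_SSP G m))"
proof (intro conjI)
  show "\<forall>(m, Hs) \<in> set minimal_table. \<forall>m' \<in> {m, rev m}. \<forall>G.
      simple_graph G \<and> order_of G = 5 \<longrightarrow> (minimal_attaining_SSP G m' \<longleftrightarrow> (\<exists>H \<in> set Hs. G \<simeq>\<^sub>G H))"
  proof (intro ballI, unfold split_paired_all prod.case, intro ballI allI impI)
    fix m Hs m' G
    assume "(m, Hs) \<in> set minimal_table" and m': "m' \<in> {m, rev m}" and G: "simple_graph G \<and> order_of G = 5"
    then obtain Es where Es: "(m, Es) \<in> set minimal_data" "Hs = map graph_of Es"
      unfolding minimal_table_data by auto
    \<comment> \<open>Negating matrices preserves each graph and reverses its lists, so both values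
      of \<open>m'\<close> reduce to the tabulated list.\<close>
    have "minimal_attaining_SSP G m' = minimal_attaining_SSP G m"
      using m' minimal_attaining_SSP_rev G by blast
    moreover have "minimal_attaining_SSP G m \<longleftrightarrow> (\<exists>E \<in> set Es. G \<simeq>\<^sub>G graph_of E)"
      using minimal_minimal_data[of G] G Es(1) by blast
    ultimately show "minimal_attaining_SSP G m' \<longleftrightarrow> (\<exists>H \<in> set Hs. G \<simeq>\<^sub>G H)"
      unfolding Es(2) by simp
  qed
  show "\<forall>G. simple_graph G \<and> order_of G = 5 \<longrightarrow> (connected_graph G \<longleftrightarrow>
      (\<exists>(Hs, _, _) \<in> set connected_table. \<exists>H \<in> set Hs. G \<simeq>\<^sub>G H))"
  proof (intro allI impI)
    fix G assume "simple_graph G \<and> order_of G = 5"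
    then have "connected_graph G \<longleftrightarrow> (\<exists>E \<in> set conn_reps. G \<simeq>\<^sub>G graph_of E)" using connected_iff by blast
    then show "connected_graph G \<longleftrightarrow> (\<exists>(Hs, _, _) \<in> set connected_table. \<exists>H \<in> set Hs. G \<simeq>\<^sub>G H)"
      unfolding conn_reps_connected_data connected_table_data by (simp add: case_prod_beta)
  qed
  show "\<forall>(Hs, ms, ms_star) \<in> set connected_table. \<forall>H \<in> set Hs. \<forall>G.
      simple_graph G \<and> order_of G = 5 \<and> G \<simeq>\<^sub>G H \<longrightarrow>
        {m. attains G m} = with_reversals ms \<union> with_reversals ms_star
      \<and> (\<forall>m. attains G m \<longrightarrow> spectrally_arbitrary m G)
      \<and> (\<forall>m \<in> with_reversals ms. attains_SSP G m)
      \<and> (\<forall>m \<in> with_reversals ms_star. \<not> attains_SMP G m \<and> \<not> attains_SSP G m)"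
  proof (intro ballI, unfold split_paired_all prod.case, intro ballI allI impI)
    fix Hs ms starred H G
    assume "(Hs, ms, starred) \<in> set connected_table" "H \<in> set Hs"
      and G: "simple_graph G \<and> order_of G = 5 \<and> G \<simeq>\<^sub>G H"
    then obtain Es E where E: "(Es, ms, starred) \<in> set connected_data" "E \<in> set Es" "H = graph_of E"
      unfolding connected_table_data by auto
    have al: "attained_lists E ms starred" using attained_lists_connected_data E(1,2) by blast
    have "E \<in> set conn_reps" unfolding conn_reps_connected_data using E(1,2) by force
    then have "E \<in> set reps" by (simp add: reps_def)
    from attained_lists_iso[OF al this] G E(3)
    show "{m. attains G m} = with_reversals ms \<union> with_reversals starred
      \<and> (\<forall>m. attains G m \<longrightarrow> spectrally_arbitrary m G)
      \<and> (\<forall>m \<in> with_reversals ms. attains_SSP G m)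
      \<and> (\<forall>m \<in> with_reversals starred. \<not> attains_SMP G m \<and> \<not> attains_SSP G m)"
      by blast
  qed
qed

end
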